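(* Let $p$ be a prime and let $A=(\mathbb{K}/\mathbb{F},\tau)$ be an abelian crossed product $\mathbb{F}$-algebra whose dimension over $\mathbb{F}$ is $p^{2n}$ and whose Schur index is $p$. Let $\mathbb{L}$ be a subfield of $\mathbb{K}$ containing $\mathbb{F}$, with $[\mathbb{L}:\mathbb{F}]$ least, such that $\mathbb{L}$ splits $A$, and let $[\mathbb{L}:\mathbb{F}]=p^r$. Then the following hold. (i) $(\mathbb{K}/\mathbb{L},\tau|_{\operatorname{Gal}(\mathbb{K}/\mathbb{L})})$ is a split $\mathbb{L}$-subalgebra of $(\mathbb{K}/\mathbb{F},\tau)$ isomorphic to $M_{p^{n-r}}(\mathbb{L})$, where $\tau|_{\operatorname{Gal}(\mathbb{K}/\mathbb{L})}$ is the restriction of $\tau$ to $\operatorname{Gal}(\mathbb{K}/\mathbb{L})\times\operatorname{Gal}(\mathbb{K}/\mathbb{L})$. (ii) If $\{E_{ij} : 1\le i,j\le p^{n-r}\}$ is a complete set of matrix units of $(\mathbb{K}/\mathbb{L},\tau|_{\operatorname{Gal}(\mathbb{K}/\mathbb{L})})$ and $B$ is the $\mathbb{F}$-span of the $E_{ij}$, $1\le i,j\le p^{n-r}$, then $\operatorname{Cen}_A(B)$ has Schur index $p$, its dimension over $\mathbb{F}$ is $p^{2r}$, and $A\cong B\otimes_{\mathbb{F}}\operatorname{Cen}_A(B)$. For (iii)–(v), fix such $\{E_{ij}\}$ and $B$. (iii) $\mathbb{L}$ is a strictly maximal subfield of $\operatorname{Cen}_A(B)$, and there exist units $u_1,u_2,\dots,u_{p^r}$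 of $\operatorname{Cen}_A(B)$ with $u_1=1$ such that $\{\sigma_{u_i} : 1\le i\le p^r\}$ is the Galois group of $\mathbb{L}/\mathbb{F}$, where $\sigma_{u_i}:\mathbb{L}\to\mathbb{L}$ is given by $\alpha\mapsto u_i^{-1}\alpha u_i$. Consequently, $\overline{\tau}:\operatorname{Gal}(\mathbb{L}/\mathbb{F})\times\operatorname{Gal}(\mathbb{L}/\mathbb{F})\to\mathcal{U}(\mathbb{L})$ given by $(\sigma_{u_i},\sigma_{u_j})\mapsto u_k^{-1}u_iu_j$, where $\sigma_{u_i}\circ\sigma_{u_j}=\sigma_{u_k}$, is a factor set and $\operatorname{Cen}_A(B)=\mathbb{L}*_{\overline{\tau}}\operatorname{Gal}(\mathbb{L}/\mathbb{F})$. (iv) Let $\mathbb{L}'$ be a subfield of $\mathbb{L}$ containing $\mathbb{F}$ with $[\mathbb{L}:\mathbb{L}']=p$. Assume that the $u_i$ are ordered so that $\{\sigma_{u_i}|_{\mathbb{L}'} : 1\le i\le p^{r-1}\}$ is the Galois group of $\mathbb{L}'/\mathbb{F}$. Then there exist nonzero $\beta_i\in\mathbb{L}*_{\overline{\tau}|_{\operatorname{Gal}(\mathbb{L}/\mathbb{L}')}}\operatorname{Gal}(\mathbb{L}/\mathbb{L}')$, $1\le i\le p^{r-1}$, such that $(\beta_iu_i)(\beta_ju_j)=\beta_ku_k$ whenever $1\le i,j,k\le p^{r-1}$ and $\sigma_{u_i}|_{\mathbb{L}'}\circ\sigma_{u_j}|_{\mathbb{L}'}=\sigma_{u_k}|_{\mathbb{L}'}$.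 Moreover, the $\beta_i$ are unique up to multiples of $\mathbb{L}'$. Consequently, $(\mathbb{L}'/\mathbb{F},\tilde{\tau})$ (the $\mathbb{F}$-subalgebra of $\operatorname{Cen}_A(B)$ with $\mathbb{L}'$-basis $\{\beta_iu_i : 1\le i\le p^{r-1}\}$) is a split $\mathbb{F}$-subalgebra of $\operatorname{Cen}_A(B)$ of dimension $p^{2(r-1)}$ over $\mathbb{F}$, where $\tilde{\tau}:\operatorname{Gal}(\mathbb{L}'/\mathbb{F})\times\operatorname{Gal}(\mathbb{L}'/\mathbb{F})\to\mathcal{U}(\mathbb{L}')$ is given, for the automorphisms induced by $\beta_iu_i$ and $\beta_ju_j$, by $(\beta_ku_k)^{-1}(\beta_iu_i)(\beta_ju_j)$, with $k$ such that $\sigma_{u_i}|_{\mathbb{L}'}\circ\sigma_{u_j}|_{\mathbb{L}'}=\sigma_{u_k}|_{\mathbb{L}'}$. Furthermore, the centralizer of $(\mathbb{L}'/\mathbb{F},\tilde{\tau})$ in $\operatorname{Cen}_A(B)$ is a division algebra, and hence a complete set of matrix units (respectively, of primitive orthogonal idempotents) of $(\mathbb{L}'/\mathbb{F},\tilde{\tau})$ is a complete set of matrix units (respectively, of primitive orthogonal idempotents) of $\operatorname{Cen}_A(B)$. (v) Finally, with $\mathbb{L}'$ and $\tilde{\tau}$ as in (iv), if $\mathcal{E}$ is a complete set of matrix units (respectively, of primitive orthogonal idempotents) of $(\mathbb{L}'/\mathbb{F},\tilde{\tau})$, then $$\{eE_{ij} : e\in\mathcal{E},\ 1\le i,j\le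 p^{n-r}\}\quad(\text{respectively } \{eE_{ii} : e\in\mathcal{E},\ 1\le i\le p^{n-r}\})$$ is a complete set of matrix units (respectively, of primitive orthogonal idempotents) of $(\mathbb{K}/\mathbb{F},\tau)$.
   Context: Crossed products: for a ring $R$ with unit group $\mathcal{U}(R)$, a finite group $\Gamma$, an action $\sigma:\Gamma\to\operatorname{Aut}(R)$ and a factor set $\tau:\Gamma\times\Gamma\to\mathcal{U}(R)$, $R*_\tau\Gamma$ is the associative ring that is free as an $R$-module with basis of units $\{z_g : g\in\Gamma\}$ and multiplication determined by $z_gz_h=z_{gh}\tau(g,h)$ and $rz_g=z_g\sigma_g(r)$. Here "factor set" means that $\tau(gh,x)\sigma_x(\tau(g,h))=\tau(g,hx)\tau(h,x)$ and $\tau(g,h)\sigma_h(\sigma_g(r))=\sigma_{gh}(r)\tau(g,h)$ for all $g,h,x\in\Gamma$, $r\in R$. For a finite Galois extension $L/F$, the classical crossed product $(L/F,\tau)$ is $L*_\tau\operatorname{Gal}(L/F)$ with the natural action and center $F$. An abelian crossed product algebra is a classical crossed product $(L/F,\tau)$ with $\operatorname{Gal}(L/F)$ abelian. For a subgroup $\Gamma'\le\Gamma$, $R*_{\tau|_{\Gamma'}}\Gamma'$ is the subring of $R*_\tau\Gamma$ spanned over $R$ by $z_g$, $g\in\Gamma'$, where $\tau|_{\Gamma'}$ is the restriction of $\tau$ to $\Gamma'\times\Gamma'$. A central simple $F$-algebra $A\cong M_m(D)$, $D$ a division algebra with center $F$, has Schur index $\sqrt{\dim_FD}$ and is split if its Schur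 index is $1$. A field $L\supseteq F$ splits $A$ if $A\otimes_FL$ is split over $L$. A strictly maximal subfield of $A$ is a subfield $E\supseteq F$ with $\dim_FA=[E:F]^2$. $\operatorname{Cen}_A(B)$ is the centralizer of $B$ in $A$. A complete set of matrix units of $A\cong M_m(D)$ is a set $\{E_{ij} : 1\le i,j\le m\}\subseteq A$ (with the same $m$) with $\sum_iE_{ii}=1_A$ and $E_{ij}E_{kl}=\delta_{jk}E_{il}$; then $\{E_{ii} : 1\le i\le m\}$ is called a complete set of primitive orthogonal idempotents of $A$.
   Formalization: In (iv), "the β_i are unique up to multiples of L'" fails for r ≥ 2 (conjugate all β_i u_i by a suitable unit); it is replaced by uniqueness up to conjugation by a nonzero element of L*Gal(L/L'), and up to multiples of L' for families spanning the same subalgebra (L'/F, τ̃). *)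

theory Defs
  imports "HOL-Algebra.Algebra"
begin

text \<open>
  Every algebra below is a (not necessarily commutative) ring of HOL-Algebra, its base field a
  central subfield of it; subalgebras are subsets \<^term>\<open>U\<close> of the ambient carrier,
  turned into rings by updating the carrier.
\<close>

abbreviation sub :: "('a, 'b) ring_scheme \<Rightarrow> 'a set \<Rightarrow> ('a, 'b) ring_scheme" where
  "sub A U \<equiv> A\<lparr>carrier := U\<rparr>"

definition centralizer :: "('a, 'b) ring_scheme \<Rightarrow> 'a set \<Rightarrow> 'a set" where
  "centralizer A B = {a \<in> carrier A. \<forall>b\<in>B. a \<otimes>\<^bsub>A\<^esub> b = b \<otimes>\<^bsub>A\<^esub> a}"

abbreviation center :: "('a, 'b) ring_scheme \<Rightarrow> 'a set" where
  "center A \<equiv> centralizer A (carrier A)"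

definition division_ring :: "('a, 'b) ring_scheme \<Rightarrow> bool" where
  "division_ring D \<longleftrightarrow> ring D \<and> \<one>\<^bsub>D\<^esub> \<noteq> \<zero>\<^bsub>D\<^esub> \<and> Units D = carrier D - {\<zero>\<^bsub>D\<^esub>}"

definition algebra_over :: "'a set \<Rightarrow> ('a, 'b) ring_scheme \<Rightarrow> bool" where
  "algebra_over F A \<longleftrightarrow> embedded_algebra F A \<and> F \<subseteq> center A"

definition subalgebra_over :: "'a set \<Rightarrow> 'a set \<Rightarrow> ('a, 'b) ring_scheme \<Rightarrow> bool" where
  "subalgebra_over F S A \<longleftrightarrow> subring S A \<and> algebra_over F (sub A S)"

text \<open>Isomorphisms of \<^term>\<open>F\<close>-algebras, where \<^term>\<open>F\<close> is contained in
  \<^term>\<open>A\<close> but is mapped into \<^term>\<open>A'\<close> by \<^term>\<open>\<iota>\<close>.\<close>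

definition algebra_iso ::
  "'a set \<Rightarrow> ('a, 'b) ring_scheme \<Rightarrow> ('a \<Rightarrow> 'c) \<Rightarrow> ('c, 'd) ring_scheme \<Rightarrow> bool" where
  "algebra_iso F A \<iota> A' \<longleftrightarrow> (\<exists>\<phi>\<in>ring_iso A A'. \<forall>c\<in>F. \<phi> c = \<iota> c)"


section \<open>Matrix rings and Schur index\<close>

definition scalar_matrix :: "nat \<Rightarrow> ('a, 'b) ring_scheme \<Rightarrow> 'a \<Rightarrow> nat \<times> nat \<Rightarrow> 'a" where
  "scalar_matrix m R c = (\<lambda>(i, j)\<in>{1..m} \<times> {1..m}. if i = j then c else \<zero>\<^bsub>R\<^esub>)"

definition matrix_ring :: "nat \<Rightarrow> ('a, 'b) ring_scheme \<Rightarrow> (nat \<times> nat \<Rightarrow> 'a) ring" where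
  "matrix_ring m R =
    \<lparr>carrier = ({1..m} \<times> {1..m}) \<rightarrow>\<^sub>E carrier R,
     monoid.mult = (\<lambda>M N. \<lambda>(i, j)\<in>{1..m} \<times> {1..m}. \<Oplus>\<^bsub>R\<^esub>k\<in>{1..m}. M (i, k) \<otimes>\<^bsub>R\<^esub> N (k, j)),
     one = scalar_matrix m R \<one>\<^bsub>R\<^esub>,
     ring.zero = scalar_matrix m R \<zero>\<^bsub>R\<^esub>,
     ring.add = (\<lambda>M N. \<lambda>ij\<in>{1..m} \<times> {1..m}. M ij \<oplus>\<^bsub>R\<^esub> N ij)\<rparr>"

text \<open>
  \<^term>\<open>A\<close> is isomorphic to the algebra of \<^term>\<open>m\<close> by \<^term>\<open>m\<close> matrices over the
  division algebra \<^term>\<open>D\<close>, which has center \<^term>\<open>F\<close>. Looking for \<^term>\<open>D\<close> among the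
  subrings of \<^term>\<open>A\<close> is no restriction: any such division algebra sits in
  \<^term>\<open>A\<close> as the preimage of the scalar matrices.
\<close>

definition matrix_form :: "'a set \<Rightarrow> ('a, 'b) ring_scheme \<Rightarrow> nat \<Rightarrow> 'a set \<Rightarrow> bool" where
  "matrix_form F A m D \<longleftrightarrow>
     algebra_over F A \<and> 1 \<le> m \<and>
     subring D A \<and> division_ring (sub A D) \<and> center (sub A D) = F \<and>
     ring.finite_dimension A F D \<and>
     algebra_iso F A (scalar_matrix m (sub A D)) (matrix_ring m (sub A D))"

definition has_schur_index :: "'a set \<Rightarrow> ('a, 'b) ring_scheme \<Rightarrow> nat \<Rightarrow> bool" where
  "has_schur_index F A d \<longleftrightarrow> (\<exists>m D. matrix_form F A m D \<and> ring.dimension A (d\<^sup>2) F D)"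

definition split_algebra :: "'a set \<Rightarrow> ('a, 'b) ring_scheme \<Rightarrow> bool" where
  "split_algebra F A \<longleftrightarrow> has_schur_index F A 1"

definition strictly_maximal_subfield :: "'a set \<Rightarrow> ('a, 'b) ring_scheme \<Rightarrow> 'a set \<Rightarrow> bool" where
  "strictly_maximal_subfield F A E \<longleftrightarrow>
     subfield E A \<and> F \<subseteq> E \<and>
     (\<exists>k. ring.dimension A k F E \<and> ring.dimension A (k\<^sup>2) F (carrier A))"


section \<open>Complete sets of matrix units and of primitive orthogonal idempotents\<close>

definition complete_matrix_units ::
  "'a set \<Rightarrow> ('a, 'b) ring_scheme \<Rightarrow> nat \<Rightarrow> (nat \<Rightarrow> nat \<Rightarrow> 'a) \<Rightarrow> bool" where
  "complete_matrix_units F A m E \<longleftrightarrow>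
     (\<exists>D. matrix_form F A m D) \<and>
     (\<forall>i\<in>{1..m}. \<forall>j\<in>{1..m}. E i j \<in> carrier A) \<and>
     (\<Oplus>\<^bsub>A\<^esub>i\<in>{1..m}. E i i) = \<one>\<^bsub>A\<^esub> \<and>
     (\<forall>i\<in>{1..m}. \<forall>j\<in>{1..m}. \<forall>k\<in>{1..m}. \<forall>l\<in>{1..m}.
        E i j \<otimes>\<^bsub>A\<^esub> E k l = (if j = k then E i l else \<zero>\<^bsub>A\<^esub>))"

definition complete_matrix_unit_set :: "'a set \<Rightarrow> ('a, 'b) ring_scheme \<Rightarrow> 'a set \<Rightarrow> bool" where
  "complete_matrix_unit_set F A U \<longleftrightarrow>
     (\<exists>m E. complete_matrix_units F A m E \<and> U = {E i j | i j. i \<in> {1..m} \<and> j \<in> {1..m}})"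

definition complete_idempotent_set :: "'a set \<Rightarrow> ('a, 'b) ring_scheme \<Rightarrow> 'a set \<Rightarrow> bool" where
  "complete_idempotent_set F A U \<longleftrightarrow>
     (\<exists>m E. complete_matrix_units F A m E \<and> U = {E i i | i. i \<in> {1..m}})"


section \<open>Tensor products of algebras\<close>

text \<open>
  A list of pairs stands for the formal sum of the corresponding pure tensors. Both
  algebras contain the base field \<^term>\<open>F\<close>, and \<open>tensor_rel\<close> is the congruence generated by
  biadditivity and balancedness over \<^term>\<open>F\<close>.
\<close>

inductive tensor_rel ::
  "'a set \<Rightarrow> ('a, 'b) ring_scheme \<Rightarrow> ('a, 'c) ring_scheme \<Rightarrow>
   ('a \<times> 'a) list \<Rightarrow> ('a \<times> 'a) list \<Rightarrow> bool"
  for F :: "'a set" and A :: "('a, 'b) ring_scheme" and B :: "('a, 'c) ring_scheme" where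
  t_refl: "set xs \<subseteq> carrier A \<times> carrier B \<Longrightarrow> tensor_rel F A B xs xs"
| t_sym: "tensor_rel F A B xs ys \<Longrightarrow> tensor_rel F A B ys xs"
| t_trans: "tensor_rel F A B xs ys \<Longrightarrow> tensor_rel F A B ys zs \<Longrightarrow> tensor_rel F A B xs zs"
| t_cong: "tensor_rel F A B xs xs' \<Longrightarrow> tensor_rel F A B ys ys' \<Longrightarrow>
           tensor_rel F A B (xs @ ys) (xs' @ ys')"
| t_comm: "set xs \<subseteq> carrier A \<times> carrier B \<Longrightarrow> set ys \<subseteq> carrier A \<times> carrier B \<Longrightarrow>
           tensor_rel F A B (xs @ ys) (ys @ xs)"
| t_zero_l: "b \<in> carrier B \<Longrightarrow> tensor_rel F A B [(\<zero>\<^bsub>A\<^esub>, b)] []"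
| t_zero_r: "a \<in> carrier A \<Longrightarrow> tensor_rel F A B [(a, \<zero>\<^bsub>B\<^esub>)] []"
| t_add_l: "a \<in> carrier A \<Longrightarrow> a' \<in> carrier A \<Longrightarrow> b \<in> carrier B \<Longrightarrow>
           tensor_rel F A B [(a \<oplus>\<^bsub>A\<^esub> a', b)] [(a, b), (a', b)]"
| t_add_r: "a \<in> carrier A \<Longrightarrow> b \<in> carrier B \<Longrightarrow> b' \<in> carrier B \<Longrightarrow>
           tensor_rel F A B [(a, b \<oplus>\<^bsub>B\<^esub> b')] [(a, b), (a, b')]"
| t_balanced: "a \<in> carrier A \<Longrightarrow> b \<in> carrier B \<Longrightarrow> c \<in> F \<Longrightarrow>
           tensor_rel F A B [(a \<otimes>\<^bsub>A\<^esub> c, b)] [(a, c \<otimes>\<^bsub>B\<^esub> b)]"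

definition tensor_class ::
  "'a set \<Rightarrow> ('a, 'b) ring_scheme \<Rightarrow> ('a, 'c) ring_scheme \<Rightarrow>
   ('a \<times> 'a) list \<Rightarrow> ('a \<times> 'a) list set" where
  "tensor_class F A B xs = {ys. tensor_rel F A B xs ys}"

abbreviation pure_tensor ::
  "'a set \<Rightarrow> ('a, 'b) ring_scheme \<Rightarrow> ('a, 'c) ring_scheme \<Rightarrow> 'a \<Rightarrow> 'a \<Rightarrow> ('a \<times> 'a) list set" where
  "pure_tensor F A B a b \<equiv> tensor_class F A B [(a, b)]"

definition tensor_product ::
  "'a set \<Rightarrow> ('a, 'b) ring_scheme \<Rightarrow> ('a, 'c) ring_scheme \<Rightarrow> ('a \<times> 'a) list set ring" where
  "tensor_product F A B =
    \<lparr>carrier = tensor_class F A B ` lists (carrier A \<times> carrier B),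
     monoid.mult = (\<lambda>U V. \<Union>xs\<in>U. \<Union>ys\<in>V.
       tensor_class F A B [(a \<otimes>\<^bsub>A\<^esub> a', b \<otimes>\<^bsub>B\<^esub> b'). (a, b) \<leftarrow> xs, (a', b') \<leftarrow> ys]),
     one = pure_tensor F A B \<one>\<^bsub>A\<^esub> \<one>\<^bsub>B\<^esub>,
     ring.zero = tensor_class F A B [],
     ring.add = (\<lambda>U V. \<Union>xs\<in>U. \<Union>ys\<in>V. tensor_class F A B (xs @ ys))\<rparr>"

definition splits :: "'a set \<Rightarrow> ('a, 'b) ring_scheme \<Rightarrow> ('a, 'c) ring_scheme \<Rightarrow> bool" where
  "splits F A E \<longleftrightarrow>
     split_algebra (pure_tensor F A E \<one>\<^bsub>A\<^esub> ` carrier E) (tensor_product F A E)"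


section \<open>Galois extensions and crossed products\<close>

text \<open>
  The product of \<^term>\<open>g\<close> and \<^term>\<open>h\<close> is \<^term>\<open>g\<close> followed by \<^term>\<open>h\<close>: this is what the factor
  set condition \<open>\<tau>(g,h) \<sigma>\<^sub>h(\<sigma>\<^sub>g(r)) = \<sigma>\<^sub>g\<^sub>h(r) \<tau>(g,h)\<close> forces for the natural action. For abelian
  groups the order is immaterial.
\<close>

definition galois_group :: "('a, 'b) ring_scheme \<Rightarrow> 'a set \<Rightarrow> 'a set \<Rightarrow> ('a \<Rightarrow> 'a) monoid" where
  "galois_group A K F =
    \<lparr>carrier = {s \<in> extensional K. s \<in> ring_iso (sub A K) (sub A K) \<and> (\<forall>x\<in>F. s x = x)},
     monoid.mult = (\<lambda>g h. compose K h g),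
     one = (\<lambda>x\<in>K. x)\<rparr>"

definition galois_extension :: "('a, 'b) ring_scheme \<Rightarrow> 'a set \<Rightarrow> 'a set \<Rightarrow> bool" where
  "galois_extension A K F \<longleftrightarrow>
     subfield F A \<and> subfield K A \<and> F \<subseteq> K \<and> ring.finite_dimension A F K \<and>
     {x \<in> K. \<forall>s\<in>carrier (galois_group A K F). s x = x} = F"

definition factor_set ::
  "('a, 'b) ring_scheme \<Rightarrow> ('g, 'c) monoid_scheme \<Rightarrow> ('g \<Rightarrow> 'a \<Rightarrow> 'a) \<Rightarrow> ('g \<Rightarrow> 'g \<Rightarrow> 'a) \<Rightarrow> bool" where
  "factor_set R \<Gamma> \<sigma> \<tau> \<longleftrightarrow>
     (\<forall>g\<in>carrier \<Gamma>. \<forall>h\<in>carrier \<Gamma>. \<tau> g h \<in> Units R) \<and>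
     (\<forall>g\<in>carrier \<Gamma>. \<forall>h\<in>carrier \<Gamma>. \<forall>x\<in>carrier \<Gamma>.
        \<tau> (g \<otimes>\<^bsub>\<Gamma>\<^esub> h) x \<otimes>\<^bsub>R\<^esub> \<sigma> x (\<tau> g h) = \<tau> g (h \<otimes>\<^bsub>\<Gamma>\<^esub> x) \<otimes>\<^bsub>R\<^esub> \<tau> h x) \<and>
     (\<forall>g\<in>carrier \<Gamma>. \<forall>h\<in>carrier \<Gamma>. \<forall>r\<in>carrier R.
        \<tau> g h \<otimes>\<^bsub>R\<^esub> \<sigma> h (\<sigma> g r) = \<sigma> (g \<otimes>\<^bsub>\<Gamma>\<^esub> h) r \<otimes>\<^bsub>R\<^esub> \<tau> g h)"

text \<open>
  An internal description: \<^term>\<open>A\<close> is the crossed product of its subring \<^term>\<open>R\<close> by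
  \<^term>\<open>\<Gamma>\<close>, with distinguished basis \<^term>\<open>z\<close>. The elements of \<^term>\<open>R\<close> are identified
  with their multiples of the identity, which is \<^term>\<open>z\<close> at the neutral element only if
  \<^term>\<open>\<tau>\<close> is normalized. For a subgroup, the restricted factor set is the same function
  \<^term>\<open>\<tau>\<close>, since only its values on the group matter.
\<close>

definition crossed_product ::
  "('a, 'b) ring_scheme \<Rightarrow> 'a set \<Rightarrow> ('g, 'c) monoid_scheme \<Rightarrow> ('g \<Rightarrow> 'a \<Rightarrow> 'a) \<Rightarrow>
   ('g \<Rightarrow> 'g \<Rightarrow> 'a) \<Rightarrow> ('g \<Rightarrow> 'a) \<Rightarrow> bool" where
  "crossed_product A R \<Gamma> \<sigma> \<tau> z \<longleftrightarrow>
     ring A \<and> subring R A \<and> group \<Gamma> \<and> finite (carrier \<Gamma>) \<and>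
     (\<forall>g\<in>carrier \<Gamma>. \<sigma> g \<in> ring_iso (sub A R) (sub A R)) \<and>
     factor_set (sub A R) \<Gamma> \<sigma> \<tau> \<and>
     (\<forall>g\<in>carrier \<Gamma>. z g \<in> Units A) \<and>
     (\<forall>a\<in>carrier A. \<exists>!c. c \<in> carrier \<Gamma> \<rightarrow>\<^sub>E R \<and> a = (\<Oplus>\<^bsub>A\<^esub>g\<in>carrier \<Gamma>. z g \<otimes>\<^bsub>A\<^esub> c g)) \<and>
     (\<forall>g\<in>carrier \<Gamma>. \<forall>h\<in>carrier \<Gamma>. z g \<otimes>\<^bsub>A\<^esub> z h = z (g \<otimes>\<^bsub>\<Gamma>\<^esub> h) \<otimes>\<^bsub>A\<^esub> \<tau> g h) \<and>
     (\<forall>g\<in>carrier \<Gamma>. \<forall>r\<in>R. r \<otimes>\<^bsub>A\<^esub> z g = z g \<otimes>\<^bsub>A\<^esub> \<sigma> g r)"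

definition classical_crossed_product ::
  "('a, 'b) ring_scheme \<Rightarrow> 'a set \<Rightarrow> 'a set \<Rightarrow>
   (('a \<Rightarrow> 'a) \<Rightarrow> ('a \<Rightarrow> 'a) \<Rightarrow> 'a) \<Rightarrow> (('a \<Rightarrow> 'a) \<Rightarrow> 'a) \<Rightarrow> bool" where
  "classical_crossed_product A K F \<tau> z \<longleftrightarrow>
     galois_extension A K F \<and> crossed_product A K (galois_group A K F) (\<lambda>g. g) \<tau> z \<and> center A = F"

definition abelian_crossed_product ::
  "('a, 'b) ring_scheme \<Rightarrow> 'a set \<Rightarrow> 'a set \<Rightarrow>
   (('a \<Rightarrow> 'a) \<Rightarrow> ('a \<Rightarrow> 'a) \<Rightarrow> 'a) \<Rightarrow> (('a \<Rightarrow> 'a) \<Rightarrow> 'a) \<Rightarrow> bool" where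
  "abelian_crossed_product A K F \<tau> z \<longleftrightarrow>
     classical_crossed_product A K F \<tau> z \<and> comm_group (galois_group A K F)"

definition span_of :: "('a, 'b) ring_scheme \<Rightarrow> 'a set \<Rightarrow> 'i set \<Rightarrow> ('i \<Rightarrow> 'a) \<Rightarrow> 'a set" where
  "span_of A R I z = {\<Oplus>\<^bsub>A\<^esub>i\<in>I. z i \<otimes>\<^bsub>A\<^esub> c i | c. c \<in> I \<rightarrow> R}"


section \<open>Automorphisms and factor sets induced by units\<close>

definition conj_map :: "('a, 'b) ring_scheme \<Rightarrow> 'a set \<Rightarrow> 'a \<Rightarrow> 'a \<Rightarrow> 'a" where
  "conj_map A L u = (\<lambda>\<alpha>\<in>L. inv\<^bsub>A\<^esub> u \<otimes>\<^bsub>A\<^esub> \<alpha> \<otimes>\<^bsub>A\<^esub> u)"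

definition galois_units ::
  "('a, 'b) ring_scheme \<Rightarrow> 'a set \<Rightarrow> 'a set \<Rightarrow> nat \<Rightarrow> (nat \<Rightarrow> 'a) \<Rightarrow> bool" where
  "galois_units A L F N u \<longleftrightarrow>
     (\<forall>i\<in>{1..N}. u i \<in> Units A) \<and> u 1 = \<one>\<^bsub>A\<^esub> \<and>
     {conj_map A L (u i) | i. i \<in> {1..N}} = carrier (galois_group A L F)"

text \<open>The member of \<open>u\<^sub>1, \<dots>, u\<^sub>N\<close> that induces \<^term>\<open>g\<close> on \<^term>\<open>L\<close>; meaningful when the
  \<open>u\<^sub>i\<close> induce distinct automorphisms.\<close>

definition unit_inducing ::
  "('a, 'b) ring_scheme \<Rightarrow> 'a set \<Rightarrow> nat \<Rightarrow> (nat \<Rightarrow> 'a) \<Rightarrow> ('a \<Rightarrow> 'a) \<Rightarrow> 'a" where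
  "unit_inducing A L N u g = u (THE i. i \<in> {1..N} \<and> conj_map A L (u i) = g)"

definition induced_factor_set ::
  "('a, 'b) ring_scheme \<Rightarrow> 'a set \<Rightarrow> nat \<Rightarrow> (nat \<Rightarrow> 'a) \<Rightarrow> ('a \<Rightarrow> 'a) \<Rightarrow> ('a \<Rightarrow> 'a) \<Rightarrow> 'a" where
  "induced_factor_set A L N u g h =
     inv\<^bsub>A\<^esub> (unit_inducing A L N u (compose L g h)) \<otimes>\<^bsub>A\<^esub>
       unit_inducing A L N u g \<otimes>\<^bsub>A\<^esub> unit_inducing A L N u h"

definition multiplicative_factors ::
  "('a, 'b) ring_scheme \<Rightarrow> 'a set \<Rightarrow> 'a set \<Rightarrow> nat \<Rightarrow> (nat \<Rightarrow> 'a) \<Rightarrow> (nat \<Rightarrow> 'a) \<Rightarrow> bool" where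
  "multiplicative_factors A M L N u \<beta> \<longleftrightarrow>
     (\<forall>i\<in>{1..N}. \<beta> i \<in> M - {\<zero>\<^bsub>A\<^esub>}) \<and>
     (\<forall>i\<in>{1..N}. \<forall>j\<in>{1..N}. \<forall>k\<in>{1..N}.
        compose L (conj_map A L (u i)) (conj_map A L (u j)) = conj_map A L (u k) \<longrightarrow>
        (\<beta> i \<otimes>\<^bsub>A\<^esub> u i) \<otimes>\<^bsub>A\<^esub> (\<beta> j \<otimes>\<^bsub>A\<^esub> u j) = \<beta> k \<otimes>\<^bsub>A\<^esub> u k)"

end

theory Submission
  imports Defs
begin

text \<open>
  The whole theorem is governed by a dictionary between subfields and matrix units. Let \<open>E\<close> be a field
  between \<open>F\<close> and \<open>K\<close>. The tensor product \<open>A \<otimes>\<^sub>F E\<close> acts on \<open>A\<close> by \<open>x \<mapsto> l x a\<close>, faithfully because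
  \<open>A\<close> is central simple (\<open>multiplications_independent\<close>), and the action commutes with left multiplication by
  the centralizer of \<open>E\<close>. A rank one idempotent on one side of this pair of commuting actions cuts out a small
  module for the other side, and a small module forces full matrix units (\<open>faithful_module_units\<close>). Hence \<open>E\<close>
  splits \<open>A\<close> exactly if its centralizer is a full matrix algebra over \<open>E\<close> (\<open>splits_imp_centralizer_units\<close>,
  \<open>centralizer_units_imp_splits\<close>). The centralizer of \<open>E\<close> is itself the crossed product of \<open>K/E\<close>, since a
  nonzero summand \<open>z\<^sub>g c\<^sub>g\<close> commutes with \<open>E\<close> only if \<open>g\<close> fixes \<open>E\<close> elementwise (\<open>crossed_centralizer\<close>).
  For \<open>E = L\<close> this is part (i).

  Matrix units \<open>E\<^sub>i\<^sub>j\<close> split an algebra into the matrices over their commutant, so \<open>A = B \<otimes> Cen(B)\<close>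
  (\<open>tensor_decomposition\<close>). Matrix units of the commutant multiply with the \<open>E\<^sub>i\<^sub>j\<close> to matrix units of the
  whole algebra (\<open>product_units\<close>), and all systems whose commutant is a division ring have commutants of the
  same dimension (\<open>commutant_dimension_unique\<close>). This moves the Schur index between \<open>A\<close> and \<open>Cen(B)\<close>, and
  it is the reason for part (ii), for the last claim of (iv) and for (v).

  For (iii), extend an automorphism of \<open>L\<close> to some \<open>g\<close> on \<open>K\<close>. Conjugation by \<open>z\<^sub>g\<close> takes the \<open>E\<^sub>i\<^sub>j\<close> to
  other matrix units of the centralizer of \<open>L\<close>; these are conjugate to the \<open>E\<^sub>i\<^sub>j\<close> inside this centralizer, and
  correcting \<open>z\<^sub>g\<close> by the conjugating element gives a unit of \<open>Cen(B)\<close> with the same effect on \<open>L\<close>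
  (\<open>inducing_unit\<close>).

  For (iv), let \<open>M\<close> be the centralizer of \<open>L'\<close> in \<open>Cen(B)\<close>. It has dimension \<open>p\<^sup>2\<close> over its center \<open>L'\<close>,
  so that it is a division ring or a ring of \<open>p\<close> by \<open>p\<close> matrices over \<open>L'\<close>. In the second case the dictionary
  would make \<open>L'\<close> a splitting field, against the choice of \<open>L\<close> (\<open>M_division\<close>). Let \<open>f\<close> be a primitive
  idempotent of \<open>Cen(B)\<close>. By dimensions \<open>M f\<close> is the whole left ideal of \<open>f\<close>, so \<open>u\<^sub>i f = m\<^sub>i f\<close> with
  \<open>m\<^sub>i \<in> M\<close>, and for \<open>\<beta>\<^sub>i = m\<^sub>i\<inverse>\<close> the products \<open>\<beta>\<^sub>i u\<^sub>i\<close> all fix \<open>f\<close>. An element of the division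
  ring \<open>M\<close> that fixes \<open>f\<close> is \<open>1\<close>, and therefore the cocycle of the \<open>\<beta>\<^sub>i u\<^sub>i\<close> is trivial
  (\<open>factors_exist\<close>). Two choices \<open>v\<close>, \<open>v'\<close> of the products are intertwined by an average
  \<open>\<Sum> v\<^sub>i l v'\<^sub>i\<inverse>\<close>, which is nonzero for some \<open>l\<close> by the independence of automorphisms
  (\<open>factors_unique\<close>). The algebra \<open>T\<close> spanned by the \<open>\<beta>\<^sub>i u\<^sub>i\<close> over \<open>L'\<close> is split because it acts on
  \<open>L' \<Sum> \<beta>\<^sub>i u\<^sub>i\<close>, a left ideal of the smallest possible dimension (\<open>T_split\<close>); its centralizer lies
  in \<open>M\<close> and so is a division ring too (\<open>T_division\<close>).
\<close>

notation monoid.mult (infixl "**\<index>" 70)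

section \<open>Sums and dimensions\<close>

lemma finsum_additive:
 assumes G: "abelian_monoid G" and H: "abelian_monoid H"
  and S: "S <= carrier G" "\<zero>\<^bsub>G\<^esub> \<in> S" "!!a b. a \<in> S ==> b : S ==> a \<oplus>\<^bsub>G\<^esub> b \<in> S"
  and h: "!!a. a \<in> S ==> h a \<in> carrier H" "h \<zero>\<^bsub>G\<^esub> = \<zero>\<^bsub>H\<^esub>"
   "!!a b. a \<in> S ==> b : S ==> h (a \<oplus>\<^bsub>G\<^esub> b) = h a \<oplus>\<^bsub>H\<^esub> h b"
  and f: "!!i. i \<in> I ==> f i \<in> S"
 shows "finsum G f I \<in> S" "h (finsum G f I) = finsum H (%i. h (f i)) I"
proof -
 interpret G: abelian_monoid G by fact
 interpret H: abelian_monoid H by fact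
 have "finsum G f I \<in> S \<and> h (finsum G f I) = finsum H (%i. h (f i)) I"
  using f
 proof (induction I rule: infinite_finite_induct)
  case (insert i I)
  then have "f : I \<rightarrow> carrier G" "(%i. h (f i)) \<in> I \<rightarrow> carrier H"
   using S h by auto
  with insert S h show ?case by (simp add: subset_iff)
 qed (use S h in auto)
 then show "finsum G f I \<in> S" "h (finsum G f I) = finsum H (%i. h (f i)) I"
  by auto
qed

lemma additive_zero:
 assumes "ring R" "ring R'" "V <= carrier R" "\<zero>\<^bsub>R\<^esub> \<in> V"
  and "!!v. v \<in> V ==> h v \<in> carrier R'"
  and "!!v w. v \<in> V ==> w : V ==> h (v \<oplus>\<^bsub>R\<^esub> w) = h v \<oplus>\<^bsub>R'\<^esub> h w"
 shows "h \<zero>\<^bsub>R\<^esub> = \<zero>\<^bsub>R'\<^esub>"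
proof -
 interpret R: ring R by fact
 interpret R': ring R' by fact
 have "h \<zero>\<^bsub>R\<^esub> \<oplus>\<^bsub>R'\<^esub> h \<zero>\<^bsub>R\<^esub> = h \<zero>\<^bsub>R\<^esub>"
  using assms(6)[of "\<zero>\<^bsub>R\<^esub>" "\<zero>\<^bsub>R\<^esub>"] assms(4) by simp
 then show ?thesis
  using assms(4,5) R'.add.l_cancel_one by metis
qed

context ring
begin

lemma finsum_in_subring:
 assumes "subring S R" "!!i. i \<in> I ==> f i \<in> S"
 shows "(\<Oplus>i\<in>I. f i) \<in> S"
 by (rule finsum_additive(1)[where H = R and h = id])
  (use assms subringE[OF assms(1)] in \<open>auto intro: abelian_monoid_axioms\<close>)

lemma finsum_sub:
 assumes "subring S R" "!!i. i \<in> I ==> f i \<in> S"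
 shows "finsum (sub R S) f I = (\<Oplus>i\<in>I. f i)"
proof -
 interpret S: ring "sub R S" by (rule subring_is_ring) fact
 have "id (finsum (sub R S) f I) = (\<Oplus>i\<in>I. id (f i))"
  by (rule finsum_additive(2)[where S = S])
   (use assms subringE[OF assms(1)] in \<open>auto intro: abelian_monoid_axioms S.abelian_monoid_axioms\<close>)
 then show ?thesis by simp
qed

lemma finsum_delta:
 assumes "finite I" "i : I" "f i \<in> carrier R"
 shows "(\<Oplus>j\<in>I. if j = i then f j else \<zero>) = f i"
proof -
 have "(\<Oplus>j\<in>I. if j = i then f j else \<zero>) = (\<Oplus>j\<in>I. if j = i then f i else \<zero>)"
  by (rule finsum_cong') (use assms in auto)
 also have "... = f i"
  using add.finprod_singleton_swap[OF assms(2,1), of "%_. f i"] assms(3) by simp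
 finally show ?thesis .
qed

lemma finsum_swap:
 assumes "finite I" "finite J" "!!i j. i \<in> I ==> j : J ==> f i j \<in> carrier R"
 shows "(\<Oplus>i\<in>I. \<Oplus>j\<in>J. f i j) = (\<Oplus>j\<in>J. \<Oplus>i\<in>I. f i j)"
 using assms(1,3)
proof (induction I rule: finite_induct)
 case empty
 then show ?case by (simp add: add.finprod_one_eqI)
next
 case (insert i I)
 have "(\<Oplus>i\<in>insert i I. \<Oplus>j\<in>J. f i j) = (\<Oplus>j\<in>J. f i j) \<oplus> (\<Oplus>j\<in>J. \<Oplus>i\<in>I. f i j)"
  using insert by (simp add: Pi_def)
 also have "... = (\<Oplus>j\<in>J. f i j \<oplus> (\<Oplus>i\<in>I. f i j))"
  using insert by (simp add: Pi_def)
 also have "... = (\<Oplus>j\<in>J. \<Oplus>i\<in>insert i I. f i j)"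
  using insert by (intro finsum_cong') (auto simp: Pi_def)
 finally show ?case .
qed

lemma finsum_Times:
 assumes "finite I" "finite J" "!!i j. i \<in> I ==> j : J ==> f i j \<in> carrier R"
 shows "(\<Oplus>x\<in>I \<times> J. f (fst x) (snd x)) = (\<Oplus>i\<in>I. \<Oplus>j\<in>J. f i j)"
 using assms(1,3)
proof (induction I rule: finite_induct)
 case (insert i I)
 have eq: "insert i I \<times> J = (Pair i) ` J \<union> I \<times> J" by auto
 have "(\<Oplus>x\<in>insert i I \<times> J. f (fst x) (snd x))
   = (\<Oplus>x\<in>Pair i ` J. f (fst x) (snd x)) \<oplus> (\<Oplus>x\<in>I \<times> J. f (fst x) (snd x))"
  unfolding eq by (rule finsum_Un_disjoint) (use insert assms(2) in auto)
 also have "(\<Oplus>x\<in>Pair i ` J. f (fst x) (snd x)) = (\<Oplus>j\<in>J. f i j)"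
  by (subst finsum_reindex) (use insert in \<open>auto simp: inj_on_def\<close>)
 finally show ?case
  using insert by (simp add: Pi_def)
qed simp

lemma finsum_uminus:
 assumes "!!i. i \<in> I ==> f i \<in> carrier R"
 shows "(\<Oplus>i\<in>I. \<ominus> f i) = \<ominus> (\<Oplus>i\<in>I. f i)"
 by (rule finsum_additive(2)[symmetric, where S = "carrier R"])
  (use assms in \<open>auto intro: abelian_monoid_axioms simp: minus_add\<close>)

lemma finsum_minus:
 assumes "!!i. i \<in> I ==> f i \<in> carrier R" "!!i. i \<in> I ==> g i \<in> carrier R"
 shows "(\<Oplus>i\<in>I. f i \<ominus> g i) = (\<Oplus>i\<in>I. f i) \<ominus> (\<Oplus>i\<in>I. g i)"
 using assms by (simp add: a_minus_def Pi_def finsum_uminus)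

lemma finsum_lmult:
 assumes "a : carrier R" "!!i. i \<in> I ==> f i \<in> carrier R"
 shows "a ** (\<Oplus>i\<in>I. f i) = (\<Oplus>i\<in>I. a ** f i)"
 by (rule finsum_additive(2)[where S = "carrier R"])
  (use assms in \<open>auto intro: abelian_monoid_axioms simp: r_distr\<close>)

lemma finsum_rmult:
 assumes "a : carrier R" "!!i. i \<in> I ==> f i \<in> carrier R"
 shows "(\<Oplus>i\<in>I. f i) ** a = (\<Oplus>i\<in>I. f i ** a)"
 by (rule finsum_additive(2)[where S = "carrier R"])
  (use assms in \<open>auto intro: abelian_monoid_axioms simp: l_distr\<close>)

end

text \<open>The map is only semilinear, along \<open>kp\<close>: a field often reappears as a copy of itself in another ring,
 such as the scalars of a tensor product.\<close>

lemma dimension_transport: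
 assumes "ring R" "ring R'" "subfield K R" "subfield K' R'"
  and dim: "ring.dimension R n K V"
  and h: "!!v. v \<in> V ==> h v \<in> carrier R'" "inj_on h V"
   "!!v w. v \<in> V ==> w : V ==> h (v \<oplus>\<^bsub>R\<^esub> w) = h v \<oplus>\<^bsub>R'\<^esub> h w"
  and kp: "kp ` K = K'" "!!k v. k \<in> K ==> v : V ==> h (k \<otimes>\<^bsub>R\<^esub> v) = kp k \<otimes>\<^bsub>R'\<^esub> h v"
 shows "ring.dimension R' n K' (h ` V)"
proof -
 interpret R: ring R by fact
 interpret R': ring R' by fact
 note K = subringE[OF subfieldE(1)[OF assms(3)]]
 show ?thesis
  using dim h kp
 proof (induction n arbitrary: V)
  case 0
  then have V: "V = {\<zero>\<^bsub>R\<^esub>}" using R.dimension_zero[OF assms(3)] by blast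
  have "h \<zero>\<^bsub>R\<^esub> = \<zero>\<^bsub>R'\<^esub>"
   by (rule additive_zero[where V = V]) (use 0 V assms in auto)
  then show ?case using R'.dimension.zero_dim V by simp
 next
  case (Suc n)
  obtain v E where v: "v : carrier R" "v \<notin> E" "R.dimension n K E"
   and V: "V = R.line_extension K v E"
   using R.dimension_backwards[OF assms(3) Suc.prems(1)] by blast
  note E = R.space_subgroup_props[OF assms(3) v(3)]
  note Vs = R.space_subgroup_props[OF assms(3) Suc.prems(1)]
  have EV: "E <= V"
  proof
   fix w assume w: "w : E"
   then have "w = \<zero>\<^bsub>R\<^esub> \<otimes>\<^bsub>R\<^esub> v \<oplus>\<^bsub>R\<^esub> w" using v E by auto
   then show "w : V" unfolding V R.line_extension_mem_iff using w K by blast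
  qed
  have "v = \<one>\<^bsub>R\<^esub> \<otimes>\<^bsub>R\<^esub> v \<oplus>\<^bsub>R\<^esub> \<zero>\<^bsub>R\<^esub>" using v by simp
  then have vV: "v : V" unfolding V R.line_extension_mem_iff using E K by blast
  have "h ` V = R'.line_extension K' (h v) (h ` E)"
  proof (intro equalityI subsetI)
   fix y assume "y : h ` V"
   then obtain k w where kw: "k : K" "w : E" "y = h (k \<otimes>\<^bsub>R\<^esub> v \<oplus>\<^bsub>R\<^esub> w)"
    unfolding V using R.line_extension_mem_iff by auto
   then have "y = kp k \<otimes>\<^bsub>R'\<^esub> h v \<oplus>\<^bsub>R'\<^esub> h w"
    using Suc.prems EV vV Vs by (metis subsetD)
   then show "y : R'.line_extension K' (h v) (h ` E)"
    unfolding R'.line_extension_mem_iff using kw Suc.prems by blast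
  next
   fix y assume "y : R'.line_extension K' (h v) (h ` E)"
   then obtain k w where kw: "k : K" "w : E" "y = kp k \<otimes>\<^bsub>R'\<^esub> h v \<oplus>\<^bsub>R'\<^esub> h w"
    unfolding R'.line_extension_mem_iff using Suc.prems by auto
   then have "y = h (k \<otimes>\<^bsub>R\<^esub> v \<oplus>\<^bsub>R\<^esub> w)"
    using Suc.prems EV vV Vs by (metis subsetD)
   then show "y : h ` V" unfolding V using R.line_extension_mem_iff kw by blast
  qed
  moreover have "R'.dimension n K' (h ` E)"
   by (rule Suc.IH) (use v Suc.prems EV subset_iff[of E V] in \<open>auto dest: inj_on_subset\<close>)
  moreover have "h v \<notin> h ` E"
   using inj_on_image_mem_iff[OF Suc.prems(3) vV EV] v by simp
  ultimately show ?case
   using R'.dimension.Suc_dim Suc.prems vV by metis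
 qed
qed

context ring
begin

definition lin_span :: "'a set \<Rightarrow> 'i set \<Rightarrow> ('i \<Rightarrow> 'a) \<Rightarrow> 'a set" where
 "lin_span K I w = {\<Oplus>i\<in>I. k i ** w i | k. k \<in> I \<rightarrow> K}"

definition lin_indep :: "'a set \<Rightarrow> 'i set \<Rightarrow> ('i \<Rightarrow> 'a) \<Rightarrow> bool" where
 "lin_indep K I w \<longleftrightarrow> (\<forall>k \<in> I \<rightarrow> K. (\<Oplus>i\<in>I. k i ** w i) = \<zero> \<longrightarrow> (\<forall>i\<in>I. k i = \<zero>))"

lemma lin_spanE:
 assumes "x : lin_span K I w"
 obtains k where "k : I \<rightarrow> K" "x = (\<Oplus>i\<in>I. k i ** w i)"
 using assms unfolding lin_span_def by blast

lemma lin_spanI: "k : I \<rightarrow> K ==> x = (\<Oplus>i\<in>I. k i ** w i) ==> x : lin_span K I w"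
 unfolding lin_span_def by blast

text \<open>The dimension counts for matrix rings and for crossed products are instances of this one, with \<open>ph\<close> running over
 multiplications by the elements of a system of matrix units or of a crossed product basis.\<close>

lemma dimension_direct_sum:
 assumes K: "subfield K R" and dim: "dimension n K V" and "finite I"
  and ph: "!!i v. i \<in> I ==> v : V ==> ph i v \<in> carrier R"
   "!!i v w. i \<in> I ==> v : V ==> w : V ==> ph i (v \<oplus> w) = ph i v \<oplus> ph i w"
   "!!i k v. i \<in> I ==> k : K ==> v : V ==> ph i (k ** v) = k ** ph i v"
  and indep: "!!v i. v \<in> I \<rightarrow> V ==> (\<Oplus>i\<in>I. ph i (v i)) = \<zero> ==> i : I ==> v i = \<zero>"
 shows "dimension (card I * n) K {\<Oplus>i\<in>I. ph i (v i) | v. v \<in> I \<rightarrow> V}"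
 using \<open>finite I\<close> ph indep
proof (induction I rule: finite_induct)
 case empty
 show ?case by simp
next
 case (insert i I)
 note V = space_subgroup_props[OF K dim]
 have ph0: "ph j \<zero> = \<zero>" if "j : insert i I" for j
  by (rule additive_zero[where V = V]) (use insert.prems that V ring_axioms in auto)
 have sum_insert: "(\<Oplus>j\<in>insert i I. ph j (v j)) = ph i (v i) \<oplus> (\<Oplus>j\<in>I. ph j (v j))"
  if "v : insert i I \<rightarrow> V" for v
  using insert that by (auto simp: Pi_def)
 let ?E = "{\<Oplus>j\<in>I. ph j (v j) | v. v \<in> I \<rightarrow> V}"
 have indep_I: "v j = \<zero>" if v: "v : I \<rightarrow> V" "(\<Oplus>j\<in>I. ph j (v j)) = \<zero>" and j: "j : I" for v j
 proof -
  let ?v = "v(i := \<zero>)"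
  have "(\<Oplus>j\<in>I. ph j (?v j)) = (\<Oplus>j\<in>I. ph j (v j))"
   by (rule finsum_cong') (use insert.hyps insert.prems(1) v in \<open>auto simp: Pi_def\<close>)
  then have "(\<Oplus>j\<in>insert i I. ph j (?v j)) = \<zero>"
   using sum_insert[of ?v] v V ph0 by (auto simp: Pi_def)
  then have "?v j = \<zero>"
   using insert.prems(4)[of ?v j] v V j by (auto simp: Pi_def)
  then show ?thesis using j insert.hyps by (auto split: if_splits)
 qed
 have E: "dimension (card I * n) K ?E"
  by (rule insert.IH) (use insert.prems(1-3) indep_I in auto)
 have inj: "inj_on (ph i) V"
 proof (rule inj_onI)
  fix a b assume ab: "a : V" "b : V" "ph i a = ph i b"
  let ?v = "(%_. \<zero>)(i := a \<ominus> b)"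
  have mem: "a \<ominus> b \<in> V" using ab V by (simp add: a_minus_def)
  have neg: "ph i (\<ominus> b) = \<ominus> ph i b"
  proof -
   have "ph i (\<ominus> b) \<oplus> ph i b = ph i (\<ominus> b \<oplus> b)"
    using insert.prems(2)[of i "\<ominus> b" b] ab V by simp
   also have "\<ominus> b \<oplus> b = \<zero>"
    using ab V(1) by (simp add: subset_iff l_neg)
   finally have "ph i (\<ominus> b) \<oplus> ph i b = \<zero>" using ph0 by simp
   then show ?thesis
    using insert.prems(1) ab V(4) by (simp add: minus_equality)
  qed
  have "ph i (a \<ominus> b) = \<zero>"
   using insert.prems(1,2)[of i] ab V neg by (simp add: a_minus_def r_neg)
  moreover have "(\<Oplus>j\<in>I. ph j (?v j)) = \<zero>"
   by (rule add.finprod_one_eqI) (use insert.hyps ph0 in auto)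
  ultimately have "(\<Oplus>j\<in>insert i I. ph j (?v j)) = \<zero>"
   using sum_insert[of ?v] mem V by (auto simp: Pi_def)
  then have "a \<ominus> b = \<zero>"
   using insert.prems(4)[of ?v i] mem V by (auto simp: Pi_def)
  then show "a = b" using ab V(1) by (simp add: subset_iff)
 qed
 have W: "dimension n K (ph i ` V)"
  by (rule dimension_transport[where R = R and R' = R and K = K and kp = id])
   (use ring_axioms K dim insert.prems inj in auto)
 have "ph i ` V \<inter> ?E = {\<zero>}"
 proof (intro equalityI subsetI)
  fix x assume "x : ph i ` V \<inter> ?E"
  then obtain a v where a: "a : V" "x = ph i a" and v: "v : I \<rightarrow> V" "x = (\<Oplus>j\<in>I. ph j (v j))"
   by auto
  let ?v = "(%j. \<ominus> v j)(i := a)"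
  have neg: "ph j (\<ominus> b) = \<ominus> ph j b" if "j : I" "b : V" for j b
  proof -
   have "ph j (\<ominus> b) \<oplus> ph j b = ph j (\<ominus> b \<oplus> b)"
    using insert.prems(2)[of j "\<ominus> b" b] that V by simp
   also have "\<ominus> b \<oplus> b = \<zero>"
    using that V(1) by (simp add: subset_iff l_neg)
   finally have "ph j (\<ominus> b) \<oplus> ph j b = \<zero>" using ph0 that by simp
   then show ?thesis
    using insert.prems(1) that V(4) by (simp add: minus_equality)
  qed
  have "(\<Oplus>j\<in>I. ph j (?v j)) = (\<Oplus>j\<in>I. \<ominus> ph j (v j))"
   by (rule finsum_cong') (use insert.hyps insert.prems(1) v neg in \<open>auto simp: Pi_def\<close>)
  also have "... = \<ominus> x"
   unfolding v(2) by (rule finsum_uminus) (use insert.prems(1) v in auto)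
  finally have "(\<Oplus>j\<in>insert i I. ph j (?v j)) = \<zero>"
   using sum_insert[of ?v] a v V insert.prems(1) by (auto simp: Pi_def r_neg)
  moreover have "?v \<in> insert i I \<rightarrow> V"
   using a(1) v(1) V(4) by (simp add: Pi_def)
  ultimately have "?v i = \<zero>"
   using insert.prems(4)[of ?v i] by blast
  then have "a = \<zero>" by simp
  then show "x : {\<zero>}" using a ph0 by simp
 next
  fix x assume "x : {\<zero>}"
  then show "x : ph i ` V \<inter> ?E"
   using space_subgroup_props(2)[OF K W] space_subgroup_props(2)[OF K E] by simp
 qed
 from dimension_direct_sum_space[OF K W E this]
 have "dimension (card (insert i I) * n) K (ph i ` V <+>\<^bsub>R\<^esub> ?E)"
  using insert.hyps by simp
 also have "ph i ` V <+>\<^bsub>R\<^esub> ?E = {\<Oplus>j\<in>insert i I. ph j (v j) | v. v \<in> insert i I \<rightarrow> V}"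
 proof (intro equalityI subsetI)
  fix x assume "x : ph i ` V <+>\<^bsub>R\<^esub> ?E"
  then obtain a v where a: "a : V" and v: "v : I \<rightarrow> V" "x = ph i a \<oplus> (\<Oplus>j\<in>I. ph j (v j))"
   unfolding set_add_def' by auto
  let ?v = "v(i := a)"
  have "(\<Oplus>j\<in>I. ph j (?v j)) = (\<Oplus>j\<in>I. ph j (v j))"
   by (rule finsum_cong') (use insert.hyps insert.prems(1) v in \<open>auto simp: Pi_def\<close>)
  then have "x = (\<Oplus>j\<in>insert i I. ph j (?v j))"
   using sum_insert[of ?v] a v by (auto simp: Pi_def)
  moreover have "?v \<in> insert i I \<rightarrow> V" using a v by auto
  ultimately show "x : {\<Oplus>j\<in>insert i I. ph j (v j) | v. v \<in> insert i I \<rightarrow> V}" by blast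
 next
  fix x assume "x : {\<Oplus>j\<in>insert i I. ph j (v j) | v. v \<in> insert i I \<rightarrow> V}"
  then obtain v where "v : insert i I \<rightarrow> V" "x = (\<Oplus>j\<in>insert i I. ph j (v j))" by blast
  then show "x : ph i ` V <+>\<^bsub>R\<^esub> ?E"
   unfolding set_add_def' using sum_insert[of v] by (auto simp: Pi_def)
 qed
 finally show ?case .
qed

lemma lin_span_subset:
 assumes "subfield K R" "finite I" "w : I \<rightarrow> E" "dimension n K E"
 shows "lin_span K I w <= E"
proof
 note E = space_subgroup_props[OF assms(1,4)]
 fix x assume "x : lin_span K I w"
 then obtain k where k: "k : I \<rightarrow> K" "x = (\<Oplus>i\<in>I. k i ** w i)"
  unfolding lin_span_def by blast
 show "x : E" unfolding k(2)
  by (rule finsum_additive(1)[where H = R and h = id])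
   (use E k assms(3) abelian_monoid_axioms in \<open>auto simp: Pi_def\<close>)
qed

lemma dimension_lin_span:
 assumes K: "subfield K R" and "finite I" "w : I \<rightarrow> carrier R" "lin_indep K I w"
 shows "dimension (card I) K (lin_span K I w)"
proof -
 note Ks = subringE[OF subfieldE(1)[OF K]]
 have "dimension (card I * 1) K {\<Oplus>i\<in>I. k i ** w i | k. k \<in> I \<rightarrow> K}"
  by (rule dimension_direct_sum[OF K dimension_one[OF K], where ph = "%i k. k ** w i"])
   (use assms Ks in \<open>auto simp: lin_indep_def Pi_def subset_iff l_distr m_assoc\<close>)
 then show ?thesis unfolding lin_span_def by simp
qed

lemma lin_indep_card_le:
 assumes K: "subfield K R" and "finite I" "w : I \<rightarrow> E" "lin_indep K I w" "dimension n K E"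
 shows "card I \<le> n"
proof -
 note E = space_subgroup_props[OF assms(1,5)]
 have "dimension (card I) K (lin_span K I w)"
  using assms E by (intro dimension_lin_span) auto
 from exists_base[OF K this] obtain Vs where Vs: "set Vs <= carrier R" "independent K Vs"
  "length Vs = card I" "Span K Vs = lin_span K I w" by blast
 have "set Vs <= E"
  using Span_base_incl[OF K Vs(1)] Vs(4) lin_span_subset[OF K assms(2,3,5)] by auto
 from independent_length_le_dimension[OF K assms(5) Vs(2) this] Vs(3) show ?thesis by simp
qed

lemma dimension_mono:
 assumes K: "subfield K R" and "dimension n K E" "dimension m K V" "V <= E"
 shows "m \<le> n" "m = n ==> V = E"
proof -
 from exists_base[OF K assms(3)] obtain Vs where Vs: "set Vs <= carrier R" "independent K Vs"
  "length Vs = m" "Span K Vs = V" by blast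
 have "set Vs <= E"
  using Span_base_incl[OF K Vs(1)] Vs(4) assms(4) by auto
 with Vs show "m \<le> n" "m = n ==> V = E"
  using independent_length_le_dimension[OF K assms(2) Vs(2)]
   independent_length_eq_dimension[OF K assms(2) Vs(2)] by auto
qed

lemma lin_span_eq_space:
 assumes K: "subfield K R" and "finite I" "w : I \<rightarrow> E" "lin_indep K I w" "dimension (card I) K E"
 shows "lin_span K I w = E"
proof -
 note E = space_subgroup_props[OF assms(1,5)]
 have "dimension (card I) K (lin_span K I w)"
  using assms E by (intro dimension_lin_span) auto
 from dimension_mono(2)[OF K assms(5) this lin_span_subset[OF K assms(2,3,5)]]
 show ?thesis by simp
qed

lemma dimension_basis:
 assumes K: "subfield K R" and "dimension n K E"
 obtains w where "w : {1..n} \<rightarrow> E" "lin_indep K {1..n} w" "lin_span K {1..n} w = E"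
proof -
 have "\<exists>w. w \<in> {1..n} \<rightarrow> E \<and> lin_indep K {1..n} w \<and> lin_span K {1..n} w = E"
  using assms(2)
 proof (induction n arbitrary: E)
  case 0
  then show ?case using dimension_zero[OF K] by (auto simp: lin_indep_def lin_span_def)
 next
  case (Suc n)
  obtain v E' where v: "v : carrier R" "v \<notin> E'" "dimension n K E'"
   and E: "E = line_extension K v E'"
   using dimension_backwards[OF K Suc.prems] by blast
  from Suc.IH[OF v(3)] obtain w where w: "w : {1..n} \<rightarrow> E'" "lin_indep K {1..n} w"
   "lin_span K {1..n} w = E'" by blast
  note E' = space_subgroup_props[OF K v(3)]
  note Ks = subringE[OF subfieldE(1)[OF K]]
  let ?w = "w(Suc n := v)"
  have eq: "{1..Suc n} = insert (Suc n) {1..n}" by auto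
  have sum: "(\<Oplus>i\<in>{1..Suc n}. k i ** ?w i) = k (Suc n) ** v \<oplus> (\<Oplus>i\<in>{1..n}. k i ** w i)"
   if "k : {1..Suc n} \<rightarrow> K" for k
  proof -
   have "(\<Oplus>i\<in>{1..n}. k i ** ?w i) = (\<Oplus>i\<in>{1..n}. k i ** w i)"
    by (rule finsum_cong') (use that w E' Ks in \<open>auto simp: Pi_def subset_iff\<close>)
   then show ?thesis unfolding eq
    using that w v E' Ks by (subst finsum_insert) (auto simp: Pi_def subset_iff)
  qed
  have inE': "(\<Oplus>i\<in>{1..n}. k i ** w i) \<in> E'" if "k : {1..Suc n} \<rightarrow> K" for k
   unfolding w(3)[symmetric] lin_span_def using that by fastforce
  have "lin_indep K {1..Suc n} ?w"
   unfolding lin_indep_def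
  proof (intro ballI impI)
   fix k i assume k: "k : {1..Suc n} \<rightarrow> K" "(\<Oplus>i\<in>{1..Suc n}. k i ** ?w i) = \<zero>"
    and i: "i : {1..Suc n}"
   then have z: "k (Suc n) ** v \<oplus> (\<Oplus>i\<in>{1..n}. k i ** w i) = \<zero>" using sum by simp
   have kn: "k (Suc n) \<in> K" using k by auto
   have k0: "k (Suc n) = \<zero>"
   proof (rule ccontr)
    assume "k (Suc n) ~= \<zero>"
    moreover have "k (Suc n) ** v = \<ominus> (\<Oplus>i\<in>{1..n}. k i ** w i)"
     using z inE'[OF k(1)] E'(1) v(1) kn Ks by (intro minus_equality[symmetric]) (auto simp: subset_iff)
    then have "k (Suc n) ** v \<in> E'" using E'(4) inE'[OF k(1)] by simp
    ultimately show False using E'(6)[of "k (Suc n)" v] v kn by simp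
   qed
   have "(\<Oplus>i\<in>{1..n}. k i ** w i) = \<zero>"
    using z k0 v inE'[OF k(1)] E'(1) by auto
   moreover have "k : {1..n} \<rightarrow> K" using k(1) by auto
   ultimately have "\<forall>i\<in>{1..n}. k i = \<zero>"
    using w(2) unfolding lin_indep_def by blast
   then show "k i = \<zero>" using i k0 by (cases "i = Suc n") auto
  qed
  moreover have "lin_span K {1..Suc n} ?w = E"
  proof (intro equalityI subsetI)
   fix x assume "x : lin_span K {1..Suc n} ?w"
   then obtain k where k: "k : {1..Suc n} \<rightarrow> K" "x = (\<Oplus>i\<in>{1..Suc n}. k i ** ?w i)"
    by (rule lin_spanE)
   have "k (Suc n) \<in> K" using k(1) by auto
   then show "x : E" unfolding E line_extension_mem_iff k(2) sum[OF k(1)]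
    using inE'[OF k(1)] by blast
  next
   fix x assume "x : E"
   then obtain c y where c: "c : K" "y : E'" "x = c ** v \<oplus> y"
    unfolding E line_extension_mem_iff by blast
   obtain k where k: "k : {1..n} \<rightarrow> K" "y = (\<Oplus>i\<in>{1..n}. k i ** w i)"
    using c(2) unfolding w(3)[symmetric] by (rule lin_spanE)
   let ?k = "k(Suc n := c)"
   have kk: "?k \<in> {1..Suc n} \<rightarrow> K" using k c by auto
   have "(\<Oplus>i\<in>{1..n}. ?k i ** w i) = y"
    unfolding k(2) by (rule finsum_cong') (use k w E' Ks in \<open>auto simp: Pi_def subset_iff\<close>)
   then have "x = (\<Oplus>i\<in>{1..Suc n}. ?k i ** ?w i)" using sum[OF kk] c by simp
   then show "x : lin_span K {1..Suc n} ?w" by (rule lin_spanI[OF kk])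
  qed
  moreover have "?w \<in> {1..Suc n} \<rightarrow> E"
  proof -
   have "w i \<in> E" if "i : {1..n}" for i
   proof -
    have "w i = \<zero> ** v \<oplus> w i" using that w v E' by (auto simp: Pi_def subset_iff)
    then show ?thesis unfolding E line_extension_mem_iff using that w Ks by blast
   qed
   moreover have "v = \<one> ** v \<oplus> \<zero>" using v by simp
   then have "v : E" unfolding E line_extension_mem_iff using Ks E' by blast
   ultimately show ?thesis by auto
  qed
  ultimately show ?case by blast
 qed
 with that show ?thesis by blast
qed

lemma subfield_sub:
 assumes "subring S R" "K <= S"
 shows "subfield K (sub R S) \<longleftrightarrow> subfield K R"
proof -
 interpret S: ring "sub R S" by (rule subring_is_ring) fact
 have S: "S <= carrier R" using subringE(1)[OF assms(1)] .
 show ?thesis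
 proof
  assume "subfield K (sub R S)"
  from S.subfield_iff(2)[OF this] show "subfield K R"
   using subfield_iff(1)[of K] assms(2) S by simp
 next
  assume "subfield K R"
  from subfield_iff(2)[OF this] show "subfield K (sub R S)"
   using S.subfield_iff(1)[of K] assms(2) by simp
 qed
qed

lemma dimension_sub:
 assumes "subring S R" "K <= S" "E <= S" "subfield K R"
 shows "ring.dimension (sub R S) n K E \<longleftrightarrow> dimension n K E"
proof -
 interpret S: ring "sub R S" by (rule subring_is_ring) fact
 have S: "S <= carrier R" using subringE(1)[OF assms(1)] .
 have KS: "subfield K (sub R S)" using subfield_sub assms by blast
 show ?thesis
 proof
  assume "S.dimension n K E"
  from dimension_transport[OF S.ring_axioms ring_axioms KS assms(4) this, where h = id and kp = id]
  show "dimension n K E" using assms S by auto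
 next
  assume "dimension n K E"
  from dimension_transport[OF ring_axioms S.ring_axioms assms(4) KS this, where h = id and kp = id]
  show "S.dimension n K E" using assms by auto
 qed
qed

lemma subspace_dimension:
 assumes K: "subfield K R" and "dimension n K E" and V: "V <= E" "\<zero> \<in> V"
  "!!v w. v \<in> V ==> w : V ==> v \<oplus> w \<in> V" "!!k v. k \<in> K ==> v : V ==> k ** v \<in> V"
 obtains m where "dimension m K V" "m \<le> n"
proof -
 note E = space_subgroup_props[OF assms(1,2)]
 note Ks = subringE[OF subfieldE(1)[OF K]]
 have neg: "\<ominus> v \<in> V" if "v : V" for v
 proof -
  have "\<ominus> v = (\<ominus> \<one>) ** v" using that V E by (auto simp: l_minus)
  then show ?thesis using V(4)[of "\<ominus> \<one>" v] that Ks by auto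
 qed
 have "subgroup V (add_monoid R)"
  by (rule add.subgroupI) (use V neg E in auto)
 then have "subalgebra K V R"
  unfolding subalgebra_def subalgebra_axioms_def using V by auto
 from subalbegra_incl_imp_finite_dimension[OF K finite_dimensionI[OF assms(2)] this V(1)]
 obtain m where m: "dimension m K V" by (auto elim: finite_dimensionE')
 with dimension_mono(1)[OF K assms(2) m V(1)] that show ?thesis by blast
qed

lemma dimension_over_intermediate:
 assumes K: "subfield K R" and L: "subfield L R" and "K <= L" "dimension d K L" "dimension n K E"
  and E: "!!k v. k \<in> L ==> v : E ==> k ** v \<in> E"
 obtains m where "dimension m L E" "n = d * m"
proof -
 note Es = space_subgroup_props[OF K assms(5)]
 from exists_base[OF K assms(5)] obtain Vs where Vs: "set Vs <= carrier R" "Span K Vs = E" by blast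
 have "subgroup E (add_monoid R)"
  by (rule add.subgroupI) (use Es in auto)
 then have sub: "subalgebra L E R"
  unfolding subalgebra_def subalgebra_axioms_def using E by auto
 have "set Vs <= E" using Span_base_incl[OF K Vs(1)] Vs(2) by simp
 then have "Span L Vs <= E" by (rule subalgebra_Span_incl[OF L sub])
 moreover have "Span K Vs <= Span L Vs"
 proof (rule subalgebra_Span_incl[OF K])
  have "subalgebra L (Span L Vs) R" by (rule Span_is_subalgebra[OF L Vs(1)])
  then show "subalgebra K (Span L Vs) R"
   unfolding subalgebra_def subalgebra_axioms_def using assms(3) by blast
  show "set Vs <= Span L Vs" by (rule Span_base_incl[OF L Vs(1)])
 qed
 ultimately have "Span L Vs = E" using Vs by simp
 then obtain m where m: "dimension m L E"
  using Span_finite_dimension[OF L Vs(1)] by (auto elim: finite_dimensionE')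
 from telescopic_base[OF K L assms(4) m] have "n = d * m"
  using dimension_is_inj[OF K assms(5)] by blast
 with m that show ?thesis by blast
qed

end

section \<open>Matrix units\<close>

definition matrix_units :: "('a, 'b) ring_scheme \<Rightarrow> nat \<Rightarrow> (nat \<Rightarrow> nat \<Rightarrow> 'a) \<Rightarrow> bool" where
 "matrix_units R m e \<longleftrightarrow>
  (\<forall>i\<in>{1..m}. \<forall>j\<in>{1..m}. e i j \<in> carrier R) \<and>
  (\<Oplus>\<^bsub>R\<^esub>i\<in>{1..m}. e i i) = \<one>\<^bsub>R\<^esub> \<and>
  (\<forall>i\<in>{1..m}. \<forall>j\<in>{1..m}. \<forall>k\<in>{1..m}. \<forall>l\<in>{1..m}.
    e i j \<otimes>\<^bsub>R\<^esub> e k l = (if j = k then e i l else \<zero>\<^bsub>R\<^esub>))"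

definition unit_commutant :: "('a, 'b) ring_scheme \<Rightarrow> nat \<Rightarrow> (nat \<Rightarrow> nat \<Rightarrow> 'a) \<Rightarrow> 'a set" where
 "unit_commutant R m e = centralizer R {e i j | i j. i \<in> {1..m} \<and> j \<in> {1..m}}"

lemma complete_matrix_units_iff:
 "complete_matrix_units F A m E \<longleftrightarrow> (\<exists>D. matrix_form F A m D) \<and> matrix_units A m E"
 unfolding complete_matrix_units_def matrix_units_def by blast

lemma centralizer_sub: "centralizer (sub A S) B = {a \<in> S. \<forall>b\<in>B. a \<otimes>\<^bsub>A\<^esub> b = b \<otimes>\<^bsub>A\<^esub> a}"
 unfolding centralizer_def by simp

lemma centralizer_memD:
 "a : centralizer A B ==> b : B ==> a \<otimes>\<^bsub>A\<^esub> b = b \<otimes>\<^bsub>A\<^esub> a"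
 "a : centralizer A B ==> a : carrier A"
 unfolding centralizer_def by auto

lemma division_ringI:
 assumes "ring D" "\<one>\<^bsub>D\<^esub> ~= \<zero>\<^bsub>D\<^esub>"
  and inv: "!!x. x \<in> carrier D ==> x ~= \<zero>\<^bsub>D\<^esub> ==> \<exists>y\<in>carrier D. y \<otimes>\<^bsub>D\<^esub> x = \<one>\<^bsub>D\<^esub>"
 shows "division_ring D"
proof -
 interpret D: ring D by fact
 have "x : Units D" if x: "x : carrier D" "x ~= \<zero>\<^bsub>D\<^esub>" for x
 proof -
  from inv[OF x] obtain y where y: "y : carrier D" "y \<otimes>\<^bsub>D\<^esub> x = \<one>\<^bsub>D\<^esub>" by blast
  with x assms(2) have "y ~= \<zero>\<^bsub>D\<^esub>" by auto
  from inv[OF y(1) this] obtain w where w: "w : carrier D" "w \<otimes>\<^bsub>D\<^esub> y = \<one>\<^bsub>D\<^esub>" by blast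
  have "w = w \<otimes>\<^bsub>D\<^esub> (y \<otimes>\<^bsub>D\<^esub> x)" using w y by simp
  also have "... = x" using w y(1) x(1) by (simp flip: D.m_assoc)
  finally show ?thesis using w y x unfolding Units_def by auto
 qed
 moreover have "\<zero>\<^bsub>D\<^esub> \<notin> Units D"
  using assms(2) unfolding Units_def by auto
 ultimately show ?thesis
  unfolding division_ring_def using assms(1,2) D.Units_closed by blast
qed

lemma division_ringE:
 assumes "division_ring D" "x : carrier D" "x ~= \<zero>\<^bsub>D\<^esub>"
 obtains y where "y : carrier D" "y \<otimes>\<^bsub>D\<^esub> x = \<one>\<^bsub>D\<^esub>" "x \<otimes>\<^bsub>D\<^esub> y = \<one>\<^bsub>D\<^esub>"
proof -
 have "x : Units D" using assms unfolding division_ring_def by blast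
 then show ?thesis using that unfolding Units_def by auto
qed

definition prime_ring :: "('a, 'b) ring_scheme \<Rightarrow> bool" where
 "prime_ring R \<longleftrightarrow> \<one>\<^bsub>R\<^esub> ~= \<zero>\<^bsub>R\<^esub> \<and> (\<forall>x\<in>carrier R. \<forall>y\<in>carrier R.
  (\<forall>a\<in>carrier R. x \<otimes>\<^bsub>R\<^esub> a \<otimes>\<^bsub>R\<^esub> y = \<zero>\<^bsub>R\<^esub>) \<longrightarrow> x = \<zero>\<^bsub>R\<^esub> \<or> y = \<zero>\<^bsub>R\<^esub>)"

text \<open>A primitive idempotent: its corner is a division ring.\<close>

definition division_idempotent :: "('a, 'b) ring_scheme \<Rightarrow> 'a \<Rightarrow> bool" where
 "division_idempotent R f \<longleftrightarrow> f \<in> carrier R \<and> f \<otimes>\<^bsub>R\<^esub> f = f \<and> f ~= \<zero>\<^bsub>R\<^esub> \<and>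
  (\<forall>x\<in>carrier R. f \<otimes>\<^bsub>R\<^esub> x = x \<longrightarrow> x \<otimes>\<^bsub>R\<^esub> f = x \<longrightarrow> x ~= \<zero>\<^bsub>R\<^esub> \<longrightarrow>
    (\<exists>y\<in>carrier R. f \<otimes>\<^bsub>R\<^esub> y = y \<and> y \<otimes>\<^bsub>R\<^esub> f = y \<and> y \<otimes>\<^bsub>R\<^esub> x = f))"

context ring
begin

lemma centralizer_subring:
 assumes "B <= carrier R"
 shows "subring (centralizer R B) R"
proof (rule subringI)
 fix h assume h: "h : centralizer R B"
 show "\<ominus> h \<in> centralizer R B"
  using h assms unfolding centralizer_def by (auto simp: l_minus r_minus subset_iff)
next
 fix g h assume gh: "g : centralizer R B" "h : centralizer R B"
 show "g ** h \<in> centralizer R B"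
 proof -
  have "g ** h ** b = b ** (g ** h)" if b: "b : B" for b
  proof -
   have c: "b : carrier R" "g : carrier R" "h : carrier R"
    using gh assms b unfolding centralizer_def by auto
   have "g ** h ** b = g ** (b ** h)"
    using centralizer_memD(1)[OF gh(2) b] c by (simp add: m_assoc)
   also have "... = b ** (g ** h)"
    using centralizer_memD(1)[OF gh(1) b] c by (simp flip: m_assoc)
   finally show ?thesis .
  qed
  then show ?thesis using gh unfolding centralizer_def by auto
 qed
 show "g \<oplus> h \<in> centralizer R B"
  using gh assms unfolding centralizer_def by (auto simp: l_distr r_distr subset_iff)
qed (use assms in \<open>auto simp: centralizer_def subset_iff\<close>)

lemma prime_ringE:
 assumes "prime_ring R" "x : carrier R" "y : carrier R" "x ~= \<zero>" "y ~= \<zero>"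
 obtains a where "a : carrier R" "x ** a ** y ~= \<zero>"
 using assms unfolding prime_ring_def by blast

lemma division_idempotent_left_inverse:
 assumes R: "prime_ring R" and f: "division_idempotent R f"
  and x: "x : carrier R" "x ** f = x" "x ~= \<zero>"
 obtains y where "y : carrier R" "f ** y = y" "y ** x = f"
proof -
 have fR: "f : carrier R" "f ** f = f" "f ~= \<zero>"
  using f unfolding division_idempotent_def by auto
 obtain a where a: "a : carrier R" "f ** a ** x ~= \<zero>"
  using prime_ringE[OF R fR(1) x(1) fR(3) x(3)] by blast
 let ?z = "f ** a ** x"
 have "?z \<in> carrier R" using fR a x by simp
 moreover have "f ** ?z = ?z" using fR a x by (simp flip: m_assoc)
 moreover have "?z ** f = ?z" using fR a x by (simp add: m_assoc)
 ultimately obtain y where y: "y : carrier R" "f ** y = y" "y ** f = y" "y ** ?z = f"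
  using f a(2) unfolding division_idempotent_def by blast
 show ?thesis
 proof
  show "y ** a \<in> carrier R" using y a by simp
  show "f ** (y ** a) = y ** a" using y a fR by (simp flip: m_assoc)
  have "y ** a ** x = (y ** f) ** a ** x" using y by simp
  also have "... = y ** ?z" using y(1) fR(1) a(1) x(1) by (simp add: m_assoc)
  finally show "y ** a ** x = f" using y by simp
 qed
qed

text \<open>In a prime ring any two primitive idempotents are conjugate, because their one-sided
 ideals are isomorphic simple modules.\<close>

lemma division_idempotents_equivalent:
 assumes R: "prime_ring R" and e: "division_idempotent R e" and f: "division_idempotent R f"
 obtains x y where "x : carrier R" "y : carrier R" "e ** x = x" "x ** f = x"
  "f ** y = y" "y ** e = y" "x ** y = e" "y ** x = f"
proof -
 have eR: "e : carrier R" "e ** e = e" "e ~= \<zero>"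
  and fR: "f : carrier R" "f ** f = f" "f ~= \<zero>"
  using e f unfolding division_idempotent_def by auto
 obtain a where a: "a : carrier R" "e ** a ** f ~= \<zero>"
  using prime_ringE[OF R eR(1) fR(1) eR(3) fR(3)] by blast
 define x where "x = e ** a ** f"
 have x: "x : carrier R" "e ** x = x" "x ** f = x" "x ~= \<zero>"
  unfolding x_def using a eR fR by (simp_all add: m_assoc) (simp flip: m_assoc)
 obtain y0 where y0: "y0 : carrier R" "f ** y0 = y0" "y0 ** x = f"
  using division_idempotent_left_inverse[OF R f x(1,3,4)] by blast
 define y where "y = y0 ** e"
 have y: "y : carrier R" "f ** y = y" "y ** e = y" "y ** x = f"
  unfolding y_def using y0 eR fR x by (simp_all add: m_assoc) (simp flip: m_assoc)
 let ?g = "x ** y"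
 have g: "?g \<in> carrier R" "e ** ?g = ?g" "?g ** e = ?g"
  using x y eR by (simp_all add: m_assoc) (simp flip: m_assoc)
 have "?g ** ?g = x ** (y ** x) ** y" using x(1) y(1) by (simp add: m_assoc)
 then have gg: "?g ** ?g = ?g" using x y by simp
 have "?g ~= \<zero>"
 proof
  assume "?g = \<zero>"
  then have "y ** ?g ** x = \<zero>" using x y by simp
  moreover have "y ** ?g ** x = (y ** x) ** (y ** x)" using x(1) y(1) by (simp add: m_assoc)
  ultimately show False using y fR by simp
 qed
 then obtain h where h: "h : carrier R" "h ** ?g = e"
  using e g unfolding division_idempotent_def by blast
 have "?g = h ** ?g ** ?g" using h g by simp
 also have "... = h ** (?g ** ?g)" by (rule m_assoc) (use h g in auto)
 also have "... = h ** ?g" using gg by simp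
 finally have "?g = e" using h by simp
 with x y that show ?thesis by blast
qed

end

locale matrix_unit_system = ring R for R :: "('a, 'b) ring_scheme" (structure) +
 fixes m :: nat and e :: "nat \<Rightarrow> nat \<Rightarrow> 'a"
 assumes units: "matrix_units R m e"
begin

abbreviation Z where "Z \<equiv> unit_commutant R m e"

definition coef :: "'a \<Rightarrow> nat \<Rightarrow> nat \<Rightarrow> 'a" where
 "coef a i j = (\<Oplus>k\<in>{1..m}. e k i ** a ** e j k)"

lemma e_closed [simp]: "i : {1..m} ==> j : {1..m} ==> e i j \<in> carrier R"
 and e_sum: "(\<Oplus>i\<in>{1..m}. e i i) = \<one>"
 and e_mult: "i : {1..m} ==> j : {1..m} ==> k : {1..m} ==> l : {1..m} ==>
  e i j ** e k l = (if j = k then e i l else \<zero>)"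
 using units unfolding matrix_units_def by blast+

lemma e_mult_left: "i : {1..m} ==> j : {1..m} ==> k : {1..m} ==> l : {1..m} ==> a : carrier R ==>
  e i j ** (e k l ** a) = (if j = k then e i l ** a else \<zero>)"
 using e_mult[of i j k l] by (simp flip: m_assoc)

lemma Z_iff: "c : Z \<longleftrightarrow>
  c \<in> carrier R \<and> (\<forall>i\<in>{1..m}. \<forall>j\<in>{1..m}. c ** e i j = e i j ** c)"
 unfolding unit_commutant_def centralizer_def by blast

lemma Z_closed: "c : Z ==> c : carrier R"
 and Z_comm: "c : Z ==> i : {1..m} ==> j : {1..m} ==> c ** e i j = e i j ** c"
 using Z_iff by auto

lemma Z_comm_left: "c : Z ==> i : {1..m} ==> j : {1..m} ==> a : carrier R ==>
  c ** (e i j ** a) = e i j ** (c ** a)"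
 using Z_comm[of c i j] by (simp add: Z_closed flip: m_assoc)

lemma Z_subring: "subring Z R"
 unfolding unit_commutant_def by (rule centralizer_subring) auto

lemma coef_closed [simp]: "a : carrier R ==> i : {1..m} ==> j : {1..m} ==> coef a i j \<in> carrier R"
 unfolding coef_def by (intro finsum_closed) auto

lemma coef_e:
 assumes "a : carrier R" "i : {1..m}" "j : {1..m}" "p : {1..m}" "q : {1..m}"
 shows "coef a i j ** e p q = e p i ** a ** e j q" "e p q ** coef a i j = e p i ** a ** e j q"
proof -
 have "coef a i j ** e p q = (\<Oplus>k\<in>{1..m}. e k i ** a ** e j k ** e p q)"
  unfolding coef_def by (rule finsum_rmult) (use assms in auto)
 also have "... = (\<Oplus>k\<in>{1..m}. if k = p then e k i ** a ** e j q else \<zero>)"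
  by (rule finsum_cong') (use assms in \<open>auto simp: m_assoc e_mult\<close>)
 also have "... = e p i ** a ** e j q"
  by (rule finsum_delta) (use assms in auto)
 finally show "coef a i j ** e p q = e p i ** a ** e j q" .
 have "e p q ** coef a i j = (\<Oplus>k\<in>{1..m}. e p q ** (e k i ** a ** e j k))"
  unfolding coef_def by (rule finsum_lmult) (use assms in auto)
 also have "... = (\<Oplus>k\<in>{1..m}. if k = q then e p i ** a ** e j k else \<zero>)"
  by (rule finsum_cong') (use assms in \<open>auto simp: m_assoc e_mult_left\<close>)
 also have "... = e p i ** a ** e j q"
  by (rule finsum_delta) (use assms in auto)
 finally show "e p q ** coef a i j = e p i ** a ** e j q" .
qed

lemma coef_in_Z: "a : carrier R ==> i : {1..m} ==> j : {1..m} ==> coef a i j \<in> Z"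
 by (simp add: Z_iff coef_e)

lemma Z_eqI:
 assumes "a : carrier R" "b : carrier R" "!!k. k \<in> {1..m} ==> a ** e k k = b ** e k k"
 shows "a = b"
proof -
 have "a ** \<one> = (\<Oplus>k\<in>{1..m}. a ** e k k)"
  unfolding e_sum[symmetric] by (rule finsum_lmult) (use assms in auto)
 also have "... = (\<Oplus>k\<in>{1..m}. b ** e k k)"
  by (rule finsum_cong') (use assms in auto)
 also have "... = b ** \<one>"
  unfolding e_sum[symmetric] by (rule finsum_lmult[symmetric]) (use assms in auto)
 finally show ?thesis using assms by simp
qed

lemma Z_eqI_corner:
 assumes "a : Z" "b : Z" "i : {1..m}" "a ** e i i = b ** e i i"
 shows "a = b"
proof (rule Z_eqI)
 fix k assume k: "k : {1..m}"
 have "c ** e k k = e k i ** (c ** e i i) ** e i k" if "c : Z" for c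
  using assms(3) k that by (simp add: m_assoc Z_closed e_mult e_mult_left Z_comm Z_comm_left)
 then show "a ** e k k = b ** e k k" using assms by simp
qed (use assms Z_closed in auto)

lemma expansion:
 assumes a: "a : carrier R"
 shows "(\<Oplus>i\<in>{1..m}. \<Oplus>j\<in>{1..m}. e i j ** coef a i j) = a"
proof -
 have "(\<Oplus>i\<in>{1..m}. \<Oplus>j\<in>{1..m}. e i j ** coef a i j)
   = (\<Oplus>i\<in>{1..m}. e i i ** a ** (\<Oplus>j\<in>{1..m}. e j j))"
 proof (rule finsum_cong')
  fix i assume i: "i : {1..m}"
  have "e i i ** a ** (\<Oplus>j\<in>{1..m}. e j j) = (\<Oplus>j\<in>{1..m}. e i i ** a ** e j j)"
   by (rule finsum_lmult) (use a i in auto)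
  also have "... = (\<Oplus>j\<in>{1..m}. e i j ** coef a i j)"
   by (rule finsum_cong') (use a i in \<open>auto simp: coef_e\<close>)
  finally show "(\<Oplus>j\<in>{1..m}. e i j ** coef a i j) = e i i ** a ** (\<Oplus>j\<in>{1..m}. e j j)" by simp
 qed (use a e_sum in auto)
 also have "... = (\<Oplus>i\<in>{1..m}. e i i ** a)"
  by (rule finsum_cong') (use a e_sum in auto)
 also have "... = (\<Oplus>i\<in>{1..m}. e i i) ** a"
  by (rule finsum_rmult[symmetric]) (use a in auto)
 finally show ?thesis using a e_sum by simp
qed

lemma coef_eqI:
 assumes "a : carrier R" "i : {1..m}" "j : {1..m}" "c : Z"
  "e i i ** a ** e j i = e i i ** c"
 shows "coef a i j = c"
proof (rule Z_eqI_corner[OF coef_in_Z[OF assms(1-3)] assms(4) assms(2)])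
 show "coef a i j ** e i i = c ** e i i"
  using assms by (simp add: coef_e Z_comm)
qed

lemma coef_combination:
 assumes c: "!!i j. i \<in> {1..m} ==> j : {1..m} ==> c i j \<in> Z" and pq: "p : {1..m}" "q : {1..m}"
 shows "coef (\<Oplus>i\<in>{1..m}. \<Oplus>j\<in>{1..m}. e i j ** c i j) p q = c p q"
proof (rule coef_eqI)
 have cR: "!!i j. i \<in> {1..m} ==> j : {1..m} ==> c i j \<in> carrier R"
  using c Z_closed by blast
 have "e p p ** (\<Oplus>i\<in>{1..m}. \<Oplus>j\<in>{1..m}. e i j ** c i j)
   = (\<Oplus>i\<in>{1..m}. \<Oplus>j\<in>{1..m}. e p p ** (e i j ** c i j))"
  using cR pq by (subst finsum_lmult) (auto intro!: finsum_cong' finsum_lmult)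
 also have "... = (\<Oplus>i\<in>{1..m}. if i = p then (\<Oplus>j\<in>{1..m}. e p j ** c i j) else \<zero>)"
  by (rule finsum_cong')
   (use cR pq in \<open>auto simp: e_mult_left intro!: finsum_cong' add.finprod_one_eqI\<close>)
 also have "... = (\<Oplus>j\<in>{1..m}. e p j ** c p j)"
  by (rule finsum_delta) (use cR pq in auto)
 finally have *: "e p p ** (\<Oplus>i\<in>{1..m}. \<Oplus>j\<in>{1..m}. e i j ** c i j) = (\<Oplus>j\<in>{1..m}. e p j ** c p j)" .
 have "... ** e q p = (\<Oplus>j\<in>{1..m}. e p j ** c p j ** e q p)"
  by (rule finsum_rmult) (use cR pq in auto)
 also have "... = (\<Oplus>j\<in>{1..m}. if j = q then e p p ** c p j else \<zero>)"
  by (rule finsum_cong') (use c cR pq in \<open>auto simp: m_assoc Z_comm e_mult_left\<close>)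
 also have "... = e p p ** c p q"
  by (rule finsum_delta) (use cR pq in auto)
 finally show "e p p ** (\<Oplus>i\<in>{1..m}. \<Oplus>j\<in>{1..m}. e i j ** c i j) ** e q p = e p p ** c p q"
  unfolding * .
qed (use assms Z_closed in auto)

lemma coef_add:
 assumes "a : carrier R" "b : carrier R" "i : {1..m}" "j : {1..m}"
 shows "coef (a \<oplus> b) i j = coef a i j \<oplus> coef b i j"
proof -
 have "coef (a \<oplus> b) i j = (\<Oplus>k\<in>{1..m}. (e k i ** a ** e j k) \<oplus> (e k i ** b ** e j k))"
  unfolding coef_def by (rule finsum_cong') (use assms in \<open>auto simp: l_distr r_distr\<close>)
 also have "... = coef a i j \<oplus> coef b i j"
  unfolding coef_def by (rule finsum_addf) (use assms in auto)
 finally show ?thesis .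
qed

lemma coef_mult:
 assumes "a : carrier R" "b : carrier R" "i : {1..m}" "j : {1..m}"
 shows "coef (a ** b) i j = (\<Oplus>l\<in>{1..m}. coef a i l ** coef b l j)"
proof -
 have "(\<Oplus>l\<in>{1..m}. coef a i l ** coef b l j)
   = (\<Oplus>l\<in>{1..m}. \<Oplus>k\<in>{1..m}. e k i ** a ** e l l ** b ** e j k)"
 proof (rule finsum_cong')
  fix l assume l: "l : {1..m}"
  have "coef a i l ** coef b l j = (\<Oplus>k\<in>{1..m}. coef a i l ** (e k l ** b ** e j k))"
   unfolding coef_def[of b] by (rule finsum_lmult) (use assms l in auto)
  also have "... = (\<Oplus>k\<in>{1..m}. e k i ** a ** e l l ** b ** e j k)"
   by (rule finsum_cong') (use assms l in \<open>auto simp flip: m_assoc simp: coef_e\<close>)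
  finally show "coef a i l ** coef b l j = (\<Oplus>k\<in>{1..m}. e k i ** a ** e l l ** b ** e j k)" .
 qed (use assms in auto)
 also have "... = (\<Oplus>k\<in>{1..m}. \<Oplus>l\<in>{1..m}. e k i ** a ** e l l ** b ** e j k)"
  by (rule finsum_swap) (use assms in auto)
 also have "... = coef (a ** b) i j"
  unfolding coef_def
 proof (rule finsum_cong')
  fix k assume k: "k : {1..m}"
  have "(\<Oplus>l\<in>{1..m}. e k i ** a ** e l l ** b ** e j k)
    = (\<Oplus>l\<in>{1..m}. (e k i ** a) ** (e l l ** (b ** e j k)))"
   by (rule finsum_cong') (use assms k in \<open>auto simp: m_assoc\<close>)
  also have "... = (e k i ** a) ** (\<Oplus>l\<in>{1..m}. e l l ** (b ** e j k))"
   by (rule finsum_lmult[symmetric]) (use assms k in auto)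
  also have "(\<Oplus>l\<in>{1..m}. e l l ** (b ** e j k)) = (\<Oplus>l\<in>{1..m}. e l l) ** (b ** e j k)"
   by (rule finsum_rmult[symmetric]) (use assms k in auto)
  finally show "(\<Oplus>l\<in>{1..m}. e k i ** a ** e l l ** b ** e j k) = e k i ** (a ** b) ** e j k"
   using assms k e_sum by (simp add: m_assoc)
 qed (use assms in auto)
 finally show ?thesis by simp
qed

lemma coef_Z:
 assumes "c : Z" "i : {1..m}" "j : {1..m}"
 shows "coef c i j = (if i = j then c else \<zero>)"
proof (rule coef_eqI)
 show "(if i = j then c else \<zero>) \<in> Z" using assms subringE(2)[OF Z_subring] by auto
 show "e i i ** c ** e j i = e i i ** (if i = j then c else \<zero>)"
  using assms by (simp add: m_assoc Z_closed Z_comm e_mult_left)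
qed (use assms Z_closed in auto)

lemma coef_Z_mult:
 assumes "c : Z" "a : carrier R" "i : {1..m}" "j : {1..m}"
 shows "coef (c ** a) i j = c ** coef a i j"
proof (rule coef_eqI)
 show "c ** coef a i j \<in> Z" using assms coef_in_Z subringE(6)[OF Z_subring] by blast
 have "e i i ** (c ** coef a i j) = c ** (e i i ** coef a i j)"
  using assms by (simp add: Z_comm_left Z_closed)
 also have "... = c ** (e i i ** a ** e j i)"
  using assms by (simp add: coef_e)
 also have "... = e i i ** (c ** a) ** e j i"
  using assms by (simp add: m_assoc Z_comm_left Z_closed)
 finally show "e i i ** (c ** a) ** e j i = e i i ** (c ** coef a i j)" by simp
qed (use assms Z_closed in auto)

text \<open>A ring with \<open>m\<close> by \<open>m\<close> matrix units is the matrix ring over their commutant.\<close>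

lemma matrix_iso:
 "(%a. \<lambda>(i, j)\<in>{1..m} \<times> {1..m}. coef a i j) \<in> ring_iso R (matrix_ring m (sub R Z))" (is "?ph \<in> _")
proof (rule ring_iso_memI)
 fix a assume a: "a : carrier R"
 then show "?ph a \<in> carrier (matrix_ring m (sub R Z))"
  using coef_in_Z by (auto simp: matrix_ring_def)
next
 fix a b assume ab: "a : carrier R" "b : carrier R"
 show "?ph (a \<oplus> b) = ?ph a \<oplus>\<^bsub>matrix_ring m (sub R Z)\<^esub> ?ph b"
  using ab by (auto simp: matrix_ring_def coef_add)
 show "?ph (a ** b) = ?ph a \<otimes>\<^bsub>matrix_ring m (sub R Z)\<^esub> ?ph b"
 proof -
  have "(\<Oplus>\<^bsub>sub R Z\<^esub>k\<in>{1..m}. ?ph a (i, k) ** ?ph b (k, j)) = coef (a ** b) i j"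
   if ij: "i : {1..m}" "j : {1..m}" for i j
  proof -
   have "(\<Oplus>\<^bsub>sub R Z\<^esub>k\<in>{1..m}. ?ph a (i, k) ** ?ph b (k, j)) = (\<Oplus>k\<in>{1..m}. ?ph a (i, k) ** ?ph b (k, j))"
    by (rule finsum_sub[OF Z_subring])
     (use ab ij coef_in_Z subringE(6)[OF Z_subring] in auto)
   also have "... = (\<Oplus>k\<in>{1..m}. coef a i k ** coef b k j)"
    by (rule finsum_cong') (use ab ij in auto)
   finally show ?thesis using ab ij coef_mult by simp
  qed
  then show ?thesis by (auto simp: matrix_ring_def)
 qed
next
 have "\<one> \<in> Z" using subringE(3)[OF Z_subring] .
 then show "?ph \<one> = \<one>\<^bsub>matrix_ring m (sub R Z)\<^esub>"
  by (auto simp: matrix_ring_def scalar_matrix_def coef_Z)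
next
 show "bij_betw ?ph (carrier R) (carrier (matrix_ring m (sub R Z)))"
  unfolding bij_betw_def
 proof (intro conjI inj_onI equalityI subsetI)
  fix a b assume ab: "a : carrier R" "b : carrier R" "?ph a = ?ph b"
  have "coef a i j = coef b i j" if "i : {1..m}" "j : {1..m}" for i j
   using fun_cong[OF ab(3), of "(i, j)"] that by simp
  then have "(\<Oplus>i\<in>{1..m}. \<Oplus>j\<in>{1..m}. e i j ** coef a i j) = (\<Oplus>i\<in>{1..m}. \<Oplus>j\<in>{1..m}. e i j ** coef b i j)"
   using ab by (intro finsum_cong') auto
  then show "a = b" using ab expansion by simp
 next
  fix M assume "M : ?ph ` carrier R"
  then obtain a where "a : carrier R" "M = ?ph a" by blast
  then show "M : carrier (matrix_ring m (sub R Z))"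
   using coef_in_Z by (auto simp: matrix_ring_def)
 next
  fix M assume M: "M : carrier (matrix_ring m (sub R Z))"
  define a where "a = (\<Oplus>i\<in>{1..m}. \<Oplus>j\<in>{1..m}. e i j ** M (i, j))"
  have MZ: "M (i, j) \<in> Z" if "i : {1..m}" "j : {1..m}" for i j
   using M that by (auto simp: matrix_ring_def)
  have "?ph a = M"
  proof
   fix x
   show "?ph a x = M x"
   proof (cases "x : {1..m} \<times> {1..m}")
    case True
    then show ?thesis
     unfolding a_def using coef_combination[of "%i j. M (i, j)"] MZ by (cases x) auto
   next
    case False
    have "M : {1..m} \<times> {1..m} \<rightarrow>\<^sub>E Z" using M by (simp add: matrix_ring_def)
    from PiE_arb[OF this False] show ?thesis using False by auto
   qed
  qed
  moreover have "a : carrier R"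
   unfolding a_def using MZ Z_closed by (intro finsum_closed) auto
  ultimately show "M : ?ph ` carrier R" by blast
 qed
qed

lemma dimension_matrix:
 assumes F: "subfield F R" "F <= center R" and d: "dimension d F Z"
 shows "dimension (m * m * d) F (carrier R)"
proof -
 let ?I = "{1..m} \<times> {1..m}"
 have Fc: "k : carrier R" "a : carrier R ==> k ** a = a ** k" if "k : F" for k a
  using F that unfolding centralizer_def by auto
 have sum: "(\<Oplus>x\<in>?I. e (fst x) (snd x) ** v x) = (\<Oplus>i\<in>{1..m}. \<Oplus>j\<in>{1..m}. e i j ** v (i, j))"
  if "v : ?I \<rightarrow> Z" for v
  using finsum_Times[of "{1..m}" "{1..m}" "%i j. e i j ** v (i, j)"] that Z_closed
  by (auto simp: Pi_def)
 have "dimension (card ?I * d) F {\<Oplus>x\<in>?I. e (fst x) (snd x) ** v x | v. v \<in> ?I \<rightarrow> Z}"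
 proof (rule dimension_direct_sum[OF F(1) d, where ph = "%x c. e (fst x) (snd x) ** c"])
  fix v x assume v: "v : ?I \<rightarrow> Z" and z: "(\<Oplus>x\<in>?I. e (fst x) (snd x) ** v x) = \<zero>" and x: "x : ?I"
  have vZ: "!!i j. i \<in> {1..m} ==> j : {1..m} ==> v (i, j) \<in> Z" using v by auto
  have "v x = coef \<zero> (fst x) (snd x)"
   using coef_combination[of "%i j. v (i, j)" "fst x" "snd x"] vZ sum[OF v] z x by auto
  also have "... = \<zero>"
   using coef_Z[OF subringE(2)[OF Z_subring]] x by auto
  finally show "v x = \<zero>" .
 next
  fix x k c assume "x : ?I" "k : F" "c : Z"
  then show "e (fst x) (snd x) ** (k ** c) = k ** (e (fst x) (snd x) ** c)"
   using Fc(2)[of k "e (fst x) (snd x)"] Fc(1)[of k] Z_closed[of c]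
   by (auto simp flip: m_assoc)
 qed (auto simp: Z_closed r_distr)
 also have "{\<Oplus>x\<in>?I. e (fst x) (snd x) ** v x | v. v \<in> ?I \<rightarrow> Z} = carrier R"
 proof (intro equalityI subsetI)
  fix a assume a: "a : carrier R"
  let ?v = "%x. coef a (fst x) (snd x)"
  have v: "?v \<in> ?I \<rightarrow> Z" using a coef_in_Z by auto
  then have "a = (\<Oplus>x\<in>?I. e (fst x) (snd x) ** ?v x)"
   using sum[OF v] expansion[OF a] by simp
  then show "a : {\<Oplus>x\<in>?I. e (fst x) (snd x) ** v x | v. v \<in> ?I \<rightarrow> Z}"
   by (intro CollectI exI conjI) (use v in auto)
 qed (auto simp: Pi_def Z_closed intro!: finsum_closed)
 finally show ?thesis by simp
qed

lemma division_idempotent_e11: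
 assumes "1 \<le> m" "division_ring (sub R Z)"
 shows "division_idempotent R (e 1 1)"
proof -
 have one: "1 : {1..m}" using assms by simp
 have Z1: "\<one> \<in> Z" "\<zero> \<in> Z" using subringE(2,3)[OF Z_subring] by auto
 have "e 1 1 ~= \<zero>"
  using Z_eqI_corner[OF Z1 one] one assms(2) Z1 unfolding division_ring_def by auto
 moreover have "\<exists>y\<in>carrier R. e 1 1 ** y = y \<and> y ** e 1 1 = y \<and> y ** x = e 1 1"
  if x: "x : carrier R" "e 1 1 ** x = x" "x ** e 1 1 = x" "x ~= \<zero>" for x
 proof -
  let ?c = "coef x 1 1"
  have c: "?c \<in> Z" "?c \<in> carrier R" using coef_in_Z[OF x(1) one one] Z_closed by auto
  have cx: "?c ** e 1 1 = x" using coef_e(1)[OF x(1) one one one one] x by simp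
  then have "?c ~= \<zero>" using x one by auto
  then obtain d where d: "d : Z" "d ** ?c = \<one>"
   using division_ringE[OF assms(2), of ?c] c by auto
  let ?y = "e 1 1 ** d"
  have dR: "d : carrier R" using d Z_closed by auto
  have "?y ** x = e 1 1 ** (d ** (?c ** e 1 1))" using dR one x cx by (simp add: m_assoc)
  also have "... = e 1 1 ** ((d ** ?c) ** e 1 1)" using dR c one by (simp add: m_assoc)
  also have "... = e 1 1" using d one by (simp add: e_mult)
  finally have "?y ** x = e 1 1" .
  moreover have "e 1 1 ** ?y = ?y" using dR one by (simp add: e_mult_left)
  moreover have "?y ** e 1 1 = ?y" using d dR one by (simp add: m_assoc Z_comm e_mult_left)
  ultimately show ?thesis using dR one by (intro bexI[of _ ?y]) auto
 qed
 ultimately show ?thesis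
  unfolding division_idempotent_def using one by (auto simp: e_mult)
qed

lemma division_commutant:
 assumes m: "1 \<le> m" and f: "division_idempotent R (e 1 1)"
 shows "division_ring (sub R Z)"
proof (rule division_ringI)
 have one: "1 : {1..m}" using m by simp
 show "ring (sub R Z)" by (rule subring_is_ring[OF Z_subring])
 have Z1: "\<one> \<in> Z" "\<zero> \<in> Z" using subringE(2,3)[OF Z_subring] by auto
 have e0: "e 1 1 ~= \<zero>" using f unfolding division_idempotent_def by auto
 then show "\<one>\<^bsub>sub R Z\<^esub> ~= \<zero>\<^bsub>sub R Z\<^esub>"
 proof -
  have "\<one> = \<zero> ==> e 1 1 = \<zero>" using one l_one[of "e 1 1"] l_null[of "e 1 1"] e_closed[of 1 1] by simp
  then show ?thesis using e0 by auto
 qed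
 fix c assume "c : carrier (sub R Z)" "c ~= \<zero>\<^bsub>sub R Z\<^esub>"
 then have c: "c : Z" "c : carrier R" "c ~= \<zero>" by (simp_all add: Z_closed)
 let ?x = "c ** e 1 1"
 have "?x ~= \<zero>" using Z_eqI_corner[OF c(1) Z1(2) one] c one by auto
 moreover have "?x \<in> carrier R" "e 1 1 ** ?x = ?x" "?x ** e 1 1 = ?x"
  using c one by (simp_all add: m_assoc e_mult Z_comm e_mult_left)
 ultimately obtain y where y: "y : carrier R" "e 1 1 ** y = y" "y ** e 1 1 = y" "y ** ?x = e 1 1"
  using f unfolding division_idempotent_def by blast
 let ?d = "coef y 1 1"
 have d: "?d \<in> Z" "?d \<in> carrier R" using coef_in_Z[OF y(1) one one] Z_closed by auto
 have "?d ** c = \<one>"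
 proof (rule Z_eqI_corner[OF _ Z1(1) one])
  show "?d ** c \<in> Z" using d c subringE(6)[OF Z_subring] by blast
  have "?d ** c ** e 1 1 = (?d ** e 1 1) ** c"
   using c d one by (simp add: m_assoc Z_comm Z_comm_left)
  also have "?d ** e 1 1 = y" using coef_e(1)[OF y(1) one one one one] y by simp
  also have "y ** c = y ** e 1 1 ** c" using y by simp
  also have "... = e 1 1" using y(1,4) c one by (simp add: m_assoc Z_comm)
  finally show "?d ** c ** e 1 1 = \<one> ** e 1 1" using one by simp
 qed
 then show "\<exists>y\<in>carrier (sub R Z). y \<otimes>\<^bsub>sub R Z\<^esub> c = \<one>\<^bsub>sub R Z\<^esub>" using d by auto
qed

lemma prime_if_division_commutant:
 assumes "1 \<le> m" "division_ring (sub R Z)"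
 shows "prime_ring R"
 unfolding prime_ring_def
proof (intro conjI ballI impI)
 show "\<one> ~= \<zero>" using assms(2) unfolding division_ring_def by simp
 fix x y assume xy: "x : carrier R" "y : carrier R" and z: "\<forall>a\<in>carrier R. x ** a ** y = \<zero>"
 have one: "1 : {1..m}" using assms by simp
 have nz: "\<exists>i\<in>{1..m}. \<exists>j\<in>{1..m}. coef x i j ~= \<zero>" if "x : carrier R" "x ~= \<zero>" for x
 proof (rule ccontr)
  assume "\<not> ?thesis"
  then have "(\<Oplus>i\<in>{1..m}. \<Oplus>j\<in>{1..m}. e i j ** coef x i j) = \<zero>"
   by (intro add.finprod_one_eqI) auto
  then show False using expansion that by simp
 qed
 show "x = \<zero> \<or> y = \<zero>"
 proof (rule ccontr)
  assume "\<not> ?thesis"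
  then obtain i j k l where ij: "i : {1..m}" "j : {1..m}" "coef x i j ~= \<zero>"
   and kl: "k : {1..m}" "l : {1..m}" "coef y k l ~= \<zero>"
   using nz xy by meson
  let ?c = "coef x i j" and ?d = "coef y k l"
  have cd: "?c \<in> Z" "?d \<in> Z" "?c \<in> carrier R" "?d \<in> carrier R"
   using coef_in_Z xy ij kl Z_closed by auto
  have "?c ** ?d ** e 1 1 = ?c ** (e 1 1 ** (?d ** e 1 1))"
   using cd one by (simp add: m_assoc Z_comm e_mult_left e_mult)
  also have "... = (?c ** e 1 1) ** (?d ** e 1 1)" using cd one by (simp add: m_assoc)
  also have "... = (e 1 i ** x ** e j 1) ** (e 1 k ** y ** e l 1)"
   using coef_e(1) xy ij kl one by simp
  also have "... = e 1 i ** (x ** (e j 1 ** e 1 k) ** y) ** e l 1"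
   using xy ij kl one by (simp add: m_assoc)
  also have "x ** (e j 1 ** e 1 k) ** y = \<zero>"
   using bspec[OF z, of "e j 1 ** e 1 k"] ij kl one by simp
  finally have "?c ** ?d ** e 1 1 = \<zero> ** e 1 1" using one ij kl by simp
  then have "?c ** ?d = \<zero>"
   using Z_eqI_corner[of "?c ** ?d" \<zero> 1] cd one subringE(2,6)[OF Z_subring] by blast
  moreover obtain h where "h : Z" "h ** ?c = \<one>"
   using division_ringE[OF assms(2), of ?c] cd ij by auto
  ultimately show False
   using cd kl Z_closed by (metis l_one m_assoc r_null)
 qed
qed

end

section \<open>Matrix forms of simple algebras\<close>

context ring
begin

lemma central_comm:
 assumes "F <= center R" "k : F" "a : carrier R"
 shows "k ** a = a ** k"
 using assms unfolding centralizer_def by auto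

lemma center_unit_commutant:
 assumes "matrix_units R m e"
 shows "center (sub R (unit_commutant R m e)) = center R"
proof -
 interpret matrix_unit_system R m e by unfold_locales fact
 show ?thesis
 proof (intro equalityI subsetI)
  fix z assume z: "z : center (sub R Z)"
  then have zZ: "z : Z" and comm: "!!c. c \<in> Z ==> z ** c = c ** z"
   unfolding centralizer_def by auto
  have "z ** a = a ** z" if a: "a : carrier R" for a
  proof -
   have "z ** (\<Oplus>i\<in>{1..m}. \<Oplus>j\<in>{1..m}. e i j ** coef a i j)
     = (\<Oplus>i\<in>{1..m}. \<Oplus>j\<in>{1..m}. z ** (e i j ** coef a i j))"
    using a zZ by (subst finsum_lmult) (auto simp: Z_closed intro!: finsum_cong' finsum_lmult)
   also have "... = (\<Oplus>i\<in>{1..m}. \<Oplus>j\<in>{1..m}. (e i j ** coef a i j) ** z)"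
    using a zZ by (auto simp: Z_closed m_assoc Z_comm_left comm coef_in_Z intro!: finsum_cong')
   also have "... = (\<Oplus>i\<in>{1..m}. \<Oplus>j\<in>{1..m}. e i j ** coef a i j) ** z"
    using a zZ by (subst finsum_rmult) (auto simp: Z_closed intro!: finsum_cong' finsum_rmult[symmetric])
   finally show ?thesis using expansion[OF a] by simp
  qed
  then show "z : center R" unfolding centralizer_def using zZ Z_closed by auto
 next
  fix z assume "z : center R"
  then show "z : center (sub R Z)"
   unfolding centralizer_def using Z_closed by (auto simp: Z_iff)
 qed
qed

lemma matrix_formI:
 assumes alg: "algebra_over F R" and cen: "center R = F" and n: "dimension n F (carrier R)"
  and m: "1 \<le> m" and e: "matrix_units R m e" and div: "division_ring (sub R (unit_commutant R m e))"
 shows "matrix_form F R m (unit_commutant R m e)"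
proof -
 interpret matrix_unit_system R m e by unfold_locales fact
 have F: "subfield F R" "F <= center R"
  using alg unfolding algebra_over_def embedded_algebra_def by auto
 have FZ: "F <= Z"
  using F(2) unfolding centralizer_def unit_commutant_def by auto
 obtain d where "dimension d F Z"
  using subspace_dimension[OF F(1) n, of Z] Z_closed subringE[OF Z_subring] FZ
  by (metis subsetD subsetI)
 then have fin: "finite_dimension F Z" by (rule finite_dimensionI)
 let ?ph = "%a. \<lambda>(i, j)\<in>{1..m} \<times> {1..m}. coef a i j"
 have "\<forall>c\<in>F. ?ph c = scalar_matrix m (sub R Z) c"
  using FZ by (auto simp: scalar_matrix_def coef_Z subset_iff fun_eq_iff)
 then have "algebra_iso F R (scalar_matrix m (sub R Z)) (matrix_ring m (sub R Z))"
  unfolding algebra_iso_def by (rule bexI[OF _ matrix_iso])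
 then show ?thesis
  unfolding matrix_form_def using alg cen m Z_subring div center_unit_commutant[OF e] fin by simp
qed

text \<open>A matrix form of an algebra is the same as a system of matrix units; the division
 algebra of the matrix form is isomorphic to the commutant of the matrix units.\<close>

lemma matrix_formE:
 assumes mf: "matrix_form F R m D"
 obtains e where "matrix_units R m e" "division_ring (sub R (unit_commutant R m e))"
  "!!d. dimension d F D ==> dimension d F (unit_commutant R m e)" "center R = F"
proof -
 from mf have alg: "algebra_over F R" and m: "1 \<le> m" and D: "subring D R"
  and div: "division_ring (sub R D)" and cenD: "center (sub R D) = F"
  and iso: "algebra_iso F R (scalar_matrix m (sub R D)) (matrix_ring m (sub R D))"
  unfolding matrix_form_def by auto
 have F: "subfield F R" "F <= center R"
  using alg unfolding algebra_over_def embedded_algebra_def by auto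
 have FD: "F <= D" using cenD unfolding centralizer_def by auto
 note Ds = subringE[OF D]
 have DR: "!!x. x \<in> D ==> x : carrier R" using Ds(1) by auto
 let ?N = "{1..m}" and ?S = "matrix_ring m (sub R D)"
 obtain ph where ph: "ph : ring_iso R ?S" and phF: "!!c. c \<in> F ==> ph c = scalar_matrix m (sub R D) c"
  using iso unfolding algebra_iso_def by blast
 note phE = ring_iso_memE[OF ph]
 have phD: "ph a (i, j) \<in> D" if "a : carrier R" "i : ?N" "j : ?N" for a i j
  using phE(1)[OF that(1)] that by (auto simp: matrix_ring_def)
 have phmult: "ph (a ** b) (i, j) = (\<Oplus>k\<in>?N. ph a (i, k) ** ph b (k, j))"
  if "a : carrier R" "b : carrier R" "i : ?N" "j : ?N" for a b i j
 proof -
  have "ph (a ** b) (i, j) = (\<Oplus>\<^bsub>sub R D\<^esub>k\<in>?N. ph a (i, k) ** ph b (k, j))"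
   using phE(2)[OF that(1,2)] that by (simp add: matrix_ring_def)
  also have "... = (\<Oplus>k\<in>?N. ph a (i, k) ** ph b (k, j))"
   by (rule finsum_sub[OF D]) (use that phD Ds in auto)
  finally show ?thesis .
 qed
 have phadd: "ph (a \<oplus> b) (i, j) = ph a (i, j) \<oplus> ph b (i, j)"
  if "a : carrier R" "b : carrier R" "i : ?N" "j : ?N" for a b i j
  using phE(3)[OF that(1,2)] that by (simp add: matrix_ring_def)
 have phone: "ph \<one> = scalar_matrix m (sub R D) \<one>"
  using phE(4) by (simp add: matrix_ring_def)
 have phzero: "ph \<zero> (i, j) = \<zero>" if "i : ?N" "j : ?N" for i j
  by (rule additive_zero[where V = "carrier R" and R = R and R' = R and h = "%a. ph a (i, j)"])
   (use that phD phadd DR ring_axioms in auto)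
 have eqI: "a = b" if "a : carrier R" "b : carrier R"
  "!!i j. i \<in> ?N ==> j : ?N ==> ph a (i, j) = ph b (i, j)" for a b
 proof -
  have "ph a \<in> ?N \<times> ?N \<rightarrow>\<^sub>E D" "ph b \<in> ?N \<times> ?N \<rightarrow>\<^sub>E D"
   using phE(1) that by (auto simp: matrix_ring_def)
  then have "ph a = ph b" by (rule PiE_ext) (use that in auto)
  then show ?thesis using phE(5) that unfolding bij_betw_def inj_on_def by auto
 qed
 define ps where "ps = (%M. inv_into (carrier R) ph (restrict M (?N \<times> ?N)))"
 have ps: "ps M \<in> carrier R" "!!i j. i \<in> ?N ==> j : ?N ==> ph (ps M) (i, j) = M (i, j)"
  if "!!i j. i \<in> ?N ==> j : ?N ==> M (i, j) \<in> D" for M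
 proof -
  have "restrict M (?N \<times> ?N) \<in> carrier ?S" using that by (auto simp: matrix_ring_def)
  then have r: "restrict M (?N \<times> ?N) \<in> ph ` carrier R" using phE(5) unfolding bij_betw_def by simp
  show "ps M \<in> carrier R" unfolding ps_def using inv_into_into[OF r] .
  have "ph (ps M) = restrict M (?N \<times> ?N)" unfolding ps_def using f_inv_into_f[OF r] .
  then show "ph (ps M) (i, j) = M (i, j)" if "i : ?N" "j : ?N" for i j using that by simp
 qed
 define e where "e = (%i j. ps (%x. if x = (i, j) then \<one> else \<zero>))"
 have e: "e i j \<in> carrier R" "!!p q. p \<in> ?N ==> q : ?N ==> ph (e i j) (p, q) = (if p = i \<and> q = j then \<one> else \<zero>)"
  for i j
  unfolding e_def using ps[of "%x. if x = (i, j) then \<one> else \<zero>"] Ds by auto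
 have e_left: "ph (e i j ** a) (p, q) = (if p = i then ph a (j, q) else \<zero>)"
  if "a : carrier R" "i : ?N" "j : ?N" "p : ?N" "q : ?N" for a i j p q
 proof -
  have "ph (e i j ** a) (p, q) = (\<Oplus>k\<in>?N. if k = j then (if p = i then ph a (k, q) else \<zero>) else \<zero>)"
   unfolding phmult[OF e(1) that(1,4,5)]
   by (rule finsum_cong') (use that e(2) phD DR in auto)
  also have "... = (if p = i then ph a (j, q) else \<zero>)"
   by (rule finsum_delta) (use that phD DR in auto)
  finally show ?thesis .
 qed
 have e_right: "ph (a ** e i j) (p, q) = (if q = j then ph a (p, i) else \<zero>)"
  if "a : carrier R" "i : ?N" "j : ?N" "p : ?N" "q : ?N" for a i j p q
 proof -
  have "ph (a ** e i j) (p, q) = (\<Oplus>k\<in>?N. if k = i then (if q = j then ph a (p, k) else \<zero>) else \<zero>)"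
   unfolding phmult[OF that(1) e(1) that(4,5)]
   by (rule finsum_cong') (use that e(2) phD DR in auto)
  also have "... = (if q = j then ph a (p, i) else \<zero>)"
   by (rule finsum_delta) (use that phD DR in auto)
  finally show ?thesis .
 qed
 have units: "matrix_units R m e"
  unfolding matrix_units_def
 proof (intro conjI ballI)
  fix i j k l assume ijkl: "i : ?N" "j : ?N" "k : ?N" "l : ?N"
  show "e i j ** e k l = (if j = k then e i l else \<zero>)"
  proof (rule eqI)
   fix p q assume pq: "p : ?N" "q : ?N"
   show "ph (e i j ** e k l) (p, q) = ph (if j = k then e i l else \<zero>) (p, q)"
    unfolding e_left[OF e(1) ijkl(1,2) pq] e(2)[OF ijkl(2) pq(2)]
    using e(2)[OF pq, of i l] phzero[OF pq]
    by (cases "p = i"; cases "q = l"; cases "j = k") auto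
  qed (use e(1) in simp_all)
 next
  have sc: "(\<Oplus>i\<in>?N. e i i) \<in> carrier R" by (rule finsum_closed) (use e in auto)
  show "(\<Oplus>i\<in>?N. e i i) = \<one>"
  proof (rule eqI[OF sc])
   fix p q assume pq: "p : ?N" "q : ?N"
   have "ph (\<Oplus>i\<in>?N. e i i) (p, q) = (\<Oplus>i\<in>?N. ph (e i i) (p, q))"
    by (rule finsum_additive(2)[where S = "carrier R" and h = "%a. ph a (p, q)"])
     (use e pq phadd phzero phD DR in \<open>auto intro: abelian_monoid_axioms\<close>)
   also have "... = (\<Oplus>i\<in>?N. if i = p then (if p = q then \<one> else \<zero>) else \<zero>)"
    by (rule finsum_cong') (use e pq in auto)
   also have "... = (if p = q then \<one> else \<zero>)" by (rule finsum_delta) (use pq in auto)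
   finally show "ph (\<Oplus>i\<in>?N. e i i) (p, q) = ph \<one> (p, q)"
    using pq phone by (simp add: scalar_matrix_def)
  qed simp
 qed (use e in auto)
 interpret matrix_unit_system R m e by unfold_locales fact
 have one: "1 : ?N" using m by simp
 define s where "s d = ps (%x. if fst x = snd x then d else \<zero>)" for d
 have s: "s d \<in> carrier R" "!!p q. p \<in> ?N ==> q : ?N ==> ph (s d) (p, q) = (if p = q then d else \<zero>)"
  if "d : D" for d
  unfolding s_def using ps[of "%x. if fst x = snd x then d else \<zero>"] Ds that by auto
 have s_Z: "s d \<in> Z" if "d : D" for d
  unfolding Z_iff
 proof (intro conjI ballI)
  fix i j assume ij: "i : ?N" "j : ?N"
  show "s d ** e i j = e i j ** s d"
  proof (rule eqI)
   fix p q assume pq: "p : ?N" "q : ?N"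
   show "ph (s d ** e i j) (p, q) = ph (e i j ** s d) (p, q)"
    unfolding e_left[OF s(1)[OF that] ij pq] e_right[OF s(1)[OF that] ij pq]
     s(2)[OF that ij(2) pq(2)] s(2)[OF that pq(1) ij(1)] by auto
  qed (use s(1)[OF that] e(1) in auto)
 qed (rule s(1)[OF that])
 have Z_s: "z = s (ph z (1, 1))" if z: "z : Z" for z
 proof (rule eqI)
  have zR: "z : carrier R" using z Z_closed by simp
  have d: "ph z (1, 1) \<in> D" using phD zR one by blast
  show "z : carrier R" "s (ph z (1, 1)) \<in> carrier R" using zR s d by auto
  fix i j assume ij: "i : ?N" "j : ?N"
  have "ph (z ** e j 1) (i, 1) = ph z (i, j)" using e_right zR ij one by simp
  moreover have "ph (e j 1 ** z) (i, 1) = (if i = j then ph z (1, 1) else \<zero>)"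
   using e_left[OF zR ij(2) one ij(1) one] by simp
  ultimately show "ph z (i, j) = ph (s (ph z (1, 1))) (i, j)"
   using Z_comm[OF z ij(2) one] s(2)[OF d ij] by simp
 qed
 have s_mult: "s (a ** b) = s a ** s b" if "a : D" "b : D" for a b
 proof (rule eqI)
  have ab: "a ** b \<in> D" using that Ds by auto
  show "s (a ** b) \<in> carrier R" "s a ** s b \<in> carrier R" using s that ab by auto
  fix p q assume pq: "p : ?N" "q : ?N"
  have "ph (s a ** s b) (p, q) = (\<Oplus>k\<in>?N. if k = p then (if p = q then a ** b else \<zero>) else \<zero>)"
   unfolding phmult[OF s(1)[OF that(1)] s(1)[OF that(2)] pq]
   by (rule finsum_cong') (use that pq s DR in auto)
  also have "... = (if p = q then a ** b else \<zero>)"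
   by (rule finsum_delta) (use that pq DR in auto)
  finally show "ph (s (a ** b)) (p, q) = ph (s a ** s b) (p, q)" using s(2)[OF ab pq] by simp
 qed
 have s_add: "s (a \<oplus> b) = s a \<oplus> s b" if "a : D" "b : D" for a b
 proof (rule eqI)
  have ab: "a \<oplus> b \<in> D" using that Ds by auto
  show "s (a \<oplus> b) \<in> carrier R" "s a \<oplus> s b \<in> carrier R" using s(1) that ab by auto
  fix p q assume pq: "p : ?N" "q : ?N"
  show "ph (s (a \<oplus> b)) (p, q) = ph (s a \<oplus> s b) (p, q)"
   unfolding phadd[OF s(1)[OF that(1)] s(1)[OF that(2)] pq] s(2)[OF ab pq]
    s(2)[OF that(1) pq] s(2)[OF that(2) pq] by simp
 qed
 have s_F: "s c = c" if "c : F" for c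
 proof (rule eqI)
  have cD: "c : D" using that FD by auto
  show "s c \<in> carrier R" "c : carrier R" using s(1)[OF cD] cD DR by auto
  fix p q assume pq: "p : ?N" "q : ?N"
  show "ph (s c) (p, q) = ph c (p, q)"
   unfolding s(2)[OF cD pq] phF[OF that] scalar_matrix_def using pq by simp
 qed
 have s_inj: "a = b" if "a : D" "b : D" "s a = s b" for a b
  using s(2)[OF that(1) one one] s(2)[OF that(2) one one] that(3) by simp
 have s_im: "s ` D = Z"
 proof (intro equalityI subsetI)
  fix z assume z: "z : Z"
  have "ph z (1, 1) \<in> D" using phD one Z_closed[OF z] by blast
  then show "z : s ` D" using Z_s[OF z] by blast
 qed (use s_Z in auto)
 have s1: "s \<one> = \<one>"
  by (rule s_F) (use subringE(3)[OF subfieldE(1)[OF F(1)]] in simp)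
 have s0: "s \<zero> = \<zero>"
  by (rule s_F) (use subringE(2)[OF subfieldE(1)[OF F(1)]] in simp)
 have divZ: "division_ring (sub R Z)"
 proof (rule division_ringI)
  show "ring (sub R Z)" by (rule subring_is_ring[OF Z_subring])
  show "\<one>\<^bsub>sub R Z\<^esub> ~= \<zero>\<^bsub>sub R Z\<^esub>"
   using div unfolding division_ring_def by simp
  fix z assume z: "z : carrier (sub R Z)" "z ~= \<zero>\<^bsub>sub R Z\<^esub>"
  then obtain d where d: "d : D" "z = s d" using s_im by auto
  then have "d ~= \<zero>" using z s0 by auto
  then obtain d' where "d' : D" "d' ** d = \<one>" using division_ringE[OF div, of d] d by auto
  then show "\<exists>y\<in>carrier (sub R Z). y \<otimes>\<^bsub>sub R Z\<^esub> z = \<one>\<^bsub>sub R Z\<^esub>"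
   using s_mult[of d' d] d s1 s_Z by (intro bexI[of _ "s d'"]) auto
 qed
 have dimZ: "dimension d F Z" if d: "dimension d F D" for d
  using dimension_transport[OF ring_axioms ring_axioms F(1) F(1) d, of s id]
   s s_inj s_add s_mult s_F s_im FD by (auto simp: inj_on_def subset_iff)
 have "center R = F"
 proof
  show "center R <= F"
  proof
   fix z assume z: "z : center R"
   then have "z : Z" unfolding Z_iff centralizer_def by auto
   then obtain d where d: "d : D" "z = s d" using s_im by auto
   have "d ** x = x ** d" if x: "x : D" for x
   proof (rule s_inj)
    show "s (d ** x) = s (x ** d)"
     using s_mult d x s(1)[OF x] z unfolding centralizer_def by auto
   qed (use d x Ds in auto)
   then have "d : center (sub R D)" unfolding centralizer_def using d by auto
   then show "z : F" using cenD s_F d by auto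
  qed
 qed (rule F(2))
 with that units divZ dimZ show ?thesis by blast
qed

section \<open>Wedderburn's theorem for prime algebras\<close>

text \<open>The element \<open>\<Sum> e\<^sub>k\<^sub>1 x f\<^sub>1\<^sub>k\<close> conjugates one system into the other, if \<open>x\<close> links the primitive
 idempotents \<open>e\<^sub>1\<^sub>1\<close> and \<open>f\<^sub>1\<^sub>1\<close>.\<close>

lemma equal_size_units_conjugate:
 assumes "prime_ring R" "1 \<le> m" and e: "matrix_units R m e" "division_ring (sub R (unit_commutant R m e))"
  and f: "matrix_units R m f" "division_ring (sub R (unit_commutant R m f))"
 obtains w w' where "w : carrier R" "w' : carrier R" "w ** w' = \<one>" "w' ** w = \<one>"
  "!!i j. i \<in> {1..m} ==> j : {1..m} ==> w' ** e i j ** w = f i j"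
proof -
 interpret e: matrix_unit_system R m e by unfold_locales fact
 interpret f: matrix_unit_system R m f by unfold_locales fact
 have one: "1 : {1..m}" using assms(2) by simp
 obtain x y where xy: "x : carrier R" "y : carrier R" "e 1 1 ** x = x" "x ** f 1 1 = x"
  "f 1 1 ** y = y" "y ** e 1 1 = y" "x ** y = e 1 1" "y ** x = f 1 1"
  using division_idempotents_equivalent[OF assms(1) e.division_idempotent_e11[OF assms(2) e(2)]
   f.division_idempotent_e11[OF assms(2) f(2)]] by blast
 have mult: "(\<Oplus>k\<in>{1..m}. e k 1 ** x ** f 1 k) ** f i j = e i 1 ** x ** f 1 j"
  if ij: "i : {1..m}" "j : {1..m}" for i j
 proof -
  have "(\<Oplus>k\<in>{1..m}. e k 1 ** x ** f 1 k) ** f i j = (\<Oplus>k\<in>{1..m}. e k 1 ** x ** f 1 k ** f i j)"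
   by (rule finsum_rmult) (use one xy ij in auto)
  also have "... = (\<Oplus>k\<in>{1..m}. if k = i then e k 1 ** x ** f 1 j else \<zero>)"
   by (rule finsum_cong') (use one xy(1) ij in \<open>auto simp: m_assoc f.e_mult\<close>)
  also have "... = e i 1 ** x ** f 1 j" by (rule finsum_delta) (use one xy ij in auto)
  finally show ?thesis .
 qed
 define w where "w = (\<Oplus>k\<in>{1..m}. e k 1 ** x ** f 1 k)"
 define w' where "w' = (\<Oplus>k\<in>{1..m}. f k 1 ** y ** e 1 k)"
 have wR: "w : carrier R" "w' : carrier R"
  unfolding w_def w'_def using one xy by (auto intro!: finsum_closed)
 have w_f: "w ** f i j = e i 1 ** x ** f 1 j" if "i : {1..m}" "j : {1..m}" for i j
  unfolding w_def using mult that by blast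
 have w'_e: "w' ** e i j = f i 1 ** y ** e 1 j" if ij: "i : {1..m}" "j : {1..m}" for i j
 proof -
  have "w' ** e i j = (\<Oplus>k\<in>{1..m}. f k 1 ** y ** e 1 k ** e i j)"
   unfolding w'_def by (rule finsum_rmult) (use one xy ij in auto)
  also have "... = (\<Oplus>k\<in>{1..m}. if k = i then f k 1 ** y ** e 1 j else \<zero>)"
   by (rule finsum_cong') (use one xy(2) ij in \<open>auto simp: m_assoc e.e_mult\<close>)
  also have "... = f i 1 ** y ** e 1 j" by (rule finsum_delta) (use one xy ij in auto)
  finally show ?thesis .
 qed
 have fx: "f i 1 ** y ** x ** f 1 j = f i j" if "i : {1..m}" "j : {1..m}" for i j
 proof -
  have "f i 1 ** y ** x ** f 1 j = f i 1 ** (y ** x) ** f 1 j"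
   using xy(1,2) one that by (simp add: m_assoc)
  then show ?thesis using one that by (simp add: xy f.e_mult)
 qed
 have ex: "e i 1 ** x ** y ** e 1 j = e i j" if "i : {1..m}" "j : {1..m}" for i j
 proof -
  have "e i 1 ** x ** y ** e 1 j = e i 1 ** (x ** y) ** e 1 j"
   using xy(1,2) one that by (simp add: m_assoc)
  then show ?thesis using one that by (simp add: xy e.e_mult)
 qed
 have e_w: "e i j ** w = e i 1 ** x ** f 1 j" if ij: "i : {1..m}" "j : {1..m}" for i j
 proof -
  have "e i j ** w = (\<Oplus>k\<in>{1..m}. e i j ** (e k 1 ** x ** f 1 k))"
   unfolding w_def by (rule finsum_lmult) (use one xy ij in auto)
  also have "... = (\<Oplus>k\<in>{1..m}. if k = j then e i 1 ** x ** f 1 k else \<zero>)"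
   by (rule finsum_cong') (use one xy(1) ij in \<open>auto simp: m_assoc e.e_mult_left\<close>)
  also have "... = e i 1 ** x ** f 1 j" by (rule finsum_delta) (use one xy ij in auto)
  finally show ?thesis .
 qed
 have conj: "w' ** e i j ** w = f i j" if ij: "i : {1..m}" "j : {1..m}" for i j
 proof -
  have "w' ** e i j ** w = w' ** (e i 1 ** (x ** f 1 j))"
   using e_w[OF ij] wR ij one xy(1) by (simp add: m_assoc)
  also have "... = (w' ** e i 1) ** (x ** f 1 j)" using wR ij one xy(1) by (simp add: m_assoc)
  also have "... = f i 1 ** (y ** e 1 1) ** x ** f 1 j"
   using w'_e[OF ij(1) one] ij one xy(1,2) by (simp add: m_assoc)
  finally show ?thesis using fx[OF ij] xy by simp
 qed
 have "w ** w' = \<one>"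
 proof (rule e.Z_eqI)
  fix k assume k: "k : {1..m}"
  have "w ** w' ** e k k = w ** (f k 1 ** (y ** e 1 k))"
   using w'_e[OF k k] wR k one xy(2) by (simp add: m_assoc)
  also have "... = (w ** f k 1) ** (y ** e 1 k)" using wR k one xy(2) by (simp add: m_assoc)
  also have "... = e k 1 ** (x ** f 1 1) ** y ** e 1 k"
   using w_f[OF k one] k one xy(1,2) by (simp add: m_assoc)
  also have "... = e k k" using ex[OF k k] xy by simp
  finally show "w ** w' ** e k k = \<one> ** e k k" using k by simp
 qed (use wR in auto)
 moreover have "w' ** w = \<one>"
 proof -
  have "w' ** w = (\<Oplus>i\<in>{1..m}. w' ** e i i) ** w"
   using finsum_lmult[of w' "{1..m}" "%i. e i i"] wR e.e_sum by auto
  also have "... = (\<Oplus>i\<in>{1..m}. w' ** e i i ** w)"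
   by (rule finsum_rmult) (use wR in auto)
  also have "... = (\<Oplus>i\<in>{1..m}. f i i)"
   by (rule finsum_cong') (use conj in \<open>auto simp del: atLeastAtMost_iff\<close>)
  finally show ?thesis using f.e_sum by simp
 qed
 ultimately show ?thesis using that wR conj by blast
qed

text \<open>The commutant is isomorphic to the corner of \<open>e\<^sub>1\<^sub>1\<close>, and the corners of two primitive idempotents are
 isomorphic. This is what makes the Schur index well defined.\<close>

lemma commutant_dimension_unique:
 assumes R: "prime_ring R" and F: "subfield F R" "F <= center R"
  and m: "1 \<le> m" "1 \<le> m'"
  and e: "matrix_units R m e" "division_ring (sub R (unit_commutant R m e))"
  and f: "matrix_units R m' f" "division_ring (sub R (unit_commutant R m' f))"
  and d: "dimension d F (unit_commutant R m e)"
 shows "dimension d F (unit_commutant R m' f)"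
proof -
 interpret e: matrix_unit_system R m e by unfold_locales fact
 interpret f: matrix_unit_system R m' f by unfold_locales fact
 have one: "1 : {1..m}" and one': "1 : {1..m'}" using m by auto
 obtain x y where xy: "x : carrier R" "y : carrier R" "e 1 1 ** x = x" "x ** f 1 1 = x"
  "f 1 1 ** y = y" "y ** e 1 1 = y" "x ** y = e 1 1" "y ** x = f 1 1"
  using division_idempotents_equivalent[OF R e.division_idempotent_e11[OF m(1) e(2)]
   f.division_idempotent_e11[OF m(2) f(2)]] by blast
 define h where "h c = f.coef (y ** c ** x) 1 1" for c
 have h_closed: "h c \<in> f.Z" if "c : carrier R" for c
  unfolding h_def using that xy one' by (intro f.coef_in_Z) auto
 have h_f11: "h c ** f 1 1 = y ** c ** x" if c: "c : carrier R" for c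
 proof -
  have "h c ** f 1 1 = f 1 1 ** (y ** c ** x) ** f 1 1"
   unfolding h_def using f.coef_e(1)[OF _ one' one' one' one'] xy c by simp
  also have "... = (f 1 1 ** y) ** c ** (x ** f 1 1)"
   using xy(1,2) c one' by (simp add: m_assoc)
  finally show ?thesis using xy by simp
 qed
 have F_comm: "!!k a. k \<in> F ==> a : carrier R ==> k ** a = a ** k"
  using central_comm[OF F(2)] .
 have FR: "F <= carrier R" using F subfieldE(3) by blast
 have "dimension d F (h ` e.Z)"
 proof (rule dimension_transport[OF ring_axioms ring_axioms F(1) F(1) d, where kp = id])
  show "inj_on h e.Z"
  proof (rule inj_onI)
   fix a b assume ab: "a : e.Z" "b : e.Z" "h a = h b"
   then have abR: "a : carrier R" "b : carrier R" using e.Z_closed by auto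
   have *: "x ** (y ** c ** x) ** y = c ** e 1 1" if c: "c : e.Z" for c
   proof -
    have cR: "c : carrier R" using c e.Z_closed by simp
    have "x ** (y ** c ** x) ** y = (x ** y) ** c ** (x ** y)"
     using xy(1,2) cR by (simp add: m_assoc)
    then show ?thesis using xy cR c one by (simp add: m_assoc e.Z_comm e.e_mult_left)
   qed
   have "y ** a ** x = y ** b ** x" using h_f11[OF abR(1)] h_f11[OF abR(2)] ab(3) by simp
   then show "a = b" using *[OF ab(1)] *[OF ab(2)] e.Z_eqI_corner[OF ab(1,2) one] by simp
  qed
  show "h (v \<oplus> w) = h v \<oplus> h w" if "v : e.Z" "w : e.Z" for v w
  proof -
   have "v : carrier R" "w : carrier R" using that e.Z_closed by auto
   then have "y ** (v \<oplus> w) ** x = y ** v ** x \<oplus> y ** w ** x"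
    using xy(1,2) by (simp add: l_distr r_distr)
   then show ?thesis
    unfolding h_def using f.coef_add[OF _ _ one' one', of "y ** v ** x" "y ** w ** x"] that e.Z_closed xy(1,2) by simp
  qed
  show "h (k ** v) = id k ** h v" if "k : F" "v : e.Z" for k v
  proof -
   have kv: "k : carrier R" "v : carrier R" using that e.Z_closed FR by auto
   have "k : f.Z" unfolding f.Z_iff using kv F_comm[OF that(1)] by simp
   moreover have "y ** (k ** v) ** x = k ** (y ** v ** x)"
    using F_comm[OF that(1) xy(2)] kv xy(1,2) by (simp flip: m_assoc)
   ultimately show ?thesis unfolding h_def using f.coef_Z_mult[OF _ _ one' one'] kv xy(1,2) by simp
  qed
 qed (use h_closed e.Z_closed f.Z_closed in auto)
 also have "h ` e.Z = f.Z"
 proof (intro equalityI subsetI)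
  fix z assume z: "z : f.Z"
  have zR: "z : carrier R" using z f.Z_closed by simp
  let ?c = "e.coef (x ** z ** y) 1 1"
  have c: "?c \<in> e.Z" "?c \<in> carrier R"
   using e.coef_in_Z[OF _ one one] e.Z_closed xy zR by auto
  have "e 1 1 ** ?c = e 1 1 ** (x ** z ** y) ** e 1 1"
   using e.coef_e(2)[OF _ one one one one] xy zR by simp
  also have "... = (e 1 1 ** x) ** z ** (y ** e 1 1)"
   using xy(1,2) zR one by (simp add: m_assoc)
  finally have ec: "e 1 1 ** ?c = x ** z ** y" using xy by simp
  have "y ** ?c ** x = (y ** e 1 1) ** ?c ** x" using xy by simp
  also have "... = y ** (e 1 1 ** ?c) ** x" using xy(1,2) c one by (simp add: m_assoc)
  also have "... = (y ** x) ** z ** (y ** x)" unfolding ec using xy(1,2) zR by (simp add: m_assoc)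
  also have "... = z ** f 1 1" using xy z zR one' by (simp add: m_assoc f.Z_comm f.e_mult_left)
  finally have "h ?c ** f 1 1 = z ** f 1 1" using h_f11[OF c(2)] by simp
  then have "h ?c = z" using f.Z_eqI_corner[OF h_closed[OF c(2)] z one'] by simp
  then show "z : h ` e.Z" using c(1) by (intro image_eqI[of z h ?c]) simp_all
 qed (use h_closed e.Z_closed in auto)
 finally show ?thesis .
qed

end

context ring
begin

text \<open>Brauer's lemma. A minimal left ideal \<open>I\<close> has an element \<open>b\<close> with \<open>I b \<noteq> 0\<close> because the ring is
 prime. Right multiplication by \<open>b\<close> is then a bijection of \<open>I\<close>, and the \<open>f\<close> with \<open>f b = b\<close> is the idempotent.\<close>

lemma exists_division_idempotent:
 assumes R: "prime_ring R" and F: "subfield F R" and n: "dimension n F (carrier R)"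
 obtains f where "division_idempotent R f"
proof -
 have FR: "F <= carrier R" using F subfieldE(3) by blast
 define P where "P I \<longleftrightarrow> I <= carrier R \<and> \<zero> \<in> I \<and> (\<forall>x\<in>I. \<forall>y\<in>I. x \<oplus> y \<in> I) \<and>
  (\<forall>a\<in>carrier R. \<forall>x\<in>I. a ** x \<in> I) \<and> I ~= {\<zero>}" for I
 define k where "k = (LEAST k. \<exists>I. P I \<and> dimension k F I)"
 have "\<one> ~= \<zero>" using R unfolding prime_ring_def by blast
 then have "P (carrier R)" unfolding P_def by auto
 then have "\<exists>I. P I \<and> dimension k F I"
  unfolding k_def by (rule_tac LeastI) (use n in blast)
 then obtain I where I: "P I" "dimension k F I" by blast
 have IR: "I <= carrier R" and I0: "\<zero> \<in> I" and Iadd: "!!x y. x \<in> I ==> y : I ==> x \<oplus> y \<in> I"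
  and Imult: "!!a x. a \<in> carrier R ==> x : I ==> a ** x \<in> I" and Inz: "I ~= {\<zero>}"
  using I(1) unfolding P_def by auto
 have min: "J = I" if J: "P J" "J <= I" for J
 proof -
  obtain j where j: "dimension j F J" "j \<le> k"
   by (rule subspace_dimension[OF F I(2) J(2)]) (use J(1) FR in \<open>auto simp: P_def subset_iff\<close>)
  have "k \<le> j" unfolding k_def by (rule Least_le) (use J(1) j in blast)
  then show ?thesis using dimension_mono(2)[OF F I(2) j(1) J(2)] j(2) by simp
 qed
 obtain x where x: "x : I" "x ~= \<zero>" using I0 Inz by blast
 have xR: "x : carrier R" using x IR by auto
 obtain a where a: "a : carrier R" "x ** a ** x ~= \<zero>"
  using prime_ringE[OF R xR xR x(2) x(2)] by blast
 define b where "b = a ** x"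
 have b: "b : I" "b : carrier R" "x ** b ~= \<zero>"
  unfolding b_def using a x xR Imult by (auto simp: m_assoc)
 have "(%i. i ** b) ` I = I"
 proof (rule min)
  show "P ((%i. i ** b) ` I)"
   unfolding P_def
  proof (intro conjI ballI)
   show "(%i. i ** b) ` I <= carrier R" using IR b by auto
   show "\<zero> \<in> (%i. i ** b) ` I" using I0 b by (intro image_eqI[of _ _ \<zero>]) auto
   show "(%i. i ** b) ` I ~= {\<zero>}" using x b by blast
  next
   fix u v assume "u : (%i. i ** b) ` I" "v : (%i. i ** b) ` I"
   then obtain i j where ij: "i : I" "j : I" "u = i ** b" "v = j ** b" by blast
   then have "u \<oplus> v = (i \<oplus> j) ** b" using IR b by (simp add: l_distr subset_iff)
   then show "u \<oplus> v \<in> (%i. i ** b) ` I" using Iadd ij by blast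
  next
   fix c u assume c: "c : carrier R" and "u : (%i. i ** b) ` I"
   then obtain i where i: "i : I" "u = i ** b" by blast
   then have "c ** u = (c ** i) ** b" using IR b c by (simp add: m_assoc subset_iff)
   then show "c ** u \<in> (%i. i ** b) ` I" using Imult c i by blast
  qed
 qed (use Imult b IR in auto)
 then obtain f where f: "f : I" "f ** b = b" using b(1) by (metis imageE)
 have fR: "f : carrier R" using f IR by auto
 have N0: "i = \<zero>" if i: "i : I" "i ** b = \<zero>" for i
 proof (rule ccontr)
  assume nz: "i ~= \<zero>"
  let ?N = "{i \<in> I. i ** b = \<zero>}"
  have "P ?N"
   unfolding P_def using I0 IR Iadd Imult b i nz by (auto simp: l_distr m_assoc subset_iff)
  then have "?N = I" by (rule min) auto
  then show False using x b by blast
 qed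
 have "f ** f \<ominus> f = \<zero>"
 proof (rule N0)
  have "f ** f \<oplus> (\<ominus> \<one>) ** f \<in> I" using Iadd Imult f fR by simp
  then show "f ** f \<ominus> f \<in> I" using fR by (simp add: a_minus_def l_minus)
  have "f ** f ** b = b" using f fR b by (simp add: m_assoc)
  then show "(f ** f \<ominus> f) ** b = \<zero>"
   using fR b f by (simp add: a_minus_def l_distr l_minus r_neg)
 qed
 then have ff: "f ** f = f" using fR by simp
 have "f ~= \<zero>" using f b xR by auto
 moreover have "\<exists>y\<in>carrier R. f ** y = y \<and> y ** f = y \<and> y ** z = f"
  if z: "z : carrier R" "f ** z = z" "z ** f = z" "z ~= \<zero>" for z
 proof -
  let ?J = "(%c. c ** z) ` carrier R"
  have zI: "z : I" using Imult[OF z(1) f(1)] z by simp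
  have "?J = I"
  proof (rule min)
   show "P ?J"
    unfolding P_def
   proof (intro conjI ballI)
    show "?J <= carrier R" using z by auto
    show "\<zero> \<in> ?J" using z by (intro image_eqI[of _ _ \<zero>]) auto
    have "z : ?J" using z by (intro image_eqI[of _ _ \<one>]) auto
    then show "?J ~= {\<zero>}" using z by blast
   next
    fix u v assume "u : ?J" "v : ?J"
    then obtain i j where ij: "i : carrier R" "j : carrier R" "u = i ** z" "v = j ** z" by blast
    then have "u \<oplus> v = (i \<oplus> j) ** z" using z by (simp add: l_distr)
    then show "u \<oplus> v \<in> ?J" using ij by blast
   next
    fix c u assume c: "c : carrier R" and "u : ?J"
    then obtain i where i: "i : carrier R" "u = i ** z" by blast
    then have "c ** u = (c ** i) ** z" using c z by (simp add: m_assoc)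
    then show "c ** u \<in> ?J" using c i by blast
   qed
  qed (use Imult zI in auto)
  then obtain y where y: "y : carrier R" "f = y ** z" using f(1) by (metis imageE)
  have "f ** y ** f ** z = f ** (y ** (f ** z))" using fR y(1) z(1) by (simp add: m_assoc)
  also have "... = f" using y z ff by simp
  finally have "f ** y ** f ** z = f" .
  moreover have "f ** (f ** y ** f) = f ** y ** f"
   using fR y(1) ff by (simp flip: m_assoc)
  moreover have "f ** y ** f ** f = f ** y ** f"
   using fR y(1) ff by (simp add: m_assoc)
  ultimately show ?thesis using fR y(1) by (intro bexI[of _ "f ** y ** f"]) auto
 qed
 ultimately show ?thesis
  using that fR ff unfolding division_idempotent_def by blast
qed

text \<open>A longest family \<open>x\<^sub>a\<close>, \<open>y\<^sub>a\<close> with \<open>y\<^sub>a x\<^sub>b = \<delta>\<^sub>a\<^sub>b f\<close> gives the matrix units \<open>x\<^sub>a y\<^sub>b\<close>: were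
 \<open>s = \<Sum> x\<^sub>a y\<^sub>a\<close> not \<open>1\<close>, a nonzero element of \<open>(1 - s) R f\<close> would extend the family. Its length is at most
 the dimension of the ring.\<close>

theorem Wedderburn_matrix_units:
 assumes R: "prime_ring R" and F: "subfield F R" "F <= center R" and n: "dimension n F (carrier R)"
 obtains q e where "1 \<le> q" "matrix_units R q e" "division_ring (sub R (unit_commutant R q e))"
proof -
 obtain f where f: "division_idempotent R f"
  using exists_division_idempotent[OF R F(1) n] by blast
 then have fR: "f : carrier R" "f ** f = f" "f ~= \<zero>"
  unfolding division_idempotent_def by auto
 have FR: "F <= carrier R" using F(1) subfieldE(3) by blast
 define P where "P q x y \<longleftrightarrow> (\<forall>a\<in>{1..q}. x a \<in> carrier R \<and> x a ** f = x a \<and> y a \<in> carrier R \<and> f ** y a = y a)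
  \<and> (\<forall>a\<in>{1..q}. \<forall>b\<in>{1..q}. y a ** x b = (if a = b then f else \<zero>))" for q :: nat and x y
 define Q where "Q q \<longleftrightarrow> (\<exists>x y. P q x y)" for q
 have PD: "a : {1..q} ==> x a \<in> carrier R" "a : {1..q} ==> x a ** f = x a"
  "a : {1..q} ==> y a \<in> carrier R" "a : {1..q} ==> f ** y a = y a"
  "a : {1..q} ==> b : {1..q} ==> y a ** x b = (if a = b then f else \<zero>)"
  if "P q x y" for q x y a b
  using that unfolding P_def by blast+
 have bound: "q \<le> n" if "Q q" for q
 proof -
  have "\<exists>x y. P q x y" using that unfolding Q_def .
  then obtain x y where "P q x y" by blast
  note xy = PD(1,3,5)[OF this]
  have "lin_indep F {1..q} x"
   unfolding lin_indep_def
  proof (intro ballI impI)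
   fix k b assume k: "k : {1..q} \<rightarrow> F" and z: "(\<Oplus>i\<in>{1..q}. k i ** x i) = \<zero>" and b: "b : {1..q}"
   have kR: "!!i. i \<in> {1..q} ==> k i \<in> carrier R" using funcset_mem[OF k] FR by blast
   have "y b ** (\<Oplus>i\<in>{1..q}. k i ** x i) = (\<Oplus>i\<in>{1..q}. y b ** (k i ** x i))"
    by (rule finsum_lmult) (use xy kR b in auto)
   also have "... = (\<Oplus>i\<in>{1..q}. if i = b then k i ** f else \<zero>)"
   proof (rule finsum_cong')
    fix i assume i: "i : {1..q}"
    have "y b ** (k i ** x i) = (k i ** y b) ** x i"
     using central_comm[OF F(2), of "k i" "y b"] xy(1,2) kR i b funcset_mem[OF k i] by (simp flip: m_assoc)
    also have "... = k i ** (y b ** x i)" using xy(1,2) kR i b by (simp add: m_assoc)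
    finally show "y b ** (k i ** x i) = (if i = b then k i ** f else \<zero>)"
     using xy(3)[OF b i] kR[OF i] by auto
   qed (use kR fR in auto)
   also have "... = k b ** f" by (rule finsum_delta) (use b kR fR in auto)
   finally have kf: "k b ** f = \<zero>" using z xy b by simp
   show "k b = \<zero>"
   proof (rule ccontr)
    assume "k b ~= \<zero>"
    then have "k b \<in> F - {\<zero>}" using funcset_mem[OF k b] by simp
    note inv = subfield_m_inv[OF F(1) this]
    have invR: "inv (k b) \<in> carrier R" using inv(1) FR by auto
    have "f = (inv (k b) ** k b) ** f" using inv fR by simp
    also have "... = inv (k b) ** (k b ** f)" by (rule m_assoc) (use invR kR b fR in auto)
    finally show False using kf fR invR by simp
   qed
  qed
  then show ?thesis
   using lin_indep_card_le[OF F(1), of "{1..q}" x "carrier R" n] xy n by auto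
 qed
 define q where "q = (GREATEST q. Q q)"
 have "Q 0" unfolding Q_def P_def by simp
 then have "Q q" unfolding q_def by (rule GreatestI_nat) (use bound in auto)
 then obtain x y where "P q x y" unfolding Q_def by blast
 note x = PD(1,2)[OF this] and y = PD(3,4)[OF this] and yx = PD(5)[OF this]
 define s where "s = (\<Oplus>a\<in>{1..q}. x a ** y a)"
 have sR: "s : carrier R" unfolding s_def using x y by (auto intro!: finsum_closed)
 have s_x: "s ** x b = x b" if b: "b : {1..q}" for b
 proof -
  have "s ** x b = (\<Oplus>a\<in>{1..q}. x a ** y a ** x b)"
   unfolding s_def by (rule finsum_rmult) (use x y b in auto)
  also have "... = (\<Oplus>a\<in>{1..q}. if a = b then x a else \<zero>)"
   by (rule finsum_cong') (use x y(1) yx b in \<open>auto simp: m_assoc simp del: atLeastAtMost_iff\<close>)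
  also have "... = x b" by (rule finsum_delta) (use x b in auto)
  finally show ?thesis .
 qed
 have y_s: "y b ** s = y b" if b: "b : {1..q}" for b
 proof -
  have "y b ** s = (\<Oplus>a\<in>{1..q}. y b ** (x a ** y a))"
   unfolding s_def by (rule finsum_lmult) (use x y b in auto)
  also have "... = (\<Oplus>a\<in>{1..q}. if a = b then y a else \<zero>)"
  proof (rule finsum_cong')
   fix a assume a: "a : {1..q}"
   have "y b ** (x a ** y a) = (y b ** x a) ** y a" using x(1) y(1) a b by (simp add: m_assoc)
   then show "y b ** (x a ** y a) = (if a = b then y a else \<zero>)"
    using yx[OF b a] y[OF a] by auto
  qed (use y in auto)
  also have "... = y b" by (rule finsum_delta) (use y b in auto)
  finally show ?thesis .
 qed
 have s1: "s = \<one>"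
 proof (rule ccontr)
  assume "s ~= \<one>"
  then have nz: "\<one> \<ominus> s ~= \<zero>" using sR by simp
  obtain a where a: "a : carrier R" "(\<one> \<ominus> s) ** a ** f ~= \<zero>"
   using prime_ringE[OF R _ fR(1) nz fR(3)] sR by auto
  define x' where "x' = (\<one> \<ominus> s) ** a ** f"
  have x'R: "x' : carrier R" "x' ** f = x'" "x' ~= \<zero>"
   unfolding x'_def using a sR fR by (auto simp: m_assoc)
  obtain y0 where y0: "y0 : carrier R" "f ** y0 = y0" "y0 ** x' = f"
   using division_idempotent_left_inverse[OF R f x'R] by blast
  have y_1s: "y b ** (\<one> \<ominus> s) = \<zero>" if "b : {1..q}" for b
   using y_s[OF that] y[OF that] sR by (simp add: a_minus_def r_distr r_minus r_neg)
  have s_1x: "(\<one> \<ominus> s) ** x b = \<zero>" if "b : {1..q}" for b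
   using s_x[OF that] x[OF that] sR by (simp add: a_minus_def l_distr l_minus r_neg)
  have ss: "s ** s = s"
  proof -
   have "s ** (\<Oplus>a\<in>{1..q}. x a ** y a) = (\<Oplus>a\<in>{1..q}. s ** (x a ** y a))"
    by (rule finsum_lmult) (use x y sR in auto)
   also have "... = (\<Oplus>a\<in>{1..q}. x a ** y a)"
    by (rule finsum_cong') (use x y sR s_x in \<open>auto simp flip: m_assoc simp del: atLeastAtMost_iff\<close>)
   finally show ?thesis unfolding s_def[symmetric] .
  qed
  have "(\<one> \<ominus> s) ** (\<one> \<ominus> s) = \<one> \<ominus> s"
   using sR ss by (simp add: a_minus_def l_distr r_distr l_minus r_minus r_neg)
  then have s_1x': "(\<one> \<ominus> s) ** x' = x'"
   unfolding x'_def using a(1) sR fR(1) by (simp flip: m_assoc)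
  define y' where "y' = y0 ** (\<one> \<ominus> s)"
  have y'R: "y' : carrier R" unfolding y'_def using y0 sR by simp
  have fy': "f ** y' = y'"
   unfolding y'_def using y0 sR fR(1) by (simp flip: m_assoc)
  have y'x': "y' ** x' = f"
   unfolding y'_def using y0 sR s_1x' x'R(1) by (simp add: m_assoc)
  have y'x: "y' ** x b = \<zero>" if "b : {1..q}" for b
   unfolding y'_def using y0(1) sR s_1x[OF that] x(1)[OF that] by (simp add: m_assoc)
  have yx': "y b ** x' = \<zero>" if "b : {1..q}" for b
  proof -
   have "y b ** x' = (y b ** (\<one> \<ominus> s)) ** a ** f"
    unfolding x'_def using a(1) sR fR(1) y(1)[OF that] by (simp add: m_assoc)
   then show ?thesis using y_1s[OF that] a fR by simp
  qed
  let ?x = "x(Suc q := x')" and ?y = "y(Suc q := y')"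
  have "P (Suc q) ?x ?y"
   unfolding P_def
  proof (intro conjI ballI)
   fix c assume c: "c : {1..Suc q}"
   show "?x c \<in> carrier R" "?x c ** f = ?x c" "?y c \<in> carrier R" "f ** ?y c = ?y c"
    using c x y x'R y'R fy' by (cases "c = Suc q"; simp)+
   fix b assume b: "b : {1..Suc q}"
   show "?y c ** ?x b = (if c = b then f else \<zero>)"
    using b c yx[of c b] y'x[of b] yx'[of c] y'x' by (cases "c = Suc q"; cases "b = Suc q") auto
  qed
  then have "Q (Suc q)" unfolding Q_def by blast
  then have "Suc q \<le> q"
   unfolding q_def by (rule Greatest_le_nat) (use bound in auto)
  then show False by simp
 qed
 have "matrix_units R q (%a b. x a ** y b)"
  unfolding matrix_units_def
 proof (intro conjI ballI)
  fix i j k l assume ijkl: "i : {1..q}" "j : {1..q}" "k : {1..q}" "l : {1..q}"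
  have "x i ** y j ** (x k ** y l) = x i ** ((y j ** x k) ** y l)"
   using x(1) y(1) ijkl by (simp add: m_assoc)
  then show "x i ** y j ** (x k ** y l) = (if j = k then x i ** y l else \<zero>)"
   using x y yx[OF ijkl(2,3)] ijkl by auto
 next
  show "(\<Oplus>i\<in>{1..q}. x i ** y i) = \<one>" using s1 unfolding s_def .
 qed (use x y in auto)
 then interpret e: matrix_unit_system R q "%a b. x a ** y b" by unfold_locales
 have q1: "1 \<le> q"
 proof (rule ccontr)
  assume "\<not> 1 \<le> q"
  then have "s = \<zero>" unfolding s_def by simp
  then show False using s1 R unfolding prime_ring_def by auto
 qed
 then have one: "1 : {1..q}" by simp
 have "division_idempotent R (x 1 ** y 1)"
  unfolding division_idempotent_def
 proof (intro conjI ballI impI)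
  show "x 1 ** y 1 \<in> carrier R" "x 1 ** y 1 ** (x 1 ** y 1) = x 1 ** y 1"
   using e.e_mult[OF one one one one] e.e_closed[OF one one] by auto
  have *: "y 1 ** (x 1 ** y 1) ** x 1 = f"
  proof -
   have "y 1 ** (x 1 ** y 1) ** x 1 = (y 1 ** x 1) ** (y 1 ** x 1)"
    using x(1) y(1) one by (simp add: m_assoc)
   then show ?thesis using yx[OF one one] fR by simp
  qed
  then show "x 1 ** y 1 ~= \<zero>" using fR x(1) y(1) one by auto
  fix z assume z: "z : carrier R" "x 1 ** y 1 ** z = z" "z ** (x 1 ** y 1) = z" "z ~= \<zero>"
  let ?z = "y 1 ** z ** x 1"
  have xz: "x 1 ** ?z ** y 1 = z"
  proof -
   have "x 1 ** ?z ** y 1 = (x 1 ** y 1 ** z) ** (x 1 ** y 1)"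
    using x(1) y(1) one z(1) by (simp add: m_assoc)
   then show ?thesis using z by simp
  qed
  have zc: "?z \<in> carrier R" using x y one z by simp
  have "f ** ?z = (f ** y 1) ** z ** x 1" using fR(1) x(1) y(1) one z(1) by (simp add: m_assoc)
  then have z1: "f ** ?z = ?z" using y one by simp
  have "?z ** f = y 1 ** z ** (x 1 ** f)" using fR(1) x(1) y(1) one z(1) by (simp add: m_assoc)
  then have z2: "?z ** f = ?z" using x one by simp
  have "?z ~= \<zero>" using xz z x y one by auto
  then obtain w where w: "w : carrier R" "f ** w = w" "w ** f = w" "w ** ?z = f"
   using f zc z1 z2 unfolding division_idempotent_def by blast
  let ?w = "x 1 ** w ** y 1"
  have "?w ** z = ?w ** (x 1 ** ?z ** y 1)" using xz by simp
  also have "... = x 1 ** (w ** ((y 1 ** x 1) ** ?z)) ** y 1"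
   using x(1) y(1) one z(1) w(1) by (simp add: m_assoc)
  also have "... = (x 1 ** f) ** y 1" using yx[OF one one] z1 w by simp
  finally have "?w ** z = x 1 ** y 1" using x one by simp
  moreover have "x 1 ** y 1 ** ?w = ?w"
  proof -
   have "x 1 ** y 1 ** ?w = x 1 ** ((y 1 ** x 1) ** w) ** y 1"
    using x(1) y(1) one w(1) by (simp add: m_assoc)
   then show ?thesis using yx[OF one one] w by simp
  qed
  moreover have "?w ** (x 1 ** y 1) = ?w"
  proof -
   have "?w ** (x 1 ** y 1) = x 1 ** (w ** (y 1 ** x 1)) ** y 1"
    using x(1) y(1) one w(1) by (simp add: m_assoc)
   then show ?thesis using yx[OF one one] w by simp
  qed
  ultimately show "\<exists>w\<in>carrier R. x 1 ** y 1 ** w = w \<and> w ** (x 1 ** y 1) = w \<and> w ** z = x 1 ** y 1"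
   using x y one w by (intro bexI[of _ ?w]) auto
 qed
 from e.division_commutant[OF q1 this] that[OF q1 e.units] show ?thesis by blast
qed

section \<open>Independence of multiplications and of automorphisms\<close>

definition simple_ring :: bool where
 "simple_ring \<longleftrightarrow> \<one> ~= \<zero> \<and> (\<forall>I. ideal I R \<longrightarrow> I = {\<zero>} \<or> I = carrier R)"

lemma ideal_setI:
 assumes "I <= carrier R" "\<zero> \<in> I" "!!x y. x \<in> I ==> y : I ==> x \<oplus> y \<in> I"
  "!!a x. a \<in> carrier R ==> x : I ==> a ** x \<in> I" "!!a x. a \<in> carrier R ==> x : I ==> x ** a \<in> I"
 shows "ideal I R"
proof (rule idealI[OF ring_axioms])
 have "\<ominus> x \<in> I" if "x : I" for x
  using assms(4)[of "\<ominus> \<one>" x] that assms(1) by (auto simp: l_minus)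
 then show "subgroup I (add_monoid R)"
  by (intro add.subgroupI) (use assms in auto)
qed (use assms in auto)

lemma simple_imp_prime:
 assumes "simple_ring"
 shows "prime_ring R"
 unfolding prime_ring_def
proof (intro conjI ballI impI)
 show "\<one> ~= \<zero>" using assms unfolding simple_ring_def by simp
 fix x y assume x: "x : carrier R" and y: "y : carrier R" and z: "\<forall>a\<in>carrier R. x ** a ** y = \<zero>"
 let ?J = "{y \<in> carrier R. \<forall>a\<in>carrier R. x ** a ** y = \<zero>}"
 have "ideal ?J R"
 proof (rule ideal_setI)
  fix a w assume a: "a : carrier R" and "w : ?J"
  then have w: "w : carrier R" "!!b. b \<in> carrier R ==> x ** b ** w = \<zero>" by auto
  have "x ** b ** (a ** w) = \<zero>" if b: "b : carrier R" for b
   using w(2)[of "b ** a"] a b x w(1) by (simp add: m_assoc)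
  then show "a ** w \<in> ?J" using a w by simp
  have "x ** b ** (w ** a) = x ** b ** w ** a" if b: "b : carrier R" for b
   using a b x w(1) by (simp add: m_assoc)
  then show "w ** a \<in> ?J" using a w by simp
 qed (use x in \<open>auto simp: r_distr\<close>)
 then have "?J = {\<zero>} \<or> ?J = carrier R" using assms unfolding simple_ring_def by blast
 then show "x = \<zero> \<or> y = \<zero>"
 proof
  assume "?J = {\<zero>}"
  then show ?thesis using y z by blast
 next
  assume "?J = carrier R"
  then have "\<one> \<in> ?J" by simp
  then have "x ** \<one> ** \<one> = \<zero>" by blast
  then show ?thesis using x by simp
 qed
qed

text \<open>In a central simple algebra the multiplications \<open>x \<mapsto> l x a\<close> satisfy no more linear relations
 than the tensors \<open>l \<otimes> a\<close>. The first coefficients of all relations form an ideal,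
 so one of them could be \<open>1\<close>. Commutators then give a shorter relation, which is trivial by induction:
 all coefficients would be central, against the independence of the \<open>a\<^sub>j\<close>.\<close>

lemma multiplications_independent:
 assumes S: "simple_ring" and F: "subfield F R" "center R = F"
  and J: "finite J" "a : J \<rightarrow> carrier R" "lin_indep F J a" "l : J \<rightarrow> carrier R"
  and rel: "!!x. x \<in> carrier R ==> (\<Oplus>j\<in>J. l j ** x ** a j) = \<zero>"
 shows "\<forall>j\<in>J. l j = \<zero>"
 using J rel
proof (induction J arbitrary: l rule: finite_induct)
 case (insert j J)
 have FR: "F <= carrier R" using F(1) subfieldE(3) by blast
 have aR: "a j \<in> carrier R" "!!i. i \<in> J ==> a i \<in> carrier R" using insert.prems by auto
 have indJ: "lin_indep F J a"
  unfolding lin_indep_def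
 proof (intro ballI impI)
  fix k i assume k: "k : J \<rightarrow> F" and z: "(\<Oplus>i\<in>J. k i ** a i) = \<zero>" and i: "i : J"
  let ?k = "k(j := \<zero>)"
  have "(\<Oplus>i\<in>J. ?k i ** a i) = (\<Oplus>i\<in>J. k i ** a i)"
   by (rule finsum_cong') (use insert.hyps k FR aR in \<open>auto simp: Pi_def subset_iff\<close>)
  then have "(\<Oplus>i\<in>insert j J. ?k i ** a i) = \<zero>"
   using insert.hyps k FR aR z by (subst finsum_insert) (auto simp: Pi_def subset_iff)
  moreover have "?k \<in> insert j J \<rightarrow> F" using k subringE(2)[OF subfieldE(1)[OF F(1)]] by auto
  ultimately have "\<forall>i\<in>insert j J. ?k i = \<zero>" using insert.prems(2) unfolding lin_indep_def by blast
  then show "k i = \<zero>" using i insert.hyps by (auto split: if_splits)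
 qed
 have sum_insert: "(\<Oplus>i\<in>insert j J. m i ** x ** a i) = m j ** x ** a j \<oplus> (\<Oplus>i\<in>J. m i ** x ** a i)"
  if "m : insert j J \<rightarrow> carrier R" "x : carrier R" for m x
  using insert.hyps aR that by (subst finsum_insert) (auto simp: Pi_def)
 define Rel where "Rel m \<longleftrightarrow> m \<in> insert j J \<rightarrow> carrier R \<and>
  (\<forall>x\<in>carrier R. (\<Oplus>i\<in>insert j J. m i ** x ** a i) = \<zero>)" for m
 let ?I = "{m j | m. Rel m}"
 have Rel_add: "Rel (%i. m i \<oplus> m' i)" if "Rel m" "Rel m'" for m m'
  unfolding Rel_def
 proof (intro conjI ballI)
  fix x assume x: "x : carrier R"
  have "(\<Oplus>i\<in>insert j J. (m i \<oplus> m' i) ** x ** a i) = (\<Oplus>i\<in>insert j J. m i ** x ** a i \<oplus> m' i ** x ** a i)"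
   by (rule finsum_cong') (use x aR that in \<open>auto simp: Rel_def l_distr Pi_def\<close>)
  also have "... = (\<Oplus>i\<in>insert j J. m i ** x ** a i) \<oplus> (\<Oplus>i\<in>insert j J. m' i ** x ** a i)"
   by (rule finsum_addf) (use x aR that in \<open>auto simp: Rel_def Pi_def\<close>)
  finally show "(\<Oplus>i\<in>insert j J. (m i \<oplus> m' i) ** x ** a i) = \<zero>"
   using that x unfolding Rel_def by simp
 qed (use that in \<open>auto simp: Rel_def Pi_def\<close>)
 have Rel_left: "Rel (%i. y ** m i)" if "Rel m" "y : carrier R" for m y
  unfolding Rel_def
 proof (intro conjI ballI)
  fix x assume x: "x : carrier R"
  have "(\<Oplus>i\<in>insert j J. y ** m i ** x ** a i) = (\<Oplus>i\<in>insert j J. y ** (m i ** x ** a i))"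
   by (rule finsum_cong') (use x aR that in \<open>auto simp: Rel_def m_assoc Pi_def\<close>)
  also have "... = y ** (\<Oplus>i\<in>insert j J. m i ** x ** a i)"
   by (rule finsum_lmult[symmetric]) (use x aR that in \<open>auto simp: Rel_def Pi_def\<close>)
  finally show "(\<Oplus>i\<in>insert j J. y ** m i ** x ** a i) = \<zero>"
   using that x unfolding Rel_def by simp
 qed (use that in \<open>auto simp: Rel_def Pi_def\<close>)
 have Rel_right: "Rel (%i. m i ** y)" if "Rel m" "y : carrier R" for m y
  unfolding Rel_def
 proof (intro conjI ballI)
  fix x assume x: "x : carrier R"
  have "(\<Oplus>i\<in>insert j J. m i ** y ** x ** a i) = (\<Oplus>i\<in>insert j J. m i ** (y ** x) ** a i)"
   by (rule finsum_cong') (use x aR that in \<open>auto simp: Rel_def m_assoc Pi_def\<close>)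
  then show "(\<Oplus>i\<in>insert j J. m i ** y ** x ** a i) = \<zero>"
   using that x unfolding Rel_def by simp
 qed (use that in \<open>auto simp: Rel_def Pi_def\<close>)
 have Rel0: "Rel (%_. \<zero>)"
  unfolding Rel_def using aR by (auto intro!: add.finprod_one_eqI)
 have "ideal ?I R"
 proof (rule ideal_setI)
  show "?I <= carrier R" unfolding Rel_def by auto
  show "\<zero> \<in> ?I" using Rel0 by (intro CollectI exI[of _ "%_. \<zero>"]) simp
 next
  fix x y assume "x : ?I" "y : ?I"
  then obtain m m' where "Rel m" "Rel m'" "x = m j" "y = m' j" by blast
  then show "x \<oplus> y \<in> ?I" using Rel_add[of m m'] by (intro CollectI exI[of _ "%i. m i \<oplus> m' i"]) simp
 next
  fix b x assume b: "b : carrier R" and "x : ?I"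
  then obtain m where m: "Rel m" "x = m j" by blast
  show "b ** x \<in> ?I" using Rel_left[OF m(1) b] m by (intro CollectI exI[of _ "%i. b ** m i"]) simp
  show "x ** b \<in> ?I" using Rel_right[OF m(1) b] m by (intro CollectI exI[of _ "%i. m i ** b"]) simp
 qed
 moreover have "?I ~= carrier R"
 proof
  assume "?I = carrier R"
  then have "\<one> \<in> ?I" by simp
  then obtain m where m: "Rel m" "m j = \<one>" by auto
  have mR: "!!i. i \<in> insert j J ==> m i \<in> carrier R" using m(1) unfolding Rel_def by auto
  have cent: "m i \<in> F" if i: "i : insert j J" for i
   unfolding F(2)[symmetric] centralizer_def
  proof (intro CollectI conjI ballI)
   fix y assume y: "y : carrier R"
   let ?m = "%i. m i ** y \<oplus> (\<ominus> y) ** m i"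
   have Rm: "Rel ?m" using Rel_add Rel_left Rel_right m(1) y by simp
   have mj: "?m j = \<zero>" using m(2) y by (simp add: r_neg)
   have "\<forall>i\<in>J. ?m i = \<zero>"
   proof (rule insert.IH[OF _ indJ])
    fix x assume x: "x : carrier R"
    show "(\<Oplus>i\<in>J. ?m i ** x ** a i) = \<zero>"
     using Rm x sum_insert[of ?m x] mj aR mR y
     unfolding Rel_def by (auto simp: Pi_def)
   qed (use aR mR y in auto)
   then have "?m i = \<zero>" using mj i by blast
   then show "m i ** y = y ** m i"
    using mR[OF i] y by (simp add: l_minus a_minus_def[symmetric])
  qed (use mR i in auto)
  have "(\<Oplus>i\<in>insert j J. m i ** \<one> ** a i) = \<zero>" using m(1) unfolding Rel_def by blast
  moreover have "(\<Oplus>i\<in>insert j J. m i ** \<one> ** a i) = (\<Oplus>i\<in>insert j J. m i ** a i)"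
   by (rule finsum_cong') (use mR aR in auto)
  ultimately have "m j = \<zero>"
   using insert.prems(2) cent unfolding lin_indep_def by (auto simp: Pi_def)
  then show False using m(2) S unfolding simple_ring_def by simp
 qed
 ultimately have I0: "?I = {\<zero>}" using S unfolding simple_ring_def by blast
 have "Rel l" unfolding Rel_def using insert.prems by auto
 then have "l j \<in> ?I" by blast
 then have lj: "l j = \<zero>" using I0 by blast
 have "\<forall>i\<in>J. l i = \<zero>"
 proof (rule insert.IH[OF _ indJ])
  fix x assume x: "x : carrier R"
  show "(\<Oplus>i\<in>J. l i ** x ** a i) = \<zero>"
   using insert.prems(3,4) x sum_insert[of l x] lj aR by (auto simp: Pi_def)
 qed (use insert.prems in auto)
 then show ?case using lj by blast
qed simp

text \<open>The summands of a sum of eigenvectors for distinct characters of \<open>L\<close> stay in every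
 \<open>L\<close>-bimodule that contains the sum.\<close>

lemma eigenvector_components:
 assumes L: "subfield L R" and V: "V <= carrier R" "!!v w. v \<in> V ==> w : V ==> v \<ominus> w \<in> V"
  "!!l v. l \<in> L ==> v : V ==> l ** v \<in> V" "!!l v. l \<in> L ==> v : V ==> v ** l \<in> V"
  and S: "finite S" "!!g l. g \<in> S ==> l : L ==> th g l \<in> L"
   "!!g h. g \<in> S ==> h : S ==> g ~= h ==> \<exists>l\<in>L. th g l ~= th h l"
  and w: "w : S \<rightarrow> carrier R" "!!g l. g \<in> S ==> l : L ==> l ** w g = w g ** th g l"
  and sum: "(\<Oplus>g\<in>S. w g) \<in> V"
 shows "\<forall>g\<in>S. w g \<in> V"
 using S w sum
proof (induction S arbitrary: w rule: finite_induct)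
 case (insert h S)
 note Ls = subringE[OF subfieldE(1)[OF L]]
 have LR: "!!l. l \<in> L ==> l : carrier R" using Ls(1) by auto
 have wR: "w h \<in> carrier R" "!!g. g \<in> S ==> w g \<in> carrier R" using insert.prems by auto
 let ?s = "\<Oplus>g\<in>insert h S. w g"
 have s: "?s = w h \<oplus> (\<Oplus>g\<in>S. w g)" using insert.hyps wR by (simp add: Pi_def)
 have SR: "(\<Oplus>g\<in>S. w g) \<in> carrier R" using wR by (simp add: Pi_def)
 have thL: "!!g l. g \<in> insert h S ==> l : L ==> th g l \<in> L" by fact
 have th: "!!g l. g \<in> insert h S ==> l : L ==> th g l \<in> carrier R" using thL LR by blast
 have mem: "w g ** (th g l \<ominus> th h l) \<in> V" if g: "g : S" and l: "l : L" for g l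
 proof -
  let ?w = "%g. w g ** (th g l \<ominus> th h l)"
  have diff: "th g l \<ominus> th h l \<in> L" if "g : S" for g
   using thL that l Ls by (simp add: a_minus_def)
  have "l ** ?s \<ominus> ?s ** th h l \<in> V" using V insert.prems(5) thL l by simp
  also have "l ** ?s \<ominus> ?s ** th h l = (\<Oplus>g\<in>S. ?w g)"
  proof -
   have "l ** (\<Oplus>g\<in>S. w g) = (\<Oplus>g\<in>S. w g ** th g l)"
    using finsum_lmult[of l S w] wR LR[OF l] insert.prems(4) l th by (auto intro: finsum_cong')
   moreover have "(\<Oplus>g\<in>S. w g) ** th h l = (\<Oplus>g\<in>S. w g ** th h l)"
    using wR th l by (intro finsum_rmult) auto
   moreover have "(\<Oplus>g\<in>S. w g ** th g l) \<ominus> (\<Oplus>g\<in>S. w g ** th h l) = (\<Oplus>g\<in>S. ?w g)"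
   proof -
    have "(\<Oplus>g\<in>S. w g ** th g l) \<ominus> (\<Oplus>g\<in>S. w g ** th h l)
      = (\<Oplus>g\<in>S. w g ** th g l \<ominus> w g ** th h l)"
     by (rule finsum_minus[symmetric]) (use wR th l in auto)
    also have "... = (\<Oplus>g\<in>S. ?w g)"
     by (rule finsum_cong') (use wR th l in \<open>auto simp: r_distr a_minus_def r_minus\<close>)
    finally show ?thesis .
   qed
   moreover have "l ** ?s \<ominus> ?s ** th h l
     = l ** (\<Oplus>g\<in>S. w g) \<ominus> (\<Oplus>g\<in>S. w g) ** th h l"
   proof -
    have "l ** ?s = w h ** th h l \<oplus> l ** (\<Oplus>g\<in>S. w g)"
     unfolding s using wR SR LR[OF l] insert.prems(4)[of h l] l by (simp add: r_distr)
    moreover have "?s ** th h l = w h ** th h l \<oplus> (\<Oplus>g\<in>S. w g) ** th h l"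
     unfolding s using wR SR th l by (simp add: l_distr)
    moreover have "x \<oplus> y \<ominus> (x \<oplus> z) = y \<ominus> z"
     if "x : carrier R" "y : carrier R" "z : carrier R" for x y z
     using that by algebra
    ultimately show ?thesis using wR SR LR[OF l] th l by simp
   qed
   ultimately show ?thesis by simp
  qed
  finally have V': "(\<Oplus>g\<in>S. ?w g) \<in> V" .
  have "\<forall>g\<in>S. ?w g \<in> V"
  proof (rule insert.IH)
   fix g x assume g: "g : S" and x: "x : L"
   have "x ** ?w g = w g ** th g x ** (th g l \<ominus> th h l)"
    using insert.prems(4)[of g x] g x wR LR th l by (simp flip: m_assoc)
   also have "... = w g ** (th g x ** (th g l \<ominus> th h l))"
    using g x wR th l by (simp add: m_assoc)
   also have "th g x ** (th g l \<ominus> th h l) = (th g l \<ominus> th h l) ** th g x"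
    using subfieldE(4)[OF L] diff[OF g] thL g x by blast
   finally show "x ** ?w g = ?w g ** th g x"
    using g x wR th l by (simp add: m_assoc)
  qed (use insert.prems V' wR th l in auto)
  then show ?thesis using g by blast
 qed
 have VS: "\<forall>g\<in>S. w g \<in> V"
 proof
  fix g assume g: "g : S"
  then obtain l where l: "l : L" "th g l ~= th h l" using insert.prems(2)[of g h] insert.hyps by blast
  let ?d = "th g l \<ominus> th h l"
  have "?d \<in> L - {\<zero>}" using thL g l Ls th by (simp add: a_minus_def[symmetric]) (simp add: a_minus_def)
  note inv = subfield_m_inv[OF L this]
  have "w g ** ?d ** inv ?d \<in> V" using mem[OF g l(1)] V(4) inv(1) by blast
  moreover have "w g ** ?d ** inv ?d = w g"
   using inv wR g th l LR by (simp add: m_assoc)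
  ultimately show "w g \<in> V" by simp
 qed
 have "w h \<in> V"
 proof -
  have sR: "?s \<in> carrier R" using V(1) insert.prems(5) by blast
  have "?s \<ominus> ?s = \<zero>" using sR by (simp only: a_minus_def r_neg)
  then have z: "\<zero> \<in> V" using V(2)[OF insert.prems(5) insert.prems(5)] by simp
  have Vadd: "v \<oplus> v' \<in> V" if "v : V" "v' : V" for v v'
  proof -
   have "v \<oplus> v' = v \<ominus> (\<zero> \<ominus> v')" using that V(1) by (simp add: a_minus_def subset_iff)
   then show ?thesis using that V(2) z by simp
  qed
  have "(\<Oplus>g\<in>S. w g) \<in> V"
   by (rule finsum_additive(1)[where H = R and h = id])
    (use V(1) z Vadd VS abelian_monoid_axioms in \<open>auto simp: subset_iff\<close>)
  then have "?s \<ominus> (\<Oplus>g\<in>S. w g) \<in> V" using V(2) insert.prems(5) by blast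
  moreover have "?s \<ominus> (\<Oplus>g\<in>S. w g) = w h"
   unfolding s using wR SR by (simp add: a_minus_def add.m_assoc r_neg)
  ultimately show ?thesis by simp
 qed
 then show ?case using VS by blast
qed simp

text \<open>Dedekind's lemma, with coefficients in an overring of \<open>K\<close>. The relation at \<open>l x\<close> minus \<open>th\<^sub>h l\<close> times the
 relation at \<open>x\<close> is a relation without \<open>h\<close>.\<close>

lemma characters_independent:
 assumes K: "subfield K R" and S: "finite S"
  and th: "!!g l. g \<in> S ==> l : L ==> th g l \<in> K"
   "!!g l l'. g \<in> S ==> l : L ==> l' : L ==> th g (l ** l') = th g l ** th g l'"
   "!!g. g \<in> S ==> th g \<one> = \<one>"
   "!!g h. g \<in> S ==> h : S ==> g ~= h ==> \<exists>l\<in>L. th g l ~= th h l"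
  and L: "\<one> \<in> L" "!!l l'. l \<in> L ==> l' : L ==> l ** l' \<in> L"
  and m: "m : S \<rightarrow> carrier R"
  and sum: "!!l. l \<in> L ==> (\<Oplus>g\<in>S. th g l ** m g) = \<zero>"
 shows "\<forall>g\<in>S. m g = \<zero>"
 using S th m sum
proof (induction S arbitrary: m rule: finite_induct)
 case (insert h S)
 note Ks = subringE[OF subfieldE(1)[OF K]]
 have thK: "!!g l. g \<in> insert h S ==> l : L ==> th g l \<in> K" by fact
 have thR: "!!g l. g \<in> insert h S ==> l : L ==> th g l \<in> carrier R" using thK Ks(1) by blast
 have mR: "m h \<in> carrier R" "!!g. g \<in> S ==> m g \<in> carrier R" using insert.prems by auto
 have sum_insert: "(\<Oplus>g\<in>insert h S. th g l ** m g) = th h l ** m h \<oplus> (\<Oplus>g\<in>S. th g l ** m g)"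
  if "l : L" for l
  using insert.hyps mR thR that by (subst finsum_insert) auto
 have neg: "(\<Oplus>g\<in>S. th g y ** m g) = \<ominus> (th h y ** m h)"
  if y: "y : L" and c: "(\<Oplus>g\<in>S. th g y ** m g) \<in> carrier R" for y
 proof -
  have hc: "th h y ** m h \<in> carrier R" using thR mR y by simp
  have "(\<Oplus>g\<in>S. th g y ** m g) \<oplus> th h y ** m h = \<zero>"
   using insert.prems(6)[OF y] sum_insert[OF y] a_comm[OF hc c] by simp
  from minus_equality[OF this hc c] show ?thesis by simp
 qed
 have zero: "(th g l \<ominus> th h l) ** m g = \<zero>" if g: "g : S" and l: "l : L" for g l
 proof -
  let ?m = "%g. (th g l \<ominus> th h l) ** m g"
  have "\<forall>g\<in>S. ?m g = \<zero>"
  proof (rule insert.IH)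
   fix x assume x: "x : L"
   have c: "(\<Oplus>g\<in>S. th g x ** m g) \<in> carrier R" "(\<Oplus>g\<in>S. th g (l ** x) ** m g) \<in> carrier R"
    using mR thR x l L(2)[OF l x] by (auto intro!: finsum_closed)
   have "(\<Oplus>g\<in>S. th g x ** ?m g)
     = (\<Oplus>g\<in>S. th g (l ** x) ** m g \<ominus> th h l ** (th g x ** m g))"
   proof (rule finsum_cong')
    fix g assume g: "g : S"
    have "th g x ** ?m g = th g x ** th g l ** m g \<ominus> th g x ** th h l ** m g"
     using g x l thR mR by (simp add: a_minus_def l_distr r_distr l_minus r_minus m_assoc)
    also have "th g x ** th g l = th g (l ** x)"
     using insert.prems(2)[of g l x] subfieldE(4)[OF K] thK g l x by auto
    also have "th g x ** th h l = th h l ** th g x"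
     using subfieldE(4)[OF K] thK g l x by auto
    finally show "th g x ** ?m g = th g (l ** x) ** m g \<ominus> th h l ** (th g x ** m g)"
     using g x l thR mR by (simp add: m_assoc)
   qed (use thR mR x l L(2) in auto)
   also have "... = (\<Oplus>g\<in>S. th g (l ** x) ** m g) \<ominus> (\<Oplus>g\<in>S. th h l ** (th g x ** m g))"
    by (rule finsum_minus) (use thR mR x l L(2) in auto)
   also have "(\<Oplus>g\<in>S. th h l ** (th g x ** m g)) = th h l ** (\<Oplus>g\<in>S. th g x ** m g)"
    by (rule finsum_lmult[symmetric]) (use thR mR x l in auto)
   also have "(\<Oplus>g\<in>S. th g x ** m g) = \<ominus> (th h x ** m h)"
    by (rule neg[OF x c(1)])
   also have "(\<Oplus>g\<in>S. th g (l ** x) ** m g) = \<ominus> (th h (l ** x) ** m h)"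
    by (rule neg[OF L(2)[OF l x] c(2)])
   also have "th h (l ** x) ** m h = th h l ** (th h x ** m h)"
    using insert.prems(2)[of h l x] l x thR mR by (simp add: m_assoc)
   finally show "(\<Oplus>g\<in>S. th g x ** ?m g) = \<zero>"
    using thR mR x l by (simp add: r_minus a_minus_def l_neg)
  qed (use insert.prems(1-4) mR thR l in auto)
  then show ?thesis using g by blast
 qed
 have mS: "m g = \<zero>" if g: "g : S" for g
 proof -
  obtain l where l: "l : L" "th g l ~= th h l" using insert.prems(4)[of g h] g insert.hyps by blast
  let ?d = "th g l \<ominus> th h l"
  have "?d ~= \<zero>" using l thR g by simp
  moreover have "?d \<in> K" using thK g l Ks by (simp add: a_minus_def)
  ultimately have "?d \<in> K - {\<zero>}" by simp
  note inv = subfield_m_inv[OF K this]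
  have "m g = (inv ?d ** ?d) ** m g" using inv mR g by simp
  also have "... = inv ?d ** (?d ** m g)" by (rule m_assoc) (use inv Ks(1) mR g thR l in auto)
  finally show ?thesis using zero[OF g l(1)] inv Ks(1) by auto
 qed
 have "(\<Oplus>g\<in>S. th g \<one> ** m g) = \<zero>"
  by (rule add.finprod_one_eqI) (use mS thR L in auto)
 then have "m h = \<zero>"
  using insert.prems(3)[of h] insert.prems(6)[OF L(1)] sum_insert[OF L(1)] mR by simp
 then show ?case using mS by blast
qed simp

text \<open>Elimination of one unknown with the help of one equation.\<close>

lemma underdetermined_system:
 assumes K: "subfield K R" and "finite I" "finite J" "card I < card J"
  and a: "!!i j. i \<in> I ==> j : J ==> a i j \<in> K"
 shows "\<exists>y \<in> J \<rightarrow> K. (\<exists>j\<in>J. y j ~= \<zero>) \<and> (\<forall>i\<in>I. (\<Oplus>j\<in>J. a i j ** y j) = \<zero>)"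
 using assms(2-)
proof (induction I arbitrary: J a rule: finite_induct)
 case empty
 then have "J ~= {}" by auto
 then show ?case
  using subfieldE(6)[OF K] subringE(3)[OF subfieldE(1)[OF K]] by (intro bexI[of _ "%_. \<one>"]) auto
next
 case (insert i I)
 note Ks = subringE[OF subfieldE(1)[OF K]]
 have KR: "!!k. k \<in> K ==> k : carrier R" using Ks(1) by blast
 show ?case
 proof (cases "\<forall>j\<in>J. a i j = \<zero>")
  case True
  obtain y where y: "y : J \<rightarrow> K" "\<exists>j\<in>J. y j ~= \<zero>" "\<forall>i\<in>I. (\<Oplus>j\<in>J. a i j ** y j) = \<zero>"
   using insert.IH[of J a] insert.hyps insert.prems by auto
  have "(\<Oplus>j\<in>J. a i j ** y j) = \<zero>"
   by (rule add.finprod_one_eqI) (use True y KR in \<open>auto simp: Pi_def\<close>)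
  then show ?thesis using y by blast
 next
  case False
  then obtain h where h: "h : J" "a i h ~= \<zero>" by blast
  let ?J = "J - {h}" and ?c = "inv (a i h)"
  have aK: "!!p q. p \<in> insert i I ==> q : J ==> a p q \<in> K" by fact
  have aR: "!!p q. p \<in> insert i I ==> q : J ==> a p q \<in> carrier R" using aK KR by blast
  have "a i h \<in> K - {\<zero>}" using aK h by simp
  note inv = subfield_m_inv[OF K this]
  have cR: "?c \<in> carrier R" using inv KR by auto
  have "finite ?J" "card I < card ?J" using insert.prems h insert.hyps by auto
  moreover have "a p q \<ominus> a p h ** ?c ** a i q \<in> K" if "p : I" "q : ?J" for p q
   using aK[of p q] aK[of p h] aK[of i q] that h inv Ks by (auto simp: a_minus_def)
  ultimately obtain y where y: "y : ?J \<rightarrow> K" "\<exists>j\<in>?J. y j ~= \<zero>"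
   "\<forall>p\<in>I. (\<Oplus>q\<in>?J. (a p q \<ominus> a p h ** ?c ** a i q) ** y q) = \<zero>"
   using insert.IH[of ?J "%p q. a p q \<ominus> a p h ** ?c ** a i q"] by blast
  have yR: "!!q. q \<in> ?J ==> y q \<in> carrier R" using y KR by blast
  define s where "s p = (\<Oplus>q\<in>?J. a p q ** y q)" for p
  have sK: "s p \<in> K" if "p : insert i I" for p
   unfolding s_def by (rule finsum_in_subring[OF subfieldE(1)[OF K]]) (use funcset_mem[OF y(1)] aK Ks(6) that in auto)
  have sR: "s p \<in> carrier R" if "p : insert i I" for p using sK KR that by blast
  let ?y = "y(h := \<ominus> (?c ** s i))"
  have eq: "J = insert h ?J" using h by auto
  have sum: "(\<Oplus>q\<in>J. a p q ** ?y q) = a p h ** (\<ominus> (?c ** s i)) \<oplus> s p" if p: "p : insert i I" for p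
  proof -
   have "(\<Oplus>q\<in>?J. a p q ** ?y q) = s p"
    unfolding s_def by (rule finsum_cong') (use p aR yR in auto)
   moreover have "(\<Oplus>q\<in>J. a p q ** ?y q) = (\<Oplus>q\<in>insert h ?J. a p q ** ?y q)"
    using eq by simp
   ultimately show ?thesis
    using insert.prems p aR[OF p] yR h cR sR by (subst (asm) finsum_insert) auto
  qed
  show ?thesis
  proof (intro bexI[of _ ?y] conjI ballI)
   show "\<exists>j\<in>J. ?y j ~= \<zero>" using y(2) by (metis Diff_iff fun_upd_apply insertCI)
   show "?y \<in> J \<rightarrow> K" using y(1) inv sK[of i] Ks by (simp add: Pi_def)
   fix p assume p: "p : insert i I"
   show "(\<Oplus>q\<in>J. a p q ** ?y q) = \<zero>"
   proof (cases "p = i")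
    case True
    have "a i h ** (\<ominus> (?c ** s i)) = \<ominus> ((a i h ** ?c) ** s i)"
     using aR[of i h] h cR sR[of i] by (simp add: r_minus m_assoc)
    then show ?thesis using sum[OF p] True inv sR[of i] by (simp add: l_neg)
   next
    case False
    then have pI: "p : I" using p by simp
    have "(\<Oplus>q\<in>?J. (a p q \<ominus> a p h ** ?c ** a i q) ** y q)
      = (\<Oplus>q\<in>?J. a p q ** y q \<ominus> a p h ** ?c ** (a i q ** y q))"
     by (rule finsum_cong')
      (use aR pI yR cR h in \<open>auto simp: a_minus_def l_distr l_minus m_assoc\<close>)
    also have "... = s p \<ominus> (\<Oplus>q\<in>?J. a p h ** ?c ** (a i q ** y q))"
     unfolding s_def by (rule finsum_minus) (use aR pI yR cR h in auto)
    also have "(\<Oplus>q\<in>?J. a p h ** ?c ** (a i q ** y q)) = a p h ** ?c ** s i"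
     unfolding s_def by (rule finsum_lmult[symmetric]) (use aR pI yR cR h in auto)
    finally have "s p \<ominus> a p h ** ?c ** s i = \<zero>" using y(3) pI by simp
    then show ?thesis
     using sum[OF p] aR[OF p] h cR sR[of i] sR[OF p]
     by (simp add: a_minus_def r_minus m_assoc a_comm)
   qed
  qed
 qed
qed

end

section \<open>Galois theory\<close>

context ring
begin

lemma lin_indepD:
 assumes "lin_indep K I w" "k : I \<rightarrow> K" "(\<Oplus>i\<in>I. k i ** w i) = \<zero>" "i : I"
 shows "k i = \<zero>"
 using assms(4) bspec[OF assms(1)[unfolded lin_indep_def] assms(2)] assms(3) by simp

lemma gal_memD:
 assumes "s : carrier (galois_group R K F)"
 shows "x : K ==> s x \<in> K"
  "x : K ==> y : K ==> s (x ** y) = s x ** s y"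
  "x : K ==> y : K ==> s (x \<oplus> y) = s x \<oplus> s y"
  "s \<one> = \<one>" "x : F ==> s x = x" "s : extensional K" "bij_betw s K K"
proof -
 have s: "s : ring_iso (sub R K) (sub R K)" using assms unfolding galois_group_def by simp
 show "x : K ==> s x \<in> K" "x : K ==> y : K ==> s (x ** y) = s x ** s y"
  "x : K ==> y : K ==> s (x \<oplus> y) = s x \<oplus> s y" "s \<one> = \<one>" "bij_betw s K K"
  using ring_iso_memE[OF s] by auto
 show "x : F ==> s x = x" "s : extensional K" using assms unfolding galois_group_def by auto
qed

lemma gal_memI:
 assumes "s : extensional K" "!!x. x \<in> K ==> s x \<in> K"
  "!!x y. x \<in> K ==> y : K ==> s (x ** y) = s x ** s y"
  "!!x y. x \<in> K ==> y : K ==> s (x \<oplus> y) = s x \<oplus> s y"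
  "s \<one> = \<one>" "!!x. x \<in> F ==> s x = x" "bij_betw s K K"
 shows "s : carrier (galois_group R K F)"
 unfolding galois_group_def using assms by (auto intro!: ring_iso_memI)

lemma galois_group_simps:
 "g \<otimes>\<^bsub>galois_group R K F\<^esub> h = compose K h g" "\<one>\<^bsub>galois_group R K F\<^esub> = (\<lambda>x\<in>K. x)"
 unfolding galois_group_def by simp_all

lemma galois_group_is_group:
 assumes K: "subring K R" and FK: "F <= K"
 shows "group (galois_group R K F)"
proof (rule groupI)
 fix g h assume g: "g : carrier (galois_group R K F)" and h: "h : carrier (galois_group R K F)"
 note g' = gal_memD[OF g] and h' = gal_memD[OF h] and Ks = subringE[OF K]
 show "g \<otimes>\<^bsub>galois_group R K F\<^esub> h \<in> carrier (galois_group R K F)"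
  unfolding galois_group_simps
 proof (rule gal_memI)
  show "bij_betw (compose K h g) K K" using bij_betw_trans[OF g'(7) h'(7)] bij_betw_cong[of K "compose K h g" "h \<circ> g"]
   by (simp add: compose_eq)
 qed (use g' h' Ks FK in \<open>auto simp: compose_eq subset_iff\<close>)
next
 show "\<one>\<^bsub>galois_group R K F\<^esub> \<in> carrier (galois_group R K F)"
  unfolding galois_group_simps
 proof (rule gal_memI)
  show "bij_betw (\<lambda>x\<in>K. x) K K" using bij_betw_cong[of K "\<lambda>x\<in>K. x" id] by auto
 qed (use FK subringE[OF K] in auto)
next
 fix g h x
 assume "g : carrier (galois_group R K F)" "h : carrier (galois_group R K F)" "x : carrier (galois_group R K F)"
 then show "g \<otimes>\<^bsub>galois_group R K F\<^esub> h \<otimes>\<^bsub>galois_group R K F\<^esub> x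
   = g \<otimes>\<^bsub>galois_group R K F\<^esub> (h \<otimes>\<^bsub>galois_group R K F\<^esub> x)"
  unfolding galois_group_simps using gal_memD(1) by (auto simp: compose_def fun_eq_iff restrict_def)
next
 fix g assume g: "g : carrier (galois_group R K F)"
 then show "\<one>\<^bsub>galois_group R K F\<^esub> \<otimes>\<^bsub>galois_group R K F\<^esub> g = g"
  unfolding galois_group_simps using gal_memD(6)[OF g]
  by (auto simp: compose_def fun_eq_iff restrict_def extensional_def)
next
 fix g assume g: "g : carrier (galois_group R K F)"
 note g' = gal_memD[OF g] and Ks = subringE[OF K]
 define h where "h = restrict (inv_into K g) K"
 have hK: "h x \<in> K" if "x : K" for x
  unfolding h_def using that g'(7) by (simp add: bij_betw_def inv_into_into)
 have gh: "g (h x) = x" if "x : K" for x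
  unfolding h_def using that g'(7) by (simp add: bij_betw_def f_inv_into_f)
 have hg: "h (g x) = x" if "x : K" for x
  unfolding h_def using that g'(1,7) by (simp add: bij_betw_def)
 have h: "h : carrier (galois_group R K F)"
 proof (rule gal_memI)
  show "h : extensional K" unfolding h_def by simp
  fix x y assume xy: "x : K" "y : K"
  show "h (x ** y) = h x ** h y"
   using hg[of "h x ** h y"] g'(2)[of "h x" "h y"] gh hK xy Ks by simp
  show "h (x \<oplus> y) = h x \<oplus> h y"
   using hg[of "h x \<oplus> h y"] g'(3)[of "h x" "h y"] gh hK xy Ks by simp
 next
  show "h \<one> = \<one>" using hg[of \<one>] g'(4) Ks by simp
  show "h x = x" if "x : F" for x using hg[of x] g'(5) FK that by auto
  show "bij_betw h K K" by (rule bij_betwI[where g = g]) (use hK g'(1) gh hg in auto)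
 qed (use hK in auto)
 moreover have "h \<otimes>\<^bsub>galois_group R K F\<^esub> g = \<one>\<^bsub>galois_group R K F\<^esub>"
  unfolding galois_group_simps using gh by (auto simp: compose_def fun_eq_iff restrict_def)
 ultimately show "\<exists>h\<in>carrier (galois_group R K F). h \<otimes>\<^bsub>galois_group R K F\<^esub> g = \<one>\<^bsub>galois_group R K F\<^esub>"
  by blast
qed

lemma gal_inverse:
 assumes K: "subring K R" and FK: "F <= K" and g: "g : carrier (galois_group R K F)"
 shows "\<exists>h \<in> carrier (galois_group R K F). \<forall>x\<in>K. h (g x) = x \<and> g (h x) = x"
proof -
 interpret G: group "galois_group R K F" by (rule galois_group_is_group[OF K FK])
 obtain h where h: "h : carrier (galois_group R K F)" "h \<otimes>\<^bsub>galois_group R K F\<^esub> g = \<one>\<^bsub>galois_group R K F\<^esub>"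
  using G.l_inv_ex[OF g] by blast
 have 2: "g \<otimes>\<^bsub>galois_group R K F\<^esub> h = \<one>\<^bsub>galois_group R K F\<^esub>"
  using G.inv_comm[OF h(2,1) g] by simp
 have "g (h x) = x" "h (g x) = x" if "x : K" for x
  using fun_cong[OF h(2)[unfolded galois_group_simps], of x]
   fun_cong[OF 2[unfolded galois_group_simps], of x] that by (auto simp: compose_eq)
 with h(1) show ?thesis by blast
qed

text \<open>More than \<open>[L:F]\<close> embeddings would satisfy a linear relation on a basis, hence on \<open>L\<close>, against Dedekind.\<close>

lemma embeddings_card_le:
 assumes F: "subfield F R" and L: "subfield L R" "F <= L" and K: "subfield K R"
  and d: "dimension d F L" and S: "finite S"
  and emb: "!!g l. g \<in> S ==> l : L ==> g l \<in> K"
   "!!g l l'. g \<in> S ==> l : L ==> l' : L ==> g (l ** l') = g l ** g l'"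
   "!!g l l'. g \<in> S ==> l : L ==> l' : L ==> g (l \<oplus> l') = g l \<oplus> g l'"
   "!!g. g \<in> S ==> g \<one> = \<one>" "!!g c. g \<in> S ==> c : F ==> g c = c"
   "!!g h. g \<in> S ==> h : S ==> g ~= h ==> \<exists>l\<in>L. g l ~= h l"
 shows "card S \<le> d"
proof (rule ccontr)
 assume "\<not> card S \<le> d"
 note Ls = subringE[OF subfieldE(1)[OF L(1)]] and Ks = subringE[OF subfieldE(1)[OF K]]
  and Fs = subringE[OF subfieldE(1)[OF F]]
 obtain w where w: "w : {1..d} \<rightarrow> L" "lin_indep F {1..d} w" "lin_span F {1..d} w = L"
  using dimension_basis[OF F d] by blast
 have wL: "!!i. i \<in> {1..d} ==> w i \<in> L" using funcset_mem[OF w(1)] .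
 have "\<exists>y \<in> S \<rightarrow> K. (\<exists>g\<in>S. y g ~= \<zero>) \<and> (\<forall>i\<in>{1..d}. (\<Oplus>g\<in>S. g (w i) ** y g) = \<zero>)"
  by (rule underdetermined_system[OF K]) (use S \<open>\<not> card S \<le> d\<close> emb(1) wL in auto)
 then obtain y where y: "y : S \<rightarrow> K" "\<exists>g\<in>S. y g ~= \<zero>"
  "!!i. i \<in> {1..d} ==> (\<Oplus>g\<in>S. g (w i) ** y g) = \<zero>" by blast
 have yR: "!!g. g \<in> S ==> y g \<in> carrier R" using funcset_mem[OF y(1)] Ks(1) by blast
 have gR: "!!g l. g \<in> S ==> l : L ==> g l \<in> carrier R" using emb(1) Ks(1) by blast
 have "\<forall>g\<in>S. y g = \<zero>"
 proof (rule characters_independent[OF K S, where L = L])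
  fix l assume "l : L"
  then obtain k where k: "k : {1..d} \<rightarrow> F" "l = (\<Oplus>i\<in>{1..d}. k i ** w i)"
   using w(3) lin_spanE by metis
  have kF: "!!i. i \<in> {1..d} ==> k i \<in> F" using funcset_mem[OF k(1)] .
  have kR: "!!i. i \<in> {1..d} ==> k i \<in> carrier R" using kF Fs(1) by blast
  have kL: "!!i. i \<in> {1..d} ==> k i \<in> L" using kF L(2) by blast
  have gl: "g l = (\<Oplus>i\<in>{1..d}. k i ** g (w i))" if g: "g : S" for g
  proof -
   have "g l = (\<Oplus>i\<in>{1..d}. g (k i ** w i))"
    unfolding k(2)
   proof (rule finsum_additive(2)[where S = L and h = g])
    show "g \<zero> = \<zero>"
     by (rule additive_zero[where V = L and R = R and R' = R])
      (use ring_axioms Ls(1,2) gR[OF g] emb(3)[OF g] in auto)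
    show "k i ** w i \<in> L" if "i : {1..d}" for i using that kL wL Ls(6) by blast
   qed (use abelian_monoid_axioms Ls(1,2,7) gR[OF g] emb(3)[OF g] in auto)
   also have "... = (\<Oplus>i\<in>{1..d}. k i ** g (w i))"
   proof (rule finsum_cong')
    fix i assume i: "i : {1..d}"
    show "g (k i ** w i) = k i ** g (w i)"
     using emb(2)[OF g kL[OF i] wL[OF i]] emb(5)[OF g kF[OF i]] by simp
   qed (use kR gR[OF g] wL in auto)
   finally show ?thesis .
  qed
  have "(\<Oplus>g\<in>S. g l ** y g) = (\<Oplus>g\<in>S. \<Oplus>i\<in>{1..d}. k i ** (g (w i) ** y g))"
  proof (rule finsum_cong')
   fix g assume g: "g : S"
   have "g l ** y g = (\<Oplus>i\<in>{1..d}. k i ** g (w i) ** y g)"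
    unfolding gl[OF g] by (rule finsum_rmult) (use kR gR g wL yR in auto)
   also have "... = (\<Oplus>i\<in>{1..d}. k i ** (g (w i) ** y g))"
    by (rule finsum_cong') (use kR gR g wL yR in \<open>auto simp: m_assoc simp del: atLeastAtMost_iff\<close>)
   finally show "g l ** y g = (\<Oplus>i\<in>{1..d}. k i ** (g (w i) ** y g))" .
  qed (use kR gR wL yR in \<open>auto intro!: finsum_closed\<close>)
  also have "... = (\<Oplus>i\<in>{1..d}. \<Oplus>g\<in>S. k i ** (g (w i) ** y g))"
   by (rule finsum_swap) (use S kR gR wL yR in auto)
  also have "... = \<zero>"
  proof (rule add.finprod_one_eqI)
   fix i assume i: "i : {1..d}"
   have "(\<Oplus>g\<in>S. k i ** (g (w i) ** y g)) = k i ** (\<Oplus>g\<in>S. g (w i) ** y g)"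
    by (rule finsum_lmult[symmetric]) (use kR gR wL yR i in auto)
   then show "(\<Oplus>g\<in>S. k i ** (g (w i) ** y g)) = \<zero>" using y(3)[OF i] kR[OF i] by simp
  qed
  finally show "(\<Oplus>g\<in>S. g l ** y g) = \<zero>" .
 next
  show "y : S \<rightarrow> carrier R" using yR by blast
 qed (use emb(1,2,4,6) Ls(3,6) in blast)+
 then show False using y(2) by blast
qed

lemma gal_distinct:
 assumes "g : carrier (galois_group R K F)" "h : carrier (galois_group R K F)" "g ~= h"
 shows "\<exists>x\<in>K. g x ~= h x"
 using assms gal_memD(6) extensionalityI by metis

lemma galois_group_finite:
 assumes "subfield F R" "subfield K R" "F <= K" "dimension m F K"
 shows "finite (carrier (galois_group R K F))" "card (carrier (galois_group R K F)) \<le> m"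
proof -
 have "finite (carrier (galois_group R K F)) \<and> card (carrier (galois_group R K F)) \<le> m"
 proof (rule finite_if_finite_subsets_card_bdd)
  fix S assume S: "S <= carrier (galois_group R K F)" "finite S"
  note mem = gal_memD[OF subsetD[OF S(1)]]
  show "card S \<le> m"
  proof (rule embeddings_card_le[OF assms(1,2,3,2,4) S(2)])
   show "\<exists>l\<in>K. g l ~= h l" if "g : S" "h : S" "g ~= h" for g h
    using gal_distinct that S(1) by blast
  qed (rule mem, assumption+)+
 qed
 then show "finite (carrier (galois_group R K F))" "card (carrier (galois_group R K F)) \<le> m" by auto
qed

text \<open>Artin's theorem. If there were more basis elements than automorphisms, elimination would give a
 nonzero \<open>y\<close> orthogonal to all conjugates of the basis. Then \<open>\<Sum> tr (c y\<^sub>i) w\<^sub>i = 0\<close> for all \<open>c\<close>, so the trace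
 vanishes on \<open>K\<close>, against Dedekind.\<close>

lemma galois_degree:
 assumes gal: "galois_extension R K F" and m: "dimension m F K"
 shows "card (carrier (galois_group R K F)) = m"
proof -
 let ?G = "carrier (galois_group R K F)"
 have F: "subfield F R" and K: "subfield K R" and FK: "F <= K"
  and fix_F: "{x \<in> K. \<forall>s\<in>?G. s x = x} = F"
  using gal unfolding galois_extension_def by auto
 note fin = galois_group_finite[OF F K FK m] and Ks = subringE[OF subfieldE(1)[OF K]]
 interpret G: group "galois_group R K F" by (rule galois_group_is_group[OF subfieldE(1)[OF K] FK])
 have "m \<le> card ?G"
 proof (rule ccontr)
  assume "\<not> m \<le> card ?G"
  obtain w where w: "w : {1..m} \<rightarrow> K" "lin_indep F {1..m} w" "lin_span F {1..m} w = K"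
   using dimension_basis[OF F m] by blast
  have wK: "!!i. i \<in> {1..m} ==> w i \<in> K" using funcset_mem[OF w(1)] .
  have "\<exists>y \<in> {1..m} \<rightarrow> K. (\<exists>i\<in>{1..m}. y i ~= \<zero>) \<and> (\<forall>g\<in>?G. (\<Oplus>i\<in>{1..m}. g (w i) ** y i) = \<zero>)"
   by (rule underdetermined_system[OF K])
    (use fin \<open>\<not> m \<le> card ?G\<close> gal_memD(1)[of _ K F] wK in auto)
  then obtain y i where y: "y : {1..m} \<rightarrow> K" "i : {1..m}" "y i ~= \<zero>"
   "!!g. g \<in> ?G ==> (\<Oplus>i\<in>{1..m}. g (w i) ** y i) = \<zero>" by blast
  have yK: "!!i. i \<in> {1..m} ==> y i \<in> K" using funcset_mem[OF y(1)] .
  have KR: "!!x. x \<in> K ==> x : carrier R" using Ks(1) by blast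
  have gK: "!!g x. g \<in> ?G ==> x : K ==> g x \<in> K" using gal_memD(1) by blast
  have gR: "!!g x. g \<in> ?G ==> x : K ==> g x \<in> carrier R" using gK KR by blast
  define tr where "tr x = (\<Oplus>g\<in>?G. g x)" for x
  have g0: "g \<zero> = \<zero>" if "g : ?G" for g
   by (rule additive_zero[where V = K and R = R and R' = R])
    (use ring_axioms Ks gR[OF that] gal_memD(3)[OF that] in auto)
  have g_sum: "g (\<Oplus>i\<in>I. f i) = (\<Oplus>i\<in>I. g (f i))" if g: "g : ?G" and f: "!!i. i \<in> I ==> f i \<in> K"
   for g I and f :: "'i \<Rightarrow> 'a"
   by (rule finsum_additive(2)[where S = K])
    (use abelian_monoid_axioms Ks gR[OF g] gal_memD(3)[OF g] g0[OF g] f in auto)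
  have g_sum': "g (\<Oplus>i\<in>I. f i) = (\<Oplus>i\<in>I. g (f i))" if g: "g : ?G" and f: "!!i. i \<in> I ==> f i \<in> K"
   for g I and f :: "('a \<Rightarrow> 'a) \<Rightarrow> 'a"
   by (rule finsum_additive(2)[where S = K])
    (use abelian_monoid_axioms Ks gR[OF g] gal_memD(3)[OF g] g0[OF g] f in auto)
  have trF: "tr x \<in> F" if x: "x : K" for x
  proof -
   have "tr x \<in> {x \<in> K. \<forall>s\<in>?G. s x = x}"
  proof (intro CollectI conjI ballI)
   show "tr x \<in> K" unfolding tr_def
    by (rule finsum_in_subring[OF subfieldE(1)[OF K]]) (rule gK[OF _ x])
   fix h assume h: "h : ?G"
   have "h (tr x) = (\<Oplus>g\<in>?G. h (g x))" unfolding tr_def by (rule g_sum'[OF h]) (rule gK[OF _ x])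
   also have "... = (\<Oplus>g\<in>?G. (g \<otimes>\<^bsub>galois_group R K F\<^esub> h) x)"
    by (rule finsum_cong') (use gR h x gK in \<open>auto simp: galois_group_simps compose_eq\<close>)
   also have "... = (\<Oplus>k\<in>(%g. g \<otimes>\<^bsub>galois_group R K F\<^esub> h) ` ?G. k x)"
    by (rule finsum_reindex[symmetric, where f = "%k. k x"])
     (use gR x G.m_closed h G.inj_on_cmult in \<open>auto simp: inj_on_def\<close>)
   also have "(%g. g \<otimes>\<^bsub>galois_group R K F\<^esub> h) ` ?G = ?G"
    using G.surj_const_mult[OF h] G.surj_const_mult
   proof -
    have "g : (%g. g \<otimes>\<^bsub>galois_group R K F\<^esub> h) ` ?G" if "g : ?G" for g
     using that h G.inv_solve_right[of g "g \<otimes>\<^bsub>galois_group R K F\<^esub> inv\<^bsub>galois_group R K F\<^esub> h" h]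
     by (intro image_eqI[of _ _ "g \<otimes>\<^bsub>galois_group R K F\<^esub> inv\<^bsub>galois_group R K F\<^esub> h"])
      (auto simp: G.m_assoc)
    then show ?thesis using h by auto
   qed
   finally show "h (tr x) = tr x" unfolding tr_def .
  qed
   then show ?thesis using fix_F by simp
  qed
  have tr_y: "tr (c ** y i) = \<zero>" if c: "c : K" and i: "i : {1..m}" for c i
  proof -
   have FR: "!!x. x \<in> F ==> x : carrier R" using FK KR by blast
   have cy: "!!i. i \<in> {1..m} ==> c ** y i \<in> K" using c yK Ks by simp
   have "(\<Oplus>i\<in>{1..m}. tr (c ** y i) ** w i) = (\<Oplus>i\<in>{1..m}. \<Oplus>g\<in>?G. g (c ** y i) ** w i)"
   proof (rule finsum_cong')
    fix i assume i: "i : {1..m}"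
    show "tr (c ** y i) ** w i = (\<Oplus>g\<in>?G. g (c ** y i) ** w i)"
     unfolding tr_def by (rule finsum_rmult) (use KR wK gR cy i in auto)
   qed (use KR wK gR cy in \<open>auto intro!: finsum_closed\<close>)
   also have "... = (\<Oplus>g\<in>?G. \<Oplus>i\<in>{1..m}. g (c ** y i) ** w i)"
    by (rule finsum_swap) (use fin KR wK gR cy in auto)
   also have "... = \<zero>"
   proof (rule add.finprod_one_eqI)
    fix g assume g: "g : ?G"
    obtain h where h: "h : ?G" "!!x. x \<in> K ==> h (g x) = x" "!!x. x \<in> K ==> g (h x) = x"
     using gal_inverse[OF subfieldE(1)[OF K] FK g] by blast
    have hw: "!!i. i \<in> {1..m} ==> h (w i) \<in> K" using gK[OF h(1)] wK by blast
    have "(\<Oplus>i\<in>{1..m}. g (c ** y i) ** w i) = (\<Oplus>i\<in>{1..m}. g (c ** (h (w i) ** y i)))"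
    proof (rule finsum_cong')
     fix i assume i: "i : {1..m}"
     have "g (c ** (h (w i) ** y i)) = g ((c ** y i) ** h (w i))"
      using subfieldE(4)[OF K hw[OF i] yK[OF i]] KR[OF hw[OF i]] KR[OF yK[OF i]] KR[OF c] by (simp add: m_assoc)
     also have "... = g (c ** y i) ** w i"
      using gal_memD(2)[OF g cy[OF i] hw[OF i]] h(3)[OF wK[OF i]] by simp
     finally show "g (c ** y i) ** w i = g (c ** (h (w i) ** y i))" by simp
    next
     show "(%i. g (c ** (h (w i) ** y i))) \<in> {1..m} \<rightarrow> carrier R"
     proof (rule Pi_I)
      fix i assume i: "i : {1..m}"
      show "g (c ** (h (w i) ** y i)) \<in> carrier R"
       by (rule gR[OF g]) (intro Ks(6) c hw[OF i] yK[OF i])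
     qed
    qed simp
    also have "... = g (\<Oplus>i\<in>{1..m}. c ** (h (w i) ** y i))"
     by (rule g_sum[OF g, symmetric]) (intro Ks(6) c hw yK)
    also have "(\<Oplus>i\<in>{1..m}. c ** (h (w i) ** y i)) = c ** (\<Oplus>i\<in>{1..m}. h (w i) ** y i)"
     by (rule finsum_lmult[symmetric]) (intro m_closed KR c hw yK, assumption?)+
    finally show "(\<Oplus>i\<in>{1..m}. g (c ** y i) ** w i) = \<zero>"
     using y(4)[OF h(1)] KR[OF c] g0[OF g] by simp
   qed
   finally have z: "(\<Oplus>i\<in>{1..m}. tr (c ** y i) ** w i) = \<zero>" .
   have "(%i. tr (c ** y i)) \<in> {1..m} \<rightarrow> F" using trF cy by blast
   from lin_indepD[OF w(2) this z i] show ?thesis .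
  qed
  have "\<forall>g\<in>?G. \<one> = \<zero>"
  proof (rule characters_independent[OF K fin(1), where L = K and th = "%g. g"])
   fix x assume x: "x : K"
   have "y i \<in> K - {\<zero>}" using y(3) yK[OF y(2)] by simp
   note inv = subfield_m_inv[OF K this]
   have "x = (x ** inv (y i)) ** y i" using inv x yK[OF y(2)] KR by (simp add: m_assoc)
   then have "tr x = \<zero>" using tr_y[OF _ y(2), of "x ** inv (y i)"] inv x Ks by auto
   moreover have "(\<Oplus>g\<in>?G. g x ** \<one>) = tr x"
    unfolding tr_def by (rule finsum_cong') (use gR x in auto)
   ultimately show "(\<Oplus>g\<in>?G. g x ** \<one>) = \<zero>" by simp
  next
   show "\<exists>l\<in>K. g l ~= h l" if "g : ?G" "h : ?G" "g ~= h" for g h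
    by (rule gal_distinct[OF that])
  qed (use gal_memD(1,2,4)[of _ K F] Ks(3,6) in blast)+
  then show False using subfieldE(6)[OF K] G.one_closed by blast
 qed
 with fin(2) show ?thesis by simp
qed

lemma subfield_in_subfieldI:
 assumes K: "subfield K R" and L: "subring L R" "L <= K"
  and inv: "!!x. x \<in> L ==> x ~= \<zero> ==> inv x \<in> L"
 shows "subfield L R"
proof (rule subfieldI)
 show "subcring L R" using subfieldE(4)[OF K] L by (intro subcringI) auto
 interpret L: ring "sub R L" by (rule subring_is_ring[OF L(1)])
 show "Units (R\<lparr>carrier := L\<rparr>) = L - {\<zero>}"
 proof (intro equalityI subsetI)
  fix x assume "x : Units (sub R L)"
  then obtain y where xy: "x : L" "y : L" "y ** x = \<one>" unfolding Units_def by auto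
  have "y : carrier R" using xy subringE(1)[OF L(1)] by blast
  then have "x ~= \<zero>" using xy subfieldE(6)[OF K] by auto
  then show "x : L - {\<zero>}" using xy by simp
 next
  fix x assume x: "x : L - {\<zero>}"
  then have "x : K - {\<zero>}" using L(2) by blast
  note i = subfield_m_inv[OF K this]
  have "inv x \<in> L" using inv x by simp
  then show "x : Units (sub R L)" unfolding Units_def using x i by auto
 qed
qed

lemma gal_inv:
 assumes K: "subfield K R" and s: "s : carrier (galois_group R K F)"
 shows "s \<zero> = \<zero>" "x : K ==> s (\<ominus> x) = \<ominus> s x"
  "x : K ==> x ~= \<zero> ==> s (inv x) = inv (s x)" "x : K ==> s x = \<zero> ==> x = \<zero>"
proof -
 note Ks = subringE[OF subfieldE(1)[OF K]] and s' = gal_memD[OF s]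
 have KR: "!!x. x \<in> K ==> x : carrier R" using Ks(1) by blast
 show z: "s \<zero> = \<zero>"
  by (rule additive_zero[where V = K and R = R and R' = R]) (use ring_axioms Ks(1,2) KR s'(1,3) in auto)
 show "s (\<ominus> x) = \<ominus> s x" if x: "x : K"
 proof -
  have "s (\<ominus> x) \<oplus> s x = s (\<ominus> x \<oplus> x)" using s'(3)[of "\<ominus> x" x] x Ks(5) by simp
  also have "\<ominus> x \<oplus> x = \<zero>" using KR[OF x] by (simp add: l_neg)
  finally have "s (\<ominus> x) \<oplus> s x = \<zero>" using z by simp
  then show ?thesis using KR[OF s'(1)[OF x]] KR[OF s'(1)[OF Ks(5)[OF x]]] by (simp add: minus_equality)
 qed
 show 0: "x = \<zero>" if "x : K" "s x = \<zero>" for x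
  using s'(7) that z Ks(2) unfolding bij_betw_def inj_on_def by auto
 show "s (inv x) = inv (s x)" if x: "x : K" "x ~= \<zero>"
 proof -
  have "x : K - {\<zero>}" using x by simp
  note i = subfield_m_inv[OF K this]
  have "s (inv x) ** s x = \<one>" using s'(2)[of "inv x" x] i x s'(4) by simp
  moreover have "s x ** s (inv x) = \<one>" using s'(2)[of x "inv x"] i x s'(4) by simp
  ultimately show ?thesis
   using KR[OF s'(1)[OF x(1)]] KR[OF s'(1), of "inv x"] i(1) by (intro inv_char[symmetric] sym[OF inv_char]) auto
 qed
qed

lemma fixed_field_subfield:
 assumes K: "subfield K R" and H: "H <= carrier (galois_group R K F)"
 shows "subfield {x \<in> K. \<forall>s\<in>H. s x = x} R"
proof (rule subfield_in_subfieldI[OF K])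
 note Ks = subringE[OF subfieldE(1)[OF K]] and mem = gal_memD[OF subsetD[OF H]] and mem' = gal_inv[OF K subsetD[OF H]]
 show "subring {x \<in> K. \<forall>s\<in>H. s x = x} R"
 proof (rule subringI)
  show "{x \<in> K. \<forall>s\<in>H. s x = x} <= carrier R" using Ks(1) by blast
  show "\<one> \<in> {x \<in> K. \<forall>s\<in>H. s x = x}" using Ks(3) mem(4) by blast
  fix x assume x: "x : {x \<in> K. \<forall>s\<in>H. s x = x}"
  show "\<ominus> x \<in> {x \<in> K. \<forall>s\<in>H. s x = x}"
  proof (intro CollectI conjI ballI)
   fix s assume s: "s : H" show "s (\<ominus> x) = \<ominus> x" using mem'(2)[OF s, of x] x bspec[OF conjunct2[OF x[unfolded mem_Collect_eq]] s] by simp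
  qed (use x Ks(5) in simp)
  fix y assume y: "y : {x \<in> K. \<forall>s\<in>H. s x = x}"
  show "x ** y \<in> {x \<in> K. \<forall>s\<in>H. s x = x}"
  proof (intro CollectI conjI ballI)
   fix s assume s: "s : H" show "s (x ** y) = x ** y" using mem(2)[OF s, of x y] x y bspec[OF conjunct2[OF x[unfolded mem_Collect_eq]] s] bspec[OF conjunct2[OF y[unfolded mem_Collect_eq]] s] by simp
  qed (use x y Ks(6) in simp)
  show "x \<oplus> y \<in> {x \<in> K. \<forall>s\<in>H. s x = x}"
  proof (intro CollectI conjI ballI)
   fix s assume s: "s : H" show "s (x \<oplus> y) = x \<oplus> y" using mem(3)[OF s, of x y] x y bspec[OF conjunct2[OF x[unfolded mem_Collect_eq]] s] bspec[OF conjunct2[OF y[unfolded mem_Collect_eq]] s] by simp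
  qed (use x y Ks(7) in simp)
 qed
 show "inv x \<in> {x \<in> K. \<forall>s\<in>H. s x = x}" if "x : {x \<in> K. \<forall>s\<in>H. s x = x}" "x ~= \<zero>" for x
 proof (intro CollectI conjI ballI)
  fix s assume s: "s : H" show "s (inv x) = inv x" using mem'(3)[OF s, of x] that bspec[OF conjunct2[OF that(1)[unfolded mem_Collect_eq]] s] by simp
 qed (use that subfield_m_inv(1)[OF K, of x] in simp)
qed auto

text \<open>The correspondence between intermediate fields and subgroups, and the extension of
 embeddings. Both come from comparing three counts: the restrictions of the automorphisms to \<open>L\<close>
 are at most \<open>[L:F]\<close> by Dedekind, the fibres of restriction have the size of the group of \<open>L\<close>,
 and the degree over its fixed field is known by Artin.\<close>

lemma intermediate_field:
 assumes gal: "galois_extension R K F" and L: "subfield L R" "F <= L" "L <= K"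
  and d: "dimension d F L" and m: "dimension m F K"
 shows "galois_extension R K L"
  and "dimension (card (carrier (galois_group R K L))) L K"
  and "m = d * card (carrier (galois_group R K L))"
  and "t : carrier (galois_group R L F) ==> \<exists>g\<in>carrier (galois_group R K F). \<forall>x\<in>L. g x = t x"
proof -
 let ?G = "carrier (galois_group R K F)" and ?H = "carrier (galois_group R K L)"
 have F: "subfield F R" and K: "subfield K R" and FK: "F <= K"
  using gal unfolding galois_extension_def by auto
 note fin = galois_group_finite[OF F K FK m] and Ks = subringE[OF subfieldE(1)[OF K]]
  and Ls = subringE[OF subfieldE(1)[OF L(1)]]
 have G: "card ?G = m" by (rule galois_degree[OF gal m])
 interpret G: group "galois_group R K F" by (rule galois_group_is_group[OF subfieldE(1)[OF K] FK])
 have HG: "?H <= ?G" using L(2) unfolding galois_group_def by auto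
 have KR: "!!x. x \<in> K ==> x : carrier R" using Ks(1) by blast
 define L1 where "L1 = {x \<in> K. \<forall>s\<in>?H. s x = x}"
 have L1: "subfield L1 R" unfolding L1_def by (rule fixed_field_subfield[OF K HG])
 have LL1: "L <= L1" unfolding L1_def using L(3) gal_memD(5) by blast
 have L1K: "L1 <= K" unfolding L1_def by blast
 have HL1: "carrier (galois_group R K L1) = ?H"
  using LL1 unfolding L1_def galois_group_def by auto
 note L1s = subringE[OF subfieldE(1)[OF L1]]
 have FL1: "F <= L1" using L(2) LL1 by blast
 obtain d1 where d1: "dimension d1 F L1"
  by (rule subspace_dimension[OF F m L1K]) (use L1s FL1 in auto)
 obtain m2 where m2: "dimension m2 L1 K" "m = d1 * m2"
  by (rule dimension_over_intermediate[OF F L1 FL1 d1 m]) (use L1K Ks in auto)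
 have fixL1: "{x \<in> K. \<forall>s\<in>carrier (galois_group R K L1). s x = x} = L1"
  unfolding HL1 by (simp add: L1_def)
 have "galois_extension R K L1"
  unfolding galois_extension_def using L1 K L1K finite_dimensionI[OF m2(1)] fixL1 by blast
 from galois_degree[OF this m2(1)] have H: "card ?H = m2" unfolding HL1 .
 define S where "S = (%g. restrict g L) ` ?G"
 have S: "finite S" unfolding S_def using fin(1) by simp
 have Sf: "\<exists>g\<in>?G. f = restrict g L" if "f : S" for f using that unfolding S_def by blast
 have emb: "g l \<in> K" "g (l ** l') = g l ** g l'" "g (l \<oplus> l') = g l \<oplus> g l'" "g \<one> = \<one>" "c : F ==> g c = c" "g : extensional L"
  if mem: "g : S" "l : L" "l' : L" for g l l' c
 proof -
  obtain h where h: "h : ?G" "g = restrict h L" using Sf[OF mem(1)] by blast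
  note h' = gal_memD[OF h(1)]
  note lK = subsetD[OF L(3) mem(2)] subsetD[OF L(3) mem(3)] subsetD[OF L(2)]
  show "g l \<in> K" "g (l ** l') = g l ** g l'" "g (l \<oplus> l') = g l \<oplus> g l'" "g \<one> = \<one>" "c : F ==> g c = c" "g : extensional L"
   using h' mem(2,3) lK Ls(3,6,7) unfolding h(2) by auto
 qed
 have Sd: "card S \<le> d"
 proof (rule embeddings_card_le[OF F L(1,2) K d S])
  fix g h assume gh: "g : S" "h : S" "g ~= h"
  then show "\<exists>l\<in>L. g l ~= h l" using emb(6)[OF _ Ls(3) Ls(3)] extensionalityI by metis
 next
  show "!!g. g \<in> S ==> g \<one> = \<one>" by (rule emb(4)[OF _ Ls(3) Ls(3)])
  show "!!g c. g \<in> S ==> c : F ==> g c = c" by (rule emb(5)[OF _ Ls(3) Ls(3)])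
 qed (rule emb, assumption+)+
 have fiber: "card {g \<in> ?G. restrict g L = f} \<le> m2" if fS: "f : S" for f
 proof -
  obtain g0 where g0: "g0 : ?G" "f = restrict g0 L" using Sf[OF fS] by blast
  obtain h0 where h0: "h0 : ?G" "!!x. x \<in> K ==> h0 (g0 x) = x"
   using gal_inverse[OF subfieldE(1)[OF K] FK g0(1)] by blast
  let ?f = "%g. g \<otimes>\<^bsub>galois_group R K F\<^esub> h0"
  have "inj_on ?f {g \<in> ?G. restrict g L = f}"
   using h0(1) by (auto simp: inj_on_def)
  moreover have "?f ` {g \<in> ?G. restrict g L = f} <= ?H"
  proof
   fix k assume "k : ?f ` {g \<in> ?G. restrict g L = f}"
   then obtain g where g: "g : ?G" "restrict g L = f" "k = ?f g" by blast
   have k: "k : ?G" using g h0(1) by simp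
   have "k x = x" if x: "x : L" for x
   proof -
    have "g x = g0 x" using fun_cong[OF g(2), of x] g0(2) x by simp
    then show ?thesis using g(3) h0(2)[of x] x L(3) by (auto simp: galois_group_simps compose_eq)
   qed
   then show "k : ?H" using k unfolding galois_group_def by auto
  qed
  moreover have "finite ?H" using HG fin(1) finite_subset by blast
  ultimately show ?thesis using card_inj_on_le[of ?f _ ?H] H by simp
 qed
 have "?G = (\<Union>f\<in>S. {g \<in> ?G. restrict g L = f})" unfolding S_def by blast
 then have "card ?G \<le> (\<Sum>f\<in>S. card {g \<in> ?G. restrict g L = f})"
  using card_UN_le[OF S, of "%f. {g \<in> ?G. restrict g L = f}"] by simp
 also have "... \<le> card S * m2" using sum_bounded_above[of S _ m2] fiber by simp
 finally have "d1 * m2 \<le> card S * m2" using G m2(2) by simp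
 moreover have "m2 > 0"
 proof -
  have "m > 0" using G fin(1) G.one_closed by (metis card_gt_0_iff empty_iff)
  then show ?thesis using m2(2) by simp
 qed
 ultimately have le: "d1 \<le> card S" by simp
 have "d \<le> d1" using dimension_mono(1)[OF F d1 d LL1] .
 then have dd: "d = d1" "card S = d" using le Sd by auto
 then have "L = L1" using dimension_mono(2)[OF F d1 d LL1] by simp
 then show "galois_extension R K L" "dimension (card ?H) L K" "m = d * card ?H"
  using \<open>galois_extension R K L1\<close> m2 H dd by auto
 show "\<exists>g\<in>?G. \<forall>x\<in>L. g x = t x" if t: "t : carrier (galois_group R L F)"
 proof (rule ccontr)
  assume no: "\<not> ?thesis"
  have tS: "t \<notin> S"
  proof
   assume "t : S"
   then obtain g where "g : ?G" "t = restrict g L" using Sf by blast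
   then show False using no by (metis restrict_apply')
  qed
  note t' = gal_memD[OF t]
  have "card (insert t S) \<le> d"
  proof (rule embeddings_card_le[OF F L(1,2) K d])
   fix g h assume gh: "g : insert t S" "h : insert t S" "g ~= h"
   then have "g : extensional L" "h : extensional L" using emb(6)[OF _ Ls(3) Ls(3)] t'(6) by auto
   then show "\<exists>l\<in>L. g l ~= h l" using gh(3) extensionalityI by metis
  next
   show "!!g. g \<in> insert t S ==> g \<one> = \<one>" using emb(4)[OF _ Ls(3) Ls(3)] t'(4) by blast
   show "!!g c. g \<in> insert t S ==> c : F ==> g c = c" using emb(5)[OF _ Ls(3) Ls(3)] t'(5) by blast
   show "finite (insert t S)" using S by simp
   show "!!g l. g \<in> insert t S ==> l : L ==> g l \<in> K" using emb(1) t'(1) L(3) by blast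
   show "!!g l l'. g \<in> insert t S ==> l : L ==> l' : L ==> g (l ** l') = g l ** g l'" using emb(2) t'(2) by blast
   show "!!g l l'. g \<in> insert t S ==> l : L ==> l' : L ==> g (l \<oplus> l') = g l \<oplus> g l'" using emb(3) t'(3) by blast
  qed
  then show False using tS S dd by simp
 qed
qed

text \<open>In an abelian group every subgroup is normal, so \<open>L\<close> is mapped to itself.\<close>

lemma intermediate_field_abelian:
 assumes gal: "galois_extension R K F" and comm: "comm_group (galois_group R K F)"
  and L: "subfield L R" "F <= L" "L <= K"
  and d: "dimension d F L" and m: "dimension m F K"
 shows "g : carrier (galois_group R K F) ==> restrict g L \<in> carrier (galois_group R L F)"
  and "galois_extension R L F" and "card (carrier (galois_group R L F)) = d"
  and "comm_group (galois_group R L F)"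
proof -
 let ?G = "carrier (galois_group R K F)" and ?H = "carrier (galois_group R K L)"
 have F: "subfield F R" and K: "subfield K R" and FK: "F <= K"
  and fixF: "{x \<in> K. \<forall>s\<in>?G. s x = x} = F"
  using gal unfolding galois_extension_def by auto
 note Ls = subringE[OF subfieldE(1)[OF L(1)]]
 interpret G: comm_group "galois_group R K F" by fact
 note int = intermediate_field[OF gal L d m]
 have fixL: "{x \<in> K. \<forall>s\<in>?H. s x = x} = L" using int(1) unfolding galois_extension_def by auto
 have HG: "?H <= ?G" using L(2) unfolding galois_group_def by auto
 have commute: "g (h x) = h (g x)" if "g : ?G" "h : ?G" "x : K" for g h x
  using fun_cong[OF G.m_comm[OF that(1,2), unfolded galois_group_simps], of x] that(3) by (simp add: compose_eq)
 have gL: "g x \<in> L" if g: "g : ?G" and x: "x : L" for g x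
 proof -
  have "g x \<in> {x \<in> K. \<forall>s\<in>?H. s x = x}"
  proof (intro CollectI conjI ballI)
   show "g x \<in> K" using gal_memD(1)[OF g] x L(3) by blast
   fix h assume h: "h : ?H"
   have "h (g x) = g (h x)" using commute[of h g x] h HG g x L(3) by blast
   then show "h (g x) = g x" using gal_memD(5)[OF h x] by simp
  qed
  then show ?thesis using fixL by simp
 qed
 show res: "restrict g L \<in> carrier (galois_group R L F)" if g: "g : ?G" for g
 proof (rule gal_memI)
  note g' = gal_memD[OF g]
  obtain h where h: "h : ?G" "!!x. x \<in> K ==> h (g x) = x" "!!x. x \<in> K ==> g (h x) = x"
   using gal_inverse[OF subfieldE(1)[OF K] FK g] by blast
  show "bij_betw (restrict g L) L L"
   by (rule bij_betwI[where g = h]) (use gL[OF g] gL[OF h(1)] h(2,3) subsetD[OF L(3)] in auto)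
 qed (use gal_memD[OF g] gL[OF g] subsetD[OF L(2)] subsetD[OF L(3)] Ls(3,6,7) in auto)
 have "{x \<in> L. \<forall>s\<in>carrier (galois_group R L F). s x = x} = F"
 proof (intro equalityI subsetI)
  fix x assume x: "x : {x \<in> L. \<forall>s\<in>carrier (galois_group R L F). s x = x}"
  have "g x = x" if g: "g : ?G" for g
  proof -
   have "restrict g L x = x" using x res[OF g] by blast
   then show ?thesis using x by simp
  qed
  then have "x : {x \<in> K. \<forall>s\<in>?G. s x = x}" using x L(3) by blast
  then show "x : F" using fixF by simp
 next
  fix x assume "x : F"
  then show "x : {x \<in> L. \<forall>s\<in>carrier (galois_group R L F). s x = x}"
   using L(2) gal_memD(5) by blast
 qed
 then show gLF: "galois_extension R L F"
  unfolding galois_extension_def using F L finite_dimensionI[OF d] by blast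
 show "card (carrier (galois_group R L F)) = d" by (rule galois_degree[OF gLF d])
 interpret GL: group "galois_group R L F" by (rule galois_group_is_group[OF subfieldE(1)[OF L(1)] L(2)])
 show "comm_group (galois_group R L F)"
 proof (rule GL.group_comm_groupI)
  fix s t assume s: "s : carrier (galois_group R L F)" and t: "t : carrier (galois_group R L F)"
  obtain g h where g: "g : ?G" "!!x. x \<in> L ==> g x = s x" and h: "h : ?G" "!!x. x \<in> L ==> h x = t x"
   using int(4)[OF s] int(4)[OF t] by blast
  have "t (s x) = s (t x)" if x: "x : L" for x
   using commute[OF g(1) h(1) subsetD[OF L(3) x]] g(2)[OF x] h(2)[OF x]
    g(2)[OF gal_memD(1)[OF t x]] h(2)[OF gal_memD(1)[OF s x]] by simp
  then show "s \<otimes>\<^bsub>galois_group R L F\<^esub> t = t \<otimes>\<^bsub>galois_group R L F\<^esub> s"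
   unfolding galois_group_simps compose_def by (auto simp: fun_eq_iff restrict_def)
 qed
qed

end

section \<open>Crossed products\<close>

lemma galois_group_sub: "galois_group (sub R S) K F = galois_group R K F"
 unfolding galois_group_def by simp

context ring
begin

lemma galois_extension_sub:
 assumes "subring S R" "K <= S"
 shows "galois_extension (sub R S) K F \<longleftrightarrow> galois_extension R K F"
proof -
 interpret S: ring "sub R S" by (rule subring_is_ring) fact
 have fd: "S.finite_dimension F K \<longleftrightarrow> finite_dimension F K" if "F <= K" "subfield F R"
  unfolding S.finite_dimension_def finite_dimension_def
  using dimension_sub[OF assms(1) _ assms(2), of F] that assms(2) by auto
 show ?thesis
  unfolding galois_extension_def galois_group_sub
  using subfield_sub[OF assms] subfield_sub[OF assms(1), of F] fd assms(2) by blast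
qed

lemma crossed_productD:
 assumes cp: "crossed_product R K (galois_group R K F) (%g. g) \<tau> z"
 defines "G \<equiv> carrier (galois_group R K F)"
 shows "subring K R" "finite G" "g : G ==> z g \<in> Units R"
  "g : G ==> h : G ==> z g ** z h = z (compose K h g) ** \<tau> g h"
  "g : G ==> k : K ==> k ** z g = z g ** g k"
  "a : carrier R ==> \<exists>c\<in>G \<rightarrow> K. a = (\<Oplus>g\<in>G. z g ** c g)"
  "c : G \<rightarrow> K ==> (\<Oplus>g\<in>G. z g ** c g) = \<zero> ==> g : G ==> c g = \<zero>"
proof -
 show K: "subring K R" and "finite G" and zU: "!!g. g \<in> G ==> z g \<in> Units R"
  and "g : G ==> h : G ==> z g ** z h = z (compose K h g) ** \<tau> g h"
  and "g : G ==> k : K ==> k ** z g = z g ** g k"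
  using cp unfolding crossed_product_def G_def galois_group_simps by blast+
 note Ks = subringE[OF K]
 have ex1: "\<exists>!c. c \<in> G \<rightarrow>\<^sub>E K \<and> a = (\<Oplus>g\<in>G. z g ** c g)" if "a : carrier R" for a
  using cp that unfolding crossed_product_def G_def by blast
 have zR: "z g \<in> carrier R" if "g : G" for g by (rule Units_closed[OF zU[OF that]])
 show "\<exists>c\<in>G \<rightarrow> K. a = (\<Oplus>g\<in>G. z g ** c g)" if aR: "a : carrier R"
 proof -
  obtain c where c: "c : G \<rightarrow>\<^sub>E K" "a = (\<Oplus>g\<in>G. z g ** c g)"
   using ex1[OF aR] by blast
  have "c : G \<rightarrow> K" using c(1) by (simp add: PiE_def)
  then show ?thesis using c(2) by (intro bexI[of _ c])
 qed
 show "c g = \<zero>" if c: "c : G \<rightarrow> K" "(\<Oplus>g\<in>G. z g ** c g) = \<zero>" "g : G"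
 proof -
  have cR: "!!g. g \<in> G ==> c g \<in> carrier R" using funcset_mem[OF c(1)] Ks(1) by blast
  have "restrict c G \<in> G \<rightarrow>\<^sub>E K" using funcset_mem[OF c(1)] by simp
  moreover have "(\<Oplus>g\<in>G. z g ** restrict c G g) = (\<Oplus>g\<in>G. z g ** c g)"
   by (rule finsum_cong') (use zR cR in auto)
  then have "\<zero> = (\<Oplus>g\<in>G. z g ** restrict c G g)" using c(2) by simp
  moreover have "restrict (%_. \<zero>) G \<in> G \<rightarrow>\<^sub>E K" using Ks(2) by simp
  moreover have "(\<Oplus>g\<in>G. z g ** restrict (%_. \<zero>) G g) = \<zero>"
   by (rule add.finprod_one_eqI) (use zR in auto)
  then have "\<zero> = (\<Oplus>g\<in>G. z g ** restrict (%_. \<zero>) G g)" by simp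
  ultimately have
   "restrict c G \<in> G \<rightarrow>\<^sub>E K \<and> \<zero> = (\<Oplus>g\<in>G. z g ** restrict c G g)"
   "restrict (%_. \<zero>) G \<in> G \<rightarrow>\<^sub>E K \<and> \<zero> = (\<Oplus>g\<in>G. z g ** restrict (%_. \<zero>) G g)"
   by blast+
  note this[THEN the1_equality[OF ex1[OF zero_closed]]]
  then have "restrict c G = restrict (%_. \<zero>) G" by (rule trans[OF sym])
  then have "restrict c G g = restrict (%_. \<zero>) G g" by simp
  then show ?thesis using c(3) by simp
 qed
qed

lemma crossed_dimension:
 assumes cp: "crossed_product R K (galois_group R K F) (%g. g) \<tau> z" and K: "subfield K R" and FK: "F <= K"
  and H: "H <= carrier (galois_group R K F)"
 shows "dimension (card H) K (span_of R K H z)"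
proof -
 let ?G = "carrier (galois_group R K F)"
 note cpD = crossed_productD[OF cp] and Ks = subringE[OF subfieldE(1)[OF K]]
 have KR: "!!k. k \<in> K ==> k : carrier R" using Ks(1) by blast
 have zR: "z g \<in> carrier R" if "g : ?G" for g by (rule Units_closed[OF cpD(3)[OF that]])
 note HG = subsetD[OF H]
 have fH: "finite H" using finite_subset[OF H cpD(2)] .
 have "dimension (card H * 1) K {\<Oplus>g\<in>H. k g ** z g | k. k \<in> H \<rightarrow> K}"
 proof (rule dimension_direct_sum[OF K dimension_one[OF K] fH, where ph = "%g k. k ** z g"])
  fix k g assume k: "k : H \<rightarrow> K" and s: "(\<Oplus>g\<in>H. k g ** z g) = \<zero>" and g: "g : H"
  let ?c = "%g. if g \<in> H then g (k g) else \<zero>"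
  have "(\<Oplus>g\<in>?G. z g ** ?c g) = (\<Oplus>g\<in>H. k g ** z g)"
  proof (rule add.finprod_mono_neutral_cong_right)
   show "z g ** ?c g = k g ** z g" if "g : H" for g
    using that cpD(5)[OF HG[OF that] funcset_mem[OF k that]] by simp
   show "(%g. z g ** ?c g) \<in> ?G \<rightarrow> carrier R"
    using zR KR gal_memD(1)[OF HG] funcset_mem[OF k] by simp
  qed (use cpD(2) H zR in simp_all)
  then have "?c g = \<zero>"
   using cpD(7)[of ?c g] s HG[OF g] Ks(2) gal_memD(1)[OF HG] funcset_mem[OF k] by simp
  then show "k g = \<zero>" using gal_inv(4)[OF K HG[OF g] funcset_mem[OF k g]] g by simp
 qed (use zR[OF HG] KR in \<open>auto simp: l_distr m_assoc\<close>)
 also have "{\<Oplus>g\<in>H. k g ** z g | k. k \<in> H \<rightarrow> K} = span_of R K H z"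
  unfolding span_of_def
 proof (intro equalityI subsetI)
  fix a assume "a : {\<Oplus>g\<in>H. k g ** z g | k. k \<in> H \<rightarrow> K}"
  then obtain k where k: "k : H \<rightarrow> K" "a = (\<Oplus>g\<in>H. k g ** z g)" by blast
  note kK = funcset_mem[OF k(1)]
  have "a = (\<Oplus>g\<in>H. z g ** g (k g))"
   unfolding k(2) by (rule finsum_cong')
    (use zR[OF HG] KR[OF gal_memD(1)[OF HG]] kK cpD(5)[OF HG] in simp_all)
  moreover have "(%g. g (k g)) \<in> H \<rightarrow> K" using gal_memD(1)[OF HG] kK by blast
  ultimately show "a : {\<Oplus>i\<in>H. z i ** c i |c. c \<in> H \<rightarrow> K}" by (intro CollectI exI[of _ "%g. g (k g)"]) simp
 next
  fix a assume "a : {\<Oplus>i\<in>H. z i ** c i |c. c \<in> H \<rightarrow> K}"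
  then obtain c where c: "c : H \<rightarrow> K" "a = (\<Oplus>g\<in>H. z g ** c g)" by blast
  note cK = funcset_mem[OF c(1)]
  have "\<forall>g\<in>H. \<exists>k\<in>K. g k = c g"
  proof
   fix g assume g: "g : H"
   show "\<exists>k\<in>K. g k = c g" using gal_memD(7)[OF HG[OF g]] cK[OF g] unfolding bij_betw_def by (metis imageE)
  qed
  then obtain k where k: "!!g. g \<in> H ==> k g \<in> K" "!!g. g \<in> H ==> g (k g) = c g" by metis
  have "a = (\<Oplus>g\<in>H. k g ** z g)"
   unfolding c(2)
  proof (rule finsum_cong')
   fix g assume g: "g : H"
   show "z g ** c g = k g ** z g" using cpD(5)[OF HG[OF g] k(1)[OF g]] k(2)[OF g] by simp
  qed (use zR[OF HG] KR[OF k(1)] in simp_all)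
  then show "a : {\<Oplus>g\<in>H. k g ** z g | k. k \<in> H \<rightarrow> K}" using k(1) by (intro CollectI exI[of _ k]) simp
 qed
 finally show ?thesis by simp
qed

text \<open>A sum of \<open>z\<^sub>g c\<^sub>g\<close> commutes with \<open>l\<close> exactly if every summand does, that is, if \<open>g\<close> fixes \<open>l\<close>.\<close>

lemma crossed_centralizer:
 assumes cp: "crossed_product R K (galois_group R K F) (%g. g) \<tau> z" and K: "subfield K R"
  and FL: "F <= L" and LK: "L <= K"
 shows "centralizer R L = span_of R K (carrier (galois_group R K L)) z"
proof (intro equalityI subsetI)
 let ?G = "carrier (galois_group R K F)" and ?H = "carrier (galois_group R K L)"
 note cpD = crossed_productD[OF cp] and Ks = subringE[OF subfieldE(1)[OF K]]
 have KR: "!!k. k \<in> K ==> k : carrier R" using Ks(1) by blast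
 have zR: "z g \<in> carrier R" if "g : ?G" for g by (rule Units_closed[OF cpD(3)[OF that]])
 have HG: "?H <= ?G" using FL unfolding galois_group_def by auto
 {
  fix a assume a: "a : centralizer R L"
  then have aR: "a : carrier R" unfolding centralizer_def by simp
  obtain c where c: "c : ?G \<rightarrow> K" "a = (\<Oplus>g\<in>?G. z g ** c g)"
   using cpD(6)[OF aR] by blast
  note cK = funcset_mem[OF c(1)]
  have c0: "c g = \<zero>" if g: "g : ?G" "g \<notin> ?H" for g
  proof (rule ccontr)
   assume cg: "c g ~= \<zero>"
   obtain l where l: "l : L" "g l ~= l" using g unfolding galois_group_def by auto
   have lK: "l : K" using l LK by blast
   let ?c = "%g. c g ** (g l \<ominus> l)"
   have "l ** a = (\<Oplus>g\<in>?G. l ** (z g ** c g))"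
    unfolding c(2) by (rule finsum_lmult) (use zR KR cK lK in simp_all)
   also have "... = (\<Oplus>g\<in>?G. z g ** c g ** g l)"
   proof (rule finsum_cong')
    fix h assume h: "h : ?G"
    have "l ** (z h ** c h) = z h ** (h l ** c h)"
     using cpD(5)[OF h lK] zR[OF h] KR[OF lK] KR[OF cK[OF h]] KR[OF gal_memD(1)[OF h lK]]
     by (metis m_assoc)
    also have "h l ** c h = c h ** h l" using subfieldE(4)[OF K gal_memD(1)[OF h lK] cK[OF h]] .
    finally show "l ** (z h ** c h) = z h ** c h ** h l"
     using zR[OF h] KR[OF cK[OF h]] KR[OF gal_memD(1)[OF h lK]] by (simp add: m_assoc)
   qed (use zR KR cK gal_memD(1) lK in auto)
   finally have 1: "l ** a = (\<Oplus>g\<in>?G. z g ** c g ** g l)" .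
   have 2: "a ** l = (\<Oplus>g\<in>?G. z g ** c g ** l)"
    unfolding c(2) by (rule finsum_rmult) (use zR KR cK lK in simp_all)
   have "(\<Oplus>g\<in>?G. z g ** ?c g) = (\<Oplus>g\<in>?G. z g ** c g ** g l \<ominus> z g ** c g ** l)"
   proof (rule finsum_cong')
    fix h assume h: "h : ?G"
    show "z h ** ?c h = z h ** c h ** h l \<ominus> z h ** c h ** l"
     using zR[OF h] KR[OF cK[OF h]] KR[OF gal_memD(1)[OF h lK]] KR[OF lK]
     by (simp add: a_minus_def r_distr r_minus m_assoc)
   qed (use zR KR cK gal_memD(1) lK in auto)
   also have "... = l ** a \<ominus> a ** l"
    unfolding 1 2 by (rule finsum_minus) (use zR KR cK gal_memD(1) lK in auto)
   also have "... = \<zero>" using centralizer_memD(1)[OF a l(1)] aR KR[OF lK] by simp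
   finally have s: "(\<Oplus>g\<in>?G. z g ** ?c g) = \<zero>" .
   have dK: "g l \<ominus> l \<in> K" if "g : ?G" for g
    using gal_memD(1)[OF that lK] lK Ks(5,7) by (simp add: a_minus_def)
   have "?c \<in> ?G \<rightarrow> K" using cK dK Ks(6) by blast
   from cpD(7)[OF this s g(1)] have z0: "c g ** (g l \<ominus> l) = \<zero>" .
   have "g l \<ominus> l ~= \<zero>" using l(2) KR[OF lK] KR[OF gal_memD(1)[OF g(1) lK]] by simp
   then show False using subfieldE(5)[OF K cK[OF g(1)] dK[OF g(1)] z0] cg by simp
  qed
  have "a = (\<Oplus>g\<in>?H. z g ** c g)"
   unfolding c(2)
  proof (rule add.finprod_mono_neutral_cong_right)
   show "(%g. z g ** c g) \<in> ?G \<rightarrow> carrier R" using zR KR cK by simp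
  qed (use cpD(2) HG c0 zR in simp_all)
  moreover have "c : ?H \<rightarrow> K" using cK HG by blast
  ultimately show "a : span_of R K ?H z" unfolding span_of_def by (intro CollectI exI[of _ c]) simp
 next
  fix a assume "a : span_of R K ?H z"
  then obtain c where c: "c : ?H \<rightarrow> K" "a = (\<Oplus>g\<in>?H. z g ** c g)"
   unfolding span_of_def by blast
  note cK = funcset_mem[OF c(1)] and zR' = zR[OF subsetD[OF HG]]
  have aR: "a : carrier R" unfolding c(2) using zR' KR cK by simp
  have "a ** l = l ** a" if l: "l : L" for l
  proof -
   have lK: "l : K" using l LK by blast
   have "l ** a = (\<Oplus>g\<in>?H. l ** (z g ** c g))"
    unfolding c(2) by (rule finsum_lmult) (use zR' KR cK lK in simp_all)
   also have "... = (\<Oplus>g\<in>?H. z g ** c g ** l)"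
   proof (rule finsum_cong')
    fix h assume h: "h : ?H"
    have "l ** (z h ** c h) = z h ** (l ** c h)"
     using cpD(5)[OF subsetD[OF HG h] lK] gal_memD(5)[OF h l] zR'[OF h] KR[OF lK] KR[OF cK[OF h]]
     by (metis m_assoc)
    also have "l ** c h = c h ** l" using subfieldE(4)[OF K lK cK[OF h]] .
    finally show "l ** (z h ** c h) = z h ** c h ** l"
     using zR'[OF h] KR[OF cK[OF h]] KR[OF lK] by (simp add: m_assoc)
   qed (use zR' KR cK lK in simp_all)
   also have "... = a ** l"
    unfolding c(2) by (rule finsum_rmult[symmetric]) (use zR' KR cK lK in simp_all)
   finally show ?thesis by simp
  qed
  then show "a : centralizer R L" unfolding centralizer_def using aR by simp
 }
qed

lemma crossed_centralizer_self:
 assumes cp: "crossed_product R K (galois_group R K F) (%g. g) \<tau> z" and K: "subfield K R" and FK: "F <= K"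
 shows "centralizer R K = K"
proof -
 have "carrier (galois_group R K K) = {\<lambda>x\<in>K. x}"
 proof (intro equalityI subsetI)
  fix s assume s: "s : carrier (galois_group R K K)"
  have "s = (\<lambda>x\<in>K. x)"
   by (rule extensionalityI[OF gal_memD(6)[OF s]]) (use gal_memD(5)[OF s] in auto)
  then show "s : {\<lambda>x\<in>K. x}" by simp
 next
  interpret G: group "galois_group R K K" by (rule galois_group_is_group[OF subfieldE(1)[OF K]]) simp
  fix s assume "s : {\<lambda>x\<in>K. x}"
  then show "s : carrier (galois_group R K K)" using G.one_closed unfolding galois_group_simps by simp
 qed
 then have card: "card (carrier (galois_group R K K)) = 1" by simp
 have "carrier (galois_group R K K) <= carrier (galois_group R K F)"
  using FK unfolding galois_group_def by auto
 from crossed_dimension[OF cp K FK this]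
 have d: "dimension 1 K (centralizer R K)"
  unfolding crossed_centralizer[OF cp K FK subset_refl] card .
 have "K <= centralizer R K"
  using subfieldE(3,4)[OF K] unfolding centralizer_def by auto
 from dimension_mono(2)[OF K d dimension_one[OF K] this] show ?thesis by simp
qed

text \<open>A nonzero ideal contains with an element every summand \<open>u\<^sub>g c\<^sub>g\<close> of it, and hence a unit.\<close>

lemma crossed_simple:
 assumes L: "subfield L R" and G: "finite G"
  and u: "!!g. g \<in> G ==> u g \<in> Units R"
   "!!g l. g \<in> G ==> l : L ==> th g l \<in> L" "!!g l. g \<in> G ==> l : L ==> l ** u g = u g ** th g l"
   "!!g h. g \<in> G ==> h : G ==> g ~= h ==> \<exists>l\<in>L. th g l ~= th h l"
  and span: "!!a. a \<in> carrier R ==> \<exists>c\<in>G \<rightarrow> L. a = (\<Oplus>g\<in>G. u g ** c g)"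
 shows "simple_ring"
 unfolding simple_ring_def
proof (intro conjI allI impI)
 note Ls = subringE[OF subfieldE(1)[OF L]]
 have LR: "!!k. k \<in> L ==> k : carrier R" using Ls(1) by blast
 have uR: "u g \<in> carrier R" if "g : G" for g by (rule Units_closed[OF u(1)[OF that]])
 show "\<one> ~= \<zero>" using subfieldE(6)[OF L] .
 fix I assume I: "ideal I R"
 interpret I: ideal I R by (rule I)
 have IR: "!!x. x \<in> I ==> x : carrier R" by (rule I.a_Hcarr)
 show "I = {\<zero>} \<or> I = carrier R"
 proof (rule disjCI)
  assume "I ~= carrier R"
  have "a = \<zero>" if a: "a : I" for a
  proof (rule ccontr)
   assume nz: "a ~= \<zero>"
   obtain c where c: "c : G \<rightarrow> L" "a = (\<Oplus>g\<in>G. u g ** c g)"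
    using span[OF IR[OF a]] by blast
   note cL = funcset_mem[OF c(1)]
   have "\<forall>g\<in>G. u g ** c g \<in> I"
   proof (rule eigenvector_components[OF L _ _ _ _ G])
    fix v w assume "v : I" "w : I"
    then show "v \<ominus> w \<in> I" using I.a_closed I.a_inv_closed by (simp add: a_minus_def)
   next
    fix g l assume g: "g : G" and l: "l : L"
    have "l ** (u g ** c g) = u g ** (th g l ** c g)"
     using u(3)[OF g l] uR[OF g] LR[OF l] LR[OF cL[OF g]] LR[OF u(2)[OF g l]] by (metis m_assoc)
    also have "th g l ** c g = c g ** th g l" using subfieldE(4)[OF L u(2)[OF g l] cL[OF g]] .
    finally show "l ** (u g ** c g) = u g ** c g ** th g l"
     using uR[OF g] LR[OF cL[OF g]] LR[OF u(2)[OF g l]] by (simp add: m_assoc)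
   next
    show "(\<Oplus>g\<in>G. u g ** c g) \<in> I" using a c(2) by simp
    show "I <= carrier R" using IR by blast
    show "(%g. u g ** c g) \<in> G \<rightarrow> carrier R" using uR LR cL by simp
   qed (use u(2,4) I.I_l_closed I.I_r_closed LR in simp_all)
   moreover have "\<exists>g\<in>G. c g ~= \<zero>"
   proof (rule ccontr)
    assume "\<not> ?thesis"
    then have "a = \<zero>" unfolding c(2) by (intro add.finprod_one_eqI) (use uR in auto)
    then show False using nz by simp
   qed
   ultimately obtain g where g: "g : G" "c g ~= \<zero>" "u g ** c g \<in> I" by blast
   have "c g \<in> L - {\<zero>}" using g cL by simp
   note inv = subfield_m_inv[OF L this]
   have iR: "inv (c g) \<in> carrier R" using inv LR by simp
   have "inv (u g) ** (u g ** c g) ** inv (c g) \<in> I"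
    using I.I_l_closed[OF g(3)] I.I_r_closed u(1)[OF g(1)] iR by simp
   moreover have "inv (u g) ** (u g ** c g) = c g"
    using u(1)[OF g(1)] uR[OF g(1)] LR[OF cL[OF g(1)]] by (simp flip: m_assoc)
   ultimately have "\<one> \<in> I" using inv by simp
   then have "x : I" if "x : carrier R" for x using I.I_l_closed[of \<one> x] that by simp
   then show False using \<open>I ~= carrier R\<close> IR by blast
  qed
  then show "I = {\<zero>}" using I.zero_closed by blast
 qed
qed

lemma crossed_product_simple:
 assumes cp: "crossed_product R K (galois_group R K F) (%g. g) \<tau> z" and K: "subfield K R"
 shows "simple_ring"
 by (rule crossed_simple[OF K crossed_productD(2)[OF cp], where u = z and th = "%g. g"])
  (fact crossed_productD[OF cp] gal_memD(1) gal_distinct | assumption)+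

lemma commutes_finsum:
 assumes "x : carrier R" "!!i. i \<in> I ==> f i \<in> carrier R" "!!i. i \<in> I ==> x ** f i = f i ** x"
 shows "x ** (\<Oplus>i\<in>I. f i) = (\<Oplus>i\<in>I. f i) ** x"
proof -
 have "(\<Oplus>i\<in>I. x ** f i) = (\<Oplus>i\<in>I. f i ** x)" by (rule finsum_cong') (use assms in auto)
 then show ?thesis using finsum_lmult[of x I f] finsum_rmult[of x I f] assms(1,2) by simp
qed

text \<open>The uniqueness of coefficients and the center follow from the other conditions: a relation between the \<open>z\<^sub>g\<close>
 breaks up by eigenvectors of \<open>L\<close>, and a central element lies in \<open>L\<close> and is fixed by the group.\<close>

lemma crossed_productI:
 assumes S: "subring S R" and L: "subfield L R" "L <= S" and gal: "galois_extension R L F"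
 defines "G \<equiv> carrier (galois_group R L F)"
 assumes z: "!!g. g \<in> G ==> z g \<in> Units R" "!!g. g \<in> G ==> z g \<in> S" "!!g. g \<in> G ==> inv (z g) \<in> S"
  and lz: "!!g l. g \<in> G ==> l : L ==> l ** z g = z g ** g l"
  and span: "!!a. a \<in> S ==> \<exists>c. c \<in> G \<rightarrow> L \<and> a = (\<Oplus>g\<in>G. z g ** c g)"
  and fs: "factor_set (sub R L) (galois_group R L F) (%g. g) \<tau>"
  and zz: "!!g h. g \<in> G ==> h : G ==> z g ** z h = z (compose L h g) ** \<tau> g h"
  and cen: "!!s. s \<in> S ==> (!!l. l \<in> L ==> s ** l = l ** s) ==> s : L"
 shows "classical_crossed_product (sub R S) L F \<tau> z"
proof -
 have F: "subfield F R" and FL: "F <= L" and fixF: "{x \<in> L. \<forall>s\<in>G. s x = x} = F" and fG: "finite G"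
  using gal galois_group_finite(1)[of F L] unfolding galois_extension_def finite_dimension_def G_def by auto
 interpret S: ring "sub R S" by (rule subring_is_ring[OF S])
 note Ls = subringE[OF subfieldE(1)[OF L(1)]] and Ss = subringE[OF S] and zR = Units_closed[OF z(1)]
 note gL = gal_memD(1)[of _ L F, folded G_def]
 have LR: "!!l. l \<in> L ==> l : carrier R" using Ls(1) by blast
 have sumS: "(\<Oplus>\<^bsub>sub R S\<^esub>g\<in>G. z g ** c g) = (\<Oplus>g\<in>G. z g ** c g)" if "!!g. g \<in> G ==> c g \<in> L" for c
  by (rule finsum_sub[OF S]) (use z(2) L(2) that Ss(6) in blast)
 have rep: "\<exists>!c. c \<in> G \<rightarrow>\<^sub>E L \<and> a = (\<Oplus>\<^bsub>sub R S\<^esub>g\<in>G. z g ** c g)" if a: "a : S" for a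
 proof -
  obtain c where c: "c : G \<rightarrow> L" "a = (\<Oplus>g\<in>G. z g ** c g)" using span[OF a] by blast
  let ?c = "restrict c G"
  have cL: "!!g. g \<in> G ==> ?c g \<in> L" using funcset_mem[OF c(1)] by simp
  have ac: "a = (\<Oplus>g\<in>G. z g ** ?c g)"
   unfolding c(2) by (rule finsum_cong') (use zR LR[OF cL] in simp_all)
  moreover have "d = ?c" if d: "d : G \<rightarrow>\<^sub>E L" "a = (\<Oplus>\<^bsub>sub R S\<^esub>g\<in>G. z g ** d g)" for d
  proof (rule PiE_ext[OF d(1), of ?c])
   show "?c \<in> G \<rightarrow>\<^sub>E L" by (rule PiE_I) (use cL in auto)
   fix g assume g: "g : G"
   have dL: "!!g. g \<in> G ==> d g \<in> L" using d(1) by (rule PiE_mem)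
   let ?e = "%g. d g \<ominus> ?c g"
   have eL: "!!g. g \<in> G ==> ?e g \<in> L" using dL cL Ls(5,7) by (simp add: a_minus_def)
   have "(\<Oplus>g\<in>G. z g ** ?e g) = (\<Oplus>g\<in>G. z g ** d g \<ominus> z g ** ?c g)"
    by (rule finsum_cong') (use zR LR[OF dL] LR[OF cL] in \<open>auto simp: a_minus_def r_distr r_minus\<close>)
   also have "... = (\<Oplus>g\<in>G. z g ** d g) \<ominus> (\<Oplus>g\<in>G. z g ** ?c g)"
    by (rule finsum_minus) (use zR LR[OF dL] LR[OF cL] in auto)
   also have "... = a \<ominus> a" using d(2) ac sumS[of d] dL by simp
   also have "... = \<zero>" using a Ss(1) by auto
   finally have s: "(\<Oplus>g\<in>G. z g ** ?e g) = \<zero>" .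
   have "\<forall>g\<in>G. z g ** ?e g \<in> {\<zero>}"
   proof (rule eigenvector_components[OF L(1) _ _ _ _ fG, where th = "%g. g"])
    show "\<exists>l\<in>L. g l ~= h l" if "g : G" "h : G" "g ~= h" for g h using that unfolding G_def by (rule gal_distinct)
    fix h l assume h: "h : G" and l: "l : L"
    note R = zR[OF h] LR[OF l] LR[OF eL[OF h]] LR[OF gL[OF h l]]
    have "l ** (z h ** ?e h) = (l ** z h) ** ?e h" using R by (simp only: m_assoc)
    also have "... = z h ** (h l ** ?e h)" unfolding lz[OF h l] using R by (simp only: m_assoc)
    also have "h l ** ?e h = ?e h ** h l" by (rule subfieldE(4)[OF L(1) gL[OF h l] eL[OF h]])
    finally show "l ** (z h ** ?e h) = z h ** ?e h ** h l" using R by (simp only: m_assoc)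
   next
    show "(%g. z g ** ?e g) \<in> G \<rightarrow> carrier R" by (intro funcsetI m_closed zR LR[OF eL])
   qed (use s gL LR in auto)
   then have "z g ** ?e g = z g ** \<zero>" using g zR[OF g] by simp
   then have "?e g = \<zero>" using Units_l_cancel[OF z(1)[OF g] LR[OF eL[OF g]] zero_closed] by simp
   then show "d g = ?c g" using LR[OF dL[OF g]] LR[OF cL[OF g]] by simp
  qed
  ultimately show ?thesis using cL sumS[of ?c] by (intro ex1I[of _ ?c]) auto
 qed
 have "crossed_product (sub R S) L (galois_group (sub R S) L F) (%g. g) \<tau> z"
  unfolding crossed_product_def galois_group_sub G_def[symmetric]
 proof (intro conjI ballI)
  show "ring (sub R S)" by (rule S.ring_axioms)
  show "subring L (sub R S)" using subfield_sub[OF S L(2)] L(1) subfieldE(1) by blast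
  show "group (galois_group R L F)" by (rule galois_group_is_group[OF subfieldE(1)[OF L(1)] FL])
  show "finite G" by (rule fG)
  show "g : ring_iso (sub (sub R S) L) (sub (sub R S) L)" if "g : G" for g
   using that unfolding galois_group_def G_def by simp
  show "factor_set (sub (sub R S) L) (galois_group R L F) (%g. g) \<tau>" using fs by simp
  show "z g \<in> Units (sub R S)" if g: "g : G" for g
   unfolding Units_def using z(2,3)[OF g] Units_l_inv[OF z(1)[OF g]] Units_r_inv[OF z(1)[OF g]] by auto
  show "\<exists>!c. c \<in> G \<rightarrow>\<^sub>E L \<and> a = (\<Oplus>\<^bsub>sub R S\<^esub>g\<in>G. z g \<otimes>\<^bsub>sub R S\<^esub> c g)"
   if "a : carrier (sub R S)" for a using rep[of a] that by simp
  show "z g \<otimes>\<^bsub>sub R S\<^esub> z h = z (g \<otimes>\<^bsub>galois_group R L F\<^esub> h) \<otimes>\<^bsub>sub R S\<^esub> \<tau> g h"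
   if "g : G" "h : G" for g h using zz[OF that] by (simp add: galois_group_simps)
  show "r \<otimes>\<^bsub>sub R S\<^esub> z g = z g \<otimes>\<^bsub>sub R S\<^esub> g r" if "g : G" "r : L" for g r
   using lz[OF that] by simp
 qed
 moreover have "galois_extension (sub R S) L F" using galois_extension_sub[OF S L(2)] gal by simp
 moreover have "center (sub R S) = F"
 proof (intro equalityI subsetI)
  fix x assume x: "x : center (sub R S)"
  then have xS: "x : S" and xc: "!!y. y \<in> S ==> x ** y = y ** x"
   unfolding centralizer_sub by auto
  have xL: "x : L" by (rule cen[OF xS]) (use xc L(2) in blast)
  have "x : {x \<in> L. \<forall>s\<in>G. s x = x}"
  proof (intro CollectI conjI ballI xL)
   fix s assume s: "s : G"
   have "z s ** s x = z s ** x" using lz[OF s xL] xc[OF z(2)[OF s]] by simp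
   then show "s x = x" using Units_l_cancel[OF z(1)[OF s] LR[OF gL[OF s xL]] LR[OF xL]] by simp
  qed
  then show "x : F" using fixF by simp
 next
  fix x assume x: "x : F"
  have xL: "x : L" using x FL by blast
  have "x ** y = y ** x" if y: "y : S" for y
  proof -
   obtain c where c: "c : G \<rightarrow> L" "y = (\<Oplus>g\<in>G. z g ** c g)" using span[OF y] by blast
   note cL = funcset_mem[OF c(1)]
   have "x ** (z g ** c g) = z g ** c g ** x" if g: "g : G" for g
   proof -
    have "x ** (z g ** c g) = z g ** x ** c g"
     using lz[OF g xL] gal_memD(5)[of g L F x] g x zR[OF g] LR[OF xL] LR[OF cL[OF g]] unfolding G_def by (simp flip: m_assoc)
    then show ?thesis using subfieldE(4)[OF L(1) xL cL[OF g]] zR[OF g] LR[OF xL] LR[OF cL[OF g]] by (simp add: m_assoc)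
   qed
   then show ?thesis unfolding c(2) by (intro commutes_finsum LR[OF xL] m_closed zR LR[OF cL])
  qed
  then show "x : center (sub R S)" unfolding centralizer_sub using xL L(2) by auto
 qed
 ultimately show ?thesis unfolding classical_crossed_product_def by simp
qed

lemma crossed_restrict:
 assumes ccp: "classical_crossed_product R K F \<tau> z"
  and L: "subfield L R" "F <= L" "L <= K" and gal: "galois_extension R K L"
 shows "classical_crossed_product (sub R (centralizer R L)) K L \<tau> z"
proof -
 let ?C = "centralizer R L" and ?G = "carrier (galois_group R K F)" and ?H = "carrier (galois_group R K L)"
 have cp: "crossed_product R K (galois_group R K F) (%g. g) \<tau> z"
  using ccp unfolding classical_crossed_product_def by simp
 have K: "subfield K R" and fixL: "{x \<in> K. \<forall>s\<in>?H. s x = x} = L"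
  using gal unfolding galois_extension_def by auto
 note cpD = crossed_productD[OF cp] and Ks = subringE[OF subfieldE(1)[OF K]]
 have KR: "!!k. k \<in> K ==> k : carrier R" using Ks(1) by blast
 have HG: "?H <= ?G" using L(2) unfolding galois_group_def by auto
 have zR: "z g \<in> carrier R" if "g : ?H" for g by (rule Units_closed[OF cpD(3)[OF subsetD[OF HG that]]])
 have LR: "L <= carrier R" using L(3) Ks(1) by blast
 have C: "subring ?C R" by (rule centralizer_subring[OF LR])
 note Cs = subringE[OF C]
 interpret C: ring "sub R ?C" by (rule subring_is_ring[OF C])
 have KC: "K <= ?C" using L(3) subfieldE(4)[OF K] KR unfolding centralizer_def by auto
 have zC: "z g \<in> ?C" if g: "g : ?H" for g
 proof -
  have "z g ** l = l ** z g" if l: "l : L" for l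
   using cpD(5)[OF subsetD[OF HG g] subsetD[OF L(3) l]] gal_memD(5)[OF g l] by simp
  then show ?thesis unfolding centralizer_def using zR[OF g] by simp
 qed
 have izC: "inv (z g) \<in> ?C" if g: "g : ?H" for g
 proof -
  have U: "z g \<in> Units R" using cpD(3)[OF subsetD[OF HG g]] .
  note UR = Units_closed[OF U]
  have "inv (z g) ** l = l ** inv (z g)" if l: "l : L" for l
  proof -
   have lR: "l : carrier R" using l LR by blast
   have "inv (z g) ** l = inv (z g) ** (l ** z g) ** inv (z g)"
    using U UR lR by (simp add: m_assoc)
   also have "l ** z g = z g ** l" using centralizer_memD(1)[OF zC[OF g] l] by simp
   also have "inv (z g) ** (z g ** l) ** inv (z g) = l ** inv (z g)"
    using U UR lR by (simp flip: m_assoc)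
   finally show ?thesis .
  qed
  then show ?thesis unfolding centralizer_def using U by simp
 qed
 show ?thesis
 proof (rule crossed_productI[OF C K KC gal])
  fix g assume g: "g : ?H"
  show "z g \<in> Units R" by (rule cpD(3)[OF subsetD[OF HG g]])
  show "z g \<in> ?C" "inv (z g) \<in> ?C" by (rule zC[OF g]) (rule izC[OF g])
  show "l ** z g = z g ** g l" if "l : K" for l by (rule cpD(5)[OF subsetD[OF HG g] that])
  show "z g ** z h = z (compose K h g) ** \<tau> g h" if "h : ?H" for h
   by (rule cpD(4)[OF subsetD[OF HG g] subsetD[OF HG that]])
 next
  show "\<exists>c. c \<in> ?H \<rightarrow> K \<and> a = (\<Oplus>g\<in>?H. z g ** c g)" if "a : ?C" for a
   using that unfolding crossed_centralizer[OF cp K L(2,3)] span_of_def by blast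
  have "factor_set (sub R K) (galois_group R K F) (%g. g) \<tau>"
   using cp unfolding crossed_product_def by simp
  then show "factor_set (sub R K) (galois_group R K L) (%g. g) \<tau>"
   unfolding factor_set_def galois_group_simps using HG by (auto simp: subset_iff)
  fix s assume s: "s : ?C" "!!l. l \<in> K ==> s ** l = l ** s"
  have "s : centralizer R K" unfolding centralizer_def using s Cs(1) by auto
  then show "s : K" using crossed_centralizer_self[OF cp K] L(2,3) by auto
 qed
qed

end

context ring
begin

text \<open>Units that normalize a self-centralizing Galois subfield \<open>L\<close> and induce its Galois group
 make the ring a crossed product, as soon as it is small enough for them to span it.\<close>

lemma units_crossed_product:
 assumes S: "subring S R" and L: "subfield L R" "L <= S"
  and gal: "galois_extension R L F" and comm: "comm_group (galois_group R L F)"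
  and N: "card (carrier (galois_group R L F)) = N" "dimension N L S"
  and v: "!!i. i \<in> {1..N} ==> v i \<in> Units R" "!!i. i \<in> {1..N} ==> v i \<in> S"
   "!!i. i \<in> {1..N} ==> inv (v i) \<in> S"
  and conj: "{conj_map R L (v i) | i. i \<in> {1..N}} = carrier (galois_group R L F)"
  and cen: "!!s. s \<in> S ==> (!!l. l \<in> L ==> s ** l = l ** s) ==> s : L"
 shows "classical_crossed_product (sub R S) L F (induced_factor_set R L N v) (unit_inducing R L N v)"
  and "factor_set (sub R L) (galois_group R L F) (%g. g) (induced_factor_set R L N v)"
  and "inj_on (%i. conj_map R L (v i)) {1..N}"
proof -
 let ?G = "carrier (galois_group R L F)"
 have F: "subfield F R" and FL: "F <= L" and fixF: "{x \<in> L. \<forall>s\<in>?G. s x = x} = F"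
  and finL: "finite_dimension F L"
  using gal unfolding galois_extension_def by auto
 interpret G: comm_group "galois_group R L F" by fact
 note Ls = subringE[OF subfieldE(1)[OF L(1)]] and Ss = subringE[OF S]
 have LR: "!!l. l \<in> L ==> l : carrier R" using Ls(1) by blast
 obtain m where m: "dimension m F L" using finL by (rule finite_dimensionE')
 have fG: "finite ?G" by (rule galois_group_finite(1)[OF F L(1) FL m])
 have im: "(%i. conj_map R L (v i)) ` {1..N} = ?G" using conj by blast
 show inj: "inj_on (%i. conj_map R L (v i)) {1..N}"
  by (rule eq_card_imp_inj_on) (use im N in auto)
 define z where "z = unit_inducing R L N v"
 have "\<exists>i\<in>{1..N}. conj_map R L (v i) = g \<and> z g = v i" if g: "g : ?G" for g
 proof -
  have "g : (%i. conj_map R L (v i)) ` {1..N}" using g im by simp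
  then obtain i where i: "i : {1..N}" "conj_map R L (v i) = g" by blast
  have "(THE j. j \<in> {1..N} \<and> conj_map R L (v j) = g) = i"
   by (rule the_equality) (use i inj in \<open>auto simp: inj_on_def simp del: atLeastAtMost_iff\<close>)
  then show ?thesis unfolding z_def unit_inducing_def using i by auto
 qed
 then have z: "z g \<in> Units R" "z g \<in> S" "inv (z g) \<in> S" "conj_map R L (z g) = g" if "g : ?G" for g
  using v that by metis+
 have zR: "!!g. g \<in> ?G ==> z g \<in> carrier R" by (rule Units_closed[OF z(1)])
 have izR: "!!g. g \<in> ?G ==> inv (z g) \<in> carrier R" by (rule Units_inv_closed[OF z(1)])
 have lz: "l ** z g = z g ** g l" if g: "g : ?G" and l: "l : L" for g l
 proof -
  have "g l = inv (z g) ** l ** z g" using fun_cong[OF z(4)[OF g], of l] l unfolding conj_map_def by simp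
  then have "z g ** g l = (z g ** inv (z g)) ** (l ** z g)"
   using zR[OF g] izR[OF g] LR[OF l] by (simp add: m_assoc)
  then show ?thesis using z(1)[OF g] zR[OF g] LR[OF l] by simp
 qed
 note gL = gal_memD(1)
 have "lin_indep L ?G z"
  unfolding lin_indep_def
 proof (intro ballI impI)
  fix k g assume k: "k : ?G \<rightarrow> L" and s: "(\<Oplus>g\<in>?G. k g ** z g) = \<zero>" and g: "g : ?G"
  note kL = funcset_mem[OF k]
  have "\<forall>g\<in>?G. k g ** z g \<in> {\<zero>}"
  proof (rule eigenvector_components[OF L(1) _ _ _ _ fG, where th = "%g. g"])
   show "!!g h. g \<in> ?G ==> h : ?G ==> g ~= h ==> \<exists>l\<in>L. g l ~= h l" by (rule gal_distinct)
   fix h l assume h: "h : ?G" and l: "l : L"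
   have "l ** (k h ** z h) = k h ** (l ** z h)"
    using subfieldE(4)[OF L(1) l kL[OF h]] LR[OF l] LR[OF kL[OF h]] zR[OF h] by (simp flip: m_assoc)
   then show "l ** (k h ** z h) = k h ** z h ** h l"
    using lz[OF h l] LR[OF kL[OF h]] LR[OF gL[OF h l]] zR[OF h] by (simp add: m_assoc)
  qed (use s zR LR[OF kL] gL LR in auto)
  then have "k g ** z g = \<zero>" using g by blast
  then have "k g ** z g ** inv (z g) = \<zero>" using izR[OF g] by simp
  then show "k g = \<zero>" using LR[OF kL[OF g]] zR[OF g] izR[OF g] z(1)[OF g] by (simp add: m_assoc)
 qed
 then have spanS: "lin_span L ?G z = S"
  by (intro lin_span_eq_space[OF L(1) fG]) (use z(2) N in auto)
 define \<tau> where "\<tau> = induced_factor_set R L N v"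
 have \<tau>: "\<tau> g h = inv (z (compose L g h)) ** z g ** z h" for g h
  unfolding \<tau>_def induced_factor_set_def z_def by simp
 have gh: "compose L h g \<in> ?G" "compose L g h = compose L h g" "compose L h g l = h (g l)" "g (h l) = h (g l)"
  if "g : ?G" "h : ?G" "l : L" for g h l
 proof -
  show "compose L h g \<in> ?G" using G.m_closed[OF that(1,2)] unfolding galois_group_simps .
  show "compose L g h = compose L h g" using G.m_comm[OF that(2,1)] unfolding galois_group_simps .
  from fun_cong[OF this, of l] show "g (h l) = h (g l)" using that(3) by (simp add: compose_eq)
  show "compose L h g l = h (g l)" using that(3) by (simp add: compose_eq)
 qed
 have zz: "z g ** z h = z (compose L h g) ** \<tau> g h" if g: "g : ?G" and h: "h : ?G" for g h
 proof -
  note k = gh(1)[OF g h Ls(3)]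
  have "z (compose L h g) ** \<tau> g h = (z (compose L h g) ** inv (z (compose L h g))) ** (z g ** z h)"
   unfolding \<tau> gh(2)[OF g h Ls(3)] using zR[OF g] zR[OF h] zR[OF k] izR[OF k] by (simp add: m_assoc)
  then show ?thesis using z(1)[OF k] zR[OF g] zR[OF h] by simp
 qed
 have \<tau>U: "\<tau> g h \<in> Units R" and \<tau>L: "\<tau> g h \<in> L" if g: "g : ?G" and h: "h : ?G" for g h
 proof -
  note k = gh(1)[OF g h Ls(3)]
  show U: "\<tau> g h \<in> Units R"
   unfolding \<tau> gh(2)[OF g h Ls(3)] using z(1)[OF g] z(1)[OF h] z(1)[OF k] by simp
  have \<tau>R: "\<tau> g h \<in> carrier R" by (rule Units_closed[OF U])
  show "\<tau> g h \<in> L"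
  proof (rule cen)
   show "\<tau> g h \<in> S" unfolding \<tau> gh(2)[OF g h Ls(3)] using z(2)[OF g] z(2)[OF h] z(3)[OF k] Ss(6) by simp
   fix y assume y: "y : L"
   obtain x where x: "x : L" "compose L h g x = y"
    using gal_memD(7)[OF k] y unfolding bij_betw_def by (metis imageE)
   have xy: "h (g x) = y" using x(2) gh(3)[OF g h x(1)] by simp
   have "z (compose L h g) ** (y ** \<tau> g h) = x ** (z (compose L h g) ** \<tau> g h)"
    using lz[OF k x(1)] x(2) zR[OF k] LR[OF y] LR[OF x(1)] \<tau>R by (simp flip: m_assoc)
   also have "... = x ** z g ** z h"
    unfolding zz[OF g h, symmetric] using zR[OF g] zR[OF h] LR[OF x(1)] by (simp add: m_assoc)
   also have "... = z g ** (g x ** z h)"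
    unfolding lz[OF g x(1)] using zR[OF g] zR[OF h] LR[OF gL[OF g x(1)]] by (simp add: m_assoc)
   also have "... = z g ** z h ** y"
    unfolding lz[OF h gL[OF g x(1)]] xy using zR[OF g] zR[OF h] LR[OF y] by (simp add: m_assoc)
   also have "... = z (compose L h g) ** (\<tau> g h ** y)"
    unfolding zz[OF g h] using zR[OF k] LR[OF y] \<tau>R by (simp add: m_assoc)
   finally show "\<tau> g h ** y = y ** \<tau> g h"
    using Units_l_cancel[OF z(1)[OF k], of "y ** \<tau> g h" "\<tau> g h ** y"] LR[OF y] \<tau>R by simp
  qed
 qed
 have \<tau>R: "!!g h. g \<in> ?G ==> h : ?G ==> \<tau> g h \<in> carrier R" by (rule LR[OF \<tau>L])
 show fs: "factor_set (sub R L) (galois_group R L F) (%g. g) (induced_factor_set R L N v)"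
  unfolding \<tau>_def[symmetric] factor_set_def galois_group_simps
 proof (intro conjI ballI)
  fix g h assume g: "g : ?G" and h: "h : ?G"
  have "\<tau> g h ~= \<zero>" using Units_r_inv[OF \<tau>U[OF g h]] Units_inv_closed[OF \<tau>U[OF g h]] subfieldE(6)[OF L(1)] by auto
  then show "\<tau> g h \<in> Units (sub R L)" using subfield.subfield_Units[OF L(1)] \<tau>L[OF g h] by simp
  show "\<tau> g h \<otimes>\<^bsub>sub R L\<^esub> h (g l) = compose L h g l \<otimes>\<^bsub>sub R L\<^esub> \<tau> g h" if "l : carrier (sub R L)" for l
   using that gh(3)[OF g h, of l] subfieldE(4)[OF L(1) \<tau>L[OF g h] gL[OF h gL[OF g]], of l] by simp
  fix x assume x: "x : ?G"
  note gh' = gh(1)[OF g h Ls(3)] and hx = gh(1)[OF h x Ls(3)]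
  let ?gh = "compose L h g" and ?hx = "compose L x h" and ?k = "compose L x (compose L h g)"
  have k: "?k = compose L ?hx g"
   using G.m_assoc[OF g h x] unfolding galois_group_simps .
  note k1 = gh(1)[OF gh' x Ls(3)]
  have xt: "x (\<tau> g h) \<in> carrier R" by (rule LR[OF gL[OF x \<tau>L[OF g h]]])
  have "z ?k ** (\<tau> ?gh x ** x (\<tau> g h)) = z ?gh ** z x ** x (\<tau> g h)"
   using zz[OF gh' x] zR[OF k1] \<tau>R[OF gh' x] xt by (simp add: m_assoc)
  also have "... = z ?gh ** (\<tau> g h ** z x)"
   unfolding lz[OF x \<tau>L[OF g h]] using zR[OF gh'] zR[OF x] xt by (simp add: m_assoc)
  also have "... = z g ** (z h ** z x)"
   using zz[OF g h] zR[OF gh'] zR[OF g] zR[OF h] zR[OF x] \<tau>R[OF g h] by (simp flip: m_assoc)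
  also have "... = z g ** z ?hx ** \<tau> h x"
   unfolding zz[OF h x] using zR[OF g] zR[OF hx] \<tau>R[OF h x] by (simp add: m_assoc)
  also have "... = z ?k ** (\<tau> g ?hx ** \<tau> h x)"
   unfolding zz[OF g hx] k using zR[OF k1] \<tau>R[OF g hx] \<tau>R[OF h x] by (simp add: m_assoc k)
  finally show "\<tau> ?gh x \<otimes>\<^bsub>sub R L\<^esub> x (\<tau> g h) = \<tau> g ?hx \<otimes>\<^bsub>sub R L\<^esub> \<tau> h x"
   using Units_l_cancel[OF z(1)[OF k1], of "\<tau> ?gh x ** x (\<tau> g h)" "\<tau> g ?hx ** \<tau> h x"]
    \<tau>R[OF gh' x] \<tau>R[OF g hx] \<tau>R[OF h x] xt by simp
 qed
 have "classical_crossed_product (sub R S) L F \<tau> z"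
 proof (rule crossed_productI[OF S L gal z(1-3) lz _ fs[folded \<tau>_def] zz cen])
  fix a assume "a : S"
  then obtain k where k: "k : ?G \<rightarrow> L" "a = (\<Oplus>g\<in>?G. k g ** z g)"
   using lin_spanE[of a L ?G z] unfolding spanS by blast
  note kL = funcset_mem[OF k(1)]
  have "a = (\<Oplus>g\<in>?G. z g ** g (k g))"
   unfolding k(2) by (rule finsum_cong') (use kL lz zR LR[OF gL[OF _ kL]] in auto)
  then show "\<exists>c. c \<in> ?G \<rightarrow> L \<and> a = (\<Oplus>g\<in>?G. z g ** c g)"
   using gL[OF _ kL] by (intro exI[of _ "%g. g (k g)"]) auto
 qed
 then show "classical_crossed_product (sub R S) L F (induced_factor_set R L N v) (unit_inducing R L N v)"
  unfolding \<tau>_def z_def .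
qed

end

section \<open>Tensor products\<close>

definition tensor_pairs :: "('a, 'b) ring_scheme \<Rightarrow> ('a, 'c) ring_scheme \<Rightarrow>
  ('a \<times> 'a) list \<Rightarrow> ('a \<times> 'a) list \<Rightarrow> ('a \<times> 'a) list" where
 "tensor_pairs A B xs ys = [(a \<otimes>\<^bsub>A\<^esub> a', b \<otimes>\<^bsub>B\<^esub> b'). (a, b) \<leftarrow> xs, (a', b') \<leftarrow> ys]"

text \<open>The value of a formal sum of tensors under a map of two arguments.\<close>

definition tensor_eval :: "('c, 'd) ring_scheme \<Rightarrow> ('a \<Rightarrow> 'a \<Rightarrow> 'c) \<Rightarrow> ('a \<times> 'a) list \<Rightarrow> 'c" where
 "tensor_eval H h xs = foldr (%x s. h (fst x) (snd x) \<oplus>\<^bsub>H\<^esub> s) xs \<zero>\<^bsub>H\<^esub>"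

lemma tensor_eval_simps [simp]:
 "tensor_eval H h [] = \<zero>\<^bsub>H\<^esub>"
 "tensor_eval H h (x # xs) = h (fst x) (snd x) \<oplus>\<^bsub>H\<^esub> tensor_eval H h xs"
 unfolding tensor_eval_def by simp_all

locale tensor = A: ring A + B: ring B
 for A :: "('a, 'b) ring_scheme" and B :: "('a, 'c) ring_scheme" +
 fixes F :: "'a set"
 assumes F_A: "F <= center A" and F_B: "F <= center B"
begin

abbreviation car where "car \<equiv> carrier A \<times> carrier B"
abbreviation rel where "rel \<equiv> tensor_rel F A B"
abbreviation cls where "cls \<equiv> tensor_class F A B"
abbreviation T where "T \<equiv> tensor_product F A B"
abbreviation pm where "pm \<equiv> tensor_pairs A B"

lemma F_carrier: "c : F ==> c : carrier A" "c : F ==> c : carrier B"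
 using F_A F_B unfolding centralizer_def by auto

lemma F_comm: "c : F ==> a : carrier A ==> c \<otimes>\<^bsub>A\<^esub> a = a \<otimes>\<^bsub>A\<^esub> c"
 "c : F ==> b : carrier B ==> c \<otimes>\<^bsub>B\<^esub> b = b \<otimes>\<^bsub>B\<^esub> c"
 using F_A F_B unfolding centralizer_def by auto

lemma rel_closed: "rel xs ys ==> set xs <= car \<and> set ys <= car"
 by (induction rule: tensor_rel.induct) (auto simp: F_carrier)

lemma cls_eq_iff: "set xs <= car ==> cls xs = cls ys \<longleftrightarrow> rel xs ys"
 unfolding tensor_class_def using t_refl t_sym t_trans by blast

lemma pm_Cons: "pm (x # xs) ys = pm [x] ys @ pm xs ys"
 and pm_append: "pm (xs @ xs') ys = pm xs ys @ pm xs' ys"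
 and pm_single: "pm [x] ys = map (%y. (fst x \<otimes>\<^bsub>A\<^esub> fst y, snd x \<otimes>\<^bsub>B\<^esub> snd y)) ys"
 by (auto simp: tensor_pairs_def case_prod_beta)

lemma pm_Nil [simp]: "pm [] ys = []"
 by (simp add: tensor_pairs_def)

lemma pm_closed: "set xs <= car ==> set ys <= car ==> set (pm xs ys) <= car"
 unfolding tensor_pairs_def by auto

lemma rel_perm:
 assumes "mset xs = mset ys" "set xs <= car"
 shows "rel xs ys"
 using assms
proof (induction xs arbitrary: ys)
 case (Cons x xs)
 have "x : set ys" using Cons.prems(1) by (metis list.set_intros(1) mset_eq_setD)
 then obtain ys1 ys2 where ys: "ys = ys1 @ x # ys2" by (meson split_list)
 have yc: "set ys <= car" using Cons.prems mset_eq_setD by metis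
 have "rel xs (ys1 @ ys2)" by (rule Cons.IH) (use Cons.prems ys in auto)
 then have "rel ([x] @ xs) ([x] @ (ys1 @ ys2))"
  by (intro t_cong t_refl) (use Cons.prems in auto)
 moreover have "rel (([x] @ ys1) @ ys2) ((ys1 @ [x]) @ ys2)"
  by (intro t_cong t_comm t_refl) (use ys yc in auto)
 ultimately show ?case unfolding ys using t_trans[of F A B "x # xs" "x # ys1 @ ys2"] by simp
qed (simp add: t_refl)

lemma pm_right_append: "mset (pm xs (ys @ zs)) = mset (pm xs ys) + mset (pm xs zs)"
 by (induction xs) (auto simp: tensor_pairs_def case_prod_beta)

text \<open>Balanced pairs of maps act on tensors. Left and right multiplications are the instances from which the product of
 tensors becomes well defined.\<close>

lemma rel_map:
 assumes f: "!!a. a \<in> carrier A ==> f a \<in> carrier A" "!!a a'. a \<in> carrier A ==> a' : carrier A ==> f (a \<oplus>\<^bsub>A\<^esub> a') = f a \<oplus>\<^bsub>A\<^esub> f a'"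
   "!!a c. a \<in> carrier A ==> c : F ==> f (a \<otimes>\<^bsub>A\<^esub> c) = f a \<otimes>\<^bsub>A\<^esub> c"
  and g: "!!b. b \<in> carrier B ==> g b \<in> carrier B" "!!b b'. b \<in> carrier B ==> b' : carrier B ==> g (b \<oplus>\<^bsub>B\<^esub> b') = g b \<oplus>\<^bsub>B\<^esub> g b'"
   "!!b c. b \<in> carrier B ==> c : F ==> g (c \<otimes>\<^bsub>B\<^esub> b) = c \<otimes>\<^bsub>B\<^esub> g b"
  and r: "rel xs ys"
 shows "rel (map (%x. (f (fst x), g (snd x))) xs) (map (%x. (f (fst x), g (snd x))) ys)"
 using r
proof (induction rule: tensor_rel.induct)
 case (t_refl xs)
 then show ?case using f(1) g(1) by (intro tensor_rel.t_refl) auto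
next
 case (t_comm xs ys)
 then show ?case unfolding map_append using f(1) g(1) by (intro tensor_rel.t_comm) auto
next
 case (t_cong xs xs' ys ys')
 then show ?case unfolding map_append by (intro tensor_rel.t_cong)
next
 case (t_trans xs ys zs)
 then show ?case using tensor_rel.t_trans by blast
next
 case (t_sym xs ys)
 then show ?case using tensor_rel.t_sym by blast
next
 case (t_zero_l b)
 have "f \<zero>\<^bsub>A\<^esub> = \<zero>\<^bsub>A\<^esub>" by (rule additive_zero[where V = "carrier A"]) (use f A.ring_axioms in auto)
 then show ?case using tensor_rel.t_zero_l[OF g(1)[OF t_zero_l]] by simp
next
 case (t_zero_r a)
 have "g \<zero>\<^bsub>B\<^esub> = \<zero>\<^bsub>B\<^esub>" by (rule additive_zero[where V = "carrier B"]) (use g B.ring_axioms in auto)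
 then show ?case using tensor_rel.t_zero_r[OF f(1)[OF t_zero_r]] by simp
qed (simp_all add: f g tensor_rel.t_add_l tensor_rel.t_add_r tensor_rel.t_balanced)

lemma pm_single_right: "pm xs [y] = map (%x. (fst x \<otimes>\<^bsub>A\<^esub> fst y, snd x \<otimes>\<^bsub>B\<^esub> snd y)) xs"
 by (induction xs) (auto simp: tensor_pairs_def case_prod_beta)

lemma pm_Nil_right [simp]: "pm xs [] = []"
 by (simp add: tensor_pairs_def case_prod_beta)

lemma rel_pm_single:
 assumes "rel ys ys'" "x : car"
 shows "rel (pm [x] ys) (pm [x] ys')" "rel (pm ys [x]) (pm ys' [x])"
proof -
 have x: "fst x \<in> carrier A" "snd x \<in> carrier B" using assms(2) by auto
 have c: "snd x \<otimes>\<^bsub>B\<^esub> (c \<otimes>\<^bsub>B\<^esub> b) = c \<otimes>\<^bsub>B\<^esub> (snd x \<otimes>\<^bsub>B\<^esub> b)" if "b : carrier B" "c : F" for b c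
  using F_comm(2)[OF that(2) x(2)] F_carrier(2)[OF that(2)] x that by (simp flip: B.m_assoc)
 have d: "a \<otimes>\<^bsub>A\<^esub> c \<otimes>\<^bsub>A\<^esub> fst x = a \<otimes>\<^bsub>A\<^esub> fst x \<otimes>\<^bsub>A\<^esub> c" if "a : carrier A" "c : F" for a c
  using F_comm(1)[OF that(2) x(1)] F_carrier(1)[OF that(2)] x that by (simp add: A.m_assoc)
 show "rel (pm [x] ys) (pm [x] ys')"
  unfolding pm_single by (rule rel_map[OF _ _ _ _ _ _ assms(1)]) (use x c F_carrier in \<open>simp_all add: A.r_distr B.r_distr A.m_assoc\<close>)
 show "rel (pm ys [x]) (pm ys' [x])"
  unfolding pm_single_right by (rule rel_map[OF _ _ _ _ _ _ assms(1)]) (use x d F_carrier in \<open>simp_all add: A.l_distr B.l_distr B.m_assoc\<close>)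
qed

lemma rel_pm_left:
 assumes "rel ys ys'" "set xs <= car"
 shows "rel (pm xs ys) (pm xs ys')"
 using assms(2)
proof (induction xs)
 case (Cons x xs)
 then show ?case
  unfolding pm_Cons[of x xs] by (intro t_cong rel_pm_single(1)[OF assms(1)]) auto
qed (simp add: t_refl)

lemma rel_pm_right:
 assumes "rel xs xs'" "set ys <= car"
 shows "rel (pm xs ys) (pm xs' ys)"
 using assms(2)
proof (induction ys)
 case (Cons y ys)
 have c: "set xs <= car" "set xs' <= car" using rel_closed[OF assms(1)] by auto
 have p: "rel (pm zs (y # ys)) (pm zs [y] @ pm zs ys)" if "set zs <= car" for zs
  by (rule rel_perm) (use pm_right_append[of zs "[y]" ys] that Cons.prems pm_closed[of zs "y # ys"] in auto)
 have "rel (pm xs [y] @ pm xs ys) (pm xs' [y] @ pm xs' ys)"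
  by (intro t_cong rel_pm_single(2)[OF assms(1)] Cons.IH) (use Cons.prems in auto)
 with p[OF c(1)] t_sym[OF p[OF c(2)]] show ?case using t_trans by blast
qed (simp add: t_refl)

lemma T_carrier: "carrier T = cls ` {xs. set xs <= car}"
 unfolding tensor_product_def lists_eq_set by simp

lemma cls_self: "set xs <= car ==> xs : cls xs"
 unfolding tensor_class_def by (simp add: t_refl)

lemma cls_closed [simp]: "set xs <= car ==> cls xs \<in> carrier T"
 unfolding T_carrier by blast

lemma T_mult:
 assumes "set xs <= car" "set ys <= car"
 shows "cls xs \<otimes>\<^bsub>T\<^esub> cls ys = cls (pm xs ys)"
proof -
 have "cls (pm xs' ys') = cls (pm xs ys)" if "xs' : cls xs" "ys' : cls ys" for xs' ys'
 proof -
  have r: "rel xs xs'" "rel ys ys'" using that unfolding tensor_class_def by auto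
  have "rel (pm xs ys) (pm xs' ys')"
   using rel_pm_right[OF r(1) assms(2)] rel_pm_left[OF r(2), of xs'] rel_closed[OF r(1)] t_trans by blast
  then have "cls (pm xs ys) = cls (pm xs' ys')" using cls_eq_iff[OF pm_closed[OF assms]] by simp
  then show ?thesis by simp
 qed
 then have "(\<Union>xs'\<in>cls xs. \<Union>ys'\<in>cls ys. cls (pm xs' ys')) = (\<Union>xs'\<in>cls xs. \<Union>ys'\<in>cls ys. cls (pm xs ys))"
  by (intro SUP_cong refl)
 also have "... = cls (pm xs ys)"
  using cls_self[OF assms(1)] cls_self[OF assms(2)] by (metis UN_constant empty_iff)
 finally show ?thesis
  unfolding tensor_product_def tensor_pairs_def[symmetric] by simp
qed

lemma T_add:
 assumes "set xs <= car" "set ys <= car"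
 shows "cls xs \<oplus>\<^bsub>T\<^esub> cls ys = cls (xs @ ys)"
proof -
 have "cls (xs' @ ys') = cls (xs @ ys)" if "xs' : cls xs" "ys' : cls ys" for xs' ys'
 proof -
  have r: "rel xs xs'" "rel ys ys'" using that unfolding tensor_class_def by auto
  then have "rel (xs @ ys) (xs' @ ys')" by (rule t_cong)
  then have "cls (xs @ ys) = cls (xs' @ ys')" using cls_eq_iff[of "xs @ ys"] assms by simp
  then show ?thesis by simp
 qed
 then have "(\<Union>xs'\<in>cls xs. \<Union>ys'\<in>cls ys. cls (xs' @ ys')) = (\<Union>xs'\<in>cls xs. \<Union>ys'\<in>cls ys. cls (xs @ ys))"
  by (intro SUP_cong refl)
 also have "... = cls (xs @ ys)"
  using cls_self[OF assms(1)] cls_self[OF assms(2)] by (metis UN_constant empty_iff)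
 finally show ?thesis
  unfolding tensor_product_def by simp
qed

lemma T_one: "\<one>\<^bsub>T\<^esub> = cls [(\<one>\<^bsub>A\<^esub>, \<one>\<^bsub>B\<^esub>)]" and T_zero: "\<zero>\<^bsub>T\<^esub> = cls []"
 unfolding tensor_product_def by simp_all

lemma T_cases:
 assumes "t : carrier T"
 obtains xs where "set xs <= car" "t = cls xs"
 using assms unfolding T_carrier by blast

lemma rel_neg: "set xs <= car ==> rel (map (%x. (\<ominus>\<^bsub>A\<^esub> fst x, snd x)) xs @ xs) []"
proof (induction xs)
 case (Cons x xs)
 let ?n = "%x. (\<ominus>\<^bsub>A\<^esub> fst x, snd x)"
 have x: "fst x \<in> carrier A" "snd x \<in> carrier B" using Cons.prems by auto
 have "rel [(\<ominus>\<^bsub>A\<^esub> fst x \<oplus>\<^bsub>A\<^esub> fst x, snd x)] [(\<ominus>\<^bsub>A\<^esub> fst x, snd x), (fst x, snd x)]"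
  by (rule t_add_l) (use x in auto)
 then have "rel [?n x, x] []" using t_zero_l[OF x(2), of F A] x t_sym t_trans by (simp add: A.l_neg) blast
 then have "rel ([?n x, x] @ (map ?n xs @ xs)) ([] @ [])"
  by (rule t_cong) (use Cons in auto)
 moreover have "rel (map ?n (x # xs) @ x # xs) ([?n x, x] @ (map ?n xs @ xs))"
  by (rule rel_perm) (use Cons.prems in auto)
 ultimately show ?case using t_trans[of F A B "map ?n (x # xs) @ x # xs"] by simp
qed (simp add: t_refl)

lemma pm_assoc:
 assumes "set xs <= car" "set ys <= car" "set zs <= car"
 shows "pm (pm xs ys) zs = pm xs (pm ys zs)"
 using assms(1)
proof (induction xs)
 case (Cons x xs)
 have x: "fst x \<in> carrier A" "snd x \<in> carrier B" using Cons.prems by auto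
 have "pm (pm [x] ys) zs = pm [x] (pm ys zs)"
  using assms(2)
 proof (induction ys)
  case (Cons y ys)
  have "pm (pm [x] [y]) zs = pm [x] (pm [y] zs)"
  proof -
   have y: "fst y \<in> carrier A" "snd y \<in> carrier B" using Cons.prems by auto
   have "fst w \<in> carrier A \<and> snd w \<in> carrier B" if "w : set zs" for w using that assms(3) by auto
   then show ?thesis
    unfolding pm_single[of _ "[y]"] list.map pm_single map_map
    using x y by (auto simp: A.m_assoc B.m_assoc)
  qed
  moreover have "pm [x] (us @ vs) = pm [x] us @ pm [x] vs" for us vs by (simp add: pm_single)
  from this[of "[y]" ys] this[of "pm [y] zs" "pm ys zs"]
  have "pm (pm [x] (y # ys)) zs = pm (pm [x] [y]) zs @ pm (pm [x] ys) zs"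
   "pm [x] (pm (y # ys) zs) = pm [x] (pm [y] zs) @ pm [x] (pm ys zs)"
   using pm_Cons[of y ys zs] by (simp_all add: pm_append)
  ultimately show ?case using Cons by simp
 qed simp
 moreover have "pm (pm (x # xs) ys) zs = pm (pm [x] ys) zs @ pm (pm xs ys) zs"
  using pm_Cons[of x xs ys] by (simp add: pm_append)
 moreover have "pm (x # xs) (pm ys zs) = pm [x] (pm ys zs) @ pm xs (pm ys zs)"
  by (rule pm_Cons)
 ultimately show ?case using Cons by simp
qed simp

lemma pm_one: "set xs <= car ==> pm [(\<one>\<^bsub>A\<^esub>, \<one>\<^bsub>B\<^esub>)] xs = xs" "set xs <= car ==> pm xs [(\<one>\<^bsub>A\<^esub>, \<one>\<^bsub>B\<^esub>)] = xs"
 unfolding pm_single pm_single_right by (auto intro!: map_idI)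

lemma T_ring: "ring T"
proof (rule ringI)
 show "abelian_group T"
 proof (rule abelian_groupI)
  fix x y assume "x : carrier T" "y : carrier T"
  then obtain xs ys where *: "set xs <= car" "x = cls xs" "set ys <= car" "y = cls ys" by (metis T_cases)
  show "x \<oplus>\<^bsub>T\<^esub> y \<in> carrier T" unfolding *(2,4) T_add[OF *(1,3)] by (rule cls_closed) (use * in auto)
  show "x \<oplus>\<^bsub>T\<^esub> y = y \<oplus>\<^bsub>T\<^esub> x"
   unfolding *(2,4) T_add[OF *(1,3)] T_add[OF *(3,1)] using * by (subst cls_eq_iff) (auto intro: t_comm)
  fix z assume "z : carrier T"
  then obtain zs where z: "set zs <= car" "z = cls zs" by (metis T_cases)
  show "x \<oplus>\<^bsub>T\<^esub> y \<oplus>\<^bsub>T\<^esub> z = x \<oplus>\<^bsub>T\<^esub> (y \<oplus>\<^bsub>T\<^esub> z)"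
   using * z by (simp add: T_add)
 next
  show "\<zero>\<^bsub>T\<^esub> \<in> carrier T" unfolding T_zero by simp
  fix x assume "x : carrier T"
  then obtain xs where *: "set xs <= car" "x = cls xs" by (metis T_cases)
  show "\<zero>\<^bsub>T\<^esub> \<oplus>\<^bsub>T\<^esub> x = x" unfolding T_zero *(2) using *(1) by (subst T_add) auto
  let ?n = "map (%x. (\<ominus>\<^bsub>A\<^esub> fst x, snd x)) xs"
  have n: "set ?n <= car" using *(1) by auto
  have "cls ?n \<oplus>\<^bsub>T\<^esub> x = \<zero>\<^bsub>T\<^esub>"
   unfolding T_zero *(2) T_add[OF n *(1)] using cls_eq_iff rel_neg[OF *(1)] n *(1) by simp
  then show "\<exists>y\<in>carrier T. y \<oplus>\<^bsub>T\<^esub> x = \<zero>\<^bsub>T\<^esub>" using cls_closed[OF n] by blast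
 qed
 show "Group.monoid T"
 proof (rule monoidI)
  fix x y assume "x : carrier T" "y : carrier T"
  then obtain xs ys where *: "set xs <= car" "x = cls xs" "set ys <= car" "y = cls ys" by (metis T_cases)
  show "x \<otimes>\<^bsub>T\<^esub> y \<in> carrier T" unfolding *(2,4) T_mult[OF *(1,3)] by (rule cls_closed[OF pm_closed[OF *(1,3)]])
  fix z assume "z : carrier T"
  then obtain zs where z: "set zs <= car" "z = cls zs" by (metis T_cases)
  show "x \<otimes>\<^bsub>T\<^esub> y \<otimes>\<^bsub>T\<^esub> z = x \<otimes>\<^bsub>T\<^esub> (y \<otimes>\<^bsub>T\<^esub> z)"
   unfolding *(2,4) z(2) T_mult[OF *(1,3)] T_mult[OF *(3) z(1)]
    T_mult[OF pm_closed[OF *(1,3)] z(1)] T_mult[OF *(1) pm_closed[OF *(3) z(1)]] pm_assoc[OF *(1,3) z(1)] ..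
 next
  have o: "set [(\<one>\<^bsub>A\<^esub>, \<one>\<^bsub>B\<^esub>)] <= car" by simp
  show "\<one>\<^bsub>T\<^esub> \<in> carrier T" unfolding T_one by (rule cls_closed[OF o])
  fix x assume "x : carrier T"
  then obtain xs where *: "set xs <= car" "x = cls xs" by (metis T_cases)
  show "\<one>\<^bsub>T\<^esub> \<otimes>\<^bsub>T\<^esub> x = x" unfolding T_one *(2) T_mult[OF o *(1)] pm_one(1)[OF *(1)] ..
  show "x \<otimes>\<^bsub>T\<^esub> \<one>\<^bsub>T\<^esub> = x" unfolding T_one *(2) T_mult[OF *(1) o] pm_one(2)[OF *(1)] ..
 qed
 fix x y z assume "x : carrier T" "y : carrier T" "z : carrier T"
 then obtain xs ys zs where *: "set xs <= car" "x = cls xs" "set ys <= car" "y = cls ys" "set zs <= car" "z = cls zs"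
  by (metis T_cases)
 have a: "set (xs @ ys) <= car" using * by simp
 show "(x \<oplus>\<^bsub>T\<^esub> y) \<otimes>\<^bsub>T\<^esub> z = x \<otimes>\<^bsub>T\<^esub> z \<oplus>\<^bsub>T\<^esub> y \<otimes>\<^bsub>T\<^esub> z"
  unfolding *(2,4,6) T_add[OF *(1,3)] T_mult[OF a *(5)] T_mult[OF *(1,5)] T_mult[OF *(3,5)]
   T_add[OF pm_closed[OF *(1,5)] pm_closed[OF *(3,5)]] pm_append ..
 have "rel (pm zs (xs @ ys)) (pm zs xs @ pm zs ys)"
  by (rule rel_perm) (use pm_right_append[of zs xs ys] pm_closed[OF *(5) a] in auto)
 then show "z \<otimes>\<^bsub>T\<^esub> (x \<oplus>\<^bsub>T\<^esub> y) = z \<otimes>\<^bsub>T\<^esub> x \<oplus>\<^bsub>T\<^esub> z \<otimes>\<^bsub>T\<^esub> y"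
  unfolding *(2,4,6) T_add[OF *(1,3)] T_mult[OF *(5) a] T_mult[OF *(5,1)] T_mult[OF *(5,3)]
   T_add[OF pm_closed[OF *(5,1)] pm_closed[OF *(5,3)]] using cls_eq_iff[OF pm_closed[OF *(5) a]] by simp
qed

lemma eval_closed:
 assumes "ring H" "!!a b. a \<in> carrier A ==> b : carrier B ==> h a b \<in> carrier H" "set xs <= car"
 shows "tensor_eval H h xs \<in> carrier H"
proof -
 interpret H: ring H by fact
 show ?thesis using assms(3) by (induction xs) (auto simp: assms(2))
qed

lemma eval_append:
 assumes "ring H" "!!a b. a \<in> carrier A ==> b : carrier B ==> h a b \<in> carrier H"
  "set xs <= car" "set ys <= car"
 shows "tensor_eval H h (xs @ ys) = tensor_eval H h xs \<oplus>\<^bsub>H\<^esub> tensor_eval H h ys"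
proof -
 interpret H: ring H by fact
 have e: "set zs <= car ==> tensor_eval H h zs \<in> carrier H" for zs by (rule eval_closed[OF assms(1,2)])
 show ?thesis using assms(3,4) by (induction xs) (auto simp: assms(2) e H.a_assoc)
qed

text \<open>The universal property of the tensor product.\<close>

lemma eval_cong:
 assumes H: "ring H" and h: "!!a b. a \<in> carrier A ==> b : carrier B ==> h a b \<in> carrier H"
  "!!a a' b. a \<in> carrier A ==> a' : carrier A ==> b : carrier B ==> h (a \<oplus>\<^bsub>A\<^esub> a') b = h a b \<oplus>\<^bsub>H\<^esub> h a' b"
  "!!a b b'. a \<in> carrier A ==> b : carrier B ==> b' : carrier B ==> h a (b \<oplus>\<^bsub>B\<^esub> b') = h a b \<oplus>\<^bsub>H\<^esub> h a b'"
  "!!a b c. a \<in> carrier A ==> b : carrier B ==> c : F ==> h (a \<otimes>\<^bsub>A\<^esub> c) b = h a (c \<otimes>\<^bsub>B\<^esub> b)"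
  and r: "rel xs ys"
 shows "tensor_eval H h xs = tensor_eval H h ys"
proof -
 interpret H: ring H by fact
 have z: "h \<zero>\<^bsub>A\<^esub> b = \<zero>\<^bsub>H\<^esub>" if "b : carrier B" for b
  by (rule additive_zero[where V = "carrier A" and h = "%a. h a b"])
   (use that h A.ring_axioms H in auto)
 have z': "h a \<zero>\<^bsub>B\<^esub> = \<zero>\<^bsub>H\<^esub>" if "a : carrier A" for a
  by (rule additive_zero[where V = "carrier B" and h = "%b. h a b"])
   (use that h B.ring_axioms H in auto)
 have e: "set zs <= car ==> tensor_eval H h zs \<in> carrier H" for zs by (rule eval_closed[OF H h(1)])
 show ?thesis
  using r
 proof (induction rule: tensor_rel.induct)
  case (t_cong xs xs' ys ys')
  have "set xs <= car" "set xs' <= car" "set ys <= car" "set ys' <= car"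
   using rel_closed[OF t_cong(1)] rel_closed[OF t_cong(2)] by auto
  then show ?case using t_cong by (simp add: eval_append[OF H h(1)])
 next
  case (t_comm xs ys)
  then show ?case using e[of xs] e[of ys] by (simp add: eval_append[OF H h(1)] H.a_comm)
 qed (simp_all add: z z' h F_carrier H.a_assoc)
qed

end

section \<open>Modules over matrix algebras\<close>

text \<open>Matrix units that fill the whole dimension leave only the scalars for the commutant.\<close>

lemma (in matrix_unit_system) full_matrix_units_commutant:
 assumes F: "subfield F R" "F <= center R" and n: "dimension (m * m) F (carrier R)" "1 \<le> m"
 shows "Z = F"
proof -
 have FZ: "F <= Z" using F(2) unfolding centralizer_def unit_commutant_def by auto
 note Zs = subringE[OF Z_subring]
 obtain d where d: "dimension d F Z"
  using subspace_dimension[OF F(1) n(1) Zs(1,2,7)] Zs(6) FZ by (metis subsetD)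
 have "m * m * d = m * m" using dimension_is_inj[OF F(1) dimension_matrix[OF F d] n(1)] .
 then have "d = 1" using n(2) by simp
 then show "Z = F" using dimension_mono(2)[OF F(1) d dimension_one[OF F(1)] FZ] by simp
qed

context ring
begin

text \<open>Maps \<open>ep\<^sub>i\<^sub>j\<close> that compose like matrix units cut a space into copies of the image of \<open>ep\<^sub>1\<^sub>1\<close>.\<close>

lemma action_dimension:
 assumes L: "subfield L R" and V: "dimension n L V" and m: "1 \<le> m"
  and ep: "!!i j v. i \<in> {1..m} ==> j : {1..m} ==> v : V ==> ep i j v \<in> V"
   "!!i j v w. i \<in> {1..m} ==> j : {1..m} ==> v : V ==> w : V ==> ep i j (v \<oplus> w) = ep i j v \<oplus> ep i j w"
   "!!i j l v. i \<in> {1..m} ==> j : {1..m} ==> l : L ==> v : V ==> ep i j (l ** v) = l ** ep i j v"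
  and mult: "!!i j a b v. i \<in> {1..m} ==> j : {1..m} ==> a : {1..m} ==> b : {1..m} ==> v : V ==>
    ep i j (ep a b v) = (if j = a then ep i b v else \<zero>)"
  and sum: "!!v. v \<in> V ==> (\<Oplus>i\<in>{1..m}. ep i i v) = v"
 obtains c where "dimension c L (ep 1 1 ` V)" "n = m * c"
proof -
 note Vs = space_subgroup_props[OF L V]
 let ?I = "{1..m}" and ?W = "ep 1 1 ` V"
 have one: "1 : ?I" using m by simp
 have VR: "v : carrier R" if "v : V" for v using Vs(1) that by blast
 have W: "w : V" "ep 1 1 w = w" if "w : ?W" for w using that ep(1) mult[OF one one one one] one by auto
 have toW: "ep 1 i v \<in> ?W" if "i : ?I" "v : V" for i v
  using mult[OF one one one that] ep(1)[OF one that] by (metis imageI)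
 have ep0: "ep i j \<zero> = \<zero>" if "i : ?I" "j : ?I" for i j
  by (rule additive_zero[where V = V and R = R and R' = R]) (use ring_axioms Vs(1,2) VR[OF ep(1)[OF that]] ep(2)[OF that] in auto)
 obtain c where c: "dimension c L ?W"
 proof (rule subspace_dimension[OF L V])
  show "?W <= V" using W(1) by blast
  show "\<zero> \<in> ?W" using ep0[OF one one] Vs(2) by (metis imageI)
  show "v \<oplus> w \<in> ?W" if "v : ?W" "w : ?W" for v w
   using ep(2)[OF one one W(1)[OF that(1)] W(1)[OF that(2)]] W[OF that(1)] W[OF that(2)] Vs(3) by (metis imageI)
  show "l ** v \<in> ?W" if "l : L" "v : ?W" for l v
   using ep(3)[OF one one that(1) W(1)[OF that(2)]] W[OF that(2)] Vs(5)[OF that(1)] by (metis imageI)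
 qed
 have "dimension (card ?I * c) L {\<Oplus>i\<in>?I. ep i 1 (v i) | v. v \<in> ?I \<rightarrow> ?W}"
 proof (rule dimension_direct_sum[OF L c, where ph = "%i. ep i 1"])
  fix v i assume v: "v : ?I \<rightarrow> ?W" and s: "(\<Oplus>j\<in>?I. ep j 1 (v j)) = \<zero>" and i: "i : ?I"
  note vW = W[OF funcset_mem[OF v]]
  have "\<zero> = ep 1 i (\<Oplus>j\<in>?I. ep j 1 (v j))" using s ep0[OF one i] by simp
  also have "... = (\<Oplus>j\<in>?I. ep 1 i (ep j 1 (v j)))"
   by (rule finsum_additive(2)[OF abelian_monoid_axioms abelian_monoid_axioms Vs(1,2,3) VR[OF ep(1)[OF one i]] ep0[OF one i]
      ep(2)[OF one i] ep(1)[OF _ one vW(1)]])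
  also have "... = (\<Oplus>j\<in>?I. if j = i then v j else \<zero>)"
   by (rule finsum_cong') (use mult[OF one i _ one vW(1)] vW VR in auto)
  also have "... = v i" by (rule finsum_delta) (use i VR[OF vW(1)] in auto)
  finally show "v i = \<zero>" ..
 qed (use ep(1-3)[OF _ one] W(1) VR in auto)
 also have "{\<Oplus>i\<in>?I. ep i 1 (v i) | v. v \<in> ?I \<rightarrow> ?W} = V"
 proof (intro equalityI subsetI)
  fix x assume "x : {\<Oplus>i\<in>?I. ep i 1 (v i) | v. v \<in> ?I \<rightarrow> ?W}"
  then obtain v where v: "v : ?I \<rightarrow> ?W" "x = (\<Oplus>i\<in>?I. ep i 1 (v i))" by blast
  show "x : V" unfolding v(2)
   by (rule finsum_additive(1)[where h = id, OF abelian_monoid_axioms abelian_monoid_axioms Vs(1,2,3)])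
    (use VR ep(1)[OF _ one W(1)[OF funcset_mem[OF v(1)]]] in auto)
 next
  fix x assume x: "x : V"
  have "(\<Oplus>i\<in>?I. ep i 1 (ep 1 i x)) = (\<Oplus>i\<in>?I. ep i i x)"
   by (rule finsum_cong') (use mult[OF _ one one _ x] VR[OF ep(1)[OF _ _ x]] in auto)
  then have "x = (\<Oplus>i\<in>?I. ep i 1 (ep 1 i x))" using sum[OF x] by simp
  moreover have "(%i. ep 1 i x) \<in> ?I \<rightarrow> ?W" by (rule funcsetI) (rule toW[OF _ x])
  ultimately show "x : {\<Oplus>i\<in>?I. ep i 1 (v i) | v. v \<in> ?I \<rightarrow> ?W}" by (intro CollectI exI conjI)
 qed
 finally have "n = m * c" using dimension_is_inj[OF L V] by simp
 with c show ?thesis by (rule that)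
qed

text \<open>Let \<open>S \<cong> M\<^sub>q(D)\<close> have dimension \<open>k\<^sup>2\<close> and a left or right module \<open>W\<close> of dimension \<open>k\<close>. Then
 \<open>k = q c\<close> where \<open>c\<close> is the dimension of \<open>e\<^sub>1\<^sub>1 W\<close>, a nonzero space over \<open>D\<close>, so that \<open>dim D \<le> c\<close>.
 Since \<open>k\<^sup>2 = q\<^sup>2 dim D\<close>, this forces \<open>D\<close> to be trivial.\<close>

lemma faithful_module_units:
 assumes S: "ring S" "prime_ring S" and F: "subfield F S" "F <= center S" "ring.dimension S (k * k) F (carrier S)"
  and L: "subfield L R" and W: "dimension k L W" and k: "1 \<le> k"
  and act: "!!s w. s \<in> carrier S ==> w : W ==> act s w \<in> W"
   "!!s t w. s \<in> carrier S ==> t : carrier S ==> w : W ==> act (s \<oplus>\<^bsub>S\<^esub> t) w = act s w \<oplus> act t w"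
   "!!s v w. s \<in> carrier S ==> v : W ==> w : W ==> act s (v \<oplus> w) = act s v \<oplus> act s w"
   "!!w. w \<in> W ==> act \<one>\<^bsub>S\<^esub> w = w"
  and mult: "(\<forall>s\<in>carrier S. \<forall>t\<in>carrier S. \<forall>w\<in>W. act (s \<otimes>\<^bsub>S\<^esub> t) w = act s (act t w)) \<or>
   (\<forall>s\<in>carrier S. \<forall>t\<in>carrier S. \<forall>w\<in>W. act (s \<otimes>\<^bsub>S\<^esub> t) w = act t (act s w))"
  and kp: "kp ` F = L" "!!c w. c \<in> F ==> w : W ==> act c w = kp c ** w"
 obtains e where "matrix_units S k e"
proof -
 interpret S: ring S by (rule S(1))
 note Ws = space_subgroup_props[OF L W]
 have WR: "w : carrier R" if "w : W" for w using Ws(1) that by blast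
 obtain q e where q: "1 \<le> q" and e: "matrix_units S q e" and div: "division_ring (sub S (unit_commutant S q e))"
  by (rule S.Wedderburn_matrix_units[OF S(2) F])
 interpret e: matrix_unit_system S q e by unfold_locales (rule e)
 note Ds = subringE[OF e.Z_subring]
 have FD: "F <= e.Z" using F(2) unfolding centralizer_def unit_commutant_def by auto
 obtain d where d: "S.dimension d F e.Z"
  using S.subspace_dimension[OF F(1,3) Ds(1,2,7)] Ds(6) FD by (metis subsetD)
 have qd: "q * q * d = k * k" by (rule S.dimension_is_inj[OF F(1) e.dimension_matrix[OF F(1,2) d] F(3)])
 have one: "1 : {1..q}" using q by simp
 have act0: "act \<zero>\<^bsub>S\<^esub> w = \<zero>" if "w : W" for w
  by (rule additive_zero[where V = "carrier S" and R = S and R' = R and h = "%s. act s w"])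
   (use S(1) ring_axioms WR act(1,2) that in auto)
 have act0': "act s \<zero> = \<zero>" if "s : carrier S" for s
  by (rule additive_zero[where V = W and R = R and R' = R]) (use ring_axioms Ws(1,2) WR act(1,3) that in auto)
 have comm: "act s (act t w) = act t (act s w)" if "s : carrier S" "t : carrier S" "s \<otimes>\<^bsub>S\<^esub> t = t \<otimes>\<^bsub>S\<^esub> s" "w : W" for s t w
  using mult that by metis
 define l where "l \<longleftrightarrow> (\<forall>s\<in>carrier S. \<forall>t\<in>carrier S. \<forall>w\<in>W. act (s \<otimes>\<^bsub>S\<^esub> t) w = act s (act t w))"
 have l: "act (s \<otimes>\<^bsub>S\<^esub> t) w = (if l then act s (act t w) else act t (act s w))"
  if "s : carrier S" "t : carrier S" "w : W" for s t w
  using mult that unfolding l_def by (metis (no_types, lifting))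
 define ep where "ep i j = (if l then act (e i j) else act (e j i))" for i j
 have ep1: "ep i i = act (e i i)" for i unfolding ep_def by simp
 obtain c where c: "dimension c L (ep 1 1 ` W)" "k = q * c"
 proof (rule action_dimension[OF L W q, of ep])
  fix i j assume ij: "i : {1..q}" "j : {1..q}"
  have ec: "e i j \<in> carrier S" "e j i \<in> carrier S" using ij by auto
  fix v assume v: "v : W"
  show "ep i j v \<in> W" unfolding ep_def using act(1) ec v by auto
  show "ep i j (v \<oplus> w) = ep i j v \<oplus> ep i j w" if "w : W" for w unfolding ep_def using act(3) ec v that by auto
  show "ep i j (l ** v) = l ** ep i j v" if l: "l : L" for l
  proof -
   obtain x where x: "x : F" "kp x = l" using l unfolding kp(1)[symmetric] by blast
   have "act s (l ** v) = l ** act s v" if s: "s : carrier S" for s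
    using comm[OF s _ _ v, of x] kp(2)[OF x(1) v] kp(2)[OF x(1) act(1)[OF s v]] x F(2)
     centralizer_memD[of x S "carrier S"] s by auto
   then show ?thesis unfolding ep_def using ec by simp
  qed
  fix a b assume ab: "a : {1..q}" "b : {1..q}"
  show "ep i j (ep a b v) = (if j = a then ep i b v else \<zero>)"
  proof (cases l)
   case True
   then have "ep i j (ep a b v) = act (e i j \<otimes>\<^bsub>S\<^esub> e a b) v" unfolding ep_def using l[of "e i j" "e a b" v] ij ab v by simp
   then show ?thesis using e.e_mult[OF ij ab] act0[OF v] True by (auto simp: ep_def)
  next
   case False
   then have "ep i j (ep a b v) = act (e b a \<otimes>\<^bsub>S\<^esub> e j i) v" unfolding ep_def using l[of "e b a" "e j i" v] ij ab v by simp
   then show ?thesis using e.e_mult[OF ab(2,1) ij(2,1)] act0[OF v] False by (auto simp: ep_def)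
  qed
 next
  fix v assume v: "v : W"
  have "(\<Oplus>i\<in>{1..q}. act (e i i) v) = act (\<Oplus>\<^bsub>S\<^esub>i\<in>{1..q}. e i i) v"
   by (rule finsum_additive(2)[where S = "carrier S" and h = "%s. act s v", symmetric])
    (use S.abelian_monoid_axioms abelian_monoid_axioms WR[OF act(1)] act0 act(2) v in auto)
  then show "(\<Oplus>i\<in>{1..q}. ep i i v) = v" unfolding ep1 e.e_sum act(4)[OF v] .
 qed
 have c1: "1 \<le> c" using c(2) k by (cases c) auto
 have "\<exists>w\<in>ep 1 1 ` W. w ~= \<zero>"
 proof (rule ccontr)
  assume "\<not> (\<exists>w\<in>ep 1 1 ` W. w ~= \<zero>)"
  then have "ep 1 1 ` W = {\<zero>}" using space_subgroup_props(2)[OF L c(1)] by blast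
  then have "c = 0" using dimension_is_inj[OF L c(1)] zero_dim by simp
  then show False using c1 by simp
 qed
 then obtain w0 where w0: "w0 : W" "act (e 1 1) w0 ~= \<zero>" unfolding ep1 by blast
 define w where "w = act (e 1 1) w0"
 have w: "w : W" unfolding w_def using act(1) w0(1) one by simp
 have wR: "act x w \<in> carrier R" if "x : carrier S" for x by (rule WR[OF act(1)[OF that w]])
 have DS: "x : carrier S" if "x : e.Z" for x by (rule e.Z_closed[OF that])
 have "dimension d L ((%x. act x w) ` e.Z)"
 proof (rule dimension_transport[OF S(1) ring_axioms F(1) L d _ _ _ kp(1)])
  show "inj_on (%x. act x w) e.Z"
  proof (rule inj_onI)
   fix x y assume xy: "x : e.Z" "y : e.Z" "act x w = act y w"
   let ?u = "x \<ominus>\<^bsub>S\<^esub> y"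
   have uZ: "?u \<in> e.Z" using xy Ds(5,7) by (simp add: a_minus_def)
   note R = DS[OF xy(1)] DS[OF xy(2)] DS[OF uZ]
   have "x = ?u \<oplus>\<^bsub>S\<^esub> y" using R by (simp add: a_minus_def S.a_assoc S.l_neg)
   then have "act x w = act ?u w \<oplus> act y w" using act(2)[OF R(3,2) w] by simp
   then have u0: "act ?u w = \<zero>" using xy(3) wR[OF R(3)] wR[OF R(2)] add.l_cancel_one by simp
   have "?u = \<zero>\<^bsub>S\<^esub>"
   proof (rule ccontr)
    assume "?u ~= \<zero>\<^bsub>S\<^esub>"
    then obtain y where y: "y : e.Z" "y \<otimes>\<^bsub>S\<^esub> ?u = \<one>\<^bsub>S\<^esub>" "?u \<otimes>\<^bsub>S\<^esub> y = \<one>\<^bsub>S\<^esub>"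
     using division_ringE[OF div, of ?u] uZ by auto
    have "act \<one>\<^bsub>S\<^esub> w = act y (act ?u w)"
     using mult comm[OF DS[OF y(1)] R(3) _ w] y DS[OF y(1)] R(3) w by metis
    then show False using u0 act0'[OF DS[OF y(1)]] act(4)[OF w] w0(2) unfolding w_def by simp
   qed
   then show "x = y" using R by (simp add: S.r_right_minus_eq)
  qed
  show "act (x \<otimes>\<^bsub>S\<^esub> y) w = kp x ** act y w" if x: "x : F" and y: "y : e.Z" for x y
  proof -
   have xS: "x : carrier S" "x \<otimes>\<^bsub>S\<^esub> y = y \<otimes>\<^bsub>S\<^esub> x" using DS[OF subsetD[OF FD x]] S.central_comm[OF F(2) x DS[OF y]] by auto
   have "act (x \<otimes>\<^bsub>S\<^esub> y) w = act x (act y w)" using mult comm[OF xS(1) DS[OF y] xS(2) w] xS DS[OF y] w by metis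
   then show ?thesis using kp(2)[OF x act(1)[OF DS[OF y] w]] by simp
  qed
 qed (use wR DS act(2)[OF _ _ w] in auto)
 moreover have "(%x. act x w) ` e.Z <= ep 1 1 ` W"
 proof
  fix y assume "y : (%x. act x w) ` e.Z"
  then obtain x where x: "x : e.Z" "y = act x w" by blast
  have "y = act (e 1 1) (act x w0)"
   unfolding x(2) w_def by (rule comm[OF DS[OF x(1)] _ e.Z_comm[OF x(1) one one] w0(1)]) (use one in simp)
  then show "y : ep 1 1 ` W" unfolding ep1 using act(1)[OF DS[OF x(1)] w0(1)] by blast
 qed
 ultimately have "d \<le> c" using dimension_mono(1)[OF L c(1)] by blast
 moreover have "q * q * d = q * q * (c * c)" using qd unfolding c(2) by (simp add: ac_simps)
 then have "d = c * c" using q by simp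
 ultimately have "c = 1" using c1 by (cases c) auto
 then show ?thesis using that e c(2) by simp
qed

lemma subfield_division_ring:
 assumes "subfield F R"
 shows "division_ring (sub R F)" "center (sub R F) = F"
proof -
 interpret F: field "sub R F" using subfield_iff(2)[OF assms] .
 show "division_ring (sub R F)"
  unfolding division_ring_def using F.ring_axioms F.one_not_zero F.field_Units by blast
 show "center (sub R F) = F"
  using subfieldE(4)[OF assms] unfolding centralizer_sub by auto
qed

text \<open>A system of matrix units of the full size is a matrix form with the base field as its division algebra.\<close>

lemma full_units_split:
 assumes F: "subfield F R" "F <= center R" and n: "dimension (k * k) F (carrier R)" "1 \<le> k" and e: "matrix_units R k e"
 shows "matrix_form F R k F" "split_algebra F R" "algebra_iso F R (scalar_matrix k (sub R F)) (matrix_ring k (sub R F))"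
proof -
 interpret matrix_unit_system R k e by unfold_locales (rule e)
 have Z: "Z = F" by (rule full_matrix_units_commutant[OF F n])
 have "center R <= Z" unfolding centralizer_def by (auto simp: Z_iff)
 then have cen: "center R = F" using F(2) Z by blast
 have "algebra_over F R" unfolding algebra_over_def embedded_algebra_def using F ring_axioms by simp
 from matrix_formI[OF this cen n e] show mf: "matrix_form F R k F"
  unfolding Z using subfield_division_ring(1)[OF F(1)] by simp
 then show "split_algebra F R"
  unfolding split_algebra_def has_schur_index_def using dimension_one[OF F(1)] by (intro exI[of _ k] exI[of _ F]) simp
 show "algebra_iso F R (scalar_matrix k (sub R F)) (matrix_ring k (sub R F))" using mf unfolding matrix_form_def by simp
qed

end

section \<open>Splitting fields and centralizers\<close>

text \<open>\<open>A \<otimes>\<^sub>F L\<close> acts on \<open>A\<close> from the right by \<open>x \<mapsto> l x a\<close>. This action commutes with left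
 multiplication by the centralizer of \<open>L\<close>.\<close>

locale field_tensor = ring R for R :: "('a, 'b) ring_scheme" (structure) +
 fixes F L :: "'a set" and n :: nat
 assumes F: "subfield F R" and L: "subfield L R" and FL: "F <= L"
  and simple: "simple_ring" and cenF: "center R = F" and dim_n: "dimension n F (carrier R)"
begin

sublocale tensor R "sub R L" F
proof -
 interpret L: field "sub R L" by (rule subfield_iff(2)[OF L])
 show "tensor R (sub R L) F"
  by unfold_locales (use cenF subfield_division_ring(2)[OF L] FL in auto)
qed

lemma LR: "l : L ==> l : carrier R" using subfieldE(3)[OF L] by blast

definition ev :: "'a \<Rightarrow> ('a \<times> 'a) list \<Rightarrow> 'a" where
 "ev x xs = tensor_eval R (%a l. l ** x ** a) xs"

definition act :: "('a \<times> 'a) list set \<Rightarrow> 'a \<Rightarrow> 'a" where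
 "act t x = ev x (SOME xs. set xs <= car \<and> t = cls xs)"

lemma ev_closed: "x : carrier R ==> set xs <= car ==> ev x xs \<in> carrier R"
 unfolding ev_def by (rule eval_closed[OF ring_axioms]) (auto simp: LR)

lemma ev_cong: "x : carrier R ==> rel xs ys ==> ev x xs = ev x ys"
 unfolding ev_def
proof (rule eval_cong[OF ring_axioms])
 fix a b c assume x: "x : carrier R" and a: "a : carrier R" and b: "b : carrier (sub R L)" and c: "c : F"
 have R: "b : carrier R" "c : carrier R" using b LR F_carrier(1)[OF c] by auto
 have "b ** x ** (a ** c) = c ** (b ** x ** a)"
  using F_comm(1)[OF c, of "b ** x ** a"] x a R by (simp add: m_assoc)
 then show "b ** x ** (a ** c) = c \<otimes>\<^bsub>sub R L\<^esub> b ** x ** a" using x a R by (simp add: m_assoc)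
qed (auto simp: LR l_distr r_distr)

lemma act_cls:
 assumes "x : carrier R" "set xs <= car"
 shows "act (cls xs) x = ev x xs"
proof -
 let ?ys = "SOME ys. set ys <= car \<and> cls xs = cls ys"
 have "set ?ys <= car \<and> cls xs = cls ?ys" by (rule someI[of _ xs]) (use assms in simp)
 then have "rel xs ?ys" using cls_eq_iff[OF assms(2)] by simp
 then show ?thesis unfolding act_def using ev_cong[OF assms(1)] by simp
qed

lemma act_closed: "t : carrier T ==> x : carrier R ==> act t x \<in> carrier R"
 by (erule T_cases) (simp add: act_cls ev_closed)

lemma ev_add: "x : carrier R ==> y : carrier R ==> set xs <= car ==> ev (x \<oplus> y) xs = ev x xs \<oplus> ev y xs"
proof (induction xs)
 case (Cons p xs)
 then have p: "fst p \<in> carrier R" "snd p \<in> carrier R" using LR by auto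
 have e: "ev x xs \<in> carrier R" "ev y xs \<in> carrier R" using Cons ev_closed by auto
 have "a \<oplus> b \<oplus> (c \<oplus> d) = a \<oplus> c \<oplus> (b \<oplus> d)"
  if "a : carrier R" "b : carrier R" "c : carrier R" "d : carrier R" for a b c d
  using that by (simp add: a_ac)
 then show ?case using Cons p e by (simp add: ev_def l_distr r_distr)
qed (simp add: ev_def)

lemma act_add: "t : carrier T ==> x : carrier R ==> y : carrier R ==> act t (x \<oplus> y) = act t x \<oplus> act t y"
 by (erule T_cases) (simp add: act_cls ev_add)

lemma act_plus:
 assumes "s : carrier T" "t : carrier T" "x : carrier R"
 shows "act (s \<oplus>\<^bsub>T\<^esub> t) x = act s x \<oplus> act t x"
proof -
 obtain xs where xs: "set xs <= car" "s = cls xs" using assms(1) by (rule T_cases)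
 obtain ys where ys: "set ys <= car" "t = cls ys" using assms(2) by (rule T_cases)
 have "ev x (xs @ ys) = ev x xs \<oplus> ev x ys"
  unfolding ev_def by (rule eval_append[OF ring_axioms]) (use xs ys assms(3) LR in auto)
 then show ?thesis unfolding xs(2) ys(2) T_add[OF xs(1) ys(1)] using xs ys assms(3) by (simp add: act_cls)
qed

lemma ev_left:
 assumes "c : centralizer R L" "x : carrier R" "set xs <= car"
 shows "ev (c ** x) xs = c ** ev x xs"
 using assms(3)
proof (induction xs)
 case (Cons p xs)
 have c: "c : carrier R" using assms(1) by (rule centralizer_memD(2))
 have p: "fst p \<in> carrier R" "snd p \<in> L" "snd p \<in> carrier R" using Cons.prems LR by auto
 have e: "ev x xs \<in> carrier R" using Cons ev_closed assms by auto
 have "snd p ** (c ** x) ** fst p = c ** (snd p ** x ** fst p)"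
  using centralizer_memD(1)[OF assms(1) p(2)] c p assms(2) by (simp flip: m_assoc)
 then show ?case using Cons p e c assms(2) by (simp add: ev_def r_distr)
qed (use assms in \<open>simp add: ev_def centralizer_memD(2)\<close>)

lemma act_left:
 "c : centralizer R L ==> t : carrier T ==> x : carrier R ==> act t (c ** x) = c ** act t x"
 by (erule T_cases) (simp add: act_cls ev_left centralizer_memD(2))

lemma L_centralizer: "L <= centralizer R L"
 using subfieldE(4)[OF L] LR unfolding centralizer_def by auto

lemma ev_pm_single:
 assumes "x : carrier R" "p : car" "set ys <= car"
 shows "ev x (pm [p] ys) = ev (snd p ** x ** fst p) ys"
 using assms(3)
proof (induction ys)
 case (Cons q ys)
 have p: "fst p \<in> carrier R" "snd p \<in> L" "snd p \<in> carrier R"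
  and q: "fst q \<in> carrier R" "snd q \<in> L" "snd q \<in> carrier R" using Cons.prems assms(2) LR by auto
 have "snd p ** snd q ** x ** (fst p ** fst q) = snd q ** (snd p ** x ** fst p) ** fst q"
  using subfieldE(4)[OF L p(2) q(2)] p q assms(1) by (simp add: m_assoc)
 then show ?case using Cons by (simp add: ev_def pm_single)
qed (simp add: ev_def pm_single)

lemma ev_pm:
 assumes "x : carrier R" "set xs <= car" "set ys <= car"
 shows "ev x (pm xs ys) = ev (ev x xs) ys"
 using assms(2)
proof (induction xs)
 case Nil
 have "ev \<zero> ys = ev (\<zero> ** \<zero>) ys" by simp
 also have "... = \<zero> ** ev \<zero> ys"
  by (rule ev_left) (use L_centralizer subringE(2)[OF subfieldE(1)[OF L]] assms(3) in auto)
 finally have "ev \<zero> ys = \<zero>" using ev_closed[OF zero_closed assms(3)] by simp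
 then show ?case by (simp add: ev_def)
next
 case (Cons p xs)
 have p: "p : car" "set xs <= car" "fst p \<in> carrier R" "snd p \<in> carrier R" using Cons.prems LR by auto
 have "ev x (pm (p # xs) ys) = ev x (pm [p] ys) \<oplus> ev x (pm xs ys)"
  unfolding pm_Cons[of p xs ys] ev_def
  by (rule eval_append[OF ring_axioms]) (use p assms LR pm_closed[of "[p]" ys] pm_closed[of xs ys] in auto)
 also have "... = ev (snd p ** x ** fst p) ys \<oplus> ev (ev x xs) ys"
  using ev_pm_single[OF assms(1) p(1) assms(3)] Cons.IH[OF p(2)] by simp
 also have "... = ev (snd p ** x ** fst p \<oplus> ev x xs) ys"
  by (rule ev_add[symmetric]) (use p assms ev_closed in auto)
 finally show ?case by (simp add: ev_def)
qed

lemma act_mult: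
 assumes "s : carrier T" "t : carrier T" "x : carrier R"
 shows "act (s \<otimes>\<^bsub>T\<^esub> t) x = act t (act s x)"
proof -
 obtain xs where xs: "set xs <= car" "s = cls xs" using assms(1) by (rule T_cases)
 obtain ys where ys: "set ys <= car" "t = cls ys" using assms(2) by (rule T_cases)
 show ?thesis
  unfolding xs(2) ys(2) T_mult[OF xs(1) ys(1)]
  using xs ys assms(3) pm_closed[OF xs(1) ys(1)] by (simp add: act_cls ev_pm ev_closed)
qed

definition scal :: "'a \<Rightarrow> ('a \<times> 'a) list set" where "scal l = cls [(\<one>, l)]"

abbreviation F' where "F' \<equiv> scal ` L"

lemma scal_closed: "l : L ==> scal l \<in> carrier T"
 unfolding scal_def by (rule cls_closed) simp

lemma act_scal: "l : L ==> x : carrier R ==> act (scal l) x = l ** x"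
 unfolding scal_def using LR[of l] by (simp add: act_cls ev_def)

sublocale TR: ring T by (rule T_ring)

lemma act_one: "x : carrier R ==> act \<one>\<^bsub>T\<^esub> x = x"
 unfolding T_one using act_scal[of \<one> x] subringE(3)[OF subfieldE(1)[OF L]] by (simp add: scal_def)

lemma act_zero: "x : carrier R ==> act \<zero>\<^bsub>T\<^esub> x = \<zero>"
 unfolding T_zero by (simp add: act_cls ev_def)

lemma scal_hom: "ring_hom_ring (sub R L) T scal"
proof (rule ring_hom_ringI2)
 show "scal : ring_hom (sub R L) T"
 proof (rule ring_hom_memI)
  fix x y assume "x : carrier (sub R L)" "y : carrier (sub R L)"
  then have xy: "x : L" "y : L" by auto
  show "scal x \<in> carrier T" using scal_closed xy by simp
  show "scal (x \<otimes>\<^bsub>sub R L\<^esub> y) = scal x \<otimes>\<^bsub>T\<^esub> scal y"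
   unfolding scal_def using xy by (subst T_mult) (auto simp: pm_single)
  have "rel [(\<one>, x \<oplus>\<^bsub>sub R L\<^esub> y)] [(\<one>, x), (\<one>, y)]" by (rule t_add_r) (use xy in auto)
  then show "scal (x \<oplus>\<^bsub>sub R L\<^esub> y) = scal x \<oplus>\<^bsub>T\<^esub> scal y"
   unfolding scal_def using xy subringE(7)[OF subfieldE(1)[OF L] xy]
   by (subst T_add) (auto simp: cls_eq_iff)
 next
  show "scal \<one>\<^bsub>sub R L\<^esub> = \<one>\<^bsub>T\<^esub>" unfolding scal_def T_one ..
 qed
qed (use B.ring_axioms TR.ring_axioms in auto)

lemma scal_inj: "inj_on scal L"
proof (rule inj_onI)
 fix x y assume "x : L" "y : L" "scal x = scal y"
 then show "x = y" by (metis LR act_scal one_closed r_one)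
qed

lemma scal_simps:
 assumes "x : L" "y : L"
 shows "scal (x ** y) = scal x \<otimes>\<^bsub>T\<^esub> scal y" "scal (x \<oplus> y) = scal x \<oplus>\<^bsub>T\<^esub> scal y"
  "scal \<one> = \<one>\<^bsub>T\<^esub>" "scal \<zero> = \<zero>\<^bsub>T\<^esub>"
proof -
 interpret h: ring_hom_ring "sub R L" T scal by (rule scal_hom)
 show "scal (x ** y) = scal x \<otimes>\<^bsub>T\<^esub> scal y" "scal (x \<oplus> y) = scal x \<oplus>\<^bsub>T\<^esub> scal y"
  "scal \<one> = \<one>\<^bsub>T\<^esub>" "scal \<zero> = \<zero>\<^bsub>T\<^esub>"
  using h.hom_mult[of x y] h.hom_add[of x y] h.hom_one h.hom_zero assms by auto
qed

lemma F'_subfield: "subfield F' T" and F'_center: "F' <= center T"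
proof -
 interpret h: ring_hom_ring "sub R L" T scal by (rule scal_hom)
 have "\<one>\<^bsub>T\<^esub> ~= \<zero>\<^bsub>T\<^esub>"
  using act_one[OF one_closed] act_zero[OF one_closed] subfieldE(6)[OF L] by auto
 moreover have "subfield L (sub R L)"
  using field.carrier_is_subfield[OF subfield_iff(2)[OF L]] by simp
 ultimately show "subfield F' T" using h.img_is_subfield by blast
 show "F' <= center T"
 proof
  fix f assume "f : F'"
  then obtain l where l: "l : L" "f = scal l" by blast
  have o: "set [(\<one>, l)] <= car" using l by simp
  have "f \<otimes>\<^bsub>T\<^esub> t = t \<otimes>\<^bsub>T\<^esub> f" if t: "t : carrier T" for t
  proof -
   obtain xs where xs: "set xs <= car" "t = cls xs" using t by (rule T_cases)
   have "pm [(\<one>, l)] xs = pm xs [(\<one>, l)]"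
    unfolding pm_single pm_single_right
   proof (rule map_cong[OF refl])
    fix p assume "p : set xs"
    then have "fst p \<in> carrier R" "snd p \<in> L" using xs by auto
    then show "(fst (\<one>, l) ** fst p, snd (\<one>, l) \<otimes>\<^bsub>sub R L\<^esub> snd p) = (fst p ** fst (\<one>, l), snd p \<otimes>\<^bsub>sub R L\<^esub> snd (\<one>, l))"
     using subfieldE(4)[OF L l(1)] by simp
   qed
   then show ?thesis unfolding l(2) scal_def xs(2) T_mult[OF o xs(1)] T_mult[OF xs(1) o] by simp
  qed
  then show "f : center T" unfolding centralizer_def using scal_closed l by auto
 qed
qed

lemma act_sum:
 assumes "!!i. i \<in> I ==> f i \<in> carrier T" "x : carrier R"
 shows "act (\<Oplus>\<^bsub>T\<^esub>i\<in>I. f i) x = (\<Oplus>i\<in>I. act (f i) x)"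
 by (rule finsum_additive(2)[where S = "carrier T" and h = "%t. act t x"])
  (use assms TR.abelian_monoid_axioms abelian_monoid_axioms act_closed act_zero act_plus in auto)

text \<open>By the independence of multiplications, the action is faithful and the tensors of an
 \<open>F\<close>-basis of \<open>A\<close> with \<open>1\<close> are a basis over \<open>L\<close>.\<close>

lemma T_dimension_faithful:
 shows "TR.dimension n F' (carrier T)"
  and "!!t y. t \<in> carrier T ==> y : carrier R ==> y ~= \<zero> ==>
   (!!x. x \<in> carrier R ==> act t (y ** x) = \<zero>) ==> t = \<zero>\<^bsub>T\<^esub>"
proof -
 obtain a where a: "a : {1..n} \<rightarrow> carrier R" "lin_indep F {1..n} a" "lin_span F {1..n} a = carrier R"
  using dimension_basis[OF F dim_n] by blast
 note aR = funcset_mem[OF a(1)]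
 define b where "b k = cls [(a k, \<one>)]" for k
 have o: "\<one> \<in> L" by (rule subringE(3)[OF subfieldE(1)[OF L]])
 have b: "b k \<in> carrier T" if "k : {1..n}" for k
  unfolding b_def by (rule cls_closed) (use aR[OF that] o in simp)
 have fb: "scal l \<otimes>\<^bsub>T\<^esub> b k = cls [(a k, l)]" if "l : L" "k : {1..n}" for l k
  unfolding scal_def b_def using that aR[OF that(2)] o LR[OF that(1)] by (subst T_mult) (auto simp: pm_single)
 have zero_coeffs: "l k = \<zero>"
  if l: "!!k. k \<in> {1..n} ==> l k \<in> L" and y: "y : carrier R" "y ~= \<zero>"
   and z: "!!x. x \<in> carrier R ==> act (\<Oplus>\<^bsub>T\<^esub>k\<in>{1..n}. scal (l k) \<otimes>\<^bsub>T\<^esub> b k) (y ** x) = \<zero>" and k: "k : {1..n}" for l y k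
 proof -
  have "\<forall>k\<in>{1..n}. l k ** y = \<zero>"
  proof (rule multiplications_independent[OF simple F cenF _ a(1,2)])
   fix x assume x: "x : carrier R"
   have "(\<Oplus>j\<in>{1..n}. l j ** y ** x ** a j) = (\<Oplus>j\<in>{1..n}. act (scal (l j) \<otimes>\<^bsub>T\<^esub> b j) (y ** x))"
   proof (rule finsum_cong')
    fix j assume j: "j : {1..n}"
    show "l j ** y ** x ** a j = act (scal (l j) \<otimes>\<^bsub>T\<^esub> b j) (y ** x)"
     unfolding fb[OF l[OF j] j] using x y(1) aR[OF j] l[OF j] LR[OF l[OF j]] by (simp add: act_cls ev_def m_assoc)
   qed (use act_closed x y scal_closed l b in auto)
   also have "... = act (\<Oplus>\<^bsub>T\<^esub>k\<in>{1..n}. scal (l k) \<otimes>\<^bsub>T\<^esub> b k) (y ** x)"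
    by (rule act_sum[symmetric]) (use x y scal_closed l b in auto)
   finally show "(\<Oplus>j\<in>{1..n}. l j ** y ** x ** a j) = \<zero>" using z[OF x] by simp
  qed (use LR[OF l] y in auto)
  then have "l k ** y = \<zero>" using k by blast
  show "l k = \<zero>"
  proof (rule ccontr)
   assume "l k ~= \<zero>"
   then have i: "inv (l k) \<in> L" "inv (l k) ** l k = \<one>" using subfield_m_inv[OF L, of "l k"] l[OF k] by auto
   have "y = inv (l k) ** (l k ** y)" using i LR[OF i(1)] LR[OF l[OF k]] y(1) by (simp flip: m_assoc)
   then show False using \<open>l k ** y = \<zero>\<close> LR[OF i(1)] y(2) by simp
  qed
 qed
 have nz: "\<one> ~= \<zero>" using simple unfolding simple_ring_def by simp
 have indep: "TR.lin_indep F' {1..n} b"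
  unfolding TR.lin_indep_def
 proof (intro ballI impI)
  fix f i assume f: "f : {1..n} \<rightarrow> F'" and s: "(\<Oplus>\<^bsub>T\<^esub>k\<in>{1..n}. f k \<otimes>\<^bsub>T\<^esub> b k) = \<zero>\<^bsub>T\<^esub>" and i: "i : {1..n}"
  have "\<forall>k\<in>{1..n}. \<exists>l\<in>L. f k = scal l" using funcset_mem[OF f] by blast
  then obtain l where l: "!!k. k \<in> {1..n} ==> l k \<in> L" "!!k. k \<in> {1..n} ==> f k = scal (l k)" by metis
  have "(\<Oplus>\<^bsub>T\<^esub>k\<in>{1..n}. scal (l k) \<otimes>\<^bsub>T\<^esub> b k) = (\<Oplus>\<^bsub>T\<^esub>k\<in>{1..n}. f k \<otimes>\<^bsub>T\<^esub> b k)"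
   by (rule TR.finsum_cong') (use l scal_closed b in auto)
  then have "l i = \<zero>" using zero_coeffs[of l \<one> i, OF l(1) one_closed nz _ i] s act_zero by simp
  then show "f i = \<zero>\<^bsub>T\<^esub>" using l(2)[OF i] i scal_simps(4)[OF o o] by simp
 qed
 have dim: "TR.dimension n F' (TR.lin_span F' {1..n} b)"
  using TR.dimension_lin_span[OF F'_subfield _ _ indep] funcsetI[of "{1..n}" b] b by simp
 note sp = TR.space_subgroup_props[OF F'_subfield dim]
 have gen: "cls xs \<in> TR.lin_span F' {1..n} b" if "set xs <= car" for xs
  using that
 proof (induction xs)
  case Nil
  then show ?case using sp(2) T_zero by simp
 next
  case (Cons p xs)
  have p: "fst p \<in> carrier R" "snd p \<in> L" using Cons.prems by (simp_all add: mem_Times_iff)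
  obtain c where c: "c : {1..n} \<rightarrow> F" "fst p = (\<Oplus>k\<in>{1..n}. c k ** a k)"
   using p(1) lin_spanE[of "fst p" F "{1..n}" a] unfolding a(3) by blast
  note cF = funcset_mem[OF c(1)]
  have cL: "!!k. k \<in> {1..n} ==> c k \<in> L" using cF FL by blast
  define h where "h x = cls [(x, snd p)]" for x
  have h: "h x \<in> carrier T" if "x : carrier R" for x
   unfolding h_def by (rule cls_closed) (use that p in simp)
  have hadd: "h (x \<oplus> y) = h x \<oplus>\<^bsub>T\<^esub> h y" if "x : carrier R" "y : carrier R" for x y
  proof -
   have "rel [(x \<oplus> y, snd p)] [(x, snd p), (y, snd p)]" by (rule t_add_l) (use that p in auto)
   then show ?thesis unfolding h_def using that p by (subst T_add) (auto simp: cls_eq_iff)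
  qed
  have h0: "h \<zero> = \<zero>\<^bsub>T\<^esub>"
   by (rule additive_zero[where V = "carrier R" and R = R and R' = T])
    (use ring_axioms TR.ring_axioms h hadd in auto)
  have "h (fst p) = (\<Oplus>\<^bsub>T\<^esub>k\<in>{1..n}. h (c k ** a k))"
   unfolding c(2) by (rule finsum_additive(2)[where S = "carrier R"])
    (use abelian_monoid_axioms TR.abelian_monoid_axioms h h0 hadd aR LR[OF cL] in auto)
  also have "... = (\<Oplus>\<^bsub>T\<^esub>k\<in>{1..n}. scal (c k ** snd p) \<otimes>\<^bsub>T\<^esub> b k)"
  proof (rule TR.finsum_cong')
   fix k assume k: "k : {1..n}"
   have cp: "c k ** snd p \<in> L" using cL[OF k] p(2) subringE(6)[OF subfieldE(1)[OF L]] by simp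
   have "rel [(a k ** c k, snd p)] [(a k, c k \<otimes>\<^bsub>sub R L\<^esub> snd p)]"
    by (rule t_balanced) (use aR[OF k] p cF[OF k] in auto)
   then have "cls [(a k ** c k, snd p)] = cls [(a k, c k ** snd p)]"
    using aR[OF k] LR[OF cL[OF k]] p by (subst cls_eq_iff) auto
   then show "h (c k ** a k) = scal (c k ** snd p) \<otimes>\<^bsub>T\<^esub> b k"
    unfolding fb[OF cp k] h_def using F_comm(1)[OF cF[OF k] aR[OF k]] by simp
  next
   show "(%k. scal (c k ** snd p) \<otimes>\<^bsub>T\<^esub> b k) \<in> {1..n} \<rightarrow> carrier T"
    using scal_closed[OF subringE(6)[OF subfieldE(1)[OF L] cL p(2)]] b by auto
  qed simp
  finally have "h (fst p) \<in> TR.lin_span F' {1..n} b"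
   by (intro TR.lin_spanI[of "%k. scal (c k ** snd p)"])
    (use subringE(6)[OF subfieldE(1)[OF L] cL p(2)] in auto)
  moreover have "cls (p # xs) = h (fst p) \<oplus>\<^bsub>T\<^esub> cls xs"
   unfolding h_def using p Cons.prems by (subst T_add) auto
  ultimately show ?case using sp(3) Cons by simp
 qed
 have span: "TR.lin_span F' {1..n} b = carrier T"
 proof
  show "carrier T <= TR.lin_span F' {1..n} b" using gen T_cases by blast
 qed (rule sp(1))
 show "TR.dimension n F' (carrier T)" using dim unfolding span .
 fix t y assume t: "t : carrier T" and y: "y : carrier R" "y ~= \<zero>" and z: "!!x. x \<in> carrier R ==> act t (y ** x) = \<zero>"
 obtain f where f: "f : {1..n} \<rightarrow> F'" "t = (\<Oplus>\<^bsub>T\<^esub>k\<in>{1..n}. f k \<otimes>\<^bsub>T\<^esub> b k)"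
  using t TR.lin_spanE[of t F' "{1..n}" b] unfolding span by blast
 have "\<forall>k\<in>{1..n}. \<exists>l\<in>L. f k = scal l" using funcset_mem[OF f(1)] by blast
 then obtain l where l: "!!k. k \<in> {1..n} ==> l k \<in> L" "!!k. k \<in> {1..n} ==> f k = scal (l k)" by metis
 have "t = (\<Oplus>\<^bsub>T\<^esub>k\<in>{1..n}. scal (l k) \<otimes>\<^bsub>T\<^esub> b k)"
  unfolding f(2) by (rule TR.finsum_cong') (use l scal_closed b in auto)
 then have l0: "l k = \<zero>" if "k : {1..n}" for k using zero_coeffs[of l y k, OF l(1) y _ that] z by simp
 show "t = \<zero>\<^bsub>T\<^esub>"
  unfolding \<open>t = (\<Oplus>\<^bsub>T\<^esub>k\<in>{1..n}. scal (l k) \<otimes>\<^bsub>T\<^esub> b k)\<close>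
 proof (rule TR.add.finprod_one_eqI)
  fix k assume k: "k : {1..n}"
  show "scal (l k) \<otimes>\<^bsub>T\<^esub> b k = \<zero>\<^bsub>T\<^esub>" using l0[OF k] scal_simps(4)[OF o o] b[OF k] by simp
 qed
qed

text \<open>If \<open>s\<close> is not zero, it sends some \<open>x\<close> to \<open>y \<noteq> 0\<close>. If moreover \<open>s a t = 0\<close> for all \<open>a\<close>, then \<open>t\<close> kills \<open>y A\<close>
 and so vanishes by the faithfulness just shown.\<close>

lemma T_prime: "prime_ring T"
 unfolding prime_ring_def
proof (intro conjI ballI impI)
 have nz: "\<one> ~= \<zero>" using simple unfolding simple_ring_def by simp
 then show "\<one>\<^bsub>T\<^esub> ~= \<zero>\<^bsub>T\<^esub>" using act_one[of \<one>] act_zero[of \<one>] by auto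
 fix s t assume s: "s : carrier T" and t: "t : carrier T"
  and z: "\<forall>a\<in>carrier T. s \<otimes>\<^bsub>T\<^esub> a \<otimes>\<^bsub>T\<^esub> t = \<zero>\<^bsub>T\<^esub>"
 show "s = \<zero>\<^bsub>T\<^esub> \<or> t = \<zero>\<^bsub>T\<^esub>"
 proof (cases "\<exists>x\<in>carrier R. act s x ~= \<zero>")
  case True
  then obtain x where x: "x : carrier R" "act s x ~= \<zero>" by blast
  have "t = \<zero>\<^bsub>T\<^esub>"
  proof (rule T_dimension_faithful(2)[OF t act_closed[OF s x(1)] x(2)])
   fix b assume b: "b : carrier R"
   have o: "\<one> \<in> L" by (rule subringE(3)[OF subfieldE(1)[OF L]])
   have c: "set [(b, \<one>)] <= car" "cls [(b, \<one>)] \<in> carrier T" using b o by auto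
   have "act s x ** b = act (s \<otimes>\<^bsub>T\<^esub> cls [(b, \<one>)]) x"
    unfolding act_mult[OF s c(2) x(1)] act_cls[OF act_closed[OF s x(1)] c(1)] ev_def
    using act_closed[OF s x(1)] b by simp
   then show "act t (act s x ** b) = \<zero>"
    using act_mult[OF TR.m_closed[OF s c(2)] t x(1)] z c(2) act_zero[OF x(1)] by simp
  qed
  then show ?thesis ..
 next
  case False
  then have "s = \<zero>\<^bsub>T\<^esub>" by (intro T_dimension_faithful(2)[OF s one_closed nz]) simp
  then show ?thesis ..
 qed
qed

lemma splits_iff: "splits F R (sub R L) \<longleftrightarrow> split_algebra F' T"
 unfolding splits_def scal_def by simp

text \<open>If \<open>L\<close> splits \<open>A\<close>, a rank one idempotent of \<open>A \<otimes>\<^sub>F L\<close> cuts out of \<open>A\<close> a module for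
 the centralizer of \<open>L\<close> of the right dimension.\<close>

lemma splits_imp_centralizer_units:
 assumes sp: "splits F R (sub R L)" and N: "n = N * N" "dimension (N * k) L (carrier R)" "0 < N" "1 \<le> k"
  and C: "dimension (k * k) L (centralizer R L)" "prime_ring (sub R (centralizer R L))"
 obtains e where "matrix_units (sub R (centralizer R L)) k e"
proof -
 let ?C = "centralizer R L"
 obtain m D where mf: "matrix_form F' T m D" and D: "TR.dimension 1 F' D"
  using sp unfolding splits_iff split_algebra_def has_schur_index_def by auto
 have m1: "1 \<le> m" using mf unfolding matrix_form_def by simp
 obtain e where e: "matrix_units T m e" and e': "!!d. TR.dimension d F' D ==> TR.dimension d F' (unit_commutant T m e)"
  by (rule TR.matrix_formE[OF mf]) (rule that)
 interpret e: matrix_unit_system T m e by unfold_locales (rule e)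
 have "TR.dimension (m * m * 1) F' (carrier T)"
  by (rule e.dimension_matrix[OF F'_subfield F'_center e'[OF D]])
 then have "m * m = N * N"
  using TR.dimension_is_inj[OF F'_subfield T_dimension_faithful(1)] N(1) by simp
 then have mN: "m = N" by (metis power2_eq_square power2_eq_imp_eq zero_le)
 have one: "1 : {1..m}" using m1 by simp
 have Csub: "subring ?C R" by (rule centralizer_subring) (use LR in blast)
 note Cs = subringE[OF Csub]
 have CR: "!!c. c \<in> ?C ==> c : carrier R" using Cs(1) by blast
 let ?W = "act (e 1 1) ` carrier R"
 have ein: "e i j \<in> carrier T" if "i : {1..m}" "j : {1..m}" for i j using e.e_closed[OF that] .
 obtain c where c: "dimension c L ?W" "N * k = m * c"
 proof (rule action_dimension[OF L N(2) m1, of "%i j. act (e j i)"])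
  fix i j v assume i: "i : {1..m}" and j: "j : {1..m}" and v: "v : carrier R"
  show "act (e j i) v \<in> carrier R" by (rule act_closed[OF ein[OF j i] v])
  show "act (e j i) (v \<oplus> w) = act (e j i) v \<oplus> act (e j i) w" if "w : carrier R" for w by (rule act_add[OF ein[OF j i] v that])
  show "act (e j i) (l ** v) = l ** act (e j i) v" if "l : L" for l
   by (rule act_left[OF subsetD[OF L_centralizer that] ein[OF j i] v])
  show "act (e j i) (act (e b a) v) = (if j = a then act (e b i) v else \<zero>)" if "a : {1..m}" "b : {1..m}" for a b
   using act_mult[OF ein[OF that(2,1)] ein[OF j i] v] e.e_mult[OF that(2,1) j i] act_zero[OF v] by (cases "j = a") auto
 next
  fix v assume v: "v : carrier R"
  show "(\<Oplus>i\<in>{1..m}. act (e i i) v) = v"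
   using act_sum[of "{1..m}" "%i. e i i" v] ein v act_one[OF v] unfolding e.e_sum by simp
 qed
 have W: "dimension k L ?W" using c N(3) mN by simp
 interpret C: ring "sub R ?C" by (rule subring_is_ring[OF Csub])
 have WR: "w : carrier R" if "w : ?W" for w using that act_closed[OF ein[OF one one]] by auto
 have LC: "subfield L (sub R ?C)" "L <= center (sub R ?C)" "C.dimension (k * k) L (carrier (sub R ?C))"
  using subfield_sub[OF Csub L_centralizer] L L_centralizer dimension_sub[OF Csub L_centralizer order_refl L] C(1)
  unfolding centralizer_sub centralizer_def by auto
 show ?thesis
 proof (rule faithful_module_units[OF C.ring_axioms C(2) LC L W N(4), where act = "(\<otimes>)" and kp = id])
  fix s w assume s: "s : carrier (sub R ?C)" and w: "w : ?W"
  obtain x where x: "x : carrier R" "w = act (e 1 1) x" using w by blast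
  have "s ** w = act (e 1 1) (s ** x)" unfolding x(2) by (rule act_left[symmetric]) (use s ein one x in auto)
  then show "s ** w \<in> ?W" using x CR[of s] s by simp
 next
  show "(\<forall>s\<in>carrier (sub R ?C). \<forall>t\<in>carrier (sub R ?C). \<forall>w\<in>?W. s \<otimes>\<^bsub>sub R ?C\<^esub> t ** w = s ** (t ** w)) \<or>
   (\<forall>s\<in>carrier (sub R ?C). \<forall>t\<in>carrier (sub R ?C). \<forall>w\<in>?W. s \<otimes>\<^bsub>sub R ?C\<^esub> t ** w = t ** (s ** w))"
   using CR WR m_assoc by (intro disjI1 ballI) simp
 qed (use CR WR in \<open>auto simp: l_distr r_distr intro: that\<close>)
qed

text \<open>Conversely, matrix units in the centralizer of \<open>L\<close> cut out of \<open>A\<close> a module for \<open>A \<otimes>\<^sub>F L\<close>.\<close>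

lemma centralizer_units_imp_splits:
 assumes f: "matrix_units R k f" "!!i j. i \<in> {1..k} ==> j : {1..k} ==> f i j \<in> centralizer R L"
  and N: "n = N * N" "dimension (N * k) L (carrier R)" "0 < N" "0 < k"
 shows "splits F R (sub R L)"
proof -
 interpret f: matrix_unit_system R k f by unfold_locales (rule f(1))
 have one: "1 : {1..k}" and k: "1 \<le> k" and N1: "1 \<le> N" using N(3,4) by auto
 have fR: "f i j \<in> carrier R" if "i : {1..k}" "j : {1..k}" for i j using f.e_closed[OF that] .
 let ?W = "(%w. f 1 1 ** w) ` carrier R"
 obtain c where c: "dimension c L ?W" "N * k = k * c"
 proof (rule action_dimension[OF L N(2) k, of "%i j w. f i j ** w"])
  fix i j assume ij: "i : {1..k}" "j : {1..k}"
  fix v assume v: "v : carrier R"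
  show "f i j ** (l ** v) = l ** (f i j ** v)" if l: "l : L" for l
   using centralizer_memD(1)[OF f(2)[OF ij] l] fR[OF ij] LR[OF l] v by (simp flip: m_assoc)
 next
  fix v assume v: "v : carrier R"
  show "(\<Oplus>i\<in>{1..k}. f i i ** v) = v" using finsum_rmult[of v "{1..k}" "%i. f i i"] v fR f.e_sum by simp
 qed (use fR f.e_mult_left in \<open>auto simp: r_distr\<close>)
 have W: "dimension N L ?W" using c N(4) by simp
 have WR: "w : carrier R" if "w : ?W" for w using that fR[OF one one] by auto
 have TT: "TR.dimension (N * N) F' (carrier T)" using T_dimension_faithful(1) N(1) by simp
 obtain e where e: "matrix_units T N e"
 proof (rule faithful_module_units[OF T_ring T_prime F'_subfield F'_center TT L W N1,
    where act = act and kp = "inv_into L scal"])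
  fix s w assume s: "s : carrier T" and w: "w : ?W"
  obtain x where x: "x : carrier R" "w = f 1 1 ** x" using w by blast
  have "act s w = f 1 1 ** act s x" unfolding x(2) by (rule act_left[OF f(2)[OF one one] s x(1)])
  then show "act s w \<in> ?W" using act_closed[OF s x(1)] by simp
 next
  show "inv_into L scal ` F' = L" using inv_into_image_cancel[OF scal_inj order_refl] .
  show "act c w = inv_into L scal c ** w" if c: "c : F'" and w: "w : ?W" for c w
  proof -
   obtain l where l: "l : L" "c = scal l" using c by blast
   then show ?thesis using inv_into_f_f[OF scal_inj l(1)] act_scal[OF l(1) WR[OF w]] by simp
  qed
  show "(\<forall>s\<in>carrier T. \<forall>t\<in>carrier T. \<forall>w\<in>?W. act (s \<otimes>\<^bsub>T\<^esub> t) w = act s (act t w)) \<or>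
   (\<forall>s\<in>carrier T. \<forall>t\<in>carrier T. \<forall>w\<in>?W. act (s \<otimes>\<^bsub>T\<^esub> t) w = act t (act s w))"
   using act_mult WR by (intro disjI2 ballI) simp
 qed (use act_plus act_add act_one WR in \<open>auto intro: that\<close>)
 show ?thesis unfolding splits_iff by (rule TR.full_units_split(2)[OF F'_subfield F'_center TT N1 e])
qed

end

section \<open>Splitting off a system of matrix units\<close>

context matrix_unit_system
begin

text \<open>Every tensor in \<open>B \<otimes>\<^sub>F Z\<close> is a combination \<open>\<Sum> e\<^sub>i\<^sub>j \<otimes> c\<^sub>i\<^sub>j\<close>, and
 multiplication sends it to the element of \<open>R\<close> with coefficients \<open>c\<^sub>i\<^sub>j\<close>.\<close>

lemma tensor_decomposition:
 assumes B: "subring B R" and eB: "!!i j. i \<in> {1..m} ==> j : {1..m} ==> e i j \<in> B"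
  and coefB: "!!b i j. b \<in> B ==> i : {1..m} ==> j : {1..m} ==> coef b i j \<in> F"
  and F: "F <= center R" "F <= B" and ZB: "centralizer R B = Z"
 shows "algebra_iso F R (%c. pure_tensor F (sub R B) (sub R Z) c \<one>) (tensor_product F (sub R B) (sub R Z))"
proof -
 interpret SB: ring "sub R B" by (rule subring_is_ring[OF B])
 interpret SZ: ring "sub R Z" by (rule subring_is_ring[OF Z_subring])
 have BR: "b : carrier R" if "b : B" for b using subringE(1)[OF B] that by blast
 have FZ: "F <= Z" using F BR unfolding centralizer_def unit_commutant_def by auto
 interpret tensor "sub R B" "sub R Z" F
 proof unfold_locales
  show "F <= center (sub R B)" using F BR unfolding centralizer_def by auto
  show "F <= center (sub R Z)" using F(1) FZ Z_closed unfolding centralizer_def by auto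
 qed
 interpret TR: ring T by (rule T_ring)
 note Bs = subringE[OF B] and Zs = subringE[OF Z_subring]
 have BZ: "b ** c = c ** b" if "b : B" "c : Z" for b c
  using centralizer_memD(1)[of c R B b] that unfolding ZB by simp
 let ?I = "{1..m} \<times> {1..m}"
 let ?e = "%p. e (fst p) (snd p)"
 let ?mu = "tensor_eval R (\<otimes>)"
 define ps where "ps t = ?mu (SOME xs. set xs <= car \<and> t = cls xs)" for t
 have mu_closed: "?mu xs \<in> carrier R" if "set xs <= car" for xs
  by (rule eval_closed[OF ring_axioms _ that]) (simp add: BR Z_closed)
 have ps: "ps (cls xs) = ?mu xs" if xs: "set xs <= car" for xs
 proof -
  let ?ys = "SOME ys. set ys <= car \<and> cls xs = cls ys"
  have "set ?ys <= car \<and> cls xs = cls ?ys" by (rule someI[of _ xs]) (use xs in simp)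
  then have r: "rel xs ?ys" using cls_eq_iff[OF xs] by simp
  have "?mu xs = ?mu ?ys"
   by (rule eval_cong[OF ring_axioms _ _ _ _ r])
    (simp_all add: BR Z_closed l_distr r_distr m_assoc F_carrier(1)[simplified] F_carrier(2)[simplified])
  then show ?thesis unfolding ps_def by simp
 qed
 have mu_pm1: "?mu (pm [p] ys) = fst p ** snd p ** ?mu ys" if p: "p : car" and ys: "set ys <= car" for p ys
  using ys
 proof (induction ys)
  case Nil
  show ?case using p BR Z_closed by (auto simp: pm_single)
 next
  case (Cons q ys)
  have R: "fst p \<in> carrier R" "snd p \<in> carrier R" "fst q \<in> carrier R" "snd q \<in> carrier R"
   using p Cons.prems BR Z_closed by auto
  have sw: "fst q ** snd p = snd p ** fst q" by (rule BZ) (use p Cons.prems in auto)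
  have "fst p ** fst q ** (snd p ** snd q) = fst p ** (fst q ** snd p) ** snd q"
   using R by (simp add: m_assoc)
  also have "... = fst p ** snd p ** (fst q ** snd q)" unfolding sw using R by (simp add: m_assoc)
  finally have "fst p ** fst q ** (snd p ** snd q) = fst p ** snd p ** (fst q ** snd q)" .
  then show ?case using Cons R mu_closed[of ys] by (simp add: pm_single r_distr)
 qed
 have mu_append: "?mu (xs @ ys) = ?mu xs \<oplus> ?mu ys" if "set xs <= car" "set ys <= car" for xs ys
  by (rule eval_append[OF ring_axioms _ that]) (simp add: BR Z_closed)
 have mu_pm: "?mu (pm xs ys) = ?mu xs ** ?mu ys" if xs: "set xs <= car" and ys: "set ys <= car" for xs ys
  using xs
 proof (induction xs)
  case (Cons p xs)
  have p: "p : car" "set xs <= car" "fst p ** snd p \<in> carrier R" using Cons.prems BR Z_closed by auto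
  have s: "set [p] <= car" using p(1) by simp
  have "?mu (pm (p # xs) ys) = ?mu (pm [p] ys) \<oplus> ?mu (pm xs ys)"
   unfolding pm_Cons[of p xs] by (rule mu_append[OF pm_closed[OF s ys] pm_closed[OF p(2) ys]])
  then show ?case
   using Cons.IH[OF p(2)] mu_pm1[OF p(1) ys] p(3) mu_closed[OF p(2)] mu_closed[OF ys] by (simp add: l_distr)
 qed (simp add: mu_closed[OF ys])
 have ps_add: "ps (s \<oplus>\<^bsub>T\<^esub> t) = ps s \<oplus> ps t" and ps_mult: "ps (s \<otimes>\<^bsub>T\<^esub> t) = ps s ** ps t"
  and ps_closed: "ps s \<in> carrier R" if st: "s : carrier T" "t : carrier T" for s t
 proof -
  obtain xs where xs: "set xs <= car" "s = cls xs" using st(1) by (rule T_cases)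
  obtain ys where ys: "set ys <= car" "t = cls ys" using st(2) by (rule T_cases)
  have "set (xs @ ys) <= car" using xs ys by simp
  then show "ps (s \<oplus>\<^bsub>T\<^esub> t) = ps s \<oplus> ps t"
   unfolding xs(2) ys(2) T_add[OF xs(1) ys(1)] ps[OF xs(1)] ps[OF ys(1)] using ps mu_append[OF xs(1) ys(1)] by simp
  show "ps (s \<otimes>\<^bsub>T\<^esub> t) = ps s ** ps t"
   unfolding xs(2) ys(2) T_mult[OF xs(1) ys(1)] ps[OF xs(1)] ps[OF ys(1)] ps[OF pm_closed[OF xs(1) ys(1)]]
   by (rule mu_pm[OF xs(1) ys(1)])
  show "ps s \<in> carrier R" unfolding xs(2) ps[OF xs(1)] by (rule mu_closed[OF xs(1)])
 qed
 have ps_0: "ps \<zero>\<^bsub>T\<^esub> = \<zero>" unfolding T_zero using ps[of "[]"] by simp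
 have ps_pure: "ps (cls [(b, c)]) = b ** c" if "b : B" "c : Z" for b c
  using ps[of "[(b, c)]"] that BR Z_closed by simp
 define nf where "nf c = (\<Oplus>\<^bsub>T\<^esub>p\<in>?I. cls [(?e p, c p)])" for c
 have t_closed: "cls [(b, c)] \<in> carrier T" if "b : B" "c : Z" for b c by (rule cls_closed) (use that in simp)
 have eI: "?e p \<in> B" if "p : ?I" for p using eB that by auto
 have nf_add: "nf c \<oplus>\<^bsub>T\<^esub> nf d = nf (%p. c p \<oplus> d p)" if c: "c : ?I \<rightarrow> Z" and d: "d : ?I \<rightarrow> Z" for c d
 proof -
  note cZ = funcset_mem[OF c] and dZ = funcset_mem[OF d]
  have "nf (%p. c p \<oplus> d p) = (\<Oplus>\<^bsub>T\<^esub>p\<in>?I. cls [(?e p, c p)] \<oplus>\<^bsub>T\<^esub> cls [(?e p, d p)])"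
   unfolding nf_def
  proof (rule TR.finsum_cong')
   fix p assume p: "p : ?I"
   have "rel [(?e p, c p \<oplus>\<^bsub>sub R Z\<^esub> d p)] [(?e p, c p), (?e p, d p)]"
    by (rule t_add_r) (use eI[OF p] cZ[OF p] dZ[OF p] in simp_all)
   then show "cls [(?e p, c p \<oplus> d p)] = cls [(?e p, c p)] \<oplus>\<^bsub>T\<^esub> cls [(?e p, d p)]"
    using eI[OF p] cZ[OF p] dZ[OF p] Zs(7) by (simp add: T_add cls_eq_iff)
  qed (use t_closed[OF eI cZ] t_closed[OF eI dZ] in \<open>auto simp: Pi_iff\<close>)
  also have "... = nf c \<oplus>\<^bsub>T\<^esub> nf d"
   unfolding nf_def by (rule TR.finsum_addf) (use t_closed[OF eI cZ] t_closed[OF eI dZ] in \<open>auto simp: Pi_iff\<close>)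
  finally show ?thesis by simp
 qed
 have nf_pure: "cls [(b, z)] = nf (%p. coef b (fst p) (snd p) ** z)" if b: "b : B" and z: "z : Z" for b z
 proof -
  have cF: "coef b (fst p) (snd p) \<in> F" if "p : ?I" for p using coefB[OF b] that by auto
  have cB: "?e p ** coef b (fst p) (snd p) \<in> B" if "p : ?I" for p
   by (rule Bs(6)[OF eI[OF that] subsetD[OF F(2) cF[OF that]]])
  let ?h = "%x. cls [(x, z)]"
  have hadd: "?h (x \<oplus> y) = ?h x \<oplus>\<^bsub>T\<^esub> ?h y" if "x : B" "y : B" for x y
  proof -
   have "rel [(x \<oplus>\<^bsub>sub R B\<^esub> y, z)] [(x, z), (y, z)]" by (rule t_add_l) (use that z in simp_all)
   then show ?thesis using that z Bs(7) by (simp add: T_add cls_eq_iff)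
  qed
  have h0: "?h \<zero> = \<zero>\<^bsub>T\<^esub>"
   by (rule additive_zero[where V = B and R = R and R' = T])
    (use ring_axioms TR.ring_axioms t_closed[OF _ z] hadd BR Bs(2) in auto)
  have "b = (\<Oplus>p\<in>?I. ?e p ** coef b (fst p) (snd p))"
   using finsum_Times[of "{1..m}" "{1..m}" "%i j. e i j ** coef b i j"] expansion[OF BR[OF b]] BR[OF b] by simp
  then have "?h b = ?h (\<Oplus>p\<in>?I. ?e p ** coef b (fst p) (snd p))" by simp
  also have "... = (\<Oplus>\<^bsub>T\<^esub>p\<in>?I. ?h (?e p ** coef b (fst p) (snd p)))"
   by (rule finsum_additive(2)[where S = B and h = ?h, OF abelian_monoid_axioms TR.abelian_monoid_axioms Bs(1,2,7)
     t_closed[OF _ z] h0 hadd cB])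
  also have "... = nf (%p. coef b (fst p) (snd p) ** z)"
   unfolding nf_def
  proof (rule TR.finsum_cong')
   fix p assume p: "p : ?I"
   have "rel [(?e p \<otimes>\<^bsub>sub R B\<^esub> coef b (fst p) (snd p), z)] [(?e p, coef b (fst p) (snd p) \<otimes>\<^bsub>sub R Z\<^esub> z)]"
    by (rule t_balanced) (use eI[OF p] cF[OF p] z in simp_all)
   then show "?h (?e p ** coef b (fst p) (snd p)) = cls [(?e p, coef b (fst p) (snd p) ** z)]"
    using cB[OF p] z by (simp add: cls_eq_iff)
  next
   show "(%p. cls [(?e p, coef b (fst p) (snd p) ** z)]) \<in> ?I \<rightarrow> carrier T"
    by (intro funcsetI t_closed[OF eI] Zs(6)[OF subsetD[OF FZ cF] z])
  qed simp
  finally show ?thesis .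
 qed
 have normal: "\<exists>c. c \<in> ?I \<rightarrow> Z \<and> cls xs = nf c" if "set xs <= car" for xs
  using that
 proof (induction xs)
  case Nil
  have "nf (%_. \<zero>) = \<zero>\<^bsub>T\<^esub>"
   unfolding nf_def
  proof (rule TR.add.finprod_one_eqI)
   fix p assume p: "p : ?I"
   have "rel [(?e p, \<zero>\<^bsub>sub R Z\<^esub>)] []" by (rule t_zero_r) (use eI[OF p] in simp)
   then show "cls [(?e p, \<zero>)] = \<zero>\<^bsub>T\<^esub>" unfolding T_zero using eI[OF p] Zs(2) by (simp add: cls_eq_iff)
  qed
  then show ?case unfolding T_zero using Zs(2) by (intro exI[of _ "%_. \<zero>"]) simp
 next
  case (Cons p xs)
  then obtain c where c: "c : ?I \<rightarrow> Z" "cls xs = nf c" by auto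
  have p: "fst p \<in> B" "snd p \<in> Z" "set xs <= car" using Cons.prems by (simp_all add: mem_Times_iff)
  let ?d = "%q. coef (fst p) (fst q) (snd q) ** snd p"
  have d: "?d \<in> ?I \<rightarrow> Z" by (intro funcsetI Zs(6)[OF _ p(2)] subsetD[OF FZ] coefB[OF p(1)]) auto
  have "cls (p # xs) = cls [p] \<oplus>\<^bsub>T\<^esub> cls xs" using p by (subst T_add) (auto simp: mem_Times_iff)
  also have "... = nf (%q. ?d q \<oplus> c q)"
   using nf_pure[OF p(1,2)] c(2) nf_add[OF d c(1)] by simp
  finally show ?case using funcset_mem[OF d] funcset_mem[OF c(1)] Zs(7) by (intro exI[of _ "%q. ?d q \<oplus> c q"]) auto
 qed
 have ps_nf: "ps (nf c) = (\<Oplus>i\<in>{1..m}. \<Oplus>j\<in>{1..m}. e i j ** c (i, j))" if c: "c : ?I \<rightarrow> Z" for c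
 proof -
  note cZ = funcset_mem[OF c]
  have "ps (nf c) = (\<Oplus>p\<in>?I. ps (cls [(?e p, c p)]))"
   unfolding nf_def
   by (rule finsum_additive(2)[where S = "carrier T" and h = ps, OF TR.abelian_monoid_axioms abelian_monoid_axioms])
    (use ps_closed ps_0 ps_add t_closed[OF eI cZ] in auto)
  also have "... = (\<Oplus>p\<in>?I. ?e p ** c (fst p, snd p))"
   by (rule finsum_cong') (use ps_pure[OF eI cZ] BR[OF eI] Z_closed[OF cZ] in auto)
  also have "... = (\<Oplus>i\<in>{1..m}. \<Oplus>j\<in>{1..m}. e i j ** c (i, j))"
   by (rule finsum_Times) (use Z_closed[OF cZ] in auto)
  finally show ?thesis .
 qed
 have inj: "inj_on ps (carrier T)"
 proof (rule inj_onI)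
  fix s t assume s: "s : carrier T" and t: "t : carrier T" and eq: "ps s = ps t"
  obtain c where c: "c : ?I \<rightarrow> Z" "s = nf c" using s normal by (metis T_cases)
  obtain d where d: "d : ?I \<rightarrow> Z" "t = nf d" using t normal by (metis T_cases)
  have "c (i, j) = coef (ps s) i j" "d (i, j) = coef (ps t) i j" if ij: "i : {1..m}" "j : {1..m}" for i j
   unfolding c(2) d(2) ps_nf[OF c(1)] ps_nf[OF d(1)]
   using coef_combination[of "%i j. c (i, j)", OF _ ij] coef_combination[of "%i j. d (i, j)", OF _ ij]
    funcset_mem[OF c(1)] funcset_mem[OF d(1)] by simp_all
  then have "c p = d p" if "p : ?I" for p using that eq by auto
  then show "s = t" unfolding c(2) d(2) nf_def
   by (intro TR.finsum_cong') (use t_closed[OF eI funcset_mem[OF d(1)]] in auto)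
 qed
 have surj: "ps ` carrier T = carrier R"
 proof (intro equalityI subsetI)
  fix a assume a: "a : carrier R"
  let ?c = "%p. coef a (fst p) (snd p)"
  have c: "?c \<in> ?I \<rightarrow> Z" using coef_in_Z[OF a] by auto
  have n: "nf ?c \<in> carrier T" unfolding nf_def by (rule TR.finsum_closed) (use t_closed[OF eI funcset_mem[OF c]] in auto)
  have "a = ps (nf ?c)" using ps_nf[OF c] expansion[OF a] by simp
  then show "a : ps ` carrier T" using n by (rule image_eqI)
 next
  fix a assume "a : ps ` carrier T"
  then obtain t where t: "t : carrier T" "a = ps t" by (rule imageE)
  show "a : carrier R" unfolding t(2) by (rule ps_closed[OF t(1) t(1)])
 qed
 have one: "ps \<one>\<^bsub>T\<^esub> = \<one>" unfolding T_one using ps_pure[OF Bs(3) Zs(3)] by simp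
 have iso: "ps : ring_iso T R"
 proof (rule ring_iso_memI[OF _ _ _ one bij_betw_imageI[OF inj surj]])
  fix s t assume st: "s : carrier T" "t : carrier T"
  show "ps (s \<otimes>\<^bsub>T\<^esub> t) = ps s ** ps t" by (rule ps_mult[OF st])
  show "ps (s \<oplus>\<^bsub>T\<^esub> t) = ps s \<oplus> ps t" by (rule ps_add[OF st])
 qed (rule ps_closed)
 have "inv_into (carrier T) ps \<in> ring_iso R T" by (rule ring_iso_set_sym[OF TR.ring_axioms iso])
 moreover have "inv_into (carrier T) ps c = cls [(c, \<one>)]" if c: "c : F" for c
  using inv_into_f_f[OF inj t_closed[OF subsetD[OF F(2) c] Zs(3)]] ps_pure[OF subsetD[OF F(2) c] Zs(3)]
   BR[OF subsetD[OF F(2) c]] by simp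
 ultimately show ?thesis unfolding algebra_iso_def by blast
qed

end

text \<open>The inverse of an element that commutes with \<open>B'\<close> commutes with \<open>B'\<close> as well.\<close>

lemma division_subcommutant:
 assumes "ring R" and B: "B <= B'" "B' <= carrier R" and div: "division_ring (sub R (centralizer R B))"
 shows "division_ring (sub R (centralizer R B'))"
proof (rule division_ringI)
 interpret ring R by fact
 have C: "subring (centralizer R B') R" by (rule centralizer_subring[OF B(2)])
 show "ring (sub R (centralizer R B'))" by (rule subring_is_ring[OF C])
 show "\<one>\<^bsub>sub R (centralizer R B')\<^esub> ~= \<zero>\<^bsub>sub R (centralizer R B')\<^esub>" using div unfolding division_ring_def by simp
 fix x assume x: "x : carrier (sub R (centralizer R B'))" "x ~= \<zero>\<^bsub>sub R (centralizer R B')\<^esub>"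
 have "x : centralizer R B" using x(1) B(1) unfolding centralizer_def by auto
 then obtain y where y: "y : centralizer R B" "y \<otimes>\<^bsub>R\<^esub> x = \<one>\<^bsub>R\<^esub>" "x \<otimes>\<^bsub>R\<^esub> y = \<one>\<^bsub>R\<^esub>"
  using division_ringE[OF div, of x] x(2) by auto
 have yR: "y : carrier R" and xR: "x : carrier R" using y(1) x(1) unfolding centralizer_def by auto
 have "y \<otimes>\<^bsub>R\<^esub> b = b \<otimes>\<^bsub>R\<^esub> y" if b: "b : B'" for b
 proof -
  have bR: "b : carrier R" using b B(2) by blast
  have "y \<otimes>\<^bsub>R\<^esub> b = y \<otimes>\<^bsub>R\<^esub> (b \<otimes>\<^bsub>R\<^esub> x) \<otimes>\<^bsub>R\<^esub> y" using y(3) yR xR bR by (simp add: m_assoc)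
  also have "b \<otimes>\<^bsub>R\<^esub> x = x \<otimes>\<^bsub>R\<^esub> b" using x(1) centralizer_memD(1)[of x R B' b] b by simp
  also have "y \<otimes>\<^bsub>R\<^esub> (x \<otimes>\<^bsub>R\<^esub> b) \<otimes>\<^bsub>R\<^esub> y = b \<otimes>\<^bsub>R\<^esub> y" using y(2) yR xR bR by (simp flip: m_assoc)
  finally show ?thesis .
 qed
 then have "y : centralizer R B'" unfolding centralizer_def using yR by simp
 then show "\<exists>y\<in>carrier (sub R (centralizer R B')). y \<otimes>\<^bsub>sub R (centralizer R B')\<^esub> x = \<one>\<^bsub>sub R (centralizer R B')\<^esub>"
  using y(2) by auto
qed

lemma (in ring) matrix_units_sub:
 assumes "subring S R"
 shows "matrix_units (sub R S) m e \<longleftrightarrow> matrix_units R m e \<and> (\<forall>i\<in>{1..m}. \<forall>j\<in>{1..m}. e i j \<in> S)"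
proof -
 have "(\<Oplus>\<^bsub>sub R S\<^esub>i\<in>{1..m}. e i i) = (\<Oplus>i\<in>{1..m}. e i i)" if "\<forall>i\<in>{1..m}. \<forall>j\<in>{1..m}. e i j \<in> S"
  by (rule finsum_sub[OF assms]) (use that in blast)
 then show ?thesis using subringE(1)[OF assms] unfolding matrix_units_def by auto
qed

context matrix_unit_system
begin

text \<open>If \<open>x c y = 0\<close> for all \<open>c\<close> in the commutant, then \<open>x b y = 0\<close> for all \<open>b\<close>, since the matrix units commute with
 \<open>x\<close> and \<open>y\<close> and the coefficients of \<open>b\<close> lie in the commutant.\<close>

lemma commutant_prime:
 assumes "prime_ring R"
 shows "prime_ring (sub R Z)"
 unfolding prime_ring_def
proof (intro conjI ballI impI)
 show "\<one>\<^bsub>sub R Z\<^esub> ~= \<zero>\<^bsub>sub R Z\<^esub>" using assms unfolding prime_ring_def by simp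
 fix x y assume xy: "x : carrier (sub R Z)" "y : carrier (sub R Z)"
  and z: "\<forall>a\<in>carrier (sub R Z). x \<otimes>\<^bsub>sub R Z\<^esub> a \<otimes>\<^bsub>sub R Z\<^esub> y = \<zero>\<^bsub>sub R Z\<^esub>"
 have xyR: "x : carrier R" "y : carrier R" using xy Z_closed by auto
 have "x ** b ** y = \<zero>" if b: "b : carrier R" for b
 proof (rule Z_eqI)
  fix k assume k: "k : {1..m}"
  have "x ** b ** y ** e k k = x ** (\<Oplus>i\<in>{1..m}. e i i) ** b ** y ** e k k" using e_sum xyR by simp
  also have "... = (\<Oplus>i\<in>{1..m}. x ** e i i) ** (b ** y ** e k k)"
   using xyR b k finsum_lmult[of x "{1..m}" "%i. e i i"] finsum_closed[of "%i. e i i" "{1..m}"]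
   by (simp add: m_assoc Pi_iff)
  also have "... = (\<Oplus>i\<in>{1..m}. x ** e i i ** (b ** y ** e k k))"
   by (rule finsum_rmult) (use xyR b k in auto)
  also have "... = \<zero>"
  proof (rule add.finprod_one_eqI)
   fix i assume i: "i : {1..m}"
   have c: "coef b i k \<in> Z" "coef b i k \<in> carrier R" using coef_in_Z[OF b i k] b i k by auto
   have "x ** e i i ** (b ** y ** e k k) = x ** (e i i ** b ** e k k) ** y"
    using xyR b i k Z_comm[of y k k] xy(2) by (simp add: m_assoc)
   also have "... = x ** (coef b i k ** e i k) ** y" using coef_e(1)[OF b i k i k] by simp
   also have "... = x ** coef b i k ** y ** e i k"
    using xyR c i k Z_comm[of y i k] xy(2) by (simp add: m_assoc)
   also have "... = \<zero>" using z c i k by simp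
   finally show "x ** e i i ** (b ** y ** e k k) = \<zero>" .
  qed
  finally show "x ** b ** y ** e k k = \<zero> ** e k k" using k by simp
 qed (use xyR b in auto)
 then have "x = \<zero> \<or> y = \<zero>" using assms xyR unfolding prime_ring_def by blast
 then show "x = \<zero>\<^bsub>sub R Z\<^esub> \<or> y = \<zero>\<^bsub>sub R Z\<^esub>" by simp
qed

text \<open>A subring in which the commutant of the matrix units is central is spanned by them over this commutant, so that
 commuting with them is commuting with it.\<close>

lemma commutant_full_subring:
 assumes S: "subring S R" and eS: "!!i j. i \<in> {1..m} ==> j : {1..m} ==> e i j \<in> S"
  and F: "unit_commutant (sub R S) m e = F" "F <= center R"
 shows "Z = centralizer R S"
proof (intro equalityI subsetI)
 fix x assume x: "x : Z"
 interpret S: matrix_unit_system "sub R S" m e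
  using subring_is_ring[OF S] matrix_units_sub[OF S] units eS
  by (intro matrix_unit_system.intro matrix_unit_system_axioms.intro) auto
 note Ss = subringE[OF S]
 have "x ** s = s ** x" if s: "s : S" for s
 proof -
  have cF: "S.coef s i j \<in> F" if "i : {1..m}" "j : {1..m}" for i j using S.coef_in_Z[of s i j] s that F(1) by simp
  have cx: "S.coef s i j \<in> carrier R" "S.coef s i j \<in> S" "x ** S.coef s i j = S.coef s i j ** x"
   if "i : {1..m}" "j : {1..m}" for i j
   using S.coef_closed[of s i j] s that Ss(1) central_comm[OF F(2) cF[OF that] Z_closed[OF x]] by auto
  have sub_sum: "(\<Oplus>\<^bsub>sub R S\<^esub>i\<in>{1..m}. \<Oplus>\<^bsub>sub R S\<^esub>j\<in>{1..m}. e i j ** S.coef s i j) = (\<Oplus>i\<in>{1..m}. \<Oplus>j\<in>{1..m}. e i j ** S.coef s i j)"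
  proof -
   have "(\<Oplus>\<^bsub>sub R S\<^esub>j\<in>{1..m}. e i j ** S.coef s i j) = (\<Oplus>j\<in>{1..m}. e i j ** S.coef s i j)" if "i : {1..m}" for i
    by (rule finsum_sub[OF S]) (use that cx(2) eS Ss(6) in blast)
   then have "(\<Oplus>\<^bsub>sub R S\<^esub>i\<in>{1..m}. \<Oplus>\<^bsub>sub R S\<^esub>j\<in>{1..m}. e i j ** S.coef s i j) = (\<Oplus>\<^bsub>sub R S\<^esub>i\<in>{1..m}. \<Oplus>j\<in>{1..m}. e i j ** S.coef s i j)"
    by (intro S.finsum_cong' refl funcsetI) (auto intro!: finsum_in_subring[OF S] Ss(6) eS cx(2))
   also have "... = (\<Oplus>i\<in>{1..m}. \<Oplus>j\<in>{1..m}. e i j ** S.coef s i j)"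
    by (rule finsum_sub[OF S]) (intro finsum_in_subring[OF S] Ss(6) eS cx(2))
   finally show ?thesis .
  qed
  have ec: "e i j ** S.coef s i j \<in> carrier R" "x ** (e i j ** S.coef s i j) = e i j ** S.coef s i j ** x"
   if ij: "i : {1..m}" "j : {1..m}" for i j
   using cx[OF ij] Z_comm_left[OF x ij cx(1)[OF ij]] e_closed[OF ij] Z_closed[OF x] by (simp_all add: m_assoc)
  have "x ** (\<Oplus>i\<in>{1..m}. \<Oplus>j\<in>{1..m}. e i j ** S.coef s i j) = (\<Oplus>i\<in>{1..m}. \<Oplus>j\<in>{1..m}. e i j ** S.coef s i j) ** x"
   by (intro commutes_finsum finsum_closed funcsetI ec Z_closed[OF x])
  then show ?thesis using S.expansion[of s] s sub_sum by simp
 qed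
 then show "x : centralizer R S" unfolding centralizer_def using Z_closed[OF x] by simp
next
 fix x assume "x : centralizer R S"
 then show "x : Z" unfolding Z_iff centralizer_def using eS by auto
qed

text \<open>Matrix units of \<open>M\<^sub>q(M\<^sub>m(D))\<close>.\<close>

lemma product_units:
 assumes g: "matrix_units (sub R Z) q g" and m: "1 \<le> m"
 obtains h where "matrix_units R (q * m) h" "unit_commutant R (q * m) h = unit_commutant (sub R Z) q g"
  "{h k l | k l. k \<in> {1..q * m} \<and> l \<in> {1..q * m}}
   = {g a b ** e i j | a b i j. a \<in> {1..q} \<and> b \<in> {1..q} \<and> i \<in> {1..m} \<and> j \<in> {1..m}}"
  "{h k k | k. k \<in> {1..q * m}} = {g a a ** e i i | a i. a \<in> {1..q} \<and> i \<in> {1..m}}"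
proof -
 let ?P = "{1..q} \<times> {1..m}" and ?N = "{1..q * m}"
 obtain \<pi> where \<pi>: "bij_betw \<pi> ?N ?P"
  using ex_bij_betw_nat_finite_1[of ?P] by (auto simp: card_cartesian_product)
 have inj: "inj_on \<pi> ?N" and im: "\<pi> ` ?N = ?P" using \<pi> unfolding bij_betw_def by auto
 have \<pi>1: "fst (\<pi> k) \<in> {1..q}" "snd (\<pi> k) \<in> {1..m}" if "k : ?N" for k using im that by (metis imageI mem_Times_iff)+
 have gR: "matrix_units R q g" and gZ: "!!a b. a \<in> {1..q} ==> b : {1..q} ==> g a b \<in> Z"
  using g unfolding matrix_units_sub[OF Z_subring] by auto
 interpret g: matrix_unit_system R q g by unfold_locales (rule gR)
 define h where "h k l = g (fst (\<pi> k)) (fst (\<pi> l)) ** e (snd (\<pi> k)) (snd (\<pi> l))" for k l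
 have ge: "g a b ** e i j ** (g c d ** e r s) = (g a b ** g c d) ** (e i j ** e r s)"
  if "a : {1..q}" "b : {1..q}" "c : {1..q}" "d : {1..q}"
   "i : {1..m}" "j : {1..m}" "r : {1..m}" "s : {1..m}" for a b c d i j r s
  using that Z_comm_left[OF gZ[OF that(3,4)] that(5,6), of "e r s"] by (simp add: m_assoc)
 have mult: "h k l ** h k' l' = (if l = k' then h k l' else \<zero>)"
  if k: "k : ?N" "l : ?N" "k' : ?N" "l' : ?N" for k l k' l'
 proof -
  have "l = k' \<longleftrightarrow> fst (\<pi> l) = fst (\<pi> k') \<and> snd (\<pi> l) = snd (\<pi> k')"
   using inj_on_eq_iff[OF inj k(2,3)] by (simp add: prod_eq_iff)
  then show ?thesis unfolding h_def
   using ge[OF \<pi>1(1)[OF k(1)] \<pi>1(1)[OF k(2)] \<pi>1(1)[OF k(3)] \<pi>1(1)[OF k(4)] \<pi>1(2)[OF k(1)] \<pi>1(2)[OF k(2)] \<pi>1(2)[OF k(3)] \<pi>1(2)[OF k(4)]]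
    g.e_mult[OF \<pi>1(1)[OF k(1)] \<pi>1(1)[OF k(2)] \<pi>1(1)[OF k(3)] \<pi>1(1)[OF k(4)]]
    e_mult[OF \<pi>1(2)[OF k(1)] \<pi>1(2)[OF k(2)] \<pi>1(2)[OF k(3)] \<pi>1(2)[OF k(4)]]
    g.e_closed[OF \<pi>1(1)[OF k(1)] \<pi>1(1)[OF k(4)]] e_closed[OF \<pi>1(2)[OF k(1)] \<pi>1(2)[OF k(4)]]
   by simp
 qed
 have "(\<Oplus>k\<in>?N. h k k) = (\<Oplus>p\<in>\<pi> ` ?N. g (fst p) (fst p) ** e (snd p) (snd p))"
  unfolding h_def by (rule finsum_reindex[OF _ inj, symmetric], unfold im) auto
 also have "... = (\<Oplus>a\<in>{1..q}. \<Oplus>i\<in>{1..m}. g a a ** e i i)"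
  unfolding im by (rule finsum_Times) auto
 also have "... = (\<Oplus>a\<in>{1..q}. g a a)"
 proof (rule finsum_cong')
  fix a assume a: "a : {1..q}"
  have "(\<Oplus>i\<in>{1..m}. g a a ** e i i) = g a a ** (\<Oplus>i\<in>{1..m}. e i i)"
   by (rule finsum_lmult[symmetric]) (use a in auto)
  then show "(\<Oplus>i\<in>{1..m}. g a a ** e i i) = g a a" using e_sum a by simp
 qed auto
 finally have h: "matrix_units R (q * m) h"
  unfolding matrix_units_def using mult g.e_sum \<pi>1 by (auto simp: h_def)
 have all: "{h k l | k l. k \<in> ?N \<and> l \<in> ?N}
   = {g a b ** e i j | a b i j. a \<in> {1..q} \<and> b \<in> {1..q} \<and> i \<in> {1..m} \<and> j \<in> {1..m}}" (is "?H = ?G")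
 proof (intro equalityI subsetI)
  fix x assume "x : ?H"
  then show "x : ?G" using \<pi>1 unfolding h_def by blast
 next
  fix x assume "x : ?G"
  then obtain a b i j where x: "x = g a b ** e i j" "(a, i) \<in> ?P" "(b, j) \<in> ?P" by auto
  obtain k l where "k : ?N" "\<pi> k = (a, i)" "l : ?N" "\<pi> l = (b, j)" using x(2,3) unfolding im[symmetric] by (metis imageE)
  then show "x : ?H" unfolding x(1) by (intro CollectI exI[of _ k] exI[of _ l]) (simp add: h_def)
 qed
 have diag: "{h k k | k. k \<in> ?N} = {g a a ** e i i | a i. a \<in> {1..q} \<and> i \<in> {1..m}}" (is "?H = ?G")
 proof (intro equalityI subsetI)
  fix x assume "x : ?H"
  then show "x : ?G" using \<pi>1 unfolding h_def by blast
 next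
  fix x assume "x : ?G"
  then obtain a i where x: "x = g a a ** e i i" "(a, i) \<in> ?P" by auto
  obtain k where "k : ?N" "\<pi> k = (a, i)" using x(2) unfolding im[symmetric] by (metis imageE)
  then show "x : ?H" unfolding x(1) by (intro CollectI exI[of _ k]) (simp add: h_def)
 qed
 have "unit_commutant R (q * m) h = unit_commutant (sub R Z) q g"
 proof (intro equalityI subsetI)
  fix x assume "x : unit_commutant R (q * m) h"
  then have xR: "x : carrier R" and xc: "!!a b i j. a \<in> {1..q} ==> b : {1..q} ==> i : {1..m} ==> j : {1..m} ==>
    x ** (g a b ** e i j) = g a b ** e i j ** x"
   unfolding unit_commutant_def[of R] all centralizer_def by blast+
  have "x ** e i j = e i j ** x" if ij: "i : {1..m}" "j : {1..m}" for i j
  proof -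
   have "e i j = (\<Oplus>a\<in>{1..q}. g a a ** e i j)"
    using finsum_rmult[of "e i j" "{1..q}" "%a. g a a"] g.e_sum ij by simp
   then show ?thesis using commutes_finsum[OF xR, of "{1..q}" "%a. g a a ** e i j"] xc ij by simp
  qed
  moreover have "x ** g a b = g a b ** x" if ab: "a : {1..q}" "b : {1..q}" for a b
  proof -
   have "g a b = (\<Oplus>i\<in>{1..m}. g a b ** e i i)"
    using finsum_lmult[of "g a b" "{1..m}" "%i. e i i"] e_sum ab by simp
   then show ?thesis using commutes_finsum[OF xR, of "{1..m}" "%i. g a b ** e i i"] xc ab by simp
  qed
  ultimately show "x : unit_commutant (sub R Z) q g"
   unfolding unit_commutant_def[of "sub R Z"] centralizer_sub using xR by (auto simp: Z_iff)
 next
  fix x assume "x : unit_commutant (sub R Z) q g"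
  then have xZ: "x : Z" and xg: "!!a b. a \<in> {1..q} ==> b : {1..q} ==> x ** g a b = g a b ** x"
   unfolding unit_commutant_def[of "sub R Z"] centralizer_sub by auto
  have "x ** (g a b ** e i j) = g a b ** e i j ** x"
   if "a : {1..q}" "b : {1..q}" "i : {1..m}" "j : {1..m}" for a b i j
  proof -
   have "x ** (g a b ** e i j) = x ** g a b ** e i j" using that Z_closed[OF xZ] by (simp add: m_assoc)
   also have "... = g a b ** (x ** e i j)" unfolding xg[OF that(1,2)] using that Z_closed[OF xZ] by (simp add: m_assoc)
   also have "... = g a b ** e i j ** x" unfolding Z_comm[OF xZ that(3,4)] using that Z_closed[OF xZ] by (simp add: m_assoc)
   finally show ?thesis .
  qed
  then show "x : unit_commutant R (q * m) h"
   unfolding unit_commutant_def[of R] all centralizer_def using Z_closed[OF xZ] by auto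
 qed
 then show ?thesis using that[OF h _ all diag] by simp
qed

text \<open>The span consists of the elements all of whose matrix coefficients lie in \<open>F\<close>.\<close>

lemma coefficient_span:
 assumes F: "subfield F R" "F <= center R" and m: "1 \<le> m"
 defines "B \<equiv> Span F [e i j. i \<leftarrow> [1..<Suc m], j \<leftarrow> [1..<Suc m]]"
 shows "subring B R" "!!i j. i \<in> {1..m} ==> j : {1..m} ==> e i j \<in> B"
  "!!b i j. b \<in> B ==> i : {1..m} ==> j : {1..m} ==> coef b i j \<in> F" "F <= B" "centralizer R B = Z"
proof -
 let ?U = "[e i j. i \<leftarrow> [1..<Suc m], j \<leftarrow> [1..<Suc m]]"
 let ?B = "{b \<in> carrier R. \<forall>i\<in>{1..m}. \<forall>j\<in>{1..m}. coef b i j \<in> F}"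
 have U: "set ?U = {e i j | i j. i \<in> {1..m} \<and> j \<in> {1..m}}" 
 proof -
  have "set [1..<Suc m] = {1..m}" by (simp only: set_upt atLeastLessThanSuc_atLeastAtMost)
  then show ?thesis by (simp only: set_concat set_map image_image) blast
 qed
 have UR: "set ?U <= carrier R" unfolding U by auto
 note Fs = subringE[OF subfieldE(1)[OF F(1)]]
 have FZ: "F <= Z" using F(2) unfolding centralizer_def unit_commutant_def by auto
 have FR: "!!c. c \<in> F ==> c : carrier R" using Fs(1) by blast
 have FB: "F <= ?B" using FR coef_Z[OF subsetD[OF FZ]] Fs(2) by auto
 have mult: "b ** c \<in> ?B" if "b : ?B" "c : ?B" for b c
  using that by (auto simp: coef_mult intro!: finsum_in_subring[OF subfieldE(1)[OF F(1)]] Fs(6))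
 have B': "subring ?B R"
 proof (rule subringI)
  fix h assume h: "h : ?B"
  have "\<ominus> \<one> ** h \<in> ?B" by (rule mult[OF subsetD[OF FB Fs(5)[OF Fs(3)]] h])
  then show "\<ominus> h \<in> ?B" using h by (simp add: l_minus)
 qed (use mult FB Fs(3,7) in \<open>auto simp: coef_add\<close>)
 have eB: "e p q \<in> ?B" if "p : {1..m}" "q : {1..m}" for p q
 proof -
  have "coef (e p q) i j \<in> F" if ij: "i : {1..m}" "j : {1..m}" for i j
  proof -
   have "coef (e p q) i j = (if i = p \<and> j = q then \<one> else \<zero>)"
    by (rule coef_eqI) (use that \<open>p \<in> {1..m}\<close> \<open>q \<in> {1..m}\<close> subringE(2,3)[OF Z_subring] in \<open>auto simp: e_mult\<close>)
   then show ?thesis using Fs(2,3) by simp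
  qed
  then show ?thesis using that by simp
 qed
 have BB: "B = ?B"
 proof (intro equalityI)
  have "F <#> set ?U <= ?B" unfolding set_mult_def U using mult[OF subsetD[OF FB] eB] by blast
  then show "B <= ?B" unfolding B_def by (rule Span_min[OF F(1) UR subring.axioms(1)[OF B']])
  show "?B <= B"
  proof
   fix b assume b: "b : ?B"
   note S = Span_subgroup_props[OF F(1) UR]
   have t: "e i j ** coef b i j \<in> B" if "i : {1..m}" "j : {1..m}" for i j
   proof -
    have c: "coef b i j \<in> F" using b that by blast
    have "e i j \<in> B" unfolding B_def using Span_base_incl[OF F(1) UR] that unfolding U by blast
    then show ?thesis using Span_smult_closed[OF F(1) UR c] central_comm[OF F(2) c e_closed[OF that]] unfolding B_def by metis
   qed
   have fin: "(\<Oplus>i\<in>I. f i) \<in> B" if "!!i. i \<in> I ==> f i \<in> B" for f :: "nat \<Rightarrow> 'a" and I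
    by (rule finsum_additive(1)[where h = id, OF abelian_monoid_axioms abelian_monoid_axioms])
     (use S that in \<open>auto simp: B_def\<close>)
   have "(\<Oplus>i\<in>{1..m}. \<Oplus>j\<in>{1..m}. e i j ** coef b i j) \<in> B" by (intro fin t)
   then show "b : B" using expansion b by simp
  qed
 qed
 show "subring B R" unfolding BB by (rule B')
 show "e i j \<in> B" if "i : {1..m}" "j : {1..m}" for i j unfolding BB by (rule eB[OF that])
 show cB: "coef b i j \<in> F" if "b : B" "i : {1..m}" "j : {1..m}" for b i j using that unfolding BB by blast
 show "F <= B" unfolding BB by (rule FB)
 show "centralizer R B = Z"
 proof (intro equalityI subsetI)
  fix x assume "x : centralizer R B"
  then show "x : Z" using eB unfolding BB centralizer_def Z_iff by blast
 next
  fix x assume x: "x : Z"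
  have "x ** b = b ** x" if b: "b : B" for b
  proof -
   have bR: "b : carrier R" using b unfolding BB by blast
   have "x ** (e i j ** coef b i j) = e i j ** coef b i j ** x" if ij: "i : {1..m}" "j : {1..m}" for i j
    using Z_comm_left[OF x ij, of "coef b i j"] central_comm[OF F(2) cB[OF b ij] Z_closed[OF x]] bR ij Z_closed[OF x]
    by (simp add: m_assoc)
   then have "x ** (\<Oplus>i\<in>{1..m}. \<Oplus>j\<in>{1..m}. e i j ** coef b i j) = (\<Oplus>i\<in>{1..m}. \<Oplus>j\<in>{1..m}. e i j ** coef b i j) ** x"
    by (intro commutes_finsum finsum_closed funcsetI Z_closed[OF x]) (use bR in auto)
   then show ?thesis using expansion[OF bR] by simp
  qed
  then show "x : centralizer R B" unfolding centralizer_def using Z_closed[OF x] by simp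
 qed
qed

end

section \<open>Multiplicative systems of units over a subfield\<close>

text \<open>The setting in which the factors \<open>\<beta>\<^sub>i\<close> are found, with \<open>L\<close> in the role of the subfield of index \<open>p\<close>: the units
 \<open>u\<^sub>i\<close> induce the group of \<open>L/F\<close>, and the centralizer \<open>M\<close> of \<open>L\<close> is a division ring.\<close>

locale galois_descent = ring R for R :: "('a, 'b) ring_scheme" (structure) +
 fixes F L :: "'a set" and N :: nat and u :: "nat \<Rightarrow> 'a"
 assumes L: "subfield L R" and gal: "galois_extension R L F" and comm: "comm_group (galois_group R L F)"
  and deg: "dimension N F L" and cenF: "center R = F"
  and M_division: "division_ring (sub R (centralizer R L))"
  and u: "!!i. i \<in> {1..N} ==> u i \<in> Units R"
  and conj: "{conj_map R L (u i) | i. i \<in> {1..N}} = carrier (galois_group R L F)"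
begin

abbreviation M where "M \<equiv> centralizer R L"
abbreviation I where "I \<equiv> {1..N}"
abbreviation G where "G \<equiv> carrier (galois_group R L F)"
abbreviation s where "s i \<equiv> conj_map R L (u i)"
abbreviation factors where "factors \<equiv> multiplicative_factors R M L N u"

lemma F: "subfield F R" and FL: "F <= L"
 using gal unfolding galois_extension_def by auto

lemma LR: "l : L ==> l : carrier R" using subfieldE(3)[OF L] by blast

lemma MR: "m : M ==> m : carrier R" by (rule centralizer_memD(2))

lemma M_subring: "subring M R" by (rule centralizer_subring[OF subfieldE(3)[OF L]])

lemma s_G: "i : I ==> s i \<in> G" using conj by blast

lemma G_s: assumes "g : G" obtains i where "i : I" "s i = g"
 using assms unfolding conj[symmetric] by blast

lemma s_inj: "inj_on s I"
proof (rule eq_card_imp_inj_on)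
 have "s ` I = G" using conj by blast
 then show "card (s ` I) = card I" using galois_degree[OF gal deg] by simp
qed simp

lemma s_closed: "i : I ==> l : L ==> s i l \<in> L" by (rule gal_memD(1)[OF s_G])

lemma uR: "i : I ==> u i \<in> carrier R" by (rule Units_closed[OF u])

lemma l_u: "i : I ==> l : L ==> l ** u i = u i ** s i l"
 using u[of i] uR[of i] LR[of l] unfolding conj_map_def by (simp flip: m_assoc)

lemma l_mu:
 assumes "m : M" "i : I" "l : L"
 shows "l ** (m ** u i) = m ** u i ** s i l"
proof -
 have "l ** (m ** u i) = m ** (l ** u i)"
  using centralizer_memD(1)[OF assms(1,3)] MR[OF assms(1)] LR[OF assms(3)] uR[OF assms(2)] by (simp flip: m_assoc)
 then show ?thesis
  unfolding l_u[OF assms(2,3)] using MR[OF assms(1)] uR[OF assms(2)] LR[OF s_closed[OF assms(2,3)]] by (simp add: m_assoc)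
qed

text \<open>The multiplication table of the Galois group, read on the indices of the units.\<close>

definition kp where "kp i j = (SOME k. k \<in> I \<and> s k = compose L (s i) (s j))"

lemma kp: "i : I ==> j : I ==> kp i j \<in> I \<and> s (kp i j) = compose L (s i) (s j)"
proof -
 assume ij: "i : I" "j : I"
 interpret G: group "galois_group R L F" using galois_group_is_group[OF subfieldE(1)[OF L] FL] .
 have "compose L (s i) (s j) \<in> G" using G.m_closed[OF s_G[OF ij(2)] s_G[OF ij(1)]] unfolding galois_group_simps .
 then obtain k where "k : I \<and> s k = compose L (s i) (s j)" using G_s by blast
 then show ?thesis unfolding kp_def by (rule someI)
qed

lemma M_inverse:
 assumes "m : M" "m ~= \<zero>"
 obtains m' where "m' : M" "m' ** m = \<one>" "m ** m' = \<one>" "m : Units R"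
proof -
 obtain m' where m': "m' : M" "m' ** m = \<one>" "m ** m' = \<one>"
  using division_ringE[OF M_division, of m] assms by auto
 then have "m : Units R" unfolding Units_def using MR[OF assms(1)] MR[OF m'(1)] by auto
 with m' show ?thesis by (rule that)
qed

end

locale factor_system = galois_descent +
 fixes \<beta> :: "nat \<Rightarrow> 'a"
 assumes factors: "factors \<beta>"
begin

definition v where "v i = \<beta> i ** u i"
definition T where "T = span_of R L I v"

lemma \<beta>: "i : I ==> \<beta> i \<in> M" "i : I ==> \<beta> i ~= \<zero>"
 using factors unfolding multiplicative_factors_def by auto

lemma v_mult: "i : I ==> j : I ==> v i ** v j = v (kp i j)"
 using factors kp[of i j] unfolding multiplicative_factors_def v_def by auto

lemma v_unit: "i : I ==> v i \<in> Units R"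
 unfolding v_def by (rule Units_m_closed[OF _ u]) (use M_inverse[OF \<beta>(1) \<beta>(2)] in metis)

lemma vR: "i : I ==> v i \<in> carrier R" by (rule Units_closed[OF v_unit])

lemma l_v: "i : I ==> l : L ==> l ** v i = v i ** s i l"
 unfolding v_def by (rule l_mu[OF \<beta>(1)])

lemma conj_v: "conj_map R L (v i) = s i" if i: "i : I" for i
proof -
 have "inv (v i) ** l ** v i = s i l" if l: "l : L" for l
 proof -
  have "inv (v i) ** l ** v i = inv (v i) ** (v i ** s i l)"
   unfolding l_v[OF i l, symmetric] using v_unit[OF i] vR[OF i] LR[OF l] by (simp add: m_assoc)
  then show ?thesis using v_unit[OF i] vR[OF i] LR[OF s_closed[OF i l]] by (simp flip: m_assoc)
 qed
 then show ?thesis unfolding conj_map_def[of R L "v i"] using gal_memD(6)[OF s_G[OF i]]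
  by (intro extensionalityI[of _ L]) (auto simp: conj_map_def)
qed

lemma one_index: obtains i where "i : I" "v i = \<one>" "s i = (\<lambda>x\<in>L. x)"
proof -
 interpret G: group "galois_group R L F" using galois_group_is_group[OF subfieldE(1)[OF L] FL] .
 have "(\<lambda>x\<in>L. x) \<in> G" using G.one_closed unfolding galois_group_simps .
 then obtain i where i: "i : I" "s i = (\<lambda>x\<in>L. x)" by (rule G_s)
 have "s (kp i i) = s i" using kp[OF i(1) i(1)] unfolding i(2) by (auto simp: compose_def)
 then have "kp i i = i" using inj_onD[OF s_inj] kp[OF i(1) i(1)] i(1) by blast
 then have "v i ** v i = v i ** \<one>" using v_mult[OF i(1) i(1)] vR[OF i(1)] by simp
 then have "v i = \<one>" using Units_l_cancel[OF v_unit[OF i(1)] vR[OF i(1)] one_closed] by simp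
 with i show ?thesis using that by blast
qed

lemma inverse_index:
 assumes i: "i : I"
 obtains j where "j : I" "inv (v i) = v j"
proof -
 obtain o' where o': "o' : I" "v o' = \<one>" "s o' = (\<lambda>x\<in>L. x)" by (rule one_index)
 obtain h where h: "h : G" "\<forall>x\<in>L. h (s i x) = x \<and> s i (h x) = x"
  using gal_inverse[OF subfieldE(1)[OF L] FL s_G[OF i]] by blast
 obtain j where j: "j : I" "s j = h" using h(1) by (rule G_s)
 have "s (kp j i) = s o'" using kp[OF j(1) i] h(2) unfolding j(2) o'(3) by (auto simp: compose_def)
 then have "kp j i = o'" using inj_onD[OF s_inj] kp[OF j(1) i] o'(1) by blast
 then have "v j ** v i = \<one>" using v_mult[OF j(1) i] o'(2) by simp
 then have "inv (v i) = v j" using inv_char[OF vR[OF i] vR[OF j(1)]]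
  by (metis Units_inv_closed Units_r_inv i j(1) l_one m_assoc r_one vR v_unit)
 with j(1) show ?thesis by (rule that)
qed

text \<open>The \<open>v\<^sub>i\<close> are eigenvectors for distinct characters of \<open>L\<close>.\<close>

lemma v_indep:
 assumes c: "!!i. i \<in> I ==> c i \<in> L" and z: "(\<Oplus>i\<in>I. v i ** c i) = \<zero>" and i: "i : I"
 shows "c i = \<zero>"
proof -
 have "\<forall>i\<in>I. v i ** c i \<in> {\<zero>}"
 proof (rule eigenvector_components[OF L, where th = s])
  show "\<exists>l\<in>L. s g l ~= s h l" if "g : I" "h : I" "g ~= h" for g h
   by (rule gal_distinct[OF s_G[OF that(1)] s_G[OF that(2)]]) (use that inj_onD[OF s_inj] in blast)
  show "l ** (v g ** c g) = v g ** c g ** s g l" if "g : I" "l : L" for g l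
   using l_v[OF that] subfieldE(4)[OF L c[OF that(1)] s_closed[OF that]]
    LR[OF c[OF that(1)]] LR[OF s_closed[OF that]] LR[OF that(2)] vR[OF that(1)]
   by (simp add: m_assoc) (simp flip: m_assoc)
 qed (use z s_closed vR LR c in auto)
 then have "v i ** c i = v i ** \<zero>" using i vR[OF i] by simp
 then show ?thesis using Units_l_cancel[OF v_unit[OF i] LR[OF c[OF i]] zero_closed] by simp
qed

lemma T_mem: "i : I ==> l : L ==> v i ** l \<in> T"
proof -
 assume i: "i : I" and l: "l : L"
 let ?c = "%j. if j = i then l else \<zero>"
 have "(\<Oplus>j\<in>I. v j ** ?c j) = (\<Oplus>j\<in>I. if j = i then v j ** l else \<zero>)"
  by (rule finsum_cong') (use vR LR[OF l] in auto)
 also have "... = v i ** l" by (rule finsum_delta) (use i vR LR[OF l] in auto)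
 finally have "v i ** l = (\<Oplus>j\<in>I. v j ** ?c j)" ..
 then show ?thesis unfolding T_def span_of_def
  using l subringE(2)[OF subfieldE(1)[OF L]] by (intro CollectI exI[of _ ?c]) auto
qed

lemma T_cases:
 assumes "x : T"
 obtains c where "c : I \<rightarrow> L" "x = (\<Oplus>i\<in>I. v i ** c i)"
 using assms unfolding T_def span_of_def by blast

lemma T_R: "x : T ==> x : carrier R"
 by (erule T_cases) (simp add: finsum_closed Pi_iff vR LR)

lemma T_add:
 assumes "x : T" "y : T"
 shows "x \<oplus> y \<in> T"
proof -
 obtain c where c': "c : I \<rightarrow> L" "x = (\<Oplus>i\<in>I. v i ** c i)" using assms(1) by (rule T_cases)
 note c = funcset_mem[OF c'(1)] c'(2)
 obtain d where d': "d : I \<rightarrow> L" "y = (\<Oplus>i\<in>I. v i ** d i)" using assms(2) by (rule T_cases)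
 note d = funcset_mem[OF d'(1)] d'(2)
 have "x \<oplus> y = (\<Oplus>i\<in>I. v i ** c i \<oplus> v i ** d i)"
  unfolding c(2) d(2) by (rule finsum_addf[symmetric]) (use vR LR c d in auto)
 also have "... = (\<Oplus>i\<in>I. v i ** (c i \<oplus> d i))"
  by (rule finsum_cong') (use vR LR c d in \<open>auto simp: r_distr\<close>)
 finally show ?thesis unfolding T_def span_of_def
  using subringE(7)[OF subfieldE(1)[OF L] c(1) d(1)] by (intro CollectI exI[of _ "%i. c i \<oplus> d i"]) auto
qed

lemma T_zero: "\<zero> \<in> T"
 by (rule one_index) (use T_mem[of _ \<zero>] subringE(2)[OF subfieldE(1)[OF L]] vR in force)

lemma T_finsum: "(!!j. j \<in> J ==> f j \<in> T) ==> (\<Oplus>j\<in>J. f j) \<in> T"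
 by (rule finsum_additive(1)[where h = id, OF abelian_monoid_axioms abelian_monoid_axioms])
  (auto simp: T_R T_zero T_add)

lemma L_T: "l : L ==> l : T"
 by (rule one_index) (use T_mem LR in force)

lemma T_subring: "subring T R"
proof -
 have mult: "x ** y \<in> T" if xy: "x : T" "y : T" for x y
 proof -
  obtain c where c': "c : I \<rightarrow> L" "x = (\<Oplus>i\<in>I. v i ** c i)" using xy(1) by (rule T_cases)
  note c = funcset_mem[OF c'(1)] c'(2)
  obtain d where d': "d : I \<rightarrow> L" "y = (\<Oplus>i\<in>I. v i ** d i)" using xy(2) by (rule T_cases)
  note d = funcset_mem[OF d'(1)] d'(2)
  have vT: "v i ** c i ** y \<in> T" if i: "i : I" for i
  proof -
   have "v i ** c i ** y = (\<Oplus>j\<in>I. v i ** c i ** (v j ** d j))"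
    unfolding d(2) by (rule finsum_lmult) (use vR LR c d i in auto)
   also have "... \<in> T"
   proof (rule T_finsum)
    fix j assume j: "j : I"
    have "v i ** c i ** (v j ** d j) = v i ** (c i ** v j) ** d j"
     using vR[OF i] vR[OF j] LR[OF c(1)[OF i]] LR[OF d(1)[OF j]] by (simp add: m_assoc)
    also have "... = (v i ** v j) ** (s j (c i) ** d j)"
     unfolding l_v[OF j c(1)[OF i]]
     using vR[OF i] vR[OF j] LR[OF s_closed[OF j c(1)[OF i]]] LR[OF d(1)[OF j]] by (simp add: m_assoc)
    finally show "v i ** c i ** (v j ** d j) \<in> T"
     unfolding v_mult[OF i j] using kp[OF i j] T_mem subringE(6)[OF subfieldE(1)[OF L] s_closed[OF j c(1)[OF i]] d(1)[OF j]] by simp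
   qed
   finally show ?thesis .
  qed
  have e: "x ** y = (\<Oplus>i\<in>I. v i ** c i ** y)"
   unfolding c(2) by (rule finsum_rmult) (use vR LR c T_R[OF xy(2)] in auto)
  show ?thesis unfolding e by (rule T_finsum[OF vT])
 qed
 note Ls = subringE[OF subfieldE(1)[OF L]]
 show ?thesis
 proof (rule subringI)
  fix x assume x: "x : T"
  have "\<ominus> \<one> ** x \<in> T" by (rule mult[OF L_T[OF Ls(5)[OF Ls(3)]] x])
  then show "\<ominus> x \<in> T" using l_minus[OF one_closed T_R[OF x]] T_R[OF x] by simp
  fix y assume y: "y : T"
  show "x ** y \<in> T" by (rule mult[OF x y])
  show "x \<oplus> y \<in> T" by (rule T_add[OF x y])
 next
  show "T <= carrier R" using T_R by blast
  show "\<one> \<in> T" by (rule L_T[OF Ls(3)])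
 qed
qed

lemma v_T: "i : I ==> v i \<in> T"
 using T_mem[of i \<one>] vR[of i] subringE(3)[OF subfieldE(1)[OF L]] by simp

text \<open>Conjugation by \<open>v\<^sub>i\<close> in the direction opposite to \<open>s i\<close>, which lets elements of \<open>L\<close> be moved to the left.\<close>

definition th where "th i l = v i ** l ** inv (v i)"

lemma th: "th i l \<in> L" "v i ** l = th i l ** v i" if il: "i : I" "l : L" for i l
proof -
 have "l : s i ` L" using gal_memD(7)[OF s_G[OF il(1)]] il(2) unfolding bij_betw_def by simp
 then obtain l' where "l = s i l'" "l' : L" by (rule imageE)
 then have l': "l' : L" "s i l' = l" by auto
 have "th i l = l' ** v i ** inv (v i)" unfolding th_def l_v[OF il(1) l'(1)] l'(2) ..
 also have "... = l'" using v_unit[OF il(1)] vR[OF il(1)] LR[OF l'(1)] by (simp add: m_assoc)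
 finally have e: "th i l = l'" .
 show "th i l \<in> L" unfolding e by (rule l'(1))
 show "v i ** l = th i l ** v i" unfolding e l_v[OF il(1) l'(1)] l'(2) ..
qed

lemma kp_bij:
 assumes i: "i : I"
 shows "inj_on (kp i) I" "kp i ` I = I"
proof -
 show "inj_on (kp i) I"
 proof (rule inj_onI)
  fix j k assume jk: "j : I" "k : I" "kp i j = kp i k"
  then have "v i ** v j = v i ** v k" using v_mult[OF i] by simp
  then have "v j = v k" using Units_l_cancel[OF v_unit[OF i] vR[OF jk(1)] vR[OF jk(2)]] by simp
  then show "j = k" using inj_onD[OF s_inj _ jk(1,2)] conj_v[OF jk(1)] conj_v[OF jk(2)] by simp
 qed
 then show "kp i ` I = I" by (rule endo_inj_surj[rotated 2]) (use kp[OF i] in auto)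
qed

lemma th_mult: "th i (l ** l') = th i l ** th i l'" if "i : I" "l : L" "l' : L" for i l l'
proof -
 have R: "l : carrier R" "l' : carrier R" "v i \<in> carrier R" "v i \<in> Units R" "th i l \<in> carrier R"
  using that LR vR v_unit th(1) by auto
 have "th i (l ** l') = (v i ** l) ** l' ** inv (v i)" unfolding th_def using R(1-4) by (simp add: m_assoc)
 also have "... = th i l ** th i l'" unfolding th(2)[OF that(1,2)] using R
  by (simp add: m_assoc th_def[of i l'])
 finally show ?thesis .
qed

lemma th_one: "i : I ==> th i \<one> = \<one>"
 unfolding th_def using v_unit[of i] vR[of i] by simp

lemma th_distinct: "\<exists>l\<in>L. th i l ~= th j l" if ij: "i : I" "j : I" "i ~= j" for i j
proof -
 obtain l where l: "l : L" "s i l ~= s j l"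
  using gal_distinct[OF s_G[OF ij(1)] s_G[OF ij(2)]] inj_onD[OF s_inj _ ij(1,2)] ij(3) by blast
 have ths: "th i (s i l) = l" if "i : I" for i
  unfolding th_def l_v[OF that l(1), symmetric] using v_unit[OF that] vR[OF that] LR[OF l(1)] by (simp add: m_assoc)
 have sth: "s i (th i x) = x" if "i : I" "x : L" for i x
  using Units_l_cancel[OF v_unit[OF that(1)] LR[OF s_closed[OF that(1) th(1)[OF that]]] LR[OF that(2)]]
   l_v[OF that(1) th(1)[OF that]] th(2)[OF that] by simp
 have "th j (s i l) ~= th i (s i l)" using sth[OF ij(2) s_closed[OF ij(1) l(1)]] ths[OF ij(1)] l(2) by metis
 then show ?thesis using s_closed[OF ij(1) l(1)] by metis
qed

lemma T_lin_span: "T = lin_span L I v" and v_lin_indep: "lin_indep L I v"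
proof -
 have sw: "(\<Oplus>i\<in>I. k i ** v i) = (\<Oplus>i\<in>I. v i ** s i (k i))" if k: "k : I \<rightarrow> L" for k
  by (rule finsum_cong') (use l_v[OF _ funcset_mem[OF k]] vR LR[OF s_closed[OF _ funcset_mem[OF k]]] in auto)
 show "lin_indep L I v"
  unfolding lin_indep_def
 proof (intro ballI impI)
  fix k i assume k: "k : I \<rightarrow> L" and z: "(\<Oplus>i\<in>I. k i ** v i) = \<zero>" and i: "i : I"
  note kL = funcset_mem[OF k]
  have "s i (k i) = \<zero>"
   by (rule v_indep[where c = "%i. s i (k i)"]) (use z sw[OF k] s_closed[OF _ kL] i in auto)
  then show "k i = \<zero>" by (rule gal_inv(4)[OF L s_G[OF i] kL[OF i]])
 qed
 show "T = lin_span L I v"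
 proof (intro equalityI subsetI)
  fix x assume "x : T"
  then obtain c where c': "c : I \<rightarrow> L" "x = (\<Oplus>i\<in>I. v i ** c i)" by (rule T_cases)
  note c = funcset_mem[OF c'(1)] c'(2)
  have "x = (\<Oplus>i\<in>I. th i (c i) ** v i)"
   unfolding c(2) by (rule finsum_cong') (use th[OF _ c(1)] LR[OF th(1)[OF _ c(1)]] vR in auto)
  then show "x : lin_span L I v" using th(1)[OF _ c(1)] by (intro lin_spanI[of "%i. th i (c i)"]) auto
 next
  fix x assume "x : lin_span L I v"
  then obtain k where k: "k : I \<rightarrow> L" "x = (\<Oplus>i\<in>I. k i ** v i)" by (rule lin_spanE)
  show "x : T" unfolding k(2) sw[OF k(1)]
   by (intro T_finsum T_mem s_closed funcset_mem[OF k(1)])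
 qed
qed

lemma T_dimension: "dimension N L T" "dimension (N * N) F T"
proof -
 show "dimension N L T"
  using dimension_lin_span[OF L _ _ v_lin_indep] vR unfolding T_lin_span by (simp add: Pi_def)
 then show "dimension (N * N) F T" by (rule telescopic_base[OF F L deg])
qed

text \<open>The commutator of \<open>\<Sum> v\<^sub>i c\<^sub>i\<close> with \<open>l\<close> has the coefficients \<open>c\<^sub>i (s\<^sub>i l - l)\<close>.\<close>

lemma T_self_centralizing:
 assumes x: "x : T" "!!l. l \<in> L ==> x ** l = l ** x"
 shows "x : L"
proof -
 obtain c where c': "c : I \<rightarrow> L" "x = (\<Oplus>i\<in>I. v i ** c i)" using x(1) by (rule T_cases)
 note c = funcset_mem[OF c'(1)] c'(2)
 obtain p where p: "p : I" "v p = \<one>" "s p = (\<lambda>x\<in>L. x)" by (rule one_index)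
 note cR = LR[OF c(1)] and Ls = subringE[OF subfieldE(1)[OF L]]
 have c0: "c i = \<zero>" if i: "i : I" "i ~= p" for i
 proof (rule ccontr)
  assume nz: "c i ~= \<zero>"
  obtain l where l: "l : L" "s i l ~= l"
   using gal_distinct[OF s_G[OF i(1)] s_G[OF p(1)]] inj_onD[OF s_inj _ i(1) p(1)] i(2) p(3) by auto
  have sl: "s j l \<in> L" "s j l \<in> carrier R" if "j : I" for j using s_closed[OF that l(1)] LR by auto
  have lR: "l : carrier R" by (rule LR[OF l(1)])
  have "(\<Oplus>j\<in>I. v j ** (c j ** (s j l \<ominus> l))) = (\<Oplus>j\<in>I. l ** (v j ** c j) \<ominus> v j ** c j ** l)"
  proof (rule finsum_cong')
   fix j assume j: "j : I"
   have "l ** (v j ** c j) = v j ** (c j ** s j l)"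
    using l_v[OF j l(1)] subfieldE(4)[OF L c(1)[OF j] sl(1)[OF j]] lR vR[OF j] cR[OF j] sl(2)[OF j]
    by (simp add: m_assoc flip: m_assoc[of l])
   then show "v j ** (c j ** (s j l \<ominus> l)) = l ** (v j ** c j) \<ominus> v j ** c j ** l"
    using lR vR[OF j] cR[OF j] sl(2)[OF j] by (simp add: a_minus_def r_distr r_minus m_assoc)
  qed (use lR vR cR in auto)
  also have "... = (\<Oplus>j\<in>I. l ** (v j ** c j)) \<ominus> (\<Oplus>j\<in>I. v j ** c j ** l)"
   by (rule finsum_minus) (use lR vR cR in auto)
  also have "... = l ** x \<ominus> x ** l"
   unfolding c(2) using finsum_lmult[of l I "%j. v j ** c j"] finsum_rmult[of l I "%j. v j ** c j"] lR vR cR by simp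
  also have "... = \<zero>" using x(2)[OF l(1)] lR T_R[OF x(1)] by (simp add: r_right_minus_eq)
  finally have "c i ** (s i l \<ominus> l) = \<zero>"
   by (rule v_indep[rotated]) (use i(1) c(1) sl(1) l(1) Ls in \<open>auto simp: a_minus_def\<close>)
  moreover have "s i l \<ominus> l \<in> L" using sl(1)[OF i(1)] l(1) Ls by (simp add: a_minus_def)
  ultimately have "s i l \<ominus> l = \<zero>" using subfieldE(5)[OF L c(1)[OF i(1)]] nz by blast
  then show False using l(2) sl(2)[OF i(1)] lR by (simp add: r_right_minus_eq)
 qed
 have "x = (\<Oplus>i\<in>I. if i = p then c i else \<zero>)"
  unfolding c(2) by (rule finsum_cong') (use c0 p(2) vR cR in auto)
 also have "... = c p" by (rule finsum_delta) (use p(1) cR in auto)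
 finally show ?thesis using c(1)[OF p(1)] by simp
qed

lemma T_crossed_product:
 "classical_crossed_product (sub R T) L F (induced_factor_set R L N v) (unit_inducing R L N v)"
proof (rule units_crossed_product(1)[OF T_subring L _ gal comm galois_degree[OF gal deg] T_dimension(1) v_unit v_T])
 show "L <= T" using L_T by blast
 show "inv (v i) \<in> T" if "i : I" for i using inverse_index[OF that] v_T by metis
 show "s : L" if "s : T" "!!l. l \<in> L ==> s ** l = l ** s" for s by (rule T_self_centralizing[OF that])
 have "{conj_map R L (v i) | i. i \<in> I} = {s i | i. i \<in> I}" using conj_v by force
 then show "{conj_map R L (v i) | i. i \<in> I} = G" using conj by simp
qed

text \<open>With \<open>ep = \<Sum> v\<^sub>i\<close>, the left ideal \<open>T ep = L ep\<close> is a module of dimension \<open>N\<close> over \<open>F\<close>.\<close>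

lemma T_matrix_form: "matrix_form F (sub R T) N F" and T_split: "split_algebra F (sub R T)"
proof -
 define ep where "ep = (\<Oplus>i\<in>I. v i)"
 have epR: "ep : carrier R" unfolding ep_def by (rule finsum_closed) (use vR in auto)
 have vep: "v i ** ep = ep" if i: "i : I" for i
 proof -
  have "v i ** ep = (\<Oplus>j\<in>I. v i ** v j)" unfolding ep_def by (rule finsum_lmult) (use vR i in auto)
  also have "... = (\<Oplus>j\<in>I. v (kp i j))" by (rule finsum_cong') (use v_mult[OF i] vR kp[OF i] in auto)
  also have "... = (\<Oplus>j\<in>kp i ` I. v j)" by (rule finsum_reindex[OF _ kp_bij(1)[OF i], symmetric]) (use kp_bij(2)[OF i] vR in auto)
  finally show ?thesis unfolding kp_bij(2)[OF i] ep_def .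
 qed
 have lep: "l = \<zero>" if l: "l : L" "l ** ep = \<zero>" for l
 proof -
  have "l ** ep = (\<Oplus>i\<in>I. l ** v i)" unfolding ep_def by (rule finsum_lmult) (use vR LR l in auto)
  then show ?thesis
   using lin_indepD[OF v_lin_indep, of "%_. l"] l by (metis Pi_I one_index)
 qed
 let ?W = "(%l. l ** ep) ` L"
 note Ls = subringE[OF subfieldE(1)[OF L]]
 have FR: "c : carrier R" if "c : F" for c using LR FL that by blast
 have dW: "dimension N F ?W"
 proof (rule dimension_transport[where kp = id, OF ring_axioms ring_axioms F F deg])
  show "inj_on (%l. l ** ep) L"
  proof (rule inj_onI)
   fix x y assume xy: "x : L" "y : L" "x ** ep = y ** ep"
   have "(x \<ominus> y) ** ep = x ** ep \<ominus> y ** ep"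
    using xy LR epR by (simp add: a_minus_def l_distr l_minus)
   then have "(x \<ominus> y) ** ep = \<zero>" using xy LR epR by (simp add: r_right_minus_eq)
   then have "x \<ominus> y = \<zero>" by (rule lep[rotated]) (use xy Ls in \<open>simp add: a_minus_def\<close>)
   then show "x = y" using xy LR by (simp add: r_right_minus_eq)
  qed
 qed (use LR FR epR in \<open>auto simp: l_distr m_assoc\<close>)
 have kv: "k ** v i ** (l ** ep) = k ** th i l ** ep" if "k : L" "i : I" "l : L" for k i l
 proof -
  have "k ** v i ** (l ** ep) = k ** (v i ** l) ** ep" using LR[OF that(1)] LR[OF that(3)] vR[OF that(2)] epR by (simp add: m_assoc)
  also have "... = k ** th i l ** (v i ** ep)" unfolding th(2)[OF that(2,3)]
   using LR[OF that(1)] LR[OF th(1)[OF that(2,3)]] vR[OF that(2)] epR by (simp add: m_assoc)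
  finally show ?thesis unfolding vep[OF that(2)] .
 qed
 have act: "(\<Oplus>i\<in>I. k i ** v i) ** (l ** ep) = (\<Oplus>i\<in>I. k i ** th i l) ** ep"
  if k': "k : I \<rightarrow> L" and l: "l : L" for k l
 proof -
  note k = funcset_mem[OF k']
  have "(\<Oplus>i\<in>I. k i ** v i) ** (l ** ep) = (\<Oplus>i\<in>I. k i ** v i ** (l ** ep))"
   by (rule finsum_rmult) (use LR[OF k] vR LR[OF l] epR in auto)
  also have "... = (\<Oplus>i\<in>I. k i ** th i l ** ep)"
   by (rule finsum_cong') (use kv[OF k _ l] LR[OF k] LR[OF th(1)[OF _ l]] epR in auto)
  also have "... = (\<Oplus>i\<in>I. k i ** th i l) ** ep"
   by (rule finsum_rmult[symmetric]) (use LR[OF k] LR[OF th(1)[OF _ l]] epR in auto)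
  finally show ?thesis .
 qed
 have sumL: "(\<Oplus>i\<in>I. k i ** th i l) \<in> L" if "k : I \<rightarrow> L" "l : L" for k l
  by (intro finsum_in_subring[OF subfieldE(1)[OF L]] Ls(6) funcset_mem[OF that(1)] that(2) th(1))
 have TW: "t ** w \<in> ?W" if t: "t : T" and w: "w : ?W" for t w
 proof -
  obtain k where k: "k : I \<rightarrow> L" "t = (\<Oplus>i\<in>I. k i ** v i)" using t unfolding T_lin_span by (rule lin_spanE)
  obtain l where l: "l : L" "w = l ** ep" using w by blast
  show ?thesis unfolding k(2) l(2) act[OF k(1) l(1)]
   using sumL[OF k(1) l(1)] by blast
 qed
 have FT: "F <= T" using FL L_T by blast
 have comm: "c ** t = t ** c" if "c : F" "t : T" for c t
  using central_comm[of F c t] cenF that T_R by simp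
 interpret T: ring "sub R T" by (rule subring_is_ring[OF T_subring])
 have N1: "1 \<le> N" using one_index by (metis atLeastAtMost_iff le_trans)
 have FsT: "subfield F (sub R T)" "F <= center (sub R T)" "T.dimension (N * N) F (carrier (sub R T))"
  using subfield_sub[OF T_subring FT] F FT comm dimension_sub[OF T_subring FT order_refl F] T_dimension(2)
  unfolding centralizer_sub by auto
 have cp: "crossed_product (sub R T) L (galois_group (sub R T) L F) (%g. g) (induced_factor_set R L N v) (unit_inducing R L N v)"
  and LT: "subfield L (sub R T)"
  using T_crossed_product unfolding classical_crossed_product_def galois_extension_def by auto
 obtain e where e: "matrix_units (sub R T) N e"
 proof (rule faithful_module_units[OF T.ring_axioms T.simple_imp_prime[OF T.crossed_product_simple[OF cp LT]] FsT F
    dW N1, where act = "(\<otimes>)" and kp = id])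
  show "s ** w \<in> ?W" if "s : carrier (sub R T)" "w : ?W" for s w using TW that by simp
  show "(\<forall>s\<in>carrier (sub R T). \<forall>t\<in>carrier (sub R T). \<forall>w\<in>?W. s \<otimes>\<^bsub>sub R T\<^esub> t ** w = s ** (t ** w)) \<or>
   (\<forall>s\<in>carrier (sub R T). \<forall>t\<in>carrier (sub R T). \<forall>w\<in>?W. s \<otimes>\<^bsub>sub R T\<^esub> t ** w = t ** (s ** w))"
   using T_R LR epR by (intro disjI1 ballI) (auto simp: m_assoc)
 qed (use T_R LR epR in \<open>auto simp: l_distr r_distr intro: that\<close>)
 show "matrix_form F (sub R T) N F" "split_algebra F (sub R T)"
  by (rule T.full_units_split[OF FsT N1 e])+
qed

end

context factor_system
begin

lemma T_division: "division_ring (sub R (centralizer R T))"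
 by (rule division_subcommutant[OF ring_axioms _ _ M_division]) (use L_T T_R in auto)

text \<open>Matrix units of \<open>T\<close> span it over \<open>F\<close>, so their commutant in \<open>R\<close> is that of \<open>T\<close>.\<close>

lemma T_units:
 assumes e: "complete_matrix_units F (sub R T) m e"
 shows "m = N" "1 \<le> N" "matrix_units R N e" "!!i j. i \<in> I ==> j : I ==> e i j \<in> T"
  "unit_commutant R N e = centralizer R T"
proof -
 interpret TT: ring "sub R T" by (rule subring_is_ring[OF T_subring])
 have FT: "F <= T" using FL L_T by blast
 have dT: "TT.dimension n F E \<longleftrightarrow> dimension n F E" if "E <= T" for n E by (rule dimension_sub[OF T_subring FT that F])
 have FsT: "subfield F (sub R T)" using subfield_sub[OF T_subring FT] F by simp
 have dimT: "TT.dimension (N * N) F (carrier (sub R T))" using T_dimension(2) dT[of T] by simp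
 obtain D where D: "matrix_form F (sub R T) m D" and eT: "matrix_units (sub R T) m e"
  using e unfolding complete_matrix_units_iff by blast
 have m1: "1 \<le> m" using D unfolding matrix_form_def by simp
 show N1: "1 \<le> N" using T_matrix_form unfolding matrix_form_def by simp
 obtain e0 where e0: "matrix_units (sub R T) N e0" "division_ring (sub (sub R T) (unit_commutant (sub R T) N e0))"
  and d0: "!!d. TT.dimension d F F ==> TT.dimension d F (unit_commutant (sub R T) N e0)" and cT: "center (sub R T) = F"
  by (rule TT.matrix_formE[OF T_matrix_form]) (rule that)
 obtain e1 where e1: "matrix_units (sub R T) m e1" "division_ring (sub (sub R T) (unit_commutant (sub R T) m e1))"
  by (rule TT.matrix_formE[OF D]) (rule that)
 interpret e0: matrix_unit_system "sub R T" N e0 by unfold_locales (rule e0(1))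
 interpret e1: matrix_unit_system "sub R T" m e1 by unfold_locales (rule e1(1))
 have Fc: "F <= center (sub R T)" using cT by simp
 have "TT.dimension 1 F (unit_commutant (sub R T) m e1)"
  by (rule TT.commutant_dimension_unique[OF e0.prime_if_division_commutant[OF N1 e0(2)] FsT Fc N1 m1 e0 e1
     d0[OF TT.dimension_one[OF FsT]]])
 then have "TT.dimension (m * m * 1) F (carrier (sub R T))" by (rule e1.dimension_matrix[OF FsT Fc])
 then have "m * m = N * N" using TT.dimension_is_inj[OF FsT _ dimT] by simp
 then show mN: "m = N" by (metis power2_eq_square power2_eq_iff_nonneg zero_le)
 have e: "matrix_units R N e" "\<forall>i\<in>I. \<forall>j\<in>I. e i j \<in> T"
  using eT matrix_units_sub[OF T_subring] unfolding mN by auto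
 show "matrix_units R N e" by (rule e(1))
 show eI: "e i j \<in> T" if "i : I" "j : I" for i j using e(2) that by blast
 interpret eT: matrix_unit_system "sub R T" N e using eT mN by unfold_locales simp
 interpret e: matrix_unit_system R N e by unfold_locales (rule e(1))
 have ZF: "unit_commutant (sub R T) N e = F" by (rule eT.full_matrix_units_commutant[OF FsT Fc dimT N1])
 show "unit_commutant R N e = centralizer R T"
  by (rule e.commutant_full_subring[OF T_subring _ ZF]) (use eI cenF in simp_all)
qed

end

context galois_descent
begin

text \<open>An average over the group intertwines the two systems. If all averages \<open>\<Sum> v\<^sub>i l v'\<^sub>i\<inverse>\<close> vanished, the
 conjugations by the \<open>v\<^sub>i\<close> would be dependent characters of \<open>L\<close>.\<close>

lemma factors_unique:
 assumes "factors \<beta>" "factors \<beta>'"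
 shows "\<exists>c\<in>M - {\<zero>}. \<forall>i\<in>I. c ** (\<beta>' i ** u i) = (\<beta> i ** u i) ** c"
proof -
 interpret a: factor_system R F L N u \<beta> by unfold_locales fact
 interpret b: factor_system R F L N u \<beta>' by unfold_locales fact
 note ivR = Units_inv_closed[OF b.v_unit]
 define c where "c l = (\<Oplus>i\<in>I. a.v i ** l ** inv (b.v i))" for l
 have t: "a.v i ** l ** inv (b.v i) \<in> carrier R" if "i : I" "l : L" for i l
  using a.vR[OF that(1)] ivR[OF that(1)] LR[OF that(2)] by simp
 have cR: "c l \<in> carrier R" if "l : L" for l unfolding c_def using t[OF _ that] by (intro finsum_closed) auto
 have b_inv: "s i l ** inv (b.v i) = inv (b.v i) ** l" if il: "i : I" "l : L" for i l
 proof -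
  have "s i l ** inv (b.v i) = inv (b.v i) ** (b.v i ** s i l) ** inv (b.v i)"
   using b.vR[OF il(1)] b.v_unit[OF il(1)] LR[OF s_closed[OF il]] by (simp flip: m_assoc)
  also have "... = inv (b.v i) ** l"
   unfolding b.l_v[OF il, symmetric] using b.vR[OF il(1)] b.v_unit[OF il(1)] LR[OF il(2)] by (simp add: m_assoc)
  finally show ?thesis .
 qed
 have cM: "c l \<in> M" if l: "l : L" for l
 proof -
  have "l' ** (a.v i ** l ** inv (b.v i)) = a.v i ** l ** inv (b.v i) ** l'" if i: "i : I" and l': "l' : L" for i l'
  proof -
   have R: "l : carrier R" "l' : carrier R" "s i l' \<in> carrier R" "a.v i \<in> carrier R" "inv (b.v i) \<in> carrier R"
    using LR l l' s_closed[OF i l'] a.vR[OF i] ivR[OF i] by auto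
   have "l' ** (a.v i ** l ** inv (b.v i)) = (l' ** a.v i) ** l ** inv (b.v i)" using R by (simp add: m_assoc)
   also have "... = a.v i ** (s i l' ** l) ** inv (b.v i)" unfolding a.l_v[OF i l'] using R by (simp add: m_assoc)
   also have "... = a.v i ** l ** (s i l' ** inv (b.v i))"
    unfolding subfieldE(4)[OF L s_closed[OF i l'] l] using R by (simp add: m_assoc)
   finally show ?thesis unfolding b_inv[OF i l'] using R by (simp add: m_assoc)
  qed
  then have "l' ** c l = c l ** l'" if "l' : L" for l'
   unfolding c_def using that LR t[OF _ l] by (intro commutes_finsum) auto
  then show ?thesis unfolding centralizer_def using cR[OF l] by simp
 qed
 have vc: "a.v j ** c l = c l ** b.v j" if j: "j : I" and l: "l : L" for j l
 proof -
  have "a.v j ** c l = (\<Oplus>i\<in>I. a.v j ** (a.v i ** l ** inv (b.v i)))"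
   unfolding c_def by (rule finsum_lmult) (use a.vR[OF j] t[OF _ l] in auto)
  also have "... = (\<Oplus>i\<in>I. a.v (kp j i) ** l ** inv (b.v (kp j i)) ** b.v j)"
  proof (rule finsum_cong')
   fix i assume i: "i : I"
   have k: "kp j i \<in> I" using kp[OF j i] by simp
   have "inv (b.v (kp j i)) ** b.v j = inv (b.v (kp j i)) ** (b.v j ** b.v i) ** inv (b.v i)"
    using ivR[OF k] b.v_unit[OF i] b.vR[OF i] b.vR[OF j] by (simp add: m_assoc)
   also have "... = inv (b.v i)"
    unfolding b.v_mult[OF j i] using b.v_unit[OF k] ivR[OF i] by simp
   finally have "inv (b.v (kp j i)) ** b.v j = inv (b.v i)" .
   then show "a.v j ** (a.v i ** l ** inv (b.v i)) = a.v (kp j i) ** l ** inv (b.v (kp j i)) ** b.v j"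
    unfolding a.v_mult[OF j i, symmetric]
    using a.vR[OF i] a.vR[OF j] LR[OF l] ivR[OF i] ivR[OF k] b.vR[OF j] by (simp add: m_assoc)
  qed (use t[OF _ l] kp[OF j] b.vR[OF j] in auto)
  also have "... = (\<Oplus>i\<in>kp j ` I. a.v i ** l ** inv (b.v i) ** b.v j)"
   by (rule finsum_reindex[OF _ a.kp_bij(1)[OF j], symmetric], unfold a.kp_bij(2)[OF j]) (use t[OF _ l] b.vR[OF j] in auto)
  also have "... = c l ** b.v j"
   unfolding a.kp_bij(2)[OF j] c_def by (rule finsum_rmult[symmetric]) (use t[OF _ l] b.vR[OF j] in auto)
  finally show ?thesis .
 qed
 have "\<exists>l\<in>L. c l ~= \<zero>"
 proof (rule ccontr)
  assume "\<not> (\<exists>l\<in>L. c l ~= \<zero>)"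
  then have c0: "c l = \<zero>" if "l : L" for l using that by blast
  note Ls = subringE[OF subfieldE(1)[OF L]]
  have mR: "a.v i ** inv (b.v i) \<in> carrier R" if "i : I" for i using a.vR[OF that] ivR[OF that] by simp
  have "\<forall>i\<in>I. a.v i ** inv (b.v i) = \<zero>"
  proof (rule characters_independent[OF L, where th = a.th and L = L])
   show "(\<Oplus>i\<in>I. a.th i l ** (a.v i ** inv (b.v i))) = \<zero>" if l: "l : L" for l
    unfolding c0[OF l, symmetric] c_def
   proof (rule finsum_cong')
    fix i assume i: "i : I"
    show "a.th i l ** (a.v i ** inv (b.v i)) = a.v i ** l ** inv (b.v i)"
     unfolding a.th(2)[OF i l] using a.vR[OF i] LR[OF a.th(1)[OF i l]] ivR[OF i] by (simp add: m_assoc)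
   qed (use t[OF _ l] in auto)
  qed (use a.th(1) a.th_mult a.th_one a.th_distinct Ls(3,6) mR in auto)
  moreover obtain i where i: "i : I" by (rule a.one_index)
  ultimately have z: "a.v i ** inv (b.v i) = \<zero>" by blast
  have "a.v i = a.v i ** inv (b.v i) ** b.v i" using a.vR[OF i] b.v_unit[OF i] b.vR[OF i] by (simp add: m_assoc)
  then have "a.v i = \<zero>" unfolding z using b.vR[OF i] by simp
  then have "\<one> = \<zero>" using Units_l_inv[OF a.v_unit[OF i]] Units_inv_closed[OF a.v_unit[OF i]] by simp
  then show False using M_division unfolding division_ring_def by simp
 qed
 then obtain l where l: "l : L" "c l ~= \<zero>" by blast
 have "c l ** (\<beta>' i ** u i) = (\<beta> i ** u i) ** c l" if "i : I" for i
  using vc[OF that l(1)] unfolding a.v_def b.v_def by simp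
 then show ?thesis using cM[OF l(1)] l(2) by blast
qed

text \<open>In a common crossed product, \<open>v\<^sub>i\<inverse> v'\<^sub>i\<close> commutes with \<open>L\<close> and therefore lies in \<open>L\<close>.\<close>

lemma factors_same_span:
 assumes "factors \<beta>" "factors \<beta>'" and S: "span_of R L I (%i. \<beta>' i ** u i) = span_of R L I (%i. \<beta> i ** u i)" and i: "i : I"
 shows "\<exists>l\<in>L - {\<zero>}. \<beta>' i = l ** \<beta> i"
proof -
 interpret a: factor_system R F L N u \<beta> by unfold_locales fact
 interpret b: factor_system R F L N u \<beta>' by unfold_locales fact
 have "b.v = (%i. \<beta>' i ** u i)" "a.v = (%i. \<beta> i ** u i)" by (auto simp: a.v_def b.v_def)
 then have "b.T = a.T" using S unfolding a.T_def b.T_def by simp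
 then have bT: "b.v i \<in> a.T" using b.v_T[OF i] by simp
 obtain j where j: "j : I" "inv (a.v i) = a.v j" by (rule a.inverse_index[OF i])
 let ?x = "inv (a.v i) ** b.v i"
 have R: "inv (a.v i) \<in> carrier R" "b.v i \<in> carrier R" "a.v i \<in> carrier R"
  using Units_inv_closed[OF a.v_unit[OF i]] b.vR[OF i] a.vR[OF i] by auto
 have xT: "?x \<in> a.T" unfolding j(2) by (rule subringE(6)[OF a.T_subring a.v_T[OF j(1)] bT])
 have x: "?x \<in> L"
 proof (rule a.T_self_centralizing[OF xT])
  fix l assume l: "l : L"
  have R': "l : carrier R" "a.th i l \<in> carrier R" "s i l \<in> carrier R" using LR l a.th(1)[OF i l] s_closed[OF i l] by auto
  have "l ** inv (a.v i) = inv (a.v i) ** (a.v i ** l) ** inv (a.v i)"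
   using R R' a.v_unit[OF i] by (simp flip: m_assoc)
  also have "... = inv (a.v i) ** a.th i l"
   unfolding a.th(2)[OF i l] using R R' a.v_unit[OF i] by (simp add: m_assoc)
  finally have 1: "l ** inv (a.v i) = inv (a.v i) ** a.th i l" .
  have sth: "s i (a.th i l) = l"
   using Units_l_cancel[OF a.v_unit[OF i] LR[OF s_closed[OF i a.th(1)[OF i l]]] R'(1)]
    a.l_v[OF i a.th(1)[OF i l]] a.th(2)[OF i l] by simp
  have "l ** ?x = inv (a.v i) ** (a.th i l ** b.v i)" using 1 R R' by (simp flip: m_assoc)
  also have "... = ?x ** l" unfolding b.l_v[OF i a.th(1)[OF i l]] sth using R R' by (simp add: m_assoc)
  finally show "?x ** l = l ** ?x" ..
 qed
 define l where "l = a.th i ?x"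
 have lL: "l : L" unfolding l_def by (rule a.th(1)[OF i x])
 have "b.v i = a.v i ** ?x" using R a.v_unit[OF i] by (simp flip: m_assoc)
 then have "b.v i = l ** a.v i" using a.th(2)[OF i x] unfolding l_def by simp
 then have "\<beta>' i ** u i = (l ** \<beta> i) ** u i"
  unfolding a.v_def b.v_def using LR[OF lL] MR[OF a.\<beta>(1)[OF i]] uR[OF i] by (simp add: m_assoc)
 then have "\<beta>' i ** u i ** inv (u i) = (l ** \<beta> i) ** u i ** inv (u i)" by simp
 then have e: "\<beta>' i = l ** \<beta> i"
  using LR[OF lL] MR[OF a.\<beta>(1)[OF i]] MR[OF b.\<beta>(1)[OF i]] uR[OF i] u[OF i] by (simp add: m_assoc)
 have "l ~= \<zero>" using e b.\<beta>(2)[OF i] MR[OF a.\<beta>(1)[OF i]] by auto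
 then show ?thesis using e lL by blast
qed

text \<open>If \<open>M f\<close> is the whole left ideal generated by \<open>f\<close>, then \<open>u\<^sub>i f = m\<^sub>i f\<close> for some \<open>m\<^sub>i\<close>, and the
 \<open>m\<^sub>i\<inverse> u\<^sub>i\<close> fix \<open>f\<close>. The cocycle they define takes values in \<open>M\<close> and fixes \<open>f\<close>, hence is trivial.\<close>

lemma factors_exist:
 assumes f: "f : carrier R" "f ** f = f" "f ~= \<zero>"
  and d: "dimension d L {x \<in> carrier R. x ** f = x}" "dimension d L M"
 shows "\<exists>\<beta>. factors \<beta>"
proof -
 let ?V = "{x \<in> carrier R. x ** f = x}"
 note Ms = subringE[OF M_subring]
 have Mf: "m = \<zero>" if m: "m : M" "m ** f = \<zero>" for m
 proof (rule ccontr)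
  assume "m ~= \<zero>"
  then obtain m' where m': "m' : M" "m' ** m = \<one>" using M_inverse[OF m(1)] by blast
  have "f = m' ** (m ** f)" using m' MR[OF m'(1)] MR[OF m(1)] f by (simp flip: m_assoc)
  then show False using m(2) MR[OF m'(1)] f by simp
 qed
 have Mf_eq: "m = m'" if m: "m : M" "m' : M" "m ** f = m' ** f" for m m'
 proof -
  have "(m \<ominus> m') ** f = m ** f \<ominus> m' ** f"
   using MR[OF m(1)] MR[OF m(2)] f by (simp add: a_minus_def l_distr l_minus)
  then have "(m \<ominus> m') ** f = \<zero>" using m(3) MR[OF m(2)] f by (simp add: r_right_minus_eq)
  moreover have "m \<ominus> m' \<in> M" using m Ms(5,7) by (simp add: a_minus_def)
  ultimately have "m \<ominus> m' = \<zero>" using Mf by blast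
  then show ?thesis using MR[OF m(1)] MR[OF m(2)] by (simp add: r_right_minus_eq)
 qed
 have dM: "dimension d L ((%m. m ** f) ` M)"
 proof (rule dimension_transport[where kp = id, OF ring_axioms ring_axioms L L d(2)])
  show "inj_on (%m. m ** f) M" by (rule inj_onI) (rule Mf_eq)
 qed (use MR LR f in \<open>auto simp: l_distr m_assoc\<close>)
 have sub: "(%m. m ** f) ` M <= ?V"
 proof
  fix x assume "x : (%m. m ** f) ` M"
  then obtain m where "m : M" "x = m ** f" by blast
  then show "x : ?V" using MR f by (simp add: m_assoc)
 qed
 have V: "?V = (%m. m ** f) ` M" by (rule dimension_mono(2)[OF L d(1) dM sub refl, symmetric])
 have ex: "\<exists>b. b \<in> M \<and> b ~= \<zero> \<and> b ** u i ** f = f" if i: "i : I" for i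
 proof -
  have "u i ** f \<in> ?V" using uR[OF i] f by (simp add: m_assoc)
  then have "u i ** f \<in> (%m. m ** f) ` M" unfolding V .
  then obtain m where m: "u i ** f = m ** f" "m : M" by (rule imageE)
  have "m ~= \<zero>"
  proof
   assume "m = \<zero>"
   then have "inv (u i) ** (u i ** f) = \<zero>" using m(1) f u[OF i] by simp
   then show False using f u[OF i] uR[OF i] by (simp flip: m_assoc)
  qed
  then obtain b where b: "b : M" "b ** m = \<one>" by (rule M_inverse[OF m(2)])
  have "b ** u i ** f = b ** m ** f" using m MR[OF m(2)] MR[OF b(1)] uR[OF i] f by (simp add: m_assoc)
  then have "b ** u i ** f = f" using b(2) f by simp
  moreover have "b ~= \<zero>"
  proof
   assume "b = \<zero>"
   then have "\<one> = \<zero>" using b(2) MR[OF m(2)] by simp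
   then show False using M_division unfolding division_ring_def by simp
  qed
  ultimately show ?thesis using b(1) by (intro exI[of _ b] conjI)
 qed
 obtain b where b: "!!i. i \<in> I ==> b i \<in> M" "!!i. i \<in> I ==> b i ~= \<zero>" "!!i. i \<in> I ==> b i ** u i ** f = f"
  using ex by metis
 define v where "v i = b i ** u i" for i
 have v_unit: "v i \<in> Units R" if "i : I" for i
  unfolding v_def by (rule Units_m_closed[OF _ u[OF that]]) (use M_inverse[OF b(1)[OF that] b(2)[OF that]] in metis)
 note vR = Units_closed[OF v_unit]
 have l_v: "l ** v i = v i ** s i l" if "i : I" "l : L" for i l unfolding v_def by (rule l_mu[OF b(1)[OF that(1)] that])
 have vf: "v i ** f = f" if "i : I" for i unfolding v_def by (rule b(3)[OF that])
 interpret G: comm_group "galois_group R L F" by (rule comm)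
 have "v i ** v j = v k" if ijk: "i : I" "j : I" "k : I" and c: "compose L (s i) (s j) = s k" for i j k
 proof -
  let ?x = "v i ** v j ** inv (v k)"
  have iR: "inv (v k) \<in> carrier R" by (rule Units_inv_closed[OF v_unit[OF ijk(3)]])
  have "compose L (s j) (s i) = s k"
   using G.m_comm[OF s_G[OF ijk(1)] s_G[OF ijk(2)]] c unfolding galois_group_simps by simp
  then have sk: "s k l = s j (s i l)" if "l : L" for l using that by (metis compose_eq)
  have "l ** ?x = ?x ** l" if l: "l : L" for l
  proof -
   have R: "l : carrier R" "s i l \<in> carrier R" "s k l \<in> carrier R" "v i \<in> carrier R" "v j \<in> carrier R" "v k \<in> carrier R"
    using LR l s_closed[OF ijk(1) l] s_closed[OF ijk(3) l] vR ijk by auto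
   have "l ** ?x = (l ** v i) ** v j ** inv (v k)" using R iR by (simp add: m_assoc)
   also have "... = v i ** (s i l ** v j) ** inv (v k)" unfolding l_v[OF ijk(1) l] using R iR by (simp add: m_assoc)
   also have "... = v i ** v j ** (s k l ** inv (v k))"
    unfolding l_v[OF ijk(2) s_closed[OF ijk(1) l]] sk[OF l, symmetric] using R iR by (simp add: m_assoc)
   also have "s k l ** inv (v k) = inv (v k) ** (v k ** s k l) ** inv (v k)"
    using R iR v_unit[OF ijk(3)] by (simp flip: m_assoc)
   also have "... = inv (v k) ** l"
    unfolding l_v[OF ijk(3) l, symmetric] using R iR v_unit[OF ijk(3)] by (simp add: m_assoc)
   finally show ?thesis using R iR by (simp add: m_assoc)
  qed
  then have xM: "?x \<in> M" unfolding centralizer_def using vR ijk iR by simp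
  have "inv (v k) ** f = inv (v k) ** (v k ** f)" using vf[OF ijk(3)] by simp
  also have "... = f" using f vR[OF ijk(3)] v_unit[OF ijk(3)] by (simp flip: m_assoc)
  finally have "?x ** f = \<one> ** f" using vf ijk vR iR f by (simp add: m_assoc)
  then have "?x = \<one>" by (rule Mf_eq[OF xM Ms(3)])
  then have "?x ** v k = v k" using vR[OF ijk(3)] by simp
  then show ?thesis using vR ijk v_unit[OF ijk(3)] by (simp add: m_assoc)
 qed
 then have "factors b" unfolding multiplicative_factors_def v_def using b by auto
 then show ?thesis by (rule exI[of _ b])
qed

end

section \<open>Abelian crossed products of prime Schur index\<close>

lemma prime_power_factor:
 assumes "Factorial_Ring.prime (p :: nat)" "p ^ a = p ^ b * c"
 shows "b \<le> a" "c = p ^ (a - b)"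
proof -
 have "1 < p" "p ~= 0" using assms(1) prime_gt_1_nat by auto
 then show "b \<le> a" using assms(2) power_dvd_imp_le[of p b a] by simp
 then have "p ^ b * p ^ (a - b) = p ^ b * c" using assms(2) by (simp flip: power_add)
 then show "c = p ^ (a - b)" using \<open>p ~= 0\<close> by simp
qed

locale index_p_crossed_product = ring A for A :: "('a, 'b) ring_scheme" (structure) +
 fixes K F L :: "'a set" and \<tau> :: "('a \<Rightarrow> 'a) \<Rightarrow> ('a \<Rightarrow> 'a) \<Rightarrow> 'a" and z :: "('a \<Rightarrow> 'a) \<Rightarrow> 'a" and p n r :: nat
 assumes p: "Factorial_Ring.prime p"
  and A: "abelian_crossed_product A K F \<tau> z"
  and dim_A: "dimension (p ^ (2 * n)) F (carrier A)"
  and index_A: "has_schur_index F A p"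
  and L: "subfield L A" "F <= L" "L <= K"
  and L_splits: "splits F A (sub A L)"
  and L_least: "!!E k. \<lbrakk>subfield E A; F <= E; E <= K; splits F A (sub A E); dimension k F E\<rbrakk> \<Longrightarrow> p ^ r \<le> k"
  and deg_L: "dimension (p ^ r) F L"
begin

lemma ccp: "classical_crossed_product A K F \<tau> z" and comm_K: "comm_group (galois_group A K F)"
 using A unfolding abelian_crossed_product_def by auto

lemma gal: "galois_extension A K F" and cp: "crossed_product A K (galois_group A K F) (%g. g) \<tau> z" and cenF: "center A = F"
 using ccp unfolding classical_crossed_product_def by auto

lemma F: "subfield F A" and K: "subfield K A" and FK: "F <= K"
 using gal unfolding galois_extension_def by auto

lemma simple: "simple_ring" by (rule crossed_product_simple[OF cp K])

lemma prime: "prime_ring A" by (rule simple_imp_prime[OF simple])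

lemma p_pos: "0 < p" using p prime_gt_0_nat by blast

lemma deg_K: "dimension (p ^ n) F K"
proof -
 let ?G = "carrier (galois_group A K F)"
 obtain d where d: "dimension d F K"
  using gal unfolding galois_extension_def finite_dimension_def by auto
 have "span_of A K ?G z = carrier A"
 proof (intro equalityI subsetI)
  fix a assume "a : carrier A"
  then show "a : span_of A K ?G z" using crossed_productD(6)[OF cp] unfolding span_of_def by blast
 next
  fix a assume "a : span_of A K ?G z"
  then obtain c where c: "c : ?G \<rightarrow> K" "a = (\<Oplus>g\<in>?G. z g ** c g)" unfolding span_of_def by blast
  show "a : carrier A"
   unfolding c(2) using funcset_mem[OF c(1)] subfieldE(3)[OF K] Units_closed[OF crossed_productD(3)[OF cp]]
   by (intro finsum_closed funcsetI m_closed) auto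
 qed
 then have "dimension (d * d) F (carrier A)"
  using telescopic_base[OF F K d crossed_dimension[OF cp K FK order_refl]] galois_degree[OF gal d] by simp
 then have "d * d = p ^ n * p ^ n"
  using dimension_is_inj[OF F dim_A] by (simp add: power_add mult_2)
 then have "d = p ^ n" by (metis power2_eq_square power2_eq_iff_nonneg zero_le)
 then show ?thesis using d by simp
qed

text \<open>The Galois theory of \<open>E\<close> under \<open>K/F\<close> and, through the crossed product, the dimension of the centralizer of \<open>E\<close>.\<close>

lemma intermediate:
 assumes E: "subfield E A" "F <= E" "E <= K" and d: "dimension d F E"
 defines "c \<equiv> card (carrier (galois_group A K E))"
 shows "p ^ n = d * c" "galois_extension A K E" "dimension (p ^ n * c) E (carrier A)" "dimension (c * c) E (centralizer A E)"
proof -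
 note i = intermediate_field[OF gal E d deg_K, folded c_def]
 show pn: "p ^ n = d * c" and gE: "galois_extension A K E" by (rule i(3), rule i(1))
 obtain m where m: "dimension m E (carrier A)" "p ^ (2 * n) = d * m"
  by (rule dimension_over_intermediate[OF F E(1,2) d dim_A]) (use subfieldE(3)[OF E(1)] in blast)
 have "d * m = p ^ n * (d * c)" using m(2) unfolding pn[symmetric] by (simp add: power_add mult_2)
 then have "d * m = d * (p ^ n * c)" by (simp add: mult.left_commute)
 moreover have "0 < d" using pn p_pos by (metis mult_is_0 power_not_zero gr0I less_numeral_extra(3))
 ultimately show "dimension (p ^ n * c) E (carrier A)" using m(1) by simp
 have "carrier (galois_group A K E) <= carrier (galois_group A K F)" using E(2) unfolding galois_group_def by auto
 then have "dimension c K (centralizer A E)"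
  unfolding c_def crossed_centralizer[OF cp K E(2,3)] by (rule crossed_dimension[OF cp K FK])
 then show "dimension (c * c) E (centralizer A E)" by (rule telescopic_base[OF E(1) K i(2)])
qed

abbreviation k where "k \<equiv> p ^ (n - r)"
abbreviation C where "C \<equiv> centralizer A L"

lemma r_le: "r \<le> n" and card_KL: "card (carrier (galois_group A K L)) = k"
 using prime_power_factor[OF p intermediate(1)[OF L deg_L]] by auto

lemma C_span: "span_of A K (carrier (galois_group A K L)) z = C"
 using crossed_centralizer[OF cp K L(2,3)] by simp

lemma C_subring: "subring C A" by (rule centralizer_subring[OF subfieldE(3)[OF L(1)]])

lemma L_C: "L <= C" using subfieldE(3,4)[OF L(1)] unfolding centralizer_def by auto

lemma L_center: "L <= center (sub A C)"
 using L_C unfolding centralizer_sub centralizer_def by auto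

lemma dim_C: "dimension (k * k) L C" using intermediate(4)[OF L deg_L] unfolding card_KL .

lemma field_tensor: "subfield E A ==> F <= E ==> field_tensor A F E (p ^ (2 * n))"
 by (rule field_tensor.intro[OF ring_axioms field_tensor_axioms.intro[OF F _ _ simple cenF dim_A]])

lemma k_pos: "1 \<le> k" using p_pos by (simp add: Suc_le_eq)

lemma L_sub: "subfield L (sub A C)" using subfield_sub[OF C_subring L_C] L(1) by simp

lemma C_ccp: "classical_crossed_product (sub A C) K L \<tau> z"
 by (rule crossed_restrict[OF ccp L intermediate(2)[OF L deg_L]])

lemma C_iso: "algebra_iso L (sub A C) (scalar_matrix k (sub A L)) (matrix_ring k (sub A L))"
 and C_split: "split_algebra L (sub A C)"
proof -
 interpret C: ring "sub A C" by (rule subring_is_ring[OF C_subring])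
 have cpC: "crossed_product (sub A C) K (galois_group (sub A C) K L) (%g. g) \<tau> z" "subfield K (sub A C)"
  using C_ccp unfolding classical_crossed_product_def galois_extension_def by auto
 have pr: "prime_ring (sub A C)" by (rule C.simple_imp_prime[OF C.crossed_product_simple[OF cpC]])
 have dC: "C.dimension (k * k) L (carrier (sub A C))" using dim_C dimension_sub[OF C_subring L_C order_refl L(1)] by simp
 have d: "dimension (p ^ n * k) L (carrier A)" using intermediate(3)[OF L deg_L] unfolding card_KL .
 have n: "p ^ (2 * n) = p ^ n * p ^ n" "0 < p ^ n" using p_pos by (simp_all add: power_add mult_2)
 interpret ft: field_tensor A F L "p ^ (2 * n)" by (rule field_tensor[OF L(1,2)])
 obtain e where e: "matrix_units (sub A C) k e"
  by (rule ft.splits_imp_centralizer_units[OF L_splits n(1) d n(2) k_pos dim_C pr])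
 note f = C.full_units_split(2,3)[OF L_sub L_center dC k_pos e]
 show "split_algebra L (sub A C)" by (rule f(1))
 show "algebra_iso L (sub A C) (scalar_matrix k (sub A L)) (matrix_ring k (sub A L))" using f(2) by simp
qed

lemma C_subalgebra: "subalgebra_over L C A"
 unfolding subalgebra_over_def algebra_over_def embedded_algebra_def
 using C_subring subring_is_ring[OF C_subring] L_sub L_center by auto

end

locale index_p_matrix_units = index_p_crossed_product +
 fixes E assumes E: "complete_matrix_units L (sub A C) k E"
begin

lemma E_units: "matrix_units A k E" and E_C: "!!i j. i \<in> {1..k} ==> j : {1..k} ==> E i j \<in> C"
 using E matrix_units_sub[OF C_subring] unfolding complete_matrix_units_iff by auto

sublocale E: matrix_unit_system A k E by unfold_locales (rule E_units)

abbreviation Cn where "Cn \<equiv> unit_commutant A k E"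

text \<open>The full matrix algebra \<open>C\<close> over \<open>L\<close> has only scalars commuting with its matrix units; this makes \<open>L\<close> a maximal
 subfield of \<open>Cen\<^sub>A(B)\<close>.\<close>

lemma commutant_in_C: "unit_commutant (sub A C) k E = L"
proof -
 interpret EC: matrix_unit_system "sub A C" k E
  using subring_is_ring[OF C_subring] matrix_units_sub[OF C_subring] E_units E_C
  by (intro matrix_unit_system.intro matrix_unit_system_axioms.intro) auto
 show ?thesis
  by (rule EC.full_matrix_units_commutant[OF L_sub L_center _ k_pos])
   (use dim_C dimension_sub[OF C_subring L_C _ L(1)] in simp)
qed

lemma Cn_L: "centralizer (sub A Cn) L = L"
proof -
 have "centralizer (sub A Cn) L = unit_commutant (sub A C) k E"
  unfolding centralizer_sub unit_commutant_def centralizer_def by auto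
 then show ?thesis using commutant_in_C by simp
qed

lemma Cn_subring: "subring Cn A" by (rule E.Z_subring)

lemma L_Cn: "L <= Cn"
proof -
 have "L <= centralizer (sub A Cn) L" unfolding Cn_L ..
 then show ?thesis unfolding centralizer_sub by blast
qed

lemma F_Cn: "F <= Cn" using L(2) L_Cn by blast

lemma dim_sub: "V <= Cn ==> Q <= Cn ==> subfield Q A ==> ring.dimension (sub A Cn) d Q V \<longleftrightarrow> dimension d Q V"
 by (rule dimension_sub[OF Cn_subring])

lemma dim_Cn: "dimension (p ^ (2 * r)) F Cn"
proof -
 note Cs = subringE[OF Cn_subring]
 obtain d where d: "dimension d F Cn"
  using subspace_dimension[OF F dim_A Cs(1,2,7)] Cs(6) F_Cn by (metis subsetD)
 have "p ^ (2 * n) = k * k * d"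
  by (rule dimension_is_inj[OF F dim_A E.dimension_matrix[OF F _ d]]) (use cenF in simp)
 then have "p ^ (2 * n) = p ^ (2 * (n - r)) * d" by (simp add: power_add mult_2)
 then have "d = p ^ (2 * n - 2 * (n - r))" by (rule prime_power_factor(2)[OF p])
 also have "2 * n - 2 * (n - r) = 2 * r" using r_le by simp
 finally show ?thesis using d by simp
qed

lemma Cn_prime: "prime_ring (sub A Cn)" by (rule E.commutant_prime[OF prime])

lemma Cn_center: "center (sub A Cn) = F" using center_unit_commutant[OF E_units] cenF by simp

sublocale Cn: ring "sub A Cn" by (rule subring_is_ring[OF Cn_subring])

lemma F_sub: "subfield F (sub A Cn)" using subfield_sub[OF Cn_subring F_Cn] F by simp

lemma Cn_algebra: "algebra_over F (sub A Cn)"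
 unfolding algebra_over_def embedded_algebra_def using F_sub Cn.ring_axioms Cn_center by simp

lemma dim_Cn': "Cn.dimension (p ^ (2 * r)) F (carrier (sub A Cn))"
 using dim_sub[OF _ F_Cn F] dim_Cn by simp

lemma A_algebra: "algebra_over F A"
 unfolding algebra_over_def embedded_algebra_def using F ring_axioms cenF by simp

text \<open>A division commutant in \<open>Cen\<^sub>A(B)\<close> is one in \<open>A\<close>, so it has the dimension prescribed by the index.\<close>

lemma division_units_dimension:
 assumes q: "1 \<le> q" and g: "matrix_units (sub A Cn) q g"
  and div: "division_ring (sub A (unit_commutant (sub A Cn) q g))"
 shows "dimension (p\<^sup>2) F (unit_commutant (sub A Cn) q g)"
proof -
 obtain h where h: "matrix_units A (q * k) h" "unit_commutant A (q * k) h = unit_commutant (sub A Cn) q g"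
  by (rule E.product_units[OF g k_pos])
 obtain m D where mf: "matrix_form F A m D" and D: "dimension (p\<^sup>2) F D"
  using index_A unfolding has_schur_index_def by blast
 have m: "1 \<le> m" using mf unfolding matrix_form_def by simp
 obtain e where e: "matrix_units A m e" "division_ring (sub A (unit_commutant A m e))"
  and e': "!!d. dimension d F D ==> dimension d F (unit_commutant A m e)"
  by (rule matrix_formE[OF mf]) (rule that)
 have qk: "1 \<le> q * k" using q k_pos by simp
 have "dimension (p\<^sup>2) F (unit_commutant A (q * k) h)"
  by (rule commutant_dimension_unique[OF prime F _ m qk e h(1) _ e'[OF D]]) (use cenF div h(2) in simp_all)
 then show ?thesis unfolding h(2) .
qed

text \<open>The size of the matrix units is forced by \<open>p\<^sup>2\<^sup>r = q\<^sup>2 p\<^sup>2\<close>.\<close>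

lemma division_units:
 obtains g where "matrix_units (sub A Cn) (p ^ (r - 1)) g"
  "division_ring (sub A (unit_commutant (sub A Cn) (p ^ (r - 1)) g))" "1 \<le> r"
proof -
 obtain q g where q: "1 \<le> q" and g: "matrix_units (sub A Cn) q g"
  "division_ring (sub (sub A Cn) (unit_commutant (sub A Cn) q g))"
  by (rule Cn.Wedderburn_matrix_units[OF Cn_prime F_sub _ dim_Cn']) (use Cn_center in simp_all)
 interpret g: matrix_unit_system "sub A Cn" q g by unfold_locales (rule g(1))
 have div: "division_ring (sub A (unit_commutant (sub A Cn) q g))" using g(2) by simp
 have sub: "unit_commutant (sub A Cn) q g <= Cn" using g.Z_closed by auto
 have d: "Cn.dimension (p\<^sup>2) F (unit_commutant (sub A Cn) q g)"
  using division_units_dimension[OF q g(1) div] dim_sub[OF sub F_Cn F] by simp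
 have "Cn.dimension (q * q * p\<^sup>2) F (carrier (sub A Cn))"
  by (rule g.dimension_matrix[OF F_sub _ d]) (use Cn_center in simp)
 then have "p ^ (2 * r) = q * q * p\<^sup>2" by (rule Cn.dimension_is_inj[OF F_sub dim_Cn'])
 then have "(p ^ r)\<^sup>2 = (p * q)\<^sup>2" by (simp add: power_mult_distrib power_mult mult.commute power2_eq_square power_add mult_2)
 then have "p ^ r = p ^ 1 * q" using power2_eq_iff_nonneg[of "p ^ r" "p * q"] by simp
 then have "1 \<le> r" "q = p ^ (r - 1)" by (rule prime_power_factor[OF p])+
 then show ?thesis using that g(1) div by simp
qed

lemma r_pos: "1 \<le> r" by (rule division_units)

lemma Cn_index: "has_schur_index F (sub A Cn) p"
proof -
 obtain g where g: "matrix_units (sub A Cn) (p ^ (r - 1)) g"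
  "division_ring (sub A (unit_commutant (sub A Cn) (p ^ (r - 1)) g))" by (rule division_units)
 have q: "1 \<le> p ^ (r - 1)" using p_pos by (simp add: Suc_le_eq)
 interpret g: matrix_unit_system "sub A Cn" "p ^ (r - 1)" g by unfold_locales (rule g(1))
 have sub: "unit_commutant (sub A Cn) (p ^ (r - 1)) g <= Cn" using g.Z_closed by auto
 have "matrix_form F (sub A Cn) (p ^ (r - 1)) (unit_commutant (sub A Cn) (p ^ (r - 1)) g)"
  by (rule Cn.matrix_formI[OF Cn_algebra Cn_center dim_Cn' q g(1)]) (use g(2) in simp)
 then show ?thesis unfolding has_schur_index_def
  using division_units_dimension[OF q g] dim_sub[OF sub F_Cn F] by blast
qed

lemma strictly_maximal_L: "strictly_maximal_subfield F (sub A Cn) L"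
 unfolding strictly_maximal_subfield_def
 using subfield_sub[OF Cn_subring L_Cn] L(1,2) dim_sub[OF L_Cn F_Cn F] deg_L dim_Cn'
 by (intro conjI exI[of _ "p ^ r"]) (simp_all flip: power_mult add: mult.commute)

lemma gal_L: "galois_extension A L F" "card (carrier (galois_group A L F)) = p ^ r" "comm_group (galois_group A L F)"
 using intermediate_field_abelian[OF gal comm_K L deg_L deg_K] by auto

text \<open>Conjugation by \<open>z\<^sub>g\<close> carries one system of matrix units of \<open>C\<close> to another; an element of \<open>C\<close>
 carries it back and does not affect the action on \<open>L\<close>.\<close>

lemma inducing_unit:
 assumes s: "s : carrier (galois_group A L F)"
 obtains v where "v : Units (sub A Cn)" "conj_map (sub A Cn) L v = s"
proof -
 obtain g where g: "g : carrier (galois_group A K F)" "\<forall>x\<in>L. g x = s x"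
  using intermediate_field(4)[OF gal L deg_L deg_K s] by blast
 have z: "z g \<in> Units A" by (rule crossed_productD(3)[OF cp g(1)])
 let ?z = "z g" and ?y = "inv (z g)"
 have zR: "?z \<in> carrier A" "?y \<in> carrier A" "?y ** ?z = \<one>" "?z ** ?y = \<one>" using z Units_closed by auto
 have LA: "l : carrier A" if "l : L" for l using subfieldE(3)[OF L(1)] that by blast
 have lz: "l ** ?z = ?z ** s l" if "l : L" for l
  using crossed_productD(5)[OF cp g(1) subsetD[OF L(3) that]] g(2) that by simp
 have sL: "s l \<in> L" if "l : L" for l by (rule gal_memD(1)[OF s that])
 interpret C: ring "sub A C" by (rule subring_is_ring[OF C_subring])
 let ?f = "%i j. ?y ** E i j ** ?z"
 have cR: "c : carrier A" if "c : C" for c by (rule centralizer_memD(2)[OF that])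
 have fC: "?y ** c ** ?z \<in> C" if c: "c : C" for c
 proof -
  have "?y ** c ** ?z ** l = l ** (?y ** c ** ?z)" if l: "l : L" for l
  proof -
   obtain l' where l': "l = s l'" "l' : L"
    using gal_memD(7)[OF s] l unfolding bij_betw_def by (metis imageE)
   have "?y ** c ** ?z ** l = ?y ** c ** (l' ** ?z)"
    unfolding lz[OF l'(2)] l'(1) using zR cR[OF c] LA[OF sL[OF l'(2)]] by (simp add: m_assoc)
   also have "... = ?y ** (l' ** c) ** ?z"
    using zR cR[OF c] LA[OF l'(2)] centralizer_memD(1)[OF c l'(2)] by (simp add: m_assoc flip: m_assoc[of c])
   also have "?y ** (l' ** c) ** ?z = (?y ** (l' ** ?z) ** ?y) ** c ** ?z"
    using zR cR[OF c] LA[OF l'(2)] by (simp add: m_assoc)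
   also have "?y ** (l' ** ?z) ** ?y = l ** ?y"
    unfolding lz[OF l'(2)] l'(1) using zR LA[OF sL[OF l'(2)]] by (simp flip: m_assoc)
   finally show ?thesis using zR cR[OF c] LA[OF l] by (simp add: m_assoc)
  qed
  then show ?thesis unfolding centralizer_def using zR cR[OF c] by simp
 qed
 have mult: "(?y ** a ** ?z) ** (?y ** b ** ?z) = ?y ** (a ** b) ** ?z" if "a : carrier A" "b : carrier A" for a b
 proof -
  have "(?y ** a ** ?z) ** (?y ** b ** ?z) = ?y ** a ** (?z ** ?y) ** b ** ?z"
   using zR(1,2) that by (simp add: m_assoc)
  then show ?thesis using zR that by (simp add: m_assoc)
 qed
 have "(\<Oplus>i\<in>{1..k}. ?f i i) = ?y ** (\<Oplus>i\<in>{1..k}. E i i) ** ?z"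
  using finsum_lmult[of ?y "{1..k}" "%i. E i i"] finsum_rmult[of ?z "{1..k}" "%i. ?y ** E i i"] zR by simp
 then have fA: "matrix_units A k ?f"
  unfolding matrix_units_def using zR E.e_sum by (auto simp: mult E.e_mult)
 then have f: "matrix_units (sub A C) k ?f" using matrix_units_sub[OF C_subring] fC E_C by simp
 have e: "matrix_units (sub A C) k E" using E unfolding complete_matrix_units_iff by simp
 have div: "division_ring (sub (sub A C) (unit_commutant (sub A C) k e))" if "matrix_units (sub A C) k e" for e
 proof -
  interpret EC: matrix_unit_system "sub A C" k e by unfold_locales (rule that)
  have "unit_commutant (sub A C) k e = L"
   by (rule EC.full_matrix_units_commutant[OF L_sub L_center _ k_pos])
    (use dim_C dimension_sub[OF C_subring L_C _ L(1)] in simp)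
  then show ?thesis using subfield_division_ring(1)[OF L(1)] by simp
 qed
 interpret EC: matrix_unit_system "sub A C" k E by unfold_locales (rule e)
 obtain w w' where w: "w : C" "w' : C" "w ** w' = \<one>" "w' ** w = \<one>"
  "!!i j. i \<in> {1..k} ==> j : {1..k} ==> w' ** ?f i j ** w = E i j"
  using C.equal_size_units_conjugate[OF EC.prime_if_division_commutant[OF k_pos div[OF e]] k_pos f div[OF f] e div[OF e]]
  by auto
 note wR = cR[OF w(1)] cR[OF w(2)]
 let ?v = "?z ** w" and ?v' = "w' ** ?y"
 have vv: "?v ** ?v' = \<one>" "?v' ** ?v = \<one>"
 proof -
  have "?v ** ?v' = ?z ** (w ** w') ** ?y" using zR(1,2) wR by (simp add: m_assoc)
  then show "?v ** ?v' = \<one>" using w(3) zR by simp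
  have "?v' ** ?v = w' ** (?y ** ?z) ** w" using zR(1,2) wR by (simp add: m_assoc)
  then show "?v' ** ?v = \<one>" using w(4) zR wR by simp
 qed
 have vR: "?v \<in> carrier A" "?v' \<in> carrier A" using zR wR by auto
 have vE: "?v' ** E i j ** ?v = E i j" if ij: "i : {1..k}" "j : {1..k}" for i j
  using w(5)[OF ij] zR(1,2) wR E.e_closed[OF ij] by (simp add: m_assoc)
 have EvR: "E i j ** ?v = ?v ** E i j" "?v' ** E i j = E i j ** ?v'" if ij: "i : {1..k}" "j : {1..k}" for i j
 proof -
  have e: "E i j \<in> carrier A" by (rule E.e_closed[OF ij])
  have "E i j ** ?v = (?v ** ?v') ** E i j ** ?v" using vv(1) e vR by simp
  also have "... = ?v ** (?v' ** E i j ** ?v)" using vR e by (simp only: m_assoc m_closed)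
  finally show "E i j ** ?v = ?v ** E i j" unfolding vE[OF ij] .
  have "?v' ** E i j = ?v' ** E i j ** (?v ** ?v')" using vv(1) e vR by simp
  also have "... = (?v' ** E i j ** ?v) ** ?v'" using vR e by (simp only: m_assoc m_closed)
  finally show "?v' ** E i j = E i j ** ?v'" unfolding vE[OF ij] .
 qed
 have vCn: "?v \<in> Cn" "?v' \<in> Cn" unfolding E.Z_iff using EvR vR by auto
 have U: "?v \<in> Units (sub A Cn)" unfolding Units_def using vCn vv by auto
 have iv: "inv\<^bsub>sub A Cn\<^esub> ?v = ?v'" by (rule Cn.inv_char) (use vCn vv in auto)
 have "?v' ** l ** ?v = s l" if l: "l : L" for l
 proof -
  have "?v' ** l ** ?v = w' ** (?y ** (l ** ?z)) ** w" using zR(1,2) wR LA[OF l] by (simp add: m_assoc)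
  also have "?y ** (l ** ?z) = s l" unfolding lz[OF l] using zR LA[OF sL[OF l]] by (simp flip: m_assoc)
  also have "w' ** s l = s l ** w'" by (rule centralizer_memD(1)[OF w(2) sL[OF l]])
  finally show ?thesis using w(4) wR LA[OF sL[OF l]] by (simp add: m_assoc)
 qed
 then have "conj_map (sub A Cn) L ?v = s"
  unfolding conj_map_def iv using gal_memD(6)[OF s] by (intro extensionalityI[of _ L]) auto
 with U show ?thesis by (rule that)
qed

lemma units_exist: "\<exists>u. galois_units (sub A Cn) L F (p ^ r) u"
proof -
 let ?G = "carrier (galois_group A L F)" and ?I = "{1..p ^ r}"
 have fin: "finite ?G" using gal_L(2) p_pos card_ge_0_finite[of ?G] by simp
 obtain f where f: "bij_betw f ?I ?G" using ex_bij_betw_nat_finite_1[OF fin] gal_L(2) by auto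
 interpret G: group "galois_group A L F" by (rule galois_group_is_group[OF subfieldE(1)[OF L(1)] L(2)])
 have id: "(\<lambda>x\<in>L. x) \<in> ?G" using G.one_closed unfolding galois_group_simps .
 then obtain o' where o': "o' : ?I" "f o' = (\<lambda>x\<in>L. x)" using f unfolding bij_betw_def by (metis imageE)
 have one: "1 : ?I" using p_pos by (simp add: Suc_le_eq)
 have "\<forall>s\<in>?G. \<exists>v. v \<in> Units (sub A Cn) \<and> conj_map (sub A Cn) L v = s" using inducing_unit by metis
 then obtain U where U: "!!s. s \<in> ?G ==> U s \<in> Units (sub A Cn)" "!!s. s \<in> ?G ==> conj_map (sub A Cn) L (U s) = s" by metis
 have fG: "f i \<in> ?G" if "i : ?I" for i using f that unfolding bij_betw_def by blast
 \<comment> \<open>The identity is moved to the first place of the enumeration.\<close>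
 define u where "u i = (if i = 1 then \<one> else if i = o' then U (f 1) else U (f i))" for i
 have LA: "l : carrier A" if "l : L" for l using subfieldE(3)[OF L(1)] that by blast
 have inv1: "inv\<^bsub>sub A Cn\<^esub> \<one> = \<one>" using Cn.inv_one by simp
 have c1: "conj_map (sub A Cn) L \<one> = (\<lambda>x\<in>L. x)" unfolding conj_map_def using LA inv1 by auto
 have c: "conj_map (sub A Cn) L (u i) = f (if i = 1 then o' else if i = o' then 1 else i)" if "i : ?I" for i
  unfolding u_def using c1 o'(2) U(2)[OF fG[OF one]] U(2)[OF fG[OF that]] by simp
 have "{conj_map (sub A Cn) L (u i) | i. i \<in> ?I} = ?G"
 proof (intro equalityI subsetI)
  fix s assume "s : {conj_map (sub A Cn) L (u i) | i. i \<in> ?I}"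
  then obtain i where i: "i : ?I" "s = conj_map (sub A Cn) L (u i)" by blast
  show "s : ?G" unfolding i(2) c[OF i(1)] by (rule fG) (use i(1) one o'(1) in \<open>simp split: if_splits\<close>)
 next
  fix s assume "s : ?G"
  then obtain i where i: "i : ?I" "f i = s" using f unfolding bij_betw_def by (metis imageE)
  let ?j = "if i = 1 then o' else if i = o' then 1 else i"
  have j: "?j \<in> ?I" using i(1) one o'(1) by (simp split: if_splits)
  have "conj_map (sub A Cn) L (u ?j) = s" unfolding c[OF j] using i(2) by auto
  then show "s : {conj_map (sub A Cn) L (u i) | i. i \<in> ?I}" using j by blast
 qed
 moreover have "u i \<in> Units (sub A Cn)" if "i : ?I" for i
  unfolding u_def using U(1)[OF fG[OF one]] U(1)[OF fG[OF that]] Cn.Units_one_closed by simp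
 ultimately have "galois_units (sub A Cn) L F (p ^ r) u"
  unfolding galois_units_def galois_group_sub using u_def by auto
 then show ?thesis by blast
qed

lemma Cn_crossed_product:
 assumes u: "galois_units (sub A Cn) L F (p ^ r) u"
 shows "classical_crossed_product (sub A Cn) L F (induced_factor_set (sub A Cn) L (p ^ r) u) (unit_inducing (sub A Cn) L (p ^ r) u)"
  and "factor_set (sub A L) (galois_group A L F) (%g. g) (induced_factor_set (sub A Cn) L (p ^ r) u)"
proof -
 have gal': "galois_extension (sub A Cn) L F" using galois_extension_sub[OF Cn_subring L_Cn] gal_L(1) by simp
 have L': "subfield L (sub A Cn)" using subfield_sub[OF Cn_subring L_Cn] L(1) by simp
 obtain m where m: "dimension m L Cn" "p ^ (2 * r) = p ^ r * m"
  by (rule dimension_over_intermediate[OF F L(1,2) deg_L dim_Cn]) (use subringE(6)[OF Cn_subring] L_Cn in blast)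
 have "m = p ^ r" using m(2) p_pos by (simp add: mult_2 power_add)
 then have d: "Cn.dimension (p ^ r) L Cn" using m(1) dim_sub[OF order_refl L_Cn L(1)] by simp
 have Us: "!!i. i \<in> {1..p ^ r} ==> u i \<in> Units (sub A Cn)"
  and cj: "{conj_map (sub A Cn) L (u i) | i. i \<in> {1..p ^ r}} = carrier (galois_group (sub A Cn) L F)"
  using u unfolding galois_units_def by auto
 have S: "subring Cn (sub A Cn)" using Cn.carrier_is_subring by simp
 have cen: "s : L" if "s : Cn" "!!l. l \<in> L ==> s \<otimes>\<^bsub>sub A Cn\<^esub> l = l \<otimes>\<^bsub>sub A Cn\<^esub> s" for s
  using that Cn_L unfolding centralizer_sub by auto
 note cpn = Cn.units_crossed_product[OF S L' L_Cn gal' _ _ d Us _ _ cj]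
 have cm: "comm_group (galois_group (sub A Cn) L F)" "card (carrier (galois_group (sub A Cn) L F)) = p ^ r"
  unfolding galois_group_sub using gal_L by auto
 have Ui: "u i \<in> Cn" "inv\<^bsub>sub A Cn\<^esub> (u i) \<in> Cn" if "i : {1..p ^ r}" for i
  using Cn.Units_closed[OF Us[OF that]] Cn.Units_inv_closed[OF Us[OF that]] by auto
 show "classical_crossed_product (sub A Cn) L F (induced_factor_set (sub A Cn) L (p ^ r) u) (unit_inducing (sub A Cn) L (p ^ r) u)"
  using Cn.units_crossed_product(1)[OF S L' L_Cn gal' cm d, of u] Us Ui cj cen by simp
 show "factor_set (sub A L) (galois_group A L F) (%g. g) (induced_factor_set (sub A Cn) L (p ^ r) u)"
  using Cn.units_crossed_product(2)[OF S L' L_Cn gal' cm d, of u] Us Ui cj cen unfolding galois_group_sub by simp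
qed

lemma tensor_factorization:
 defines "B \<equiv> Span F [E i j. i \<leftarrow> [1..<Suc k], j \<leftarrow> [1..<Suc k]]"
 shows "centralizer A B = Cn"
  "algebra_iso F A (%c. pure_tensor F (sub A B) (sub A Cn) c \<one>) (tensor_product F (sub A B) (sub A Cn))"
proof -
 have Fc: "F <= center A" using cenF by simp
 note B = E.coefficient_span[OF F Fc k_pos, folded B_def]
 show "centralizer A B = Cn" by (rule B(5))
 show "algebra_iso F A (%c. pure_tensor F (sub A B) (sub A Cn) c \<one>) (tensor_product F (sub A B) (sub A Cn))"
  by (rule E.tensor_decomposition[OF B(1) _ _ Fc B(4,5)]) (use B(2,3) in auto)
qed

end

section \<open>The subfield \<open>L'\<close> and its factors\<close>

lemma (in ring) span_of_sub:
 assumes "subring S R" "!!i. i \<in> I ==> z i \<in> S" "K <= S"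
 shows "span_of (sub R S) K I z = span_of R K I z"
proof -
 have "(\<Oplus>\<^bsub>sub R S\<^esub>i\<in>I. z i ** c i) = (\<Oplus>i\<in>I. z i ** c i)" if "c : I \<rightarrow> K" for c
  by (rule finsum_sub[OF assms(1)]) (use funcset_mem[OF that] assms subringE(6)[OF assms(1)] in blast)
 then show ?thesis unfolding span_of_def by (intro Collect_cong ex_cong1) auto
qed

text \<open>The ring is the sum of the \<open>m\<close> columns, all isomorphic to the first.\<close>

lemma (in matrix_unit_system) column_dimension:
 assumes L: "subfield L R" and n: "dimension n L (carrier R)" and m: "1 \<le> m"
 obtains d where "dimension d L {x \<in> carrier R. x ** e 1 1 = x}" "n = m * d"
proof -
 have one: "1 : {1..m}" using m by simp
 have LR: "l : carrier R" if "l : L" for l using subfieldE(3)[OF L] that by blast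
 obtain d where d: "dimension d L ((%x. x ** e 1 1) ` carrier R)" "n = m * d"
 proof (rule action_dimension[OF L n m, of "%i j x. x ** e j i"])
  fix v assume v: "v : carrier R"
  show "(\<Oplus>i\<in>{1..m}. v ** e i i) = v" using finsum_lmult[of v "{1..m}" "%i. e i i"] v e_sum by simp
 qed (use LR e_mult in \<open>auto simp: l_distr m_assoc\<close>)
 have "(%x. x ** e 1 1) ` carrier R = {x \<in> carrier R. x ** e 1 1 = x}"
  using e_closed[OF one one] e_mult[OF one one one one] by (auto simp: m_assoc) (metis image_eqI)
 with d show ?thesis using that by simp
qed

locale index_p_subfield = index_p_matrix_units +
 fixes L' :: "'a set" and u :: "nat \<Rightarrow> 'a"
 assumes u: "galois_units (sub A Cn) L F (p ^ r) u"
  and L': "subfield L' A" "F <= L'" "L' <= L" "dimension p L' L"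
  and conj_u: "{restrict (conj_map (sub A Cn) L (u i)) L' | i. i \<in> {1..p ^ (r - 1)}} = carrier (galois_group A L' F)"
begin

abbreviation N where "N \<equiv> p ^ (r - 1)"
abbreviation M where "M \<equiv> centralizer (sub A Cn) L'"
abbreviation zu where "zu \<equiv> unit_inducing (sub A Cn) L (p ^ r) u"

lemma N_pos: "1 \<le> N" using p_pos by (simp add: Suc_le_eq)

lemma p_N: "p ^ r = N * p" using r_pos by (cases r) simp_all

lemma deg_L': "dimension N F L'"
proof -
 note Ls = subringE[OF subfieldE(1)[OF L'(1)]]
 obtain d where d: "dimension d F L'"
  using subspace_dimension[OF F deg_L L'(3) Ls(2,7)] Ls(6) L'(2) by (metis subsetD)
 have "p ^ r = d * p" by (rule dimension_is_inj[OF F deg_L telescopic_base[OF F L'(1) d L'(4)]])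
 then have "d = N" using p_N p_pos by simp
 then show ?thesis using d by simp
qed

lemma L'_Cn: "L' <= Cn" using L'(3) L_Cn by blast

lemma sub_simps: "subfield L' (sub A Cn)" "subfield L (sub A Cn)"
 "galois_extension (sub A Cn) L F" "Cn.dimension (p ^ r) F L" "Cn.dimension N F L'"
 using subfield_sub[OF Cn_subring L'_Cn] subfield_sub[OF Cn_subring L_Cn] L'(1) L(1) gal_L(1)
  galois_extension_sub[OF Cn_subring L_Cn] dim_sub[OF L_Cn F_Cn F] dim_sub[OF L'_Cn F_Cn F] deg_L deg_L' by auto

lemma gal_L': "galois_extension (sub A Cn) L L'" "card (carrier (galois_group (sub A Cn) L L')) = p"
  "galois_extension (sub A Cn) L' F" "comm_group (galois_group (sub A Cn) L' F)"
proof -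
 note i = Cn.intermediate_field[OF sub_simps(3,1) L'(2,3) sub_simps(5,4)]
 show "galois_extension (sub A Cn) L L'" by (rule i(1))
 show "card (carrier (galois_group (sub A Cn) L L')) = p" using i(3) p_N N_pos p_pos by simp
 have "comm_group (galois_group (sub A Cn) L F)" using gal_L(3) unfolding galois_group_sub .
 note a = Cn.intermediate_field_abelian[OF sub_simps(3) this sub_simps(1) L'(2,3) sub_simps(5,4)]
 show "galois_extension (sub A Cn) L' F" "comm_group (galois_group (sub A Cn) L' F)" by (rule a(2), rule a(4))
qed

lemma cpn: "classical_crossed_product (sub A Cn) L F (induced_factor_set (sub A Cn) L (p ^ r) u) zu"
 by (rule Cn_crossed_product(1)[OF u])

lemma M_span: "span_of A L (carrier (galois_group A L L')) zu = M"
proof -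
 have cp: "crossed_product (sub A Cn) L (galois_group (sub A Cn) L F) (%g. g) (induced_factor_set (sub A Cn) L (p ^ r) u) zu"
  using cpn unfolding classical_crossed_product_def by simp
 have HG: "carrier (galois_group A L L') <= carrier (galois_group (sub A Cn) L F)" using L'(2) unfolding galois_group_def by auto
 have zC: "zu g \<in> Cn" if "g : carrier (galois_group A L L')" for g
  using Cn.Units_closed[OF Cn.crossed_productD(3)[OF cp subsetD[OF HG that]]] by simp
 have "span_of A L (carrier (galois_group A L L')) zu = span_of (sub A Cn) L (carrier (galois_group A L L')) zu"
  by (rule span_of_sub[OF Cn_subring _ L_Cn, symmetric]) (rule zC)
 also have "... = M"
  using Cn.crossed_centralizer[OF cp sub_simps(2) L'(2,3)] unfolding galois_group_sub by simp
 finally show ?thesis .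
qed

lemma M_ccp: "classical_crossed_product (sub A M) L L' (induced_factor_set (sub A Cn) L (p ^ r) u) zu"
 using Cn.crossed_restrict[OF cpn sub_simps(1) L'(2,3) gal_L'(1)] by simp

lemma M_subring: "subring M (sub A Cn)" by (rule Cn.centralizer_subring) (use L'_Cn in simp)

lemma M_Cn: "M <= Cn" unfolding centralizer_sub by blast

lemma L'_M: "L' <= M" using L'_Cn subfieldE(4)[OF L'(1)] unfolding centralizer_sub by auto

lemma dim_M: "Cn.dimension (p\<^sup>2) L' M"
proof -
 have cp: "crossed_product (sub A Cn) L (galois_group (sub A Cn) L F) (%g. g) (induced_factor_set (sub A Cn) L (p ^ r) u) zu"
  using cpn unfolding classical_crossed_product_def by simp
 have HG: "carrier (galois_group (sub A Cn) L L') <= carrier (galois_group (sub A Cn) L F)" using L'(2) unfolding galois_group_def by auto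
 have "Cn.dimension p L M"
  using Cn.crossed_dimension[OF cp sub_simps(2) L(2) HG] unfolding Cn.crossed_centralizer[OF cp sub_simps(2) L'(2,3)] gal_L'(2) .
 moreover have "Cn.dimension p L' L" using dim_sub[OF L_Cn L'_Cn L'(1)] L'(4) by simp
 ultimately show ?thesis using Cn.telescopic_base[OF sub_simps(1,2)] by (simp add: power2_eq_square)
qed

text \<open>A proper system of matrix units of \<open>M\<close>, together with the \<open>E\<^sub>i\<^sub>j\<close>, would show that \<open>L'\<close> splits
 \<open>A\<close>, against the choice of \<open>L\<close>.\<close>

lemma M_division: "division_ring (sub A M)"
proof -
 interpret M: ring "sub A M" using Cn.subring_is_ring[OF M_subring] by simp
 have cpM: "crossed_product (sub A M) L (galois_group (sub A M) L L') (%g. g) (induced_factor_set (sub A Cn) L (p ^ r) u) zu"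
  and LM: "subfield L (sub A M)" and cM: "center (sub A M) = L'"
  using M_ccp unfolding classical_crossed_product_def galois_extension_def by auto
 have pr: "prime_ring (sub A M)" by (rule M.simple_imp_prime[OF M.crossed_product_simple[OF cpM LM]])
 have L'sub: "subfield L' (sub A M)" using Cn.subfield_sub[OF M_subring L'_M] sub_simps(1) by simp
 have dM: "M.dimension (p\<^sup>2) L' (carrier (sub A M))"
  using Cn.dimension_sub[OF M_subring L'_M order_refl sub_simps(1)] dim_M by simp
 obtain q g where q: "1 \<le> q" and g: "matrix_units (sub A M) q g"
  and div: "division_ring (sub (sub A M) (unit_commutant (sub A M) q g))"
  by (rule M.Wedderburn_matrix_units[OF pr L'sub _ dM]) (use cM in simp_all)
 interpret g: matrix_unit_system "sub A M" q g by unfold_locales (rule g)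
 note gs = subringE[OF g.Z_subring]
 obtain d where d: "M.dimension d L' (unit_commutant (sub A M) q g)"
 proof (rule M.subspace_dimension[OF L'sub dM gs(1,2,7)])
  have "x : unit_commutant (sub A M) q g" if "x : L'" for x
  proof -
   have "x : center (sub A M)" using that cM by simp
   then show ?thesis unfolding g.Z_iff using centralizer_memD[of x "sub A M"] g.e_closed by blast
  qed
  then show "x \<otimes>\<^bsub>sub A M\<^esub> v \<in> unit_commutant (sub A M) q g" if "x : L'" "v : unit_commutant (sub A M) q g" for x v
   using gs(6) that by blast
 qed
 have "p\<^sup>2 = q * q * d"
  by (rule M.dimension_is_inj[OF L'sub dM g.dimension_matrix[OF L'sub _ d]]) (use cM in simp)
 then have "q\<^sup>2 dvd p\<^sup>2" by (simp add: power2_eq_square)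
 then have "q dvd p" by simp
 then consider "q = 1" | "q = p" using p prime_nat_iff by blast
 then show ?thesis
 proof cases
  case 1
  have MA: "x : carrier A" if "x : M" for x using that M_Cn subringE(1)[OF Cn_subring] by blast
  have g1: "g 1 1 = \<one>" using g.e_sum g.e_closed[of 1 1] MA[of "g 1 1"] unfolding 1 by simp
  have "unit_commutant (sub A M) q g = M"
  proof (intro equalityI subsetI)
   fix x assume "x : M"
   then show "x : unit_commutant (sub A M) q g" unfolding g.Z_iff using MA[of x] g1 1 by simp
  qed (use g.Z_closed in simp)
  then show ?thesis using div by simp
 next
  case 2
  have gCn: "matrix_units (sub A Cn) q g" and gM: "!!a b. a \<in> {1..q} ==> b : {1..q} ==> g a b \<in> M"
   using g Cn.matrix_units_sub[OF M_subring] by auto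
  obtain h where h: "matrix_units A (q * k) h" "{h i j | i j. i \<in> {1..q * k} \<and> j \<in> {1..q * k}}
   = {g a b ** E i j | a b i j. a \<in> {1..q} \<and> b \<in> {1..q} \<and> i \<in> {1..k} \<and> j \<in> {1..k}}"
   by (rule E.product_units[OF gCn k_pos]) (rule that)
  have S: "subring (centralizer A L') A" by (rule centralizer_subring[OF subfieldE(3)[OF L'(1)]])
  have hC: "h i j \<in> centralizer A L'" if ij: "i : {1..q * k}" "j : {1..q * k}" for i j
  proof -
   have "h i j \<in> {h i j | i j. i \<in> {1..q * k} \<and> j \<in> {1..q * k}}" using ij by blast
   then obtain a b i' j' where x: "h i j = g a b ** E i' j'" "a : {1..q}" "b : {1..q}" "i' : {1..k}" "j' : {1..k}"
    unfolding h(2) by blast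
   have "g a b \<in> centralizer A L'" using gM[OF x(2,3)] subringE(1)[OF Cn_subring] unfolding centralizer_sub centralizer_def by auto
   moreover have "E i' j' \<in> centralizer A L'" using E_C[OF x(4,5)] L'(3) unfolding centralizer_def by auto
   ultimately show ?thesis unfolding x(1) by (rule subringE(6)[OF S])
  qed
  have LK: "L' <= K" using L'(3) L(3) by blast
  have "p ^ n = N * card (carrier (galois_group A K L'))" by (rule intermediate(1)[OF L'(1,2) LK deg_L'])
  moreover have "p ^ n = p ^ r * k" using r_le by (simp flip: power_add)
  then have "p ^ n = N * (p * k)" unfolding p_N by (simp only: mult.assoc)
  ultimately have c: "card (carrier (galois_group A K L')) = q * k" using N_pos p_pos 2 by auto
  have dA: "dimension (p ^ n * (q * k)) L' (carrier A)" using intermediate(3)[OF L'(1,2) LK deg_L'] unfolding c .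
  have pn: "p ^ (2 * n) = p ^ n * p ^ n" "0 < p ^ n" "0 < q * k" using p_pos q k_pos by (simp_all add: power_add mult_2)
  interpret ft: field_tensor A F L' "p ^ (2 * n)" by (rule field_tensor[OF L'(1,2)])
  have "splits F A (sub A L')" by (rule ft.centralizer_units_imp_splits[OF h(1) hC pn(1) dA pn(2,3)])
  then have "p ^ r \<le> N" by (rule L_least[OF L'(1,2) LK _ deg_L'])
  then have False using p_N p prime_gt_1_nat[of p] N_pos by simp
  then show ?thesis ..
 qed
qed

sublocale D: galois_descent "sub A Cn" F L' N u
proof (rule galois_descent.intro[OF Cn.ring_axioms galois_descent_axioms.intro[OF sub_simps(1) gal_L'(3,4) sub_simps(5) Cn_center]])
 show "division_ring (sub (sub A Cn) M)" using M_division by simp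
 have sub: "{1..N} <= {1..p ^ r}" using p_N p_pos by auto
 then show "u i \<in> Units (sub A Cn)" if "i : {1..N}" for i using u that unfolding galois_units_def by blast
 have "conj_map (sub A Cn) L' (u i) = restrict (conj_map (sub A Cn) L (u i)) L'" for i
  unfolding conj_map_def restrict_def by (rule ext) (use L'(3) in auto)
 then show "{conj_map (sub A Cn) L' (u i) | i. i \<in> {1..N}} = carrier (galois_group (sub A Cn) L' F)"
  using conj_u unfolding galois_group_sub by simp
qed

text \<open>The first column of matrix units with division commutant has dimension \<open>p\<^sup>2\<close> over \<open>L'\<close>, the same as \<open>M\<close>.\<close>

lemma factors_exist: "\<exists>\<beta>. D.factors \<beta>"
proof -
 obtain g where g: "matrix_units (sub A Cn) N g" "division_ring (sub A (unit_commutant (sub A Cn) N g))"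
  by (rule division_units)
 interpret g: matrix_unit_system "sub A Cn" N g by unfold_locales (rule g(1))
 have f: "division_idempotent (sub A Cn) (g 1 1)" by (rule g.division_idempotent_e11[OF N_pos]) (use g(2) in simp)
 obtain m where m: "Cn.dimension m L' (carrier (sub A Cn))" "p ^ (2 * r) = N * m"
  by (rule Cn.dimension_over_intermediate[OF F_sub sub_simps(1) L'(2) sub_simps(5) dim_Cn'])
   (use subringE(6)[OF Cn_subring] L'_Cn in \<open>simp_all add: subset_iff\<close>)
 obtain d where d: "Cn.dimension d L' {x \<in> carrier (sub A Cn). x \<otimes>\<^bsub>sub A Cn\<^esub> g 1 1 = x}" "m = N * d"
  by (rule g.column_dimension[OF sub_simps(1) m(1) N_pos])
 have "N * (N * d) = N * (N * p\<^sup>2)"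
  using m(2) unfolding d(2) mult_2 power_add p_N by (simp only: power2_eq_square ac_simps)
 then have "d = p\<^sup>2" using N_pos p_pos by simp
 then show ?thesis
  using D.factors_exist[of "g 1 1" d] f d(1) dim_M unfolding division_idempotent_def by simp
qed

lemma span_system:
 assumes "D.factors \<beta>"
 shows "span_of (sub A Cn) L' {1..N} (%i. \<beta> i ** u i) = span_of A L' {1..N} (%i. \<beta> i ** u i)"
proof (rule span_of_sub[OF Cn_subring _ L'_Cn])
 interpret T: factor_system "sub A Cn" F L' N u \<beta> by unfold_locales (rule assms)
 show "\<beta> i ** u i \<in> Cn" if "i : {1..N}" for i using T.vR[OF that] unfolding T.v_def by simp
qed

lemma factors_same_span:
 assumes "D.factors \<beta>" "D.factors \<beta>'"
  "span_of A L' {1..N} (%i. \<beta>' i ** u i) = span_of A L' {1..N} (%i. \<beta> i ** u i)" "i : {1..N}"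
 shows "\<exists>l\<in>L' - {\<zero>}. \<beta>' i = l ** \<beta> i"
 using D.factors_same_span[OF assms(1,2) _ assms(4)] assms(3)
 unfolding span_system[OF assms(1), symmetric] span_system[OF assms(2), symmetric] by simp

lemma factor_algebra:
 assumes \<beta>: "D.factors \<beta>"
 defines "S \<equiv> span_of A L' {1..N} (%i. \<beta> i ** u i)"
 shows "subalgebra_over F S (sub A Cn)"
  "classical_crossed_product (sub A S) L' F (induced_factor_set (sub A Cn) L' N (%i. \<beta> i ** u i))
   (unit_inducing (sub A Cn) L' N (%i. \<beta> i ** u i))"
  "split_algebra F (sub A S)" "ring.dimension (sub A S) (p ^ (2 * (r - 1))) F S"
  "division_ring (sub A (centralizer (sub A Cn) S))"
  "!!m e. complete_matrix_units F (sub A S) m e ==> complete_matrix_units F (sub A Cn) m e"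
  "!!m e. complete_matrix_units F (sub A S) m e ==> \<exists>m' h. complete_matrix_units F A m' h \<and>
   {h i j | i j. i \<in> {1..m'} \<and> j \<in> {1..m'}}
    = {e a b ** E i j | a b i j. a \<in> {1..m} \<and> b \<in> {1..m} \<and> i \<in> {1..k} \<and> j \<in> {1..k}} \<and>
   {h i i | i. i \<in> {1..m'}} = {e a a ** E i i | a i. a \<in> {1..m} \<and> i \<in> {1..k}}"
proof -
 interpret T: factor_system "sub A Cn" F L' N u \<beta> by unfold_locales (rule \<beta>)
 have v: "T.v = (%i. \<beta> i ** u i)" unfolding T.v_def[abs_def] by simp
 have S: "S = T.T" unfolding S_def T.T_def v span_system[OF \<beta>] ..
 have FT: "F <= T.T" using L'(2) T.L_T by blast
 show "subalgebra_over F S (sub A Cn)"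
  unfolding S subalgebra_over_def algebra_over_def embedded_algebra_def
  using T.T_subring Cn.subring_is_ring[OF T.T_subring] T.T_crossed_product
  by (simp add: classical_crossed_product_def galois_extension_def)
 show "classical_crossed_product (sub A S) L' F (induced_factor_set (sub A Cn) L' N (%i. \<beta> i ** u i))
   (unit_inducing (sub A Cn) L' N (%i. \<beta> i ** u i))"
  using T.T_crossed_product unfolding S v by simp
 show "split_algebra F (sub A S)" using T.T_split unfolding S by simp
 show "ring.dimension (sub A S) (p ^ (2 * (r - 1))) F S"
  using Cn.dimension_sub[OF T.T_subring FT order_refl F_sub] T.T_dimension(2) unfolding S by (simp add: mult_2 power_add)
 have div: "division_ring (sub A (centralizer (sub A Cn) S))" using T.T_division unfolding S by simp
 then show "division_ring (sub A (centralizer (sub A Cn) S))" .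
 fix m e assume e: "complete_matrix_units F (sub A S) m e"
 have "complete_matrix_units F (sub (sub A Cn) T.T) m e" using e unfolding S by simp
 note eT = T.T_units[OF this]
 have eC: "matrix_units (sub A Cn) m e" "unit_commutant (sub A Cn) m e = centralizer (sub A Cn) S"
  using eT(1,3,5) unfolding S by simp_all
 have m1: "1 \<le> m" using eT(1,2) by simp
 have "matrix_form F (sub A Cn) m (unit_commutant (sub A Cn) m e)"
  by (rule Cn.matrix_formI[OF Cn_algebra Cn_center dim_Cn' m1 eC(1)]) (use div eC(2) in simp)
 then show "complete_matrix_units F (sub A Cn) m e" unfolding complete_matrix_units_iff using eC(1) by blast
 obtain h where h: "matrix_units A (m * k) h" "unit_commutant A (m * k) h = unit_commutant (sub A Cn) m e"
  and hs: "{h i j | i j. i \<in> {1..m * k} \<and> j \<in> {1..m * k}}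
    = {e a b ** E i j | a b i j. a \<in> {1..m} \<and> b \<in> {1..m} \<and> i \<in> {1..k} \<and> j \<in> {1..k}}"
   "{h i i | i. i \<in> {1..m * k}} = {e a a ** E i i | a i. a \<in> {1..m} \<and> i \<in> {1..k}}"
  by (rule E.product_units[OF eC(1) k_pos]) (rule that)
 have "matrix_form F A (m * k) (unit_commutant A (m * k) h)"
  by (rule matrix_formI[OF A_algebra cenF dim_A _ h(1)]) (use m1 k_pos div h(2) eC(2) in simp_all)
 then have "complete_matrix_units F A (m * k) h" unfolding complete_matrix_units_iff using h(1) by blast
 then show "\<exists>m' h. complete_matrix_units F A m' h \<and>
   {h i j | i j. i \<in> {1..m'} \<and> j \<in> {1..m'}}
    = {e a b ** E i j | a b i j. a \<in> {1..m} \<and> b \<in> {1..m} \<and> i \<in> {1..k} \<and> j \<in> {1..k}} \<and>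
   {h i i | i. i \<in> {1..m'}} = {e a a ** E i i | a i. a \<in> {1..m} \<and> i \<in> {1..k}}"
  using hs by (intro exI[of _ "m * k"] exI[of _ h] conjI)
qed

lemma factor_units:
 assumes \<beta>: "D.factors \<beta>"
 defines "S \<equiv> span_of A L' {1..N} (%i. \<beta> i ** u i)"
 shows "complete_matrix_unit_set F (sub A S) U ==> complete_matrix_unit_set F (sub A Cn) U"
  "complete_idempotent_set F (sub A S) U ==> complete_idempotent_set F (sub A Cn) U"
  "complete_matrix_unit_set F (sub A S) U ==>
   complete_matrix_unit_set F A {e ** E i j | e i j. e \<in> U \<and> i \<in> {1..k} \<and> j \<in> {1..k}}"
  "complete_idempotent_set F (sub A S) U ==>
   complete_idempotent_set F A {e ** E i i | e i. e \<in> U \<and> i \<in> {1..k}}"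
proof -
 note fa = factor_algebra(6,7)[OF \<beta>, folded S_def]
 show "complete_matrix_unit_set F (sub A S) U ==> complete_matrix_unit_set F (sub A Cn) U"
  "complete_idempotent_set F (sub A S) U ==> complete_idempotent_set F (sub A Cn) U"
  unfolding complete_matrix_unit_set_def complete_idempotent_set_def using fa(1) by blast+
 show "complete_matrix_unit_set F A {e ** E i j | e i j. e \<in> U \<and> i \<in> {1..k} \<and> j \<in> {1..k}}"
  if U: "complete_matrix_unit_set F (sub A S) U"
 proof -
  obtain m e where e: "complete_matrix_units F (sub A S) m e" "U = {e i j | i j. i \<in> {1..m} \<and> j \<in> {1..m}}"
   using U unfolding complete_matrix_unit_set_def by blast
  obtain m' h where h: "complete_matrix_units F A m' h" "{h i j | i j. i \<in> {1..m'} \<and> j \<in> {1..m'}}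
    = {e a b ** E i j | a b i j. a \<in> {1..m} \<and> b \<in> {1..m} \<and> i \<in> {1..k} \<and> j \<in> {1..k}}"
   using fa(2)[OF e(1)] by blast
  have "{x ** E i j | x i j. x \<in> U \<and> i \<in> {1..k} \<and> j \<in> {1..k}} = {h i j | i j. i \<in> {1..m'} \<and> j \<in> {1..m'}}"
   unfolding h(2) e(2) by blast
  then show ?thesis unfolding complete_matrix_unit_set_def using h(1) by blast
 qed
 show "complete_idempotent_set F A {e ** E i i | e i. e \<in> U \<and> i \<in> {1..k}}"
  if U: "complete_idempotent_set F (sub A S) U"
 proof -
  obtain m e where e: "complete_matrix_units F (sub A S) m e" "U = {e i i | i. i \<in> {1..m}}"
   using U unfolding complete_idempotent_set_def by blast
  obtain m' h where h: "complete_matrix_units F A m' h"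
    "{h i i | i. i \<in> {1..m'}} = {e a a ** E i i | a i. a \<in> {1..m} \<and> i \<in> {1..k}}"
   using fa(2)[OF e(1)] by blast
  have "{x ** E i i | x i. x \<in> U \<and> i \<in> {1..k}} = {h i i | i. i \<in> {1..m'}}"
   unfolding h(2) e(2) by blast
  then show ?thesis unfolding complete_idempotent_set_def using h(1) by blast
 qed
qed

end

theorem theorem3p3:
  fixes A :: "('a, 'b) ring_scheme"
    and K F L :: "'a set"
    and \<tau> :: "('a \<Rightarrow> 'a) \<Rightarrow> ('a \<Rightarrow> 'a) \<Rightarrow> 'a"
    and z :: "('a \<Rightarrow> 'a) \<Rightarrow> 'a"
    and p n r :: nat
  assumes p: "Factorial_Ring.prime p"
    and A: "abelian_crossed_product A K F \<tau> z"
    and dim_A: "ring.dimension A (p ^ (2 * n)) F (carrier A)"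
    and index_A: "has_schur_index F A p"
    and L: "subfield L A" "F \<subseteq> L" "L \<subseteq> K"
    and L_splits: "splits F A (sub A L)"
    and L_least: "\<And>E k. \<lbrakk>subfield E A; F \<subseteq> E; E \<subseteq> K; splits F A (sub A E);
                          ring.dimension A k F E\<rbrakk> \<Longrightarrow> p ^ r \<le> k"
    and deg_L: "ring.dimension A (p ^ r) F L"
  shows
    "let C = span_of A K (carrier (galois_group A K L)) z in
      \<comment> \<open>(i)\<close>
      (subalgebra_over L C A \<and>
       classical_crossed_product (sub A C) K L \<tau> z \<and>
       split_algebra L (sub A C) \<and>
       algebra_iso L (sub A C) (scalar_matrix (p ^ (n - r)) (sub A L))
         (matrix_ring (p ^ (n - r)) (sub A L))) \<and>
      (\<forall>E. complete_matrix_units L (sub A C) (p ^ (n - r)) E \<longrightarrow>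
        (let B = ring.Span A F [E i j. i \<leftarrow> [1..<Suc (p ^ (n - r))], j \<leftarrow> [1..<Suc (p ^ (n - r))]];
             Cn = centralizer A B
         in
          \<comment> \<open>(ii)\<close>
          (has_schur_index F (sub A Cn) p \<and>
           ring.dimension (sub A Cn) (p ^ (2 * r)) F Cn \<and>
           algebra_iso F A (\<lambda>c. pure_tensor F (sub A B) (sub A Cn) c \<one>\<^bsub>A\<^esub>)
             (tensor_product F (sub A B) (sub A Cn))) \<and>
          \<comment> \<open>(iii)\<close>
          (strictly_maximal_subfield F (sub A Cn) L \<and>
           (\<exists>u. galois_units (sub A Cn) L F (p ^ r) u) \<and>
           (\<forall>u. galois_units (sub A Cn) L F (p ^ r) u \<longrightarrow>
              factor_set (sub A L) (galois_group A L F) (\<lambda>g. g)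
                (induced_factor_set (sub A Cn) L (p ^ r) u) \<and>
              classical_crossed_product (sub A Cn) L F
                (induced_factor_set (sub A Cn) L (p ^ r) u)
                (unit_inducing (sub A Cn) L (p ^ r) u))) \<and>
          (\<forall>u L'. galois_units (sub A Cn) L F (p ^ r) u \<longrightarrow>
            subfield L' A \<longrightarrow> F \<subseteq> L' \<longrightarrow> L' \<subseteq> L \<longrightarrow> ring.dimension A p L' L \<longrightarrow>
            {restrict (conj_map (sub A Cn) L (u i)) L' | i. i \<in> {1..p ^ (r - 1)}}
              = carrier (galois_group A L' F) \<longrightarrow>
            (let M = span_of A L (carrier (galois_group A L L'))
                       (unit_inducing (sub A Cn) L (p ^ r) u);
                 factors = multiplicative_factors (sub A Cn) M L' (p ^ (r - 1)) u;
                 S = (\<lambda>\<beta>. span_of A L' {1..p ^ (r - 1)} (\<lambda>i. \<beta> i \<otimes>\<^bsub>A\<^esub> u i))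
             in
              \<comment> \<open>(iv)\<close>
              (\<exists>\<beta>. factors \<beta>) \<and>
              \<comment> \<open>uniqueness: up to conjugation by M, and up to L' once the subalgebra is fixed\<close>
              (\<forall>\<beta> \<beta>'. factors \<beta> \<longrightarrow> factors \<beta>' \<longrightarrow>
                 (\<exists>c\<in>M - {\<zero>\<^bsub>A\<^esub>}. \<forall>i\<in>{1..p ^ (r - 1)}.
                    c \<otimes>\<^bsub>A\<^esub> (\<beta>' i \<otimes>\<^bsub>A\<^esub> u i) = (\<beta> i \<otimes>\<^bsub>A\<^esub> u i) \<otimes>\<^bsub>A\<^esub> c) \<and>
                 (S \<beta>' = S \<beta> \<longrightarrow>
                    (\<forall>i\<in>{1..p ^ (r - 1)}. \<exists>l\<in>L' - {\<zero>\<^bsub>A\<^esub>}. \<beta>' i = l \<otimes>\<^bsub>A\<^esub> \<beta> i))) \<and>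
              (\<forall>\<beta>. factors \<beta> \<longrightarrow>
                 (let v = (\<lambda>i. \<beta> i \<otimes>\<^bsub>A\<^esub> u i);
                      T = sub A (S \<beta>)
                  in
                   subalgebra_over F (S \<beta>) (sub A Cn) \<and>
                   classical_crossed_product T L' F
                     (induced_factor_set (sub A Cn) L' (p ^ (r - 1)) v)
                     (unit_inducing (sub A Cn) L' (p ^ (r - 1)) v) \<and>
                   split_algebra F T \<and>
                   ring.dimension T (p ^ (2 * (r - 1))) F (carrier T) \<and>
                   division_ring (sub A (centralizer (sub A Cn) (S \<beta>))) \<and>
                   (\<forall>U. complete_matrix_unit_set F T U \<longrightarrow>
                        complete_matrix_unit_set F (sub A Cn) U) \<and>
                   (\<forall>U. complete_idempotent_set F T U \<longrightarrow>
                        complete_idempotent_set F (sub A Cn) U) \<and>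
                   \<comment> \<open>(v)\<close>
                   (\<forall>U. complete_matrix_unit_set F T U \<longrightarrow>
                        complete_matrix_unit_set F A
                          {e \<otimes>\<^bsub>A\<^esub> E i j | e i j. e \<in> U \<and> i \<in> {1..p ^ (n - r)} \<and> j \<in> {1..p ^ (n - r)}}) \<and>
                   (\<forall>U. complete_idempotent_set F T U \<longrightarrow>
                        complete_idempotent_set F A
                          {e \<otimes>\<^bsub>A\<^esub> E i i | e i. e \<in> U \<and> i \<in> {1..p ^ (n - r)}})))))))"
proof -
 interpret A: ring A
  using A unfolding abelian_crossed_product_def classical_crossed_product_def crossed_product_def by blast
 interpret X: index_p_crossed_product A K F L \<tau> z p n r
  by (rule index_p_crossed_product.intro[OF A.ring_axioms index_p_crossed_product_axioms.intro[OF
     p A dim_A index_A L L_splits L_least deg_L]])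
 show ?thesis
  unfolding Let_def X.C_span
 proof (rule conjI, goal_cases)
  case 1
  show ?case by (intro conjI X.C_subalgebra X.C_ccp X.C_split X.C_iso)
 next
  case 2
  show ?case
  proof (intro allI impI, goal_cases)
   case (1 E)
   interpret Y: index_p_matrix_units A K F L \<tau> z p n r E
    by (rule index_p_matrix_units.intro[OF X.index_p_crossed_product_axioms index_p_matrix_units_axioms.intro[OF 1]])
   show ?case
    unfolding Y.tensor_factorization(1)
   proof (intro conjI, goal_cases)
    case 1
    show ?case by (rule Y.Cn_index)
   next
    case 2
    show ?case using Y.dim_Cn' by simp
   next
    case 3
    show ?case by (rule Y.tensor_factorization(2))
   next
    case 4
    show ?case by (rule Y.strictly_maximal_L)
   next
    case 5
    show ?case by (rule Y.units_exist)
   next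
    case 6
    show ?case by (intro allI impI conjI Y.Cn_crossed_product)
   next
    case 7
    show ?case
    proof (intro allI impI, goal_cases)
     case (1 u L')
     interpret W: index_p_subfield A K F L \<tau> z p n r E L' u
      by (rule index_p_subfield.intro[OF Y.index_p_matrix_units_axioms index_p_subfield_axioms.intro[OF 1]])
     show ?case
      unfolding W.M_span
     proof (intro conjI allI impI, goal_cases)
      case 1
      show ?case by (rule W.factors_exist)
     next
      case (2 \<beta> \<beta>')
      then show ?case using W.D.factors_unique[of \<beta> \<beta>'] by simp
     next
      case (3 \<beta> \<beta>')
      then show ?case using W.factors_same_span[of \<beta> \<beta>'] by blast
     next
      case (7 \<beta>)
      then show ?case using W.factor_algebra(4)[of \<beta>] by simp
     qed (rule W.factor_algebra(1-3,5) W.factor_units; assumption)+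
    qed
   qed
  qed
 qed
qed

end
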